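(* Let $Y_1,\dots,Y_n$ be i.i.d. copies of a random variable $Y$ with $\mathbb{E}Y^4<\infty$, mean $\mu$ and variance $\sigma^2>0$. Then there exist an absolute positive constant $c_1$ and positive constants $c_2$ and $A$ depending on $\sigma$, $\mathbb{E}|Y|^3$ and $\mathbb{E}Y^4$ such that for $$\tau\ge c_1n^{1/6}\max\{(\mathbb{E}Y^4)^{1/2}/\sigma,\,(\mathbb{E}Y^4/\sigma)^{1/3}\}$$ it holds that $$\mathbb{P}(U^*_{\tau,n}>x)=[1-\Phi(x)]\exp\Big\{-\frac{x^3\mathbb{E}(Y-\mu)^3}{3\sqrt n\sigma^3}\Big\}\Big[1+O_1\Big(\frac{1+x^4}{n}+\frac{(1+x)\sqrt n}{\tau^3}+\frac{1+x}{\sqrt n}\Big)\Big]$$ uniformly for $x\in(0,c_2\min\{n^{1/4},\tau^3n^{-1/2}\})$, where $|O_1|\le A$.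
   Context: For $\tau>0$ let $\mathcal{N}=\{1\le i\le n:|Y_i|\le\tau\}$. The self-normalized trimmed mean is $U^*_{\tau,n}=\dfrac{\sum_{i\in\mathcal{N}}(Y_i\mathbb{1}\{|Y_i|\le\tau\}-\mu)}{\sqrt{\sum_{i\in\mathcal{N}}(Y_i\mathbb{1}\{|Y_i|\le\tau\}-\mu)^2}}$. $\Phi$ is the standard normal distribution function. *)

theory Defs
  imports "HOL-Probability.Probability"
begin

definition Phi :: "real \<Rightarrow> real" where
  "Phi x = measure (density lborel std_normal_density) {..x}"

text \<open>Index set of untrimmed observations (indices 0..n-1 play the role of 1..n).\<close>
definition trim_set :: "real \<Rightarrow> nat \<Rightarrow> (nat \<Rightarrow> real) \<Rightarrow> nat set" where
  "trim_set \<tau> n Y = {i. i < n \<and> \<bar>Y i\<bar> \<le> \<tau>}"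

text \<open>Self-normalized trimmed mean; division by zero yields 0 (Isabelle convention).\<close>
definition U_star :: "real \<Rightarrow> real \<Rightarrow> nat \<Rightarrow> (nat \<Rightarrow> real) \<Rightarrow> real" where
  "U_star \<mu> \<tau> n Y =
     (\<Sum>i\<in>trim_set \<tau> n Y. Y i * indicator {t. \<bar>t\<bar> \<le> \<tau>} (Y i) - \<mu>) /
     sqrt (\<Sum>i\<in>trim_set \<tau> n Y. (Y i * indicator {t. \<bar>t\<bar> \<le> \<tau>} (Y i) - \<mu>)\<^sup>2)"

end

theory Submission
  imports Defs "HOL-Real_Asymp.Real_Asymp"
begin

text \<open>
  Let \<open>X\<close> be the trimmed and rescaled observation, with \<open>S\<close> the sum of \<open>n\<close> copies and \<open>V\<close> the sum of their squares, and let
  \<open>h = x / sqrt n\<close>. Linearising \<open>sqrt V\<close> at \<open>sqrt n\<close> turns \<open>S > x * sqrt V\<close> into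
  \<open>h * S - h\<^sup>2 * V / 2 > x\<^sup>2 / 2 - R\<close> with a quadratic remainder \<open>R \<ge> 0\<close>. Tilt the law of \<open>X\<close> by
  \<open>exp (h * X - h\<^sup>2 * X\<^sup>2 / 2)\<close>, a bounded weight, so that no exponential moments are needed. The \<open>n\<close>-th power of the
  normalising constant produces \<open>exp (- x\<^sup>3 * E X\<^sup>3 / (3 * sqrt n))\<close>. Under the tilted law the linear statistic is
  nearly normal with mean \<open>x\<^sup>2 / 2\<close> and standard deviation \<open>x\<close>, and Stein's method gives a Berry-Esseen error of order
  \<open>1 / sqrt n\<close>, which is a relative error of order \<open>(1 + x) / sqrt n\<close> after comparison with the Mills ratio. The
  remainder \<open>R\<close> is handled by a concentration inequality with random window width, and atypical values of \<open>V\<close> by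
  further tilts on dyadic shells. Trimming shifts the mean by \<open>O(\<tau>\<^sup>-\<^sup>3)\<close>, which is the source of the term
  \<open>(1 + x) * sqrt n / \<tau>\<^sup>3\<close>.
\<close>

section \<open>Bounded measurable functions and i.i.d. products\<close>

text \<open>The expansion is relative: every error competes with a probability of order exp (- x^2 /
  2) / (1 + x). Absolute errors are therefore estimated under the critical tilt, where the event is
  typical, and an event estimated under another tilt must gain a further factor exp (- c * x^2),
  which pays for powers of x and for the skewness factor. All quantitative bounds go through a bound
  \<open>K\<close> on the fourth moment of the normalised variable; boundedness by trimming only
  makes integrals finite, and that is all \<open>bmeas\<close> records. The fluctuation of V calls
  for an eighth moment, which has a usable bound only because the tilting weight decays like a
  Gaussian. The tilting argument presupposes that \<tau>^3 is large against sqrt n, hence the case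
  distinction at the end.\<close>

definition bmeas :: "'a measure \<Rightarrow> ('a \<Rightarrow> real) \<Rightarrow> bool" where
  "bmeas M f \<longleftrightarrow> f \<in> borel_measurable M \<and> (\<exists>B. \<forall>x\<in>space M. \<bar>f x\<bar> \<le> B)"

lemma bmeasI: "f \<in> borel_measurable M \<Longrightarrow> (\<And>x. x \<in> space M \<Longrightarrow> \<bar>f x\<bar> \<le> B) \<Longrightarrow> bmeas M f"
  unfolding bmeas_def by auto

lemma bmeas_measurable: "bmeas M f \<Longrightarrow> f \<in> borel_measurable M"
  unfolding bmeas_def by auto

lemma bmeas_const: "bmeas M (\<lambda>x. c)"
  unfolding bmeas_def by auto

lemma bmeas_of_bool: "Measurable.pred M P \<Longrightarrow> bmeas M (\<lambda>x. of_bool (P x))"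
proof -
  assume [measurable]: "Measurable.pred M P"
  have "(\<lambda>x. of_bool (P x)) = (\<lambda>x. if P x then 1 else (0::real))" by auto
  then show ?thesis by (auto intro!: bmeasI[where B=1])
qed

lemma bmeas_add:
  assumes "bmeas M f" "bmeas M g" shows "bmeas M (\<lambda>x. f x + g x)"
proof -
  from assms obtain A B where *: "\<forall>x\<in>space M. \<bar>f x\<bar> \<le> A" "\<forall>x\<in>space M. \<bar>g x\<bar> \<le> B" unfolding bmeas_def by auto
  note [measurable] = assms[THEN bmeas_measurable]
  show ?thesis by (rule bmeasI[where B="A+B"], measurable) (use * in fastforce)
qed

lemma bmeas_mult:
  assumes "bmeas M f" "bmeas M g" shows "bmeas M (\<lambda>x. f x * g x)"
proof -
  from assms obtain A B where *: "\<forall>x\<in>space M. \<bar>f x\<bar> \<le> A" "\<forall>x\<in>space M. \<bar>g x\<bar> \<le> B" unfolding bmeas_def by auto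
  note [measurable] = assms[THEN bmeas_measurable]
  show ?thesis
  proof (rule bmeasI[where B="A*B"], measurable)
    fix x assume "x \<in> space M"
    then show "\<bar>f x * g x\<bar> \<le> A * B" using * by (auto simp: abs_mult intro!: mult_mono intro: order_trans[OF abs_ge_zero])
  qed
qed

lemma bmeas_uminus: "bmeas M f \<Longrightarrow> bmeas M (\<lambda>x. - f x)"
  using bmeas_mult[OF bmeas_const[of M "-1"], of f] by simp

lemma bmeas_diff: "bmeas M f \<Longrightarrow> bmeas M g \<Longrightarrow> bmeas M (\<lambda>x. f x - g x)"
  using bmeas_add[of M f, OF _ bmeas_uminus[of M g]] by simp

text \<open>The values of \<open>f\<close> lie in a compact interval, on which a continuous
  \<open>g\<close> is bounded; this covers \<open>exp\<close>, \<open>sqrt\<close> and powers at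
  once.\<close>

lemma bmeas_compose:
  fixes g :: "real \<Rightarrow> real"
  assumes "continuous_on UNIV g" "bmeas M f" shows "bmeas M (\<lambda>x. g (f x))"
proof -
  from assms obtain A where *: "\<forall>x\<in>space M. \<bar>f x\<bar> \<le> A" unfolding bmeas_def by auto
  have "compact (g ` {-A..A})"
    by (rule compact_continuous_image) (auto intro: continuous_on_subset[OF assms(1)])
  then obtain B where B: "\<forall>y\<in>g ` {-A..A}. norm y \<le> B" using compact_imp_bounded bounded_iff by blast
  have [measurable]: "g \<in> borel_measurable borel" by (rule borel_measurable_continuous_onI[OF assms(1)])
  note [measurable] = assms(2)[THEN bmeas_measurable]
  show ?thesis
  proof (rule bmeasI[where B=B], measurable)
    fix x assume "x \<in> space M"
    then have "f x \<in> {-A..A}" using * by (auto simp: abs_le_iff minus_le_iff)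
    then show "\<bar>g (f x)\<bar> \<le> B" using B by auto
  qed
qed

lemma bmeas_power: "bmeas M f \<Longrightarrow> bmeas M (\<lambda>x. f x ^ k)"
  by (rule bmeas_compose[of "\<lambda>y. y ^ k"]) (auto intro!: continuous_intros)
lemma bmeas_abs: "bmeas M f \<Longrightarrow> bmeas M (\<lambda>x. \<bar>f x\<bar>)"
  by (rule bmeas_compose[of abs]) (auto intro!: continuous_intros)
lemma bmeas_exp: "bmeas M f \<Longrightarrow> bmeas M (\<lambda>x. exp (f x))"
  by (rule bmeas_compose[of exp]) (auto intro!: continuous_intros)
lemma bmeas_sqrt: "bmeas M f \<Longrightarrow> bmeas M (\<lambda>x. sqrt (f x))"
  by (rule bmeas_compose[of sqrt]) (auto intro!: continuous_intros)
lemma bmeas_divide: "bmeas M f \<Longrightarrow> bmeas M (\<lambda>x. f x / c)"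
  using bmeas_mult[OF _ bmeas_const[of M "1/c"], of f] by simp
text \<open>min a b = (a + b - |a - b|) / 2.\<close>

lemma bmeas_min: "bmeas M f \<Longrightarrow> bmeas M g \<Longrightarrow> bmeas M (\<lambda>x. min (f x) (g x))"
  using bmeas_divide[OF bmeas_diff[OF bmeas_add[of M f g] bmeas_abs[OF bmeas_diff[of M f g]]], of 2]
  by (simp add: min_def abs_if if_distrib cong: if_cong) (erule back_subst[of "bmeas M"], auto)
lemma bmeas_max: "bmeas M f \<Longrightarrow> bmeas M g \<Longrightarrow> bmeas M (\<lambda>x. max (f x) (g x))"
  using bmeas_uminus[OF bmeas_min[OF bmeas_uminus[of M f] bmeas_uminus[of M g]]]
  by (simp add: minus_min_eq_max)
lemma bmeas_sum: "(\<And>i. i \<in> I \<Longrightarrow> bmeas M (f i)) \<Longrightarrow> bmeas M (\<lambda>x. \<Sum>i\<in>I. f i x)"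
  by (induction I rule: infinite_finite_induct) (auto intro: bmeas_const bmeas_add)
lemma bmeas_prod: "(\<And>i. i \<in> I \<Longrightarrow> bmeas M (f i)) \<Longrightarrow> bmeas M (\<lambda>x. \<Prod>i\<in>I. f i x)"
  by (induction I rule: infinite_finite_induct) (auto intro: bmeas_const bmeas_mult)

lemmas bmeas_intros = bmeas_const bmeas_add bmeas_diff bmeas_uminus bmeas_mult bmeas_power bmeas_abs
  bmeas_exp bmeas_divide bmeas_min bmeas_max bmeas_sum bmeas_prod bmeas_sqrt

lemma pred_bmeas_le: "bmeas M f \<Longrightarrow> bmeas M g \<Longrightarrow> Measurable.pred M (\<lambda>x. f x \<le> g x)"
  and pred_bmeas_less: "bmeas M f \<Longrightarrow> bmeas M g \<Longrightarrow> Measurable.pred M (\<lambda>x. f x < g x)"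
  by (auto dest!: bmeas_measurable)

lemma pred_bmeas_conj: "Measurable.pred M P \<Longrightarrow> Measurable.pred M Q \<Longrightarrow> Measurable.pred M (\<lambda>x. P x \<and> Q x)"
  by auto

lemmas pred_bmeas = pred_bmeas_le pred_bmeas_less pred_bmeas_conj

lemma (in finite_measure) bmeas_integrable: "bmeas M f \<Longrightarrow> integrable M f"
  unfolding bmeas_def by (auto intro!: integrable_const_bound AE_I2)

lemma (in finite_measure) measure_eq_integral_of_bool:
  "Measurable.pred M P \<Longrightarrow> measure M {x\<in>space M. P x} = (\<integral>x. of_bool (P x) \<partial>M)"
proof -
  assume [measurable]: "Measurable.pred M P"
  have "(\<integral>x. of_bool (P x) \<partial>M) = (\<integral>x. indicator {x\<in>space M. P x} x \<partial>M)"
    by (intro Bochner_Integration.integral_cong) (auto simp: indicator_def)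
  also have "\<dots> = measure M {x\<in>space M. P x}"
    by (subst Bochner_Integration.integral_indicator) (auto intro!: arg_cong[where f="measure M"])
  finally show ?thesis by simp
qed

section \<open>Fubini, independence and moments of sums on finite i.i.d. products\<close>

context prob_space
begin

abbreviation iid :: "nat set \<Rightarrow> (nat \<Rightarrow> 'a) measure" where
  "iid I \<equiv> Pi\<^sub>M I (\<lambda>_. M)"

lemma prob_space_iid: "prob_space (iid I)"
  by (intro prob_space_PiM prob_space_axioms)

lemma bmeas_component: "i \<in> I \<Longrightarrow> bmeas M f \<Longrightarrow> bmeas (iid I) (\<lambda>p. f (p i))"
proof -
  assume "i \<in> I" "bmeas M f"
  then obtain B where "\<forall>x\<in>space M. \<bar>f x\<bar> \<le> B" and [measurable]: "f \<in> borel_measurable M" unfolding bmeas_def by auto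
  with \<open>i \<in> I\<close> show ?thesis by (auto intro!: bmeasI[where B=B] simp: space_PiM PiE_iff)
qed

lemma iid_measurable_upd:
  assumes "finite I" "i \<in> I"
  shows "(\<lambda>(p,z). p(i := z)) \<in> measurable (iid (I - {i}) \<Otimes>\<^sub>M M) (iid I)"
  using measurable_add_dim[of i "I - {i}" "\<lambda>_. M"] assms by (simp add: insert_absorb)

lemma bmeas_upd:
  assumes "finite I" "i \<in> I" "bmeas (iid I) F" "z \<in> space M"
  shows "bmeas (iid (I - {i})) (\<lambda>p. F (p(i := z)))"
proof -
  from assms obtain B where B: "\<forall>x\<in>space (iid I). \<bar>F x\<bar> \<le> B" and F[measurable]: "F \<in> borel_measurable (iid I)"
    unfolding bmeas_def by auto
  have m: "(\<lambda>p. p(i := z)) \<in> measurable (iid (I - {i})) (iid I)"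
    using assms by (intro measurable_fun_upd[where J="I - {i}"]) auto
  show ?thesis
    using B measurable_space[OF m] by (intro bmeasI[where B=B] measurable_compose[OF m F]) auto
qed

text \<open>Fubini with coordinate \<open>i\<close> outermost, that is, conditioning on one
  observation while the others remain a product. All leave-one-out arguments rest on it.\<close>

lemma iid_split:
  assumes "finite I" "i \<in> I" "bmeas (iid I) F"
  shows "(\<integral>p. F p \<partial>iid I) = (\<integral>z. (\<integral>p. F (p(i := z)) \<partial>iid (I - {i})) \<partial>M)"
    and "bmeas M (\<lambda>z. \<integral>p. F (p(i := z)) \<partial>iid (I - {i}))"
proof -
  interpret J: prob_space "iid (I - {i})" by (rule prob_space_iid)
  interpret II: prob_space "iid I" by (rule prob_space_iid)
  interpret product_sigma_finite "\<lambda>_. M" by standard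
  interpret PR: pair_prob_space "iid (I - {i})" M ..
  from assms obtain B where B: "\<forall>x\<in>space (iid I). \<bar>F x\<bar> \<le> B" and F[measurable]: "F \<in> borel_measurable (iid I)"
    unfolding bmeas_def by auto
  have eq: "insert i (I - {i}) = I" using assms by auto
  have bm: "bmeas (iid (I - {i}) \<Otimes>\<^sub>M M) (\<lambda>(p,z). F (p(i := z)))"
  proof (rule bmeasI[where B=B])
    show "(\<lambda>(p, z). F (p(i := z))) \<in> borel_measurable (iid (I - {i}) \<Otimes>\<^sub>M M)"
      using measurable_compose[OF iid_measurable_upd[OF assms(1,2)] F] by (simp add: case_prod_beta')
    fix x assume "x \<in> space (iid (I - {i}) \<Otimes>\<^sub>M M)"
    then show "\<bar>case x of (p, z) \<Rightarrow> F (p(i := z))\<bar> \<le> B"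
      using measurable_space[OF iid_measurable_upd[OF assms(1,2)], of x] B by (auto split: prod.splits)
  qed
  have int: "integrable (iid (I - {i}) \<Otimes>\<^sub>M M) (\<lambda>(p,z). F (p(i := z)))"
    by (rule PR.bmeas_integrable[OF bm])
  have "(\<integral>p. F p \<partial>iid I) = (\<integral>p. (\<integral>z. F (p(i:=z)) \<partial>M) \<partial>iid (I - {i}))"
    using product_integral_insert[of "I - {i}" i F] II.bmeas_integrable[OF assms(3)] assms(1) eq by simp
  also have "\<dots> = (\<integral>z. (\<integral>p. F (p(i := z)) \<partial>iid (I - {i})) \<partial>M)"
    using PR.Fubini_integral[OF int] by simp
  finally show "(\<integral>p. F p \<partial>iid I) = (\<integral>z. (\<integral>p. F (p(i := z)) \<partial>iid (I - {i})) \<partial>M)" .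
  show "bmeas M (\<lambda>z. \<integral>p. F (p(i := z)) \<partial>iid (I - {i}))"
  proof (rule bmeasI[where B=B])
    have [measurable]: "(\<lambda>(p,z). F (p(i := z))) \<in> borel_measurable (iid (I - {i}) \<Otimes>\<^sub>M M)"
      using bm by (rule bmeas_measurable)
    show "(\<lambda>z. \<integral>p. F (p(i := z)) \<partial>iid (I - {i})) \<in> borel_measurable M"
      by (rule J.borel_measurable_lebesgue_integral) (use measurable_compose[OF measurable_pair_swap' bmeas_measurable[OF bm]] in \<open>simp add: case_prod_beta'\<close>)
    fix z assume z: "z \<in> space M"
    note bz = bmeas_upd[OF assms z]
    have "\<bar>\<integral>p. F (p(i := z)) \<partial>iid (I - {i})\<bar> \<le> (\<integral>p. \<bar>F (p(i := z))\<bar> \<partial>iid (I - {i}))"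
      by (rule integral_abs_bound)
    also have "\<dots> \<le> (\<integral>p. B \<partial>iid (I - {i}))"
    proof (rule integral_mono)
      show "integrable (iid (I - {i})) (\<lambda>p. \<bar>F (p(i := z))\<bar>)" by (intro J.bmeas_integrable bmeas_abs bz)
      fix p assume "p \<in> space (iid (I - {i}))"
      then show "\<bar>F (p(i := z))\<bar> \<le> B" using B measurable_space[OF iid_measurable_upd[OF assms(1,2)], of "(p,z)"] z
        by (auto simp: space_pair_measure)
    qed simp
    also have "\<dots> = B" by (simp add: J.prob_space)
    finally show "\<bar>\<integral>p. F (p(i := z)) \<partial>iid (I - {i})\<bar> \<le> B" .
  qed
qed

lemma integral_le_iid_split:
  assumes "finite I" "i \<in> I" "bmeas (iid I) F" "bmeas M G"
    and "\<And>z. z \<in> space M \<Longrightarrow> (\<integral>p. F (p(i := z)) \<partial>iid (I - {i})) \<le> G z"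
  shows "(\<integral>p. F p \<partial>iid I) \<le> (\<integral>z. G z \<partial>M)"
  unfolding iid_split(1)[OF assms(1-3)]
  by (intro integral_mono bmeas_integrable iid_split(2) assms)

text \<open>Independence of coordinate \<open>i\<close> is encoded as invariance of \<open>g\<close>
  under updating that coordinate, so no sigma-algebra has to be named.\<close>

lemma iid_indep_mult:
  assumes "finite I" "i \<in> I" "bmeas M u" "bmeas (iid I) g"
    and g: "\<And>p z. g (p(i := z)) = g p"
  shows "(\<integral>p. u (p i) * g p \<partial>iid I) = (\<integral>z. u z \<partial>M) * (\<integral>p. g p \<partial>iid I)"
proof -
  have "(\<integral>p. u (p i) * g p \<partial>iid I) = (\<integral>z. u z * (\<integral>p. g p \<partial>iid (I - {i})) \<partial>M)"
    by (subst iid_split[OF assms(1,2)]) (auto intro!: bmeas_intros bmeas_component assms simp: g)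
  also have "\<dots> = (\<integral>z. u z \<partial>M) * (\<integral>p. g p \<partial>iid (I - {i}))" by simp
  also have "(\<integral>p. g p \<partial>iid (I - {i})) = (\<integral>p. g p \<partial>iid I)"
    by (subst iid_split(1)[OF assms(1,2,4)]) (simp add: g prob_space)
  finally show ?thesis .
qed

lemma iid_component:
  assumes "finite I" "i \<in> I" "bmeas M u"
  shows "(\<integral>p. u (p i) \<partial>iid I) = (\<integral>z. u z \<partial>M)"
proof -
  interpret II: prob_space "iid I" by (rule prob_space_iid)
  show ?thesis using iid_indep_mult[OF assms bmeas_const[of _ 1]] by (simp add: II.prob_space)
qed

lemma iid_integral_exp_sum:
  assumes "finite I" "bmeas M u"
  shows "(\<integral>p. exp (\<Sum>i\<in>I. u (p i)) \<partial>iid I) = (\<integral>z. exp (u z) \<partial>M) ^ card I"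
proof -
  interpret product_sigma_finite "\<lambda>_. M" by standard
  show ?thesis using product_integral_prod[of I "\<lambda>_ z. exp (u z)"] assms
    by (simp add: exp_sum bmeas_integrable bmeas_exp)
qed

lemma iid_sum_moments:
  assumes "finite I" "bmeas M u" "(\<integral>z. u z \<partial>M) = 0"
  shows iid_sum_mean: "(\<integral>p. (\<Sum>i\<in>I. u (p i)) \<partial>iid I) = 0"
    and iid_sum_second: "(\<integral>p. (\<Sum>i\<in>I. u (p i))\<^sup>2 \<partial>iid I) = card I * (\<integral>z. (u z)\<^sup>2 \<partial>M)"
    and iid_sum_fourth: "(\<integral>p. (\<Sum>i\<in>I. u (p i)) ^ 4 \<partial>iid I)
       \<le> card I * (\<integral>z. (u z)^4 \<partial>M) + 3 * (real (card I) * (\<integral>z. (u z)\<^sup>2 \<partial>M))\<^sup>2"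
proof -
  let ?E = "\<lambda>I g. \<integral>p. g (\<Sum>i\<in>I. u (p i)) \<partial>iid I"
  let ?v = "\<integral>z. (u z)\<^sup>2 \<partial>M" and ?q = "\<integral>z. (u z)^4 \<partial>M"
  have "?E I (\<lambda>s. s) = 0 \<and> ?E I (\<lambda>s. s\<^sup>2) = card I * ?v \<and> ?E I (\<lambda>s. s^4) \<le> card I * ?q + 3 * (real (card I) * ?v)\<^sup>2"
    using assms(1)
  proof (induction I rule: finite_induct)
    case empty show ?case by simp
  next
    case (insert j I)
    interpret II: prob_space "iid I" by (rule prob_space_iid)
    let ?S = "\<lambda>p. \<Sum>i\<in>I. u (p i)"
    have S: "bmeas (iid I) ?S" by (intro bmeas_intros bmeas_component assms)
    have S': "bmeas (iid (insert j I)) (\<lambda>p. \<Sum>i\<in>insert j I. u (p i))" by (intro bmeas_intros bmeas_component assms)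
    have fin: "finite (insert j I)" and ji: "j \<in> insert j I" using insert by auto
    have upd: "(\<Sum>i\<in>insert j I. u ((p(j := z)) i)) = ?S p + u z" for p z
    proof -
      have "(\<Sum>i\<in>I. u ((p(j := z)) i)) = ?S p" using insert(2) by (intro sum.cong) auto
      then show ?thesis using insert by (simp del: fun_upd_apply) simp
    qed
    have step: "?E (insert j I) g = (\<integral>z. (\<integral>p. g (?S p + u z) \<partial>iid I) \<partial>M)"
      if "\<And>N (f:: (nat \<Rightarrow> 'a) \<Rightarrow> real). bmeas N f \<Longrightarrow> bmeas N (\<lambda>x. g (f x))" for g :: "real \<Rightarrow> real"
      using iid_split(1)[OF fin ji that[OF S']] upd insert(2) by simp
    note ii = II.bmeas_integrable[OF bmeas_power[OF S]]
    note i1 = II.bmeas_integrable[OF S]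
    have ub: "bmeas M (\<lambda>z. u z ^ k)" for k by (intro bmeas_intros assms)
    note iu = bmeas_integrable[OF ub]
    note iu1 = bmeas_integrable[OF assms(2)]
    have e1: "?E (insert j I) (\<lambda>s. s) = 0"
      by (subst step) (use insert.IH i1 iu1 assms(3) in \<open>auto simp: II.prob_space prob_space\<close>)
    have e2: "?E (insert j I) (\<lambda>s. s\<^sup>2) = card (insert j I) * ?v"
    proof -
      have *: "(\<integral>p. (?S p + u z)\<^sup>2 \<partial>iid I) = card I * ?v + (u z)\<^sup>2" for z
        using insert.IH i1 ii by (simp add: power2_sum II.prob_space)
      show ?thesis by (subst step, erule bmeas_power) (use insert iu in \<open>simp add: * prob_space ring_distribs\<close>)
    qed
    have e4: "?E (insert j I) (\<lambda>s. s^4) \<le> card (insert j I) * ?q + 3 * (real (card (insert j I)) * ?v)\<^sup>2"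
    proof -
      have ex: "(a + b)^4 = a^4 + 4 * b * a^3 + 6 * b\<^sup>2 * a\<^sup>2 + 4 * b^3 * a + b^4" for a b :: real
        by (simp add: power2_eq_square power4_eq_xxxx power3_eq_cube algebra_simps)
      have *: "(\<integral>p. (?S p + u z)^4 \<partial>iid I) = ?E I (\<lambda>s. s^4) + 4 * u z * ?E I (\<lambda>s. s^3) + 6 * (u z)\<^sup>2 * (card I * ?v) + (u z)^4" for z
        unfolding ex using insert.IH i1 ii by (simp add: II.prob_space)
      \<comment> \<open>The odd terms are gone: the one linear in \<open>u z\<close> because
        \<open>u\<close> is centred, the one with \<open>u z ^ 3\<close> because the old sum
        is.\<close>
      have "?E (insert j I) (\<lambda>s. s^4) = ?E I (\<lambda>s. s^4) + 6 * (card I * ?v) * ?v + ?q"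
        by (subst step, erule bmeas_power) (use insert iu iu1 assms(3) in \<open>simp add: * prob_space\<close>)
      also have "\<dots> \<le> card I * ?q + 3 * (real (card I) * ?v)\<^sup>2 + 6 * (card I * ?v) * ?v + ?q" using insert.IH by simp
      \<comment> \<open>3 * (k + 1)^2 - 3 * k^2 = 6 * k + 3 for k = \<open>card I\<close>, so the
        cross term 6 * k * \<open>?v\<close>^2 fits with 3 * \<open>?v\<close>^2 to spare.\<close>
      also have "\<dots> = card (insert j I) * ?q + 3 * ((real (card (insert j I)) * ?v)\<^sup>2 - ?v\<^sup>2)"
        using insert by (simp add: power2_eq_square algebra_simps)
      also have "\<dots> \<le> card (insert j I) * ?q + 3 * (real (card (insert j I)) * ?v)\<^sup>2" by (simp add: algebra_simps)
      finally show ?thesis .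
    qed
    show ?case using e1 e2 e4 by simp
  qed
  then show "(\<integral>p. (\<Sum>i\<in>I. u (p i)) \<partial>iid I) = 0"
    "(\<integral>p. (\<Sum>i\<in>I. u (p i))\<^sup>2 \<partial>iid I) = card I * ?v"
    "(\<integral>p. (\<Sum>i\<in>I. u (p i)) ^ 4 \<partial>iid I) \<le> card I * ?q + 3 * (real (card I) * ?v)\<^sup>2" by auto
qed

text \<open>Integrate 2 p q |f g| \<le> p^2 f^2 + q^2 g^2 and choose the weights: p =
  \<open>?B\<close>, q = \<open>?C\<close> in general; if \<open>?B\<close> vanishes, the right side
  does not grow with q, so \<open>?C\<close> must vanish too.\<close>

lemma bmeas_cauchy_schwarz:
  assumes f: "bmeas M f" and g: "bmeas M g"
  shows "(\<integral>x. \<bar>f x * g x\<bar> \<partial>M) \<le> sqrt (\<integral>x. (f x)\<^sup>2 \<partial>M) * sqrt (\<integral>x. (g x)\<^sup>2 \<partial>M)"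
proof -
  let ?A = "\<integral>x. (f x)\<^sup>2 \<partial>M" and ?B = "\<integral>x. (g x)\<^sup>2 \<partial>M" and ?C = "\<integral>x. \<bar>f x * g x\<bar> \<partial>M"
  have A: "?A \<ge> 0" "?B \<ge> 0" "?C \<ge> 0" by auto
  have i: "integrable M (\<lambda>x. (f x)\<^sup>2)" "integrable M (\<lambda>x. (g x)\<^sup>2)" "integrable M (\<lambda>x. \<bar>f x * g x\<bar>)"
    by (intro bmeas_integrable bmeas_intros assms)+
  have *: "2 * p * q * ?C \<le> p\<^sup>2 * ?A + q\<^sup>2 * ?B" for p q :: real
  proof -
    have "(\<integral>x. 2 * p * q * \<bar>f x * g x\<bar> \<partial>M) \<le> (\<integral>x. p\<^sup>2 * (f x)\<^sup>2 + q\<^sup>2 * (g x)\<^sup>2 \<partial>M)"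
    proof (rule integral_mono)
      fix x have "0 \<le> (p * \<bar>f x\<bar> - q * \<bar>g x\<bar>)\<^sup>2" by simp
      then show "2 * p * q * \<bar>f x * g x\<bar> \<le> p\<^sup>2 * (f x)\<^sup>2 + q\<^sup>2 * (g x)\<^sup>2"
        by (simp add: power2_diff power_mult_distrib abs_mult algebra_simps)
    qed (use i in auto)
    then show ?thesis using i by simp
  qed
  have "?C\<^sup>2 \<le> ?A * ?B"
  proof (cases "?B = 0")
    case True
    have "?C = 0"
    proof (rule ccontr)
      assume "?C \<noteq> 0" then have C: "?C > 0" using A(3) by linarith
      from *[of 1 "(?A + 1) / ?C"] show False using C True A by simp
    qed
    then show ?thesis using A by simp
  next
    case False
    from *[of ?B ?C] have "2 * ?B * ?C\<^sup>2 \<le> ?B * (?A * ?B + ?C\<^sup>2)" by (simp add: power2_eq_square algebra_simps)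
    then have "?B * (2 * ?C\<^sup>2) \<le> ?B * (?A * ?B + ?C\<^sup>2)" by (simp add: algebra_simps)
    then have "2 * ?C\<^sup>2 \<le> ?A * ?B + ?C\<^sup>2" using False A by (subst (asm) mult_le_cancel_left) auto
    then show ?thesis by simp
  qed
  from real_le_rsqrt[OF this] show ?thesis by (simp add: real_sqrt_mult)
qed

lemma bmeas_abs_le_sqrt:
  assumes f: "bmeas M f"
  shows "(\<integral>x. \<bar>f x\<bar> \<partial>M) \<le> sqrt (\<integral>x. (f x)\<^sup>2 \<partial>M)"
  using bmeas_cauchy_schwarz[OF f bmeas_const[of _ 1]] by (simp add: prob_space)

end

section \<open>Concentration with random window width\<close>

text \<open>Clamping to \<open>[a - d - \<alpha>, a + \<alpha>]\<close> and centring: the slope is 1 on a neighbourhood of the window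
  \<open>[a - d, a]\<close> whose probability is to be bounded, while the function itself stays small.\<close>

definition ramp :: "real \<Rightarrow> real \<Rightarrow> real \<Rightarrow> real \<Rightarrow> real" where
  "ramp a \<alpha> d w = min (max w (a - d - \<alpha>)) (a + \<alpha>) - (a - d / 2)"

lemma ramp_abs_le: "0 \<le> d \<Longrightarrow> 0 \<le> \<alpha> \<Longrightarrow> \<bar>ramp a \<alpha> d w\<bar> \<le> d / 2 + \<alpha>"
  unfolding ramp_def by (auto simp: min_def max_def abs_if)

text \<open>The lower clamp moves by the change of width and the centring constant by half of it,
  whence 3/2.\<close>

lemma ramp_diff_width: "0 \<le> d \<Longrightarrow> 0 \<le> d' \<Longrightarrow> 0 \<le> \<alpha> \<Longrightarrow> \<bar>ramp a \<alpha> d w - ramp a \<alpha> d' w\<bar> \<le> 3 / 2 * \<bar>d - d'\<bar>"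
  unfolding ramp_def by (auto simp: min_def max_def abs_if field_simps)

text \<open>The first claim is monotonicity. For the second, a margin of length
  \<open>\<alpha>\<close> with slope 1 remains on both sides of the window, so a step of size |r| is
  registered in full up to length \<open>\<alpha>\<close>.\<close>

lemma ramp_increment:
  assumes "0 \<le> d" "0 \<le> \<alpha>"
  shows "0 \<le> r * (ramp a \<alpha> d w - ramp a \<alpha> d (w - r))"
    and "a - d \<le> w \<Longrightarrow> w \<le> a \<Longrightarrow> \<bar>r\<bar> * min \<bar>r\<bar> \<alpha> \<le> r * (ramp a \<alpha> d w - ramp a \<alpha> d (w - r))"
proof -
  have "0 \<le> ramp a \<alpha> d w - ramp a \<alpha> d (w - r)" if "r \<ge> 0" using that assms unfolding ramp_def by (auto simp: min_def max_def)
  moreover have "ramp a \<alpha> d w - ramp a \<alpha> d (w - r) \<le> 0" if "r \<le> 0" using that assms unfolding ramp_def by (auto simp: min_def max_def)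
  ultimately show "0 \<le> r * (ramp a \<alpha> d w - ramp a \<alpha> d (w - r))"
    by (cases "r \<ge> 0") (auto intro: mult_nonneg_nonneg mult_nonpos_nonpos)
  assume w: "a - d \<le> w" "w \<le> a"
  have 1: "min \<bar>r\<bar> \<alpha> \<le> ramp a \<alpha> d w - ramp a \<alpha> d (w - r)" if "r \<ge> 0"
    using that assms w unfolding ramp_def by (auto simp: min_def max_def)
  have 2: "min \<bar>r\<bar> \<alpha> \<le> -(ramp a \<alpha> d w - ramp a \<alpha> d (w - r))" if "r \<le> 0"
    using that assms w unfolding ramp_def by (auto simp: min_def max_def)
  show "\<bar>r\<bar> * min \<bar>r\<bar> \<alpha> \<le> r * (ramp a \<alpha> d w - ramp a \<alpha> d (w - r))"
  proof (cases "r \<ge> 0")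
    case True then show ?thesis using mult_left_mono[OF 1, of r] by simp
  next
    case False then show ?thesis using mult_left_mono[OF 2, of "-r"] by (simp add: algebra_simps)
  qed
qed

context prob_space
begin

text \<open>Stein's argument for concentration in the style of Chen and Shao. E [\<xi>_i F] vanishes
  if F uses neither the i-th term of W nor a width depending on it; hence E [W F] is a sum of ramp
  increments, which on the event dominate a truncated variance sum, up to the cost of exchanging
  \<open>\<Delta>\<close> for \<open>\<Delta>' i\<close>. On the other hand |F| \<le>
  \<open>\<Delta>\<close> / 2 + \<open>\<Gamma>\<close> makes E [W F] small. The variance may range
  over [1/2, 1] so that sums with one term removed are covered.\<close>

theorem randomized_concentration:
  assumes I: "finite I" and xi: "bmeas M \<xi>" and mean: "(\<integral>z. \<xi> z \<partial>M) = 0"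
    and v: "card I * (\<integral>z. (\<xi> z)\<^sup>2 \<partial>M) \<le> 1" "1/2 \<le> card I * (\<integral>z. (\<xi> z)\<^sup>2 \<partial>M)"
    and G: "card I * (\<integral>z. \<bar>\<xi> z\<bar> ^ 3 \<partial>M) \<le> \<Gamma>" "0 < \<Gamma>"
    and D: "bmeas (iid I) \<Delta>" "\<And>p. 0 \<le> \<Delta> p"
    and Di: "\<And>i. i \<in> I \<Longrightarrow> bmeas (iid I) (\<Delta>' i)" "\<And>i p. 0 \<le> \<Delta>' i p" "\<And>i p z. i \<in> I \<Longrightarrow> \<Delta>' i (p(i := z)) = \<Delta>' i p"
  shows "measure (iid I) {p \<in> space (iid I). a - \<Delta> p \<le> (\<Sum>i\<in>I. \<xi> (p i)) \<and> (\<Sum>i\<in>I. \<xi> (p i)) \<le> a}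
     \<le> 2 * sqrt (\<integral>p. (\<Delta> p)\<^sup>2 \<partial>iid I) + 8 * \<Gamma> + 6 * (\<Sum>i\<in>I. \<integral>p. \<bar>\<xi> (p i)\<bar> * \<bar>\<Delta> p - \<Delta>' i p\<bar> \<partial>iid I)"
proof -
  interpret II: prob_space "iid I" by (rule prob_space_iid)
  define W where "W p = (\<Sum>i\<in>I. \<xi> (p i))" for p
  define W' where "W' i p = (\<Sum>j\<in>I - {i}. \<xi> (p j))" for i p
  define A where "A p \<longleftrightarrow> a - \<Delta> p \<le> W p \<and> W p \<le> a" for p
  define \<eta> where "\<eta> z = \<bar>\<xi> z\<bar> * min \<bar>\<xi> z\<bar> \<Gamma>" for z
  define F where "F d w = ramp a \<Gamma> d w" for d w
  have W: "bmeas (iid I) W" unfolding W_def by (intro bmeas_intros bmeas_component xi)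
  have W': "bmeas (iid I) (W' i)" for i unfolding W'_def by (intro bmeas_intros bmeas_component xi) auto
  have WW': "W' i p = W p - \<xi> (p i)" if "i \<in> I" for i p
    unfolding W_def W'_def using that I by (simp add: sum_diff1)
  have W'i: "W' i (p(i := z)) = W' i p" for i p z unfolding W'_def by (intro sum.cong) auto
  have A: "bmeas (iid I) (\<lambda>p. of_bool (A p))" unfolding A_def by (intro bmeas_of_bool pred_bmeas bmeas_intros W D)
  have eta: "bmeas M \<eta>" unfolding \<eta>_def by (intro bmeas_intros xi)
  have bF: "bmeas N (\<lambda>p. F (d p) (w p))" if "bmeas N d" "bmeas N w" for N and d w :: "(nat \<Rightarrow> 'a) \<Rightarrow> real"
    unfolding F_def ramp_def by (intro bmeas_intros that)
  note ei = II.bmeas_integrable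
  have xic: "i \<in> I \<Longrightarrow> bmeas (iid I) (\<lambda>p. \<xi> (p i))" for i by (intro bmeas_component xi)
  have zero: "(\<integral>p. \<xi> (p i) * F (\<Delta>' i p) (W' i p) \<partial>iid I) = 0" if "i \<in> I" for i
    by (subst iid_indep_mult[OF I that xi]) (use that in \<open>auto intro!: bF Di W' simp: Di(3) W'i mean\<close>)
  have low: "(\<integral>p. of_bool (A p) * (\<Sum>i\<in>I. \<eta> (p i)) \<partial>iid I) \<le>
     (\<integral>p. (W p * F (\<Delta> p) (W p) + 3/2 * (\<Sum>i\<in>I. \<bar>\<xi> (p i)\<bar> * \<bar>\<Delta> p - \<Delta>' i p\<bar>)) - (\<Sum>i\<in>I. \<xi> (p i) * F (\<Delta>' i p) (W' i p)) \<partial>iid I)"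
  proof (rule integral_mono)
    fix p assume "p \<in> space (iid I)"
    have t: "of_bool (A p) * \<eta> (p i) \<le> \<xi> (p i) * F (\<Delta> p) (W p) + 3/2 * (\<bar>\<xi> (p i)\<bar> * \<bar>\<Delta> p - \<Delta>' i p\<bar>) - \<xi> (p i) * F (\<Delta>' i p) (W' i p)" if "i \<in> I" for i
    proof -
      have "of_bool (A p) * \<eta> (p i) \<le> \<xi> (p i) * (F (\<Delta> p) (W p) - F (\<Delta> p) (W p - \<xi> (p i)))"
        using ramp_increment[where d="\<Delta> p" and \<alpha>=\<Gamma> and r="\<xi> (p i)" and a=a and w="W p"] D(2)[of p] G(2) by (auto simp: A_def \<eta>_def F_def)
      moreover have "\<bar>\<xi> (p i) * (F (\<Delta> p) (W' i p) - F (\<Delta>' i p) (W' i p))\<bar> \<le> \<bar>\<xi> (p i)\<bar> * (3/2 * \<bar>\<Delta> p - \<Delta>' i p\<bar>)"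
        unfolding abs_mult F_def by (intro mult_left_mono ramp_diff_width) (use D Di G in auto)
      ultimately show ?thesis unfolding WW'[OF that, of p, symmetric] right_diff_distrib by linarith
    qed
    have "of_bool (A p) * (\<Sum>i\<in>I. \<eta> (p i)) = (\<Sum>i\<in>I. of_bool (A p) * \<eta> (p i))" by (simp add: sum_distrib_left)
    also have "\<dots> \<le> (\<Sum>i\<in>I. \<xi> (p i) * F (\<Delta> p) (W p) + 3/2 * (\<bar>\<xi> (p i)\<bar> * \<bar>\<Delta> p - \<Delta>' i p\<bar>) - \<xi> (p i) * F (\<Delta>' i p) (W' i p))"
      by (rule sum_mono) (rule t)
    also have "\<dots> = (W p * F (\<Delta> p) (W p) + 3/2 * (\<Sum>i\<in>I. \<bar>\<xi> (p i)\<bar> * \<bar>\<Delta> p - \<Delta>' i p\<bar>)) - (\<Sum>i\<in>I. \<xi> (p i) * F (\<Delta>' i p) (W' i p))"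
      unfolding W_def by (simp add: sum.distrib sum_subtractf sum_distrib_left sum_distrib_right)
    finally show "of_bool (A p) * (\<Sum>i\<in>I. \<eta> (p i)) \<le> \<dots>" .
  qed (intro ei bmeas_intros A bF W W' D Di xi bmeas_component eta; assumption)+
  also have "\<dots> = (\<integral>p. W p * F (\<Delta> p) (W p) \<partial>iid I) + 3/2 * (\<Sum>i\<in>I. \<integral>p. \<bar>\<xi> (p i)\<bar> * \<bar>\<Delta> p - \<Delta>' i p\<bar> \<partial>iid I)"
  proof -
    have i1: "integrable (iid I) (\<lambda>p. W p * F (\<Delta> p) (W p))" by (intro ei bmeas_intros bF W D)
    have i2: "i \<in> I \<Longrightarrow> integrable (iid I) (\<lambda>p. \<bar>\<xi> (p i)\<bar> * \<bar>\<Delta> p - \<Delta>' i p\<bar>)" for i by (intro ei bmeas_intros xic D Di)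
    have i3: "i \<in> I \<Longrightarrow> integrable (iid I) (\<lambda>p. \<xi> (p i) * F (\<Delta>' i p) (W' i p))" for i by (intro ei bmeas_intros xic bF W' Di)
    show ?thesis using i1 i2 i3 zero by simp
  qed
  also have "(\<integral>p. W p * F (\<Delta> p) (W p) \<partial>iid I) \<le> sqrt (\<integral>p. (\<Delta> p)\<^sup>2 \<partial>iid I) / 2 + \<Gamma>"
  proof -
    have "(\<integral>p. W p * F (\<Delta> p) (W p) \<partial>iid I) \<le> (\<integral>p. \<bar>W p * \<Delta> p\<bar> / 2 + \<Gamma> * \<bar>W p\<bar> \<partial>iid I)"
    proof (rule integral_mono)
      fix p
      have "W p * F (\<Delta> p) (W p) \<le> \<bar>W p\<bar> * \<bar>F (\<Delta> p) (W p)\<bar>" by (metis abs_mult abs_ge_self)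
      also have "\<dots> \<le> \<bar>W p\<bar> * (\<Delta> p / 2 + \<Gamma>)" unfolding F_def
        by (intro mult_left_mono ramp_abs_le D) (use G in auto)
      finally show "W p * F (\<Delta> p) (W p) \<le> \<bar>W p * \<Delta> p\<bar> / 2 + \<Gamma> * \<bar>W p\<bar>" using D(2)[of p] by (simp add: abs_mult algebra_simps)
    qed (intro ei bmeas_intros bF W D)+
    also have "\<dots> = (\<integral>p. \<bar>W p * \<Delta> p\<bar> \<partial>iid I) / 2 + \<Gamma> * (\<integral>p. \<bar>W p\<bar> \<partial>iid I)"
      by (subst Bochner_Integration.integral_add) (auto intro!: ei bmeas_intros W D)
    also have "\<dots> \<le> sqrt (\<integral>p. (\<Delta> p)\<^sup>2 \<partial>iid I) / 2 + \<Gamma> * 1"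
    proof -
      have *: "sqrt (\<integral>p. (W p)\<^sup>2 \<partial>iid I) \<le> 1" unfolding W_def by (subst iid_sum_second[OF I xi mean]) (use v in auto)
      have "(\<integral>p. \<bar>W p * \<Delta> p\<bar> \<partial>iid I) \<le> 1 * sqrt (\<integral>p. (\<Delta> p)\<^sup>2 \<partial>iid I)"
        by (rule order_trans[OF II.bmeas_cauchy_schwarz[OF W D(1)]]) (intro mult_right_mono *, simp)
      moreover have "(\<integral>p. \<bar>W p\<bar> \<partial>iid I) \<le> 1" by (rule order_trans[OF II.bmeas_abs_le_sqrt[OF W] *])
      ultimately show ?thesis using G by (intro add_mono mult_left_mono) auto
    qed
    finally show ?thesis by simp
  qed
  finally have up: "(\<integral>p. of_bool (A p) * (\<Sum>i\<in>I. \<eta> (p i)) \<partial>iid I) \<le> sqrt (\<integral>p. (\<Delta> p)\<^sup>2 \<partial>iid I) / 2 + \<Gamma> + 3/2 * (\<Sum>i\<in>I. \<integral>p. \<bar>\<xi> (p i)\<bar> * \<bar>\<Delta> p - \<Delta>' i p\<bar> \<partial>iid I)"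
    by simp
  define e where "e = (\<integral>z. \<eta> z \<partial>M)"
  \<comment> \<open>Truncation at \<open>\<Gamma>\<close> loses at most half of the guaranteed
    variance: t^2 \<le> t^3 / (4 * \<Gamma>) + \<Gamma> * t is the inequality of means, and the
    third moments sum to at most \<open>\<Gamma>\<close>.\<close>
  have e: "card I * e \<ge> 1/4"
  proof -
    have "(\<integral>z. (\<xi> z)\<^sup>2 - \<bar>\<xi> z\<bar>^3 / (4 * \<Gamma>) \<partial>M) \<le> e" unfolding e_def
    proof (rule integral_mono)
      fix z
      show "(\<xi> z)\<^sup>2 - \<bar>\<xi> z\<bar>^3 / (4 * \<Gamma>) \<le> \<eta> z"
      proof (cases "\<bar>\<xi> z\<bar> \<le> \<Gamma>")
        case True then show ?thesis using G by (simp add: \<eta>_def power2_eq_square)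
      next
        case False
        define t where "t = \<bar>\<xi> z\<bar>"
        have "0 \<le> t * (t - 2 * \<Gamma>)\<^sup>2 / (4 * \<Gamma>)" using G unfolding t_def by simp
        also have "\<dots> = t^3 / (4 * \<Gamma>) - t\<^sup>2 + t * \<Gamma>" using G by (simp add: field_simps power2_eq_square power3_eq_cube)
        finally show ?thesis using False by (simp add: \<eta>_def t_def)
      qed
    qed (intro bmeas_integrable bmeas_intros xi eta)+
    also have "(\<integral>z. (\<xi> z)\<^sup>2 - \<bar>\<xi> z\<bar>^3 / (4 * \<Gamma>) \<partial>M) = (\<integral>z. (\<xi> z)\<^sup>2 \<partial>M) - (\<integral>z. \<bar>\<xi> z\<bar>^3 \<partial>M) / (4 * \<Gamma>)"
      by (subst Bochner_Integration.integral_diff) (auto intro!: bmeas_integrable bmeas_intros xi)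
    finally have "card I * ((\<integral>z. (\<xi> z)\<^sup>2 \<partial>M) - (\<integral>z. \<bar>\<xi> z\<bar>^3 \<partial>M) / (4 * \<Gamma>)) \<le> card I * e" by (intro mult_left_mono) auto
    moreover have "card I * ((\<integral>z. \<bar>\<xi> z\<bar>^3 \<partial>M) / (4 * \<Gamma>)) \<le> 1/4" using G by (simp add: divide_simps mult_ac)
    ultimately show ?thesis using v by (simp add: right_diff_distrib)
  qed
  \<comment> \<open>The truncated variance sum is random, but truncation keeps its standard
    deviation below \<open>\<Gamma>\<close>, since \<eta>^2 \<le> \<Gamma>^2 * \<xi>^2.\<close>
  have dev: "(\<integral>p. \<bar>\<Sum>i\<in>I. (\<eta> (p i) - e)\<bar> \<partial>iid I) \<le> \<Gamma>"
  proof -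
    have be: "bmeas M (\<lambda>z. \<eta> z - e)" by (intro bmeas_intros eta)
    have me: "(\<integral>z. \<eta> z - e \<partial>M) = 0" using bmeas_integrable[OF eta] by (simp add: e_def prob_space)
    have "(\<integral>z. (\<eta> z - e)\<^sup>2 \<partial>M) \<le> (\<integral>z. (\<eta> z)\<^sup>2 \<partial>M)"
    proof -
      have "(\<integral>z. (\<eta> z - e)\<^sup>2 \<partial>M) = (\<integral>z. (\<eta> z)\<^sup>2 \<partial>M) - e\<^sup>2"
        using bmeas_integrable[OF eta] bmeas_integrable[OF bmeas_power[OF eta, of 2]]
        by (simp add: power2_diff prob_space flip: e_def) (simp add: power2_eq_square)
      then show ?thesis by simp
    qed
    also have "\<dots> \<le> (\<integral>z. \<Gamma>\<^sup>2 * (\<xi> z)\<^sup>2 \<partial>M)"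
    proof (rule integral_mono)
      fix z have "\<eta> z \<le> \<bar>\<xi> z\<bar> * \<Gamma>" "0 \<le> \<eta> z" unfolding \<eta>_def using G by (auto intro!: mult_left_mono)
      from power_mono[OF this, of 2] show "(\<eta> z)\<^sup>2 \<le> \<Gamma>\<^sup>2 * (\<xi> z)\<^sup>2" by (simp add: power_mult_distrib mult.commute)
    qed (intro bmeas_integrable bmeas_intros xi eta)+
    finally have "card I * (\<integral>z. (\<eta> z - e)\<^sup>2 \<partial>M) \<le> card I * (\<Gamma>\<^sup>2 * (\<integral>z. (\<xi> z)\<^sup>2 \<partial>M))" by (intro mult_left_mono) auto
    also have "\<dots> = \<Gamma>\<^sup>2 * (card I * (\<integral>z. (\<xi> z)\<^sup>2 \<partial>M))" by simp
    also have "\<dots> \<le> \<Gamma>\<^sup>2 * 1" by (intro mult_left_mono v) auto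
    finally have "sqrt (\<integral>p. (\<Sum>i\<in>I. (\<eta> (p i) - e))\<^sup>2 \<partial>iid I) \<le> \<Gamma>"
      using G by (subst iid_sum_second[OF I be me]) (auto intro: real_le_lsqrt)
    moreover have "(\<integral>p. \<bar>\<Sum>i\<in>I. (\<eta> (p i) - e)\<bar> \<partial>iid I) \<le> sqrt (\<integral>p. (\<Sum>i\<in>I. (\<eta> (p i) - e))\<^sup>2 \<partial>iid I)"
      by (intro II.bmeas_abs_le_sqrt bmeas_sum bmeas_component[OF _ be])
    ultimately show ?thesis by simp
  qed
  have "(\<integral>p. (card I * e) * of_bool (A p) - \<bar>\<Sum>i\<in>I. (\<eta> (p i) - e)\<bar> \<partial>iid I) \<le> (\<integral>p. of_bool (A p) * (\<Sum>i\<in>I. \<eta> (p i)) \<partial>iid I)"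
  proof (rule integral_mono)
    fix p show "(card I * e) * of_bool (A p) - \<bar>\<Sum>i\<in>I. (\<eta> (p i) - e)\<bar> \<le> of_bool (A p) * (\<Sum>i\<in>I. \<eta> (p i))"
      by (auto simp: sum_subtractf)
  qed (intro ei bmeas_intros A bmeas_component eta; assumption)+
  moreover have "(\<integral>p. (card I * e) * of_bool (A p) - \<bar>\<Sum>i\<in>I. (\<eta> (p i) - e)\<bar> \<partial>iid I) = (card I * e) * (\<integral>p. of_bool (A p) \<partial>iid I) - (\<integral>p. \<bar>\<Sum>i\<in>I. (\<eta> (p i) - e)\<bar> \<partial>iid I)"
    by (subst Bochner_Integration.integral_diff) (auto intro!: ei bmeas_intros A bmeas_component eta)
  moreover have "1/4 * (\<integral>p. of_bool (A p) \<partial>iid I) \<le> (card I * e) * (\<integral>p. of_bool (A p) \<partial>iid I)"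
    by (intro mult_right_mono e) simp
  ultimately have "1/4 * (\<integral>p. of_bool (A p) \<partial>iid I) \<le> \<Gamma> + (sqrt (\<integral>p. (\<Delta> p)\<^sup>2 \<partial>iid I) / 2 + \<Gamma> + 3/2 * (\<Sum>i\<in>I. \<integral>p. \<bar>\<xi> (p i)\<bar> * \<bar>\<Delta> p - \<Delta>' i p\<bar> \<partial>iid I))"
    using dev up by linarith
  moreover have "(\<integral>p. of_bool (A p) \<partial>iid I) = measure (iid I) {p \<in> space (iid I). A p}"
    by (rule II.measure_eq_integral_of_bool[symmetric]) (unfold A_def, intro pred_bmeas bmeas_intros W D)
  ultimately show ?thesis unfolding A_def W_def by linarith
qed

text \<open>Constant width 2 * r with right endpoint a + r; width and leave-one-out width coincide,
  so the last term of the random-width bound disappears.\<close>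

lemma concentration:
  assumes I: "finite I" and xi: "bmeas M \<xi>" and mean: "(\<integral>z. \<xi> z \<partial>M) = 0"
    and v: "card I * (\<integral>z. (\<xi> z)\<^sup>2 \<partial>M) \<le> 1" "1/2 \<le> card I * (\<integral>z. (\<xi> z)\<^sup>2 \<partial>M)"
    and G: "card I * (\<integral>z. \<bar>\<xi> z\<bar> ^ 3 \<partial>M) \<le> \<Gamma>" "0 < \<Gamma>" and r: "0 \<le> r"
  shows "measure (iid I) {p \<in> space (iid I). \<bar>(\<Sum>i\<in>I. \<xi> (p i)) - a\<bar> \<le> r} \<le> 4 * r + 8 * \<Gamma>"
proof -
  interpret II: prob_space "iid I" by (rule prob_space_iid)
  have "{p \<in> space (iid I). \<bar>(\<Sum>i\<in>I. \<xi> (p i)) - a\<bar> \<le> r}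
      = {p \<in> space (iid I). (a + r) - 2 * r \<le> (\<Sum>i\<in>I. \<xi> (p i)) \<and> (\<Sum>i\<in>I. \<xi> (p i)) \<le> a + r}" by auto
  moreover have "sqrt ((2 * r)\<^sup>2) = 2 * r" using r real_sqrt_abs[of "2 * r"] by simp
  ultimately show ?thesis
    using randomized_concentration[OF I xi mean v G, of "\<lambda>_. 2 * r" "\<lambda>_ _. 2 * r" "a + r"] r
    by (simp add: bmeas_const II.prob_space del: power_mult_distrib real_sqrt_abs)
qed

end

section \<open>The Mills ratio\<close>

abbreviation gauss :: "real \<Rightarrow> real" where "gauss \<equiv> std_normal_density"

lemma gauss_pos: "gauss x > 0"
  by (simp add: std_normal_density_def)

lemma gauss_deriv: "(gauss has_real_derivative - x * gauss x) (at x)"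
  unfolding std_normal_density_def[abs_def]
  by (auto intro!: derivative_eq_intros simp: field_simps power2_eq_square)

lemma continuous_on_gauss: "continuous_on A gauss"
  unfolding std_normal_density_def[abs_def] by (auto intro!: continuous_intros)

lemma gauss_minus: "gauss (- x) = gauss x"
  by (simp add: std_normal_density_def)

interpretation NORM: prob_space "density lborel gauss"
  by (rule prob_space_normal_density) simp

lemma Phi_diff:
  assumes "a \<le> b" shows "Phi b - Phi a = integral {a..b} gauss"
proof -
  have "Phi b = measure (density lborel gauss) ({..a} \<union> {a<..b})" unfolding Phi_def
    using assms by (auto intro!: arg_cong2[where f=measure])
  also have "\<dots> = Phi a + measure (density lborel gauss) {a<..b}" unfolding Phi_def
    by (rule NORM.finite_measure_Union) auto
  also have "measure (density lborel gauss) {a<..b} = (\<integral>x. indicator {a<..b} x * gauss x \<partial>lborel)"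
  proof -
    have "emeasure (density lborel gauss) {a<..b} = (\<integral>\<^sup>+ x. ennreal (gauss x * indicator {a<..b} x) \<partial>lborel)"
      by (subst emeasure_density) (auto intro!: nn_integral_cong simp: indicator_def)
    also have "\<dots> = ennreal (\<integral>x. gauss x * indicator {a<..b} x \<partial>lborel)"
      by (rule nn_integral_eq_integral) (auto intro!: integrable_real_mult_indicator integrable_normal_density)
    finally show ?thesis by (simp add: NORM.emeasure_eq_measure mult.commute)
  qed
  also have "\<dots> = (\<integral>x. indicator {a..b} x * gauss x \<partial>lborel)"
  proof (rule integral_cong_AE)
    have "AE x in lborel. x \<noteq> a" by (rule AE_lborel_singleton)
    then show "AE x in lborel. indicator {a<..b} x * gauss x = indicator {a..b} x * gauss x"
      by eventually_elim (auto simp: indicator_def)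
  qed auto
  also have "\<dots> = integral {a..b} gauss"
  proof -
    have "set_integrable lborel {a..b} gauss" unfolding set_integrable_def
      using integrable_real_mult_indicator[of "{a..b}" lborel gauss] by (auto simp: mult.commute)
    from set_borel_integral_eq_integral(2)[OF this] show ?thesis
      by (simp add: set_lebesgue_integral_def)
  qed
  finally show ?thesis by simp
qed

lemma Phi_deriv: "(Phi has_real_derivative gauss x) (at x)"
proof -
  have "((\<lambda>u. integral {x-1..u} gauss) has_real_derivative gauss x) (at x within {x-1..x+1})"
    by (rule integral_has_real_derivative[OF continuous_on_gauss]) auto
  then have "((\<lambda>u. integral {x-1..u} gauss + Phi (x - 1)) has_real_derivative gauss x) (at x within {x-1..x+1})"
    by (auto intro!: derivative_eq_intros)
  then have "(Phi has_real_derivative gauss x) (at x within {x-1..x+1})"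
    by (rule has_field_derivative_transform_within[of _ _ _ _ 1]) (auto simp flip: Phi_diff)
  moreover have "at x within {x-1..x+1} = at x" by (rule at_within_interior) simp
  ultimately show ?thesis by simp
qed

lemma Phi_mono: "a \<le> b \<Longrightarrow> Phi a \<le> Phi b"
  unfolding Phi_def by (intro NORM.finite_measure_mono) auto

lemma Phi_less: "a < b \<Longrightarrow> Phi a < Phi b"
  by (rule DERIV_pos_imp_increasing[of a b Phi]) (use Phi_deriv gauss_pos in blast)+

lemma Phi_at_top: "(Phi \<longlongrightarrow> 1) at_top"
proof -
  interpret R: real_distribution "density lborel gauss" by standard auto
  show ?thesis using R.cdf_lim_at_top_prob unfolding Phi_def cdf_def .
qed

text \<open>The density is even, so \<open>Phi (- x) + Phi x\<close> has derivative 0; its constant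
  value is read off at infinity.\<close>

lemma Phi_minus: "Phi (- x) = 1 - Phi x"
proof -
  have d: "((\<lambda>x. Phi (- x) + Phi x) has_real_derivative 0) (at x)" for x
    by (auto intro!: derivative_eq_intros DERIV_chain'[OF _ Phi_deriv, of "\<lambda>x. -x"] Phi_deriv simp: gauss_minus)
  have c: "Phi (- x) + Phi x = Phi (- y) + Phi y" for x y
    using DERIV_isconst_all[of "\<lambda>x. Phi (- x) + Phi x"] d by blast
  have b: "(Phi \<longlongrightarrow> 0) at_bot"
  proof -
    interpret R: real_distribution "density lborel gauss" by standard auto
    show ?thesis using R.cdf_lim_at_bot unfolding Phi_def cdf_def .
  qed
  have "((\<lambda>y. Phi (- y) + Phi y) \<longlongrightarrow> 0 + 1) at_top"
    by (intro tendsto_add filterlim_compose[OF b] Phi_at_top filterlim_uminus_at_bot_at_top)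
  moreover have "((\<lambda>y. Phi (- y) + Phi y) \<longlongrightarrow> Phi (- x) + Phi x) at_top"
    by (subst c[of _ x]) simp
  ultimately have "Phi (- x) + Phi x = 0 + 1" by (rule tendsto_unique[OF trivial_limit_at_top_linorder, rotated])
  then show ?thesis by simp
qed

lemma Phi_0: "Phi 0 = 1 / 2"
  using Phi_minus[of 0] by simp

lemma Phi_less_1: "Phi x < 1"
proof -
  have "Phi (x + 1) \<le> 1" unfolding Phi_def by (rule NORM.prob_le_1)
  then show ?thesis using Phi_less[of x "x + 1"] by simp
qed

lemma Phi_pos: "0 < Phi x"
  using Phi_minus[of "-x"] Phi_less_1[of "-x"] by simp

lemma gauss_at_top: "(gauss \<longlongrightarrow> 0) at_top"
  unfolding std_normal_density_def[abs_def] by real_asymp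

definition mills :: "real \<Rightarrow> real" where
  "mills x = (1 - Phi x) / gauss x"

lemma mills_pos: "0 < mills x"
  unfolding mills_def using Phi_less_1 gauss_pos by (simp add: less_diff_eq)

lemma mills_deriv: "(mills has_real_derivative x * mills x - 1) (at x)"
proof -
  have "gauss x \<noteq> 0" using gauss_pos[of x] by simp
  then show ?thesis unfolding mills_def[abs_def]
    by (auto intro!: derivative_eq_intros Phi_deriv gauss_deriv simp: field_simps)
qed

text \<open>Reduces each of the two Mills inequalities to the sign of one derivative.\<close>

lemma nonneg_if_decreasing_to_0:
  fixes f :: "real \<Rightarrow> real"
  assumes "\<And>y. y \<ge> x \<Longrightarrow> \<exists>D. (f has_real_derivative D) (at y) \<and> D \<le> 0" and lim: "(f \<longlongrightarrow> 0) at_top"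
  shows "0 \<le> f x"
proof -
  have "eventually (\<lambda>y. f y \<le> f x) at_top"
    using eventually_ge_at_top[of x] by eventually_elim (rule DERIV_nonpos_imp_nonincreasing; use assms in auto)
  from tendsto_upperbound[OF lim this] show ?thesis by simp
qed

lemma mills_upper: assumes "0 < x" shows "x * mills x \<le> 1"
proof -
  have "0 \<le> gauss x / x - (1 - Phi x)"
  proof (rule nonneg_if_decreasing_to_0[where f="\<lambda>x. gauss x / x - (1 - Phi x)"])
    fix y assume "y \<ge> x"
    then have y: "y > 0" using assms by simp
    have "((\<lambda>x. gauss x / x - (1 - Phi x)) has_real_derivative (- gauss y / y\<^sup>2)) (at y)"
      using y by (auto intro!: derivative_eq_intros Phi_deriv gauss_deriv simp: field_simps power2_eq_square)
    then show "\<exists>D. ((\<lambda>x. gauss x / x - (1 - Phi x)) has_real_derivative D) (at y) \<and> D \<le> 0"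
      using gauss_pos[of y] by (intro exI conjI) auto
  next
    have "((\<lambda>x. gauss x * inverse x - (1 - Phi x)) \<longlongrightarrow> 0 * 0 - (1 - 1)) at_top"
      by (intro tendsto_intros gauss_at_top Phi_at_top tendsto_inverse_0_at_top filterlim_ident)
    then show "((\<lambda>x. gauss x / x - (1 - Phi x)) \<longlongrightarrow> 0) at_top" by (simp add: divide_inverse)
  qed
  then show ?thesis using assms gauss_pos[of x] unfolding mills_def by (simp add: field_simps)
qed

lemma mills_lower: assumes "0 < x" shows "x / (1 + x\<^sup>2) \<le> mills x"
proof -
  have nz: "1 + y\<^sup>2 \<noteq> 0" for y :: real by (metis add_pos_nonneg less_irrefl zero_le_power2 zero_less_one)
  have "0 \<le> (1 - Phi x) - gauss x * (x / (1 + x\<^sup>2))"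
  proof (rule nonneg_if_decreasing_to_0[where f="\<lambda>x. (1 - Phi x) - gauss x * (x / (1 + x\<^sup>2))"])
    fix y assume "y \<ge> x"
    have "((\<lambda>x. x / (1 + x\<^sup>2)) has_real_derivative (1 - y\<^sup>2) / (1 + y\<^sup>2)\<^sup>2) (at y)"
      using nz[of y] by (auto intro!: derivative_eq_intros simp: power2_eq_square)
    from DERIV_diff[OF DERIV_diff[OF DERIV_const Phi_deriv] DERIV_mult[OF gauss_deriv this]]
    have "((\<lambda>x. (1 - Phi x) - gauss x * (x / (1 + x\<^sup>2))) has_real_derivative
       (0 - gauss y - (- y * gauss y * (y / (1 + y\<^sup>2)) + (1 - y\<^sup>2) / (1 + y\<^sup>2)\<^sup>2 * gauss y))) (at y)" .
    moreover have "(0 - gauss y - (- y * gauss y * (y / (1 + y\<^sup>2)) + (1 - y\<^sup>2) / (1 + y\<^sup>2)\<^sup>2 * gauss y))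
       = - gauss y * 2 / (1 + y\<^sup>2)\<^sup>2"
    proof -
      define q where "q = 1 + y\<^sup>2"
      have q: "q \<noteq> 0" "y\<^sup>2 = q - 1" "y * (y * t) = (q - 1) * t" for t using nz[of y] by (auto simp: q_def power2_eq_square)
      show ?thesis unfolding q_def[symmetric] using q(1) by (simp add: field_simps power2_eq_square q(3))
    qed
    ultimately show "\<exists>D. ((\<lambda>x. (1 - Phi x) - gauss x * (x / (1 + x\<^sup>2))) has_real_derivative D) (at y) \<and> D \<le> 0"
      using gauss_pos[of y] by (intro exI conjI) auto
  next
    have "((\<lambda>x::real. x / (1 + x\<^sup>2)) \<longlongrightarrow> 0) at_top" by real_asymp
    then have "((\<lambda>x. (1 - Phi x) - gauss x * (x / (1 + x\<^sup>2))) \<longlongrightarrow> (1 - 1) - 0 * 0) at_top"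
      by (intro tendsto_intros gauss_at_top Phi_at_top)
    then show "((\<lambda>x. (1 - Phi x) - gauss x * (x / (1 + x\<^sup>2))) \<longlongrightarrow> 0) at_top" by simp
  qed
  then show ?thesis using assms gauss_pos[of x] unfolding mills_def by (simp add: field_simps)
qed

lemma mills_decreasing: assumes "x \<le> y" shows "mills y \<le> mills x"
proof (rule DERIV_nonpos_imp_nonincreasing[OF assms])
  fix z
  have "z * mills z \<le> 1" using mills_upper[of z] mills_pos[of z] mult_nonpos_nonneg[of z "mills z"] by (cases "z > 0") auto
  then show "\<exists>D. (mills has_real_derivative D) (at z) \<and> D \<le> 0" using mills_deriv[of z] by (intro exI[of _ "z * mills z - 1"]) auto
qed

lemma sqrt_2pi_le: "sqrt (2 * pi) \<le> 2.6"
  using pi_less_4 pi_approx by (intro real_le_lsqrt) (auto simp: power2_eq_square)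

lemma mills_0_le: "mills 0 \<le> 1.3"
  using sqrt_2pi_le by (simp add: mills_def Phi_0 std_normal_density_def)

lemma mills_half_le: "mills (-1/2) \<le> 3"
proof -
  have "mills (-1/2) \<le> 1 / gauss (-1/2)" unfolding mills_def
    using Phi_pos gauss_pos by (intro divide_right_mono) (auto simp: less_imp_le)
  also have "\<dots> = sqrt (2 * pi) * exp (1/8)" by (simp add: std_normal_density_def exp_minus field_simps power2_eq_square)
  also have "exp (1/8::real) \<le> 1.15" using exp_bound[of "1/8::real"] by (simp add: power2_eq_square)
  then have "sqrt (2 * pi) * exp (1/8) \<le> 2.6 * 1.15" by (intro mult_mono sqrt_2pi_le) auto
  finally show ?thesis by simp
qed

lemma mills_ge: assumes "0 \<le> x" shows "1 / (2 * (1 + x)) \<le> mills x"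
proof (cases "x \<ge> 1")
  case True
  have "1 / (2 * (1 + x)) \<le> x / (1 + x\<^sup>2)"
  proof (subst frac_le_eq)
    have "1 \<le> x * x + x * 2" using True mult_mono[of 1 x 1 x] by simp
    then show "(1 * (1 + x\<^sup>2) - x * (2 * (1 + x))) / (2 * (1 + x) * (1 + x\<^sup>2)) \<le> 0"
      using True by (intro divide_nonpos_nonneg) (auto simp: power2_eq_square algebra_simps mult_nonneg_nonneg add_nonneg_nonneg)
    show "1 + x\<^sup>2 \<noteq> 0" using True by (metis add_pos_nonneg less_irrefl zero_le_power2 zero_less_one)
  qed (use True in auto)
  then show ?thesis using mills_lower[of x] True by simp
next
  case False
  have "1 / 2 \<le> mills 1" using mills_lower[of 1] by simp
  also have "\<dots> \<le> mills x" using False by (intro mills_decreasing) auto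
  finally show ?thesis using assms by (smt (verit, best) frac_le)
qed

text \<open>The range extends to the left of 0 because the argument later compared with x may be
  negative when x is near 0. For t \<ge> 0 the two Mills inequalities confine 1 - t * mills t to
  [0, 1 / (1 + t^2)].\<close>

lemma mills_deriv_bound: assumes "-1/2 \<le> t" shows "\<bar>t * mills t - 1\<bar> \<le> 4 / (1 + t)\<^sup>2"
proof (cases "t < 0")
  case True
  have "mills t \<le> 3" using mills_half_le mills_decreasing[of "-1/2" t] assms by simp
  then have "\<bar>t\<bar> * mills t \<le> (1/2) * 3" using True assms mills_pos[of t] by (intro mult_mono) auto
  then have "\<bar>t * mills t - 1\<bar> \<le> 4" using True mult_neg_pos[OF True mills_pos[of t]] by (simp add: abs_if)
  also have "(1 + t)\<^sup>2 \<le> 1" using True assms by (intro power_le_one) auto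
  then have "4 \<le> 4 / (1 + t)\<^sup>2" using True assms by (simp add: field_simps)
  finally show ?thesis .
next
  case False
  have u: "t * mills t \<le> 1" using mills_upper[of t] False by (cases "t = 0") auto
  have l: "t\<^sup>2 / (1 + t\<^sup>2) \<le> t * mills t" using mills_lower[of t] False mult_left_mono[of "t / (1 + t\<^sup>2)" "mills t" t]
    by (cases "t = 0") (auto simp: power2_eq_square)
  have p: "1 + t\<^sup>2 > 0" by (simp add: add_pos_nonneg)
  have "1 - t\<^sup>2 / (1 + t\<^sup>2) = 1 / (1 + t\<^sup>2)" using p by (simp add: field_simps)
  also have "\<dots> \<le> 4 / (1 + t)\<^sup>2"
  proof -
    have "2 * t \<le> 1 + t\<^sup>2" using zero_le_power2[of "1 - t"] by (simp add: power2_diff)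
    also have "\<dots> \<le> 3 * t\<^sup>2 + 3" by simp
    finally have "(1 + t)\<^sup>2 \<le> 4 * (1 + t\<^sup>2)" by (simp add: power2_sum)
    then show ?thesis using p False by (simp add: field_simps)
  qed
  finally show ?thesis using u l by simp
qed

text \<open>The derivative decays like (1 + t)^-2 and the ratio itself only like (1 + x)^-1, so a
  shift of the argument costs a relative error equal to the shift over 1 + x. The hypothesis on
  \<open>u\<close> gives 1 + u \<ge> (1 + x) / 2 and in particular u \<ge> -1/2.\<close>

lemma mills_lipschitz:
  assumes "0 \<le> x" "\<bar>u - x\<bar> \<le> (1 + x) / 2"
  shows "\<bar>mills u - mills x\<bar> \<le> 32 * \<bar>u - x\<bar> / (1 + x) * mills x"
proof -
  have "\<bar>mills u - mills x\<bar> \<le> 16 / (1 + x)\<^sup>2 * \<bar>u - x\<bar>"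
  proof -
    have "norm (mills u - mills x) \<le> 16 / (1 + x)\<^sup>2 * norm (u - x)"
    proof (rule field_differentiable_bound[where S="{min u x..max u x}" and f'="\<lambda>t. t * mills t - 1"])
      fix t assume t: "t \<in> {min u x..max u x}"
      show "(mills has_field_derivative t * mills t - 1) (at t within {min u x..max u x})"
        using mills_deriv by (rule has_field_derivative_at_within)
      have h: "(1 + x) / 2 \<le> 1 + t" using t assms by (auto simp: abs_if min_def max_def field_simps split: if_splits)
      have "norm (t * mills t - 1) \<le> 4 / (1 + t)\<^sup>2" using mills_deriv_bound[of t] h assms by simp
      also have "\<dots> \<le> 4 / ((1 + x) / 2)\<^sup>2" using h assms by (intro divide_left_mono power_mono) auto
      also have "\<dots> = 16 / (1 + x)\<^sup>2" by (simp add: power_divide)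
      finally show "norm (t * mills t - 1) \<le> 16 / (1 + x)\<^sup>2" .
    qed auto
    then show ?thesis by simp
  qed
  also have "\<dots> = 32 * \<bar>u - x\<bar> / (1 + x) * (1 / (2 * (1 + x)))"
  proof -
    define q where "q = 1 + x"
    have "q \<noteq> 0" using assms by (simp add: q_def)
    then show ?thesis unfolding q_def[symmetric] by (simp add: field_simps power2_eq_square)
  qed
  also have "\<dots> \<le> 32 * \<bar>u - x\<bar> / (1 + x) * mills x" using assms by (intro mult_left_mono mills_ge) auto
  finally show ?thesis .
qed

section \<open>Stein's equation and a Berry-Esseen bound\<close>

text \<open>The bounded solution of Stein's equation \<open>f' w - w f w = 1{w \<le> z} - \<Phi> z\<close>, written with the Mills ratio;
  \<open>stein'\<close> is its derivative away from \<open>z\<close>.\<close>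

definition stein :: "real \<Rightarrow> real \<Rightarrow> real" where
  "stein z w = (if w \<le> z then mills (- w) * (1 - Phi z) else mills w * Phi z)"

definition stein' :: "real \<Rightarrow> real \<Rightarrow> real" where
  "stein' z w = w * stein z w + of_bool (w \<le> z) - Phi z"

lemma mills_minus: "mills (- w) = Phi w / gauss w"
  by (simp add: mills_def Phi_minus gauss_minus)

text \<open>One branch suffices, since the other arises by (w, z) -> (-w, -z). For w \<le> 0 the
  Mills ratio is taken at a nonnegative point. For w > 0, monotonicity allows \<open>Phi w\<close>
  in place of \<open>Phi z\<close>, and mills (- w) * (1 - Phi w) = Phi w * mills w returns to a
  nonnegative point.\<close>

lemma stein_half_bounds:
  assumes "w \<le> z"
  shows "0 \<le> mills (- w) * (1 - Phi z)" "mills (- w) * (1 - Phi z) \<le> 1.3" "\<bar>w * (mills (- w) * (1 - Phi z))\<bar> \<le> 1"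
proof -
  let ?f = "mills (- w) * (1 - Phi z)"
  show 0: "0 \<le> ?f" using mills_pos[of "-w"] Phi_less_1[of z] by simp
  have "?f \<le> 1.3 \<and> \<bar>w\<bar> * ?f \<le> 1"
  proof (cases "w \<le> 0")
    case True
    have "?f \<le> mills (- w) * 1" using mills_pos[of "-w"] Phi_pos[of z] by (intro mult_left_mono) auto
    moreover have "mills (- w) \<le> 1.3" using mills_0_le mills_decreasing[of 0 "-w"] True by simp
    moreover have "\<bar>w\<bar> * mills (- w) \<le> 1" using mills_upper[of "-w"] True by (cases "w = 0") auto
    ultimately show ?thesis using mult_left_mono[of ?f "mills (- w)" "\<bar>w\<bar>"] by auto
  next
    case False
    have "?f \<le> mills (- w) * (1 - Phi w)" using mills_pos[of "-w"] Phi_mono[OF assms] by (intro mult_left_mono) auto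
    also have "\<dots> = Phi w * mills w" by (simp add: mills_minus) (simp add: mills_def)
    also have "\<dots> \<le> 1 * mills w" using mills_pos[of w] Phi_less_1[of w] by (intro mult_right_mono) auto
    finally have 1: "?f \<le> mills w" by simp
    moreover have "mills w \<le> 1.3" using mills_0_le mills_decreasing[of 0 w] False by simp
    moreover have "\<bar>w\<bar> * mills w \<le> 1" using mills_upper[of w] False by auto
    ultimately show ?thesis using mult_left_mono[of ?f "mills w" "\<bar>w\<bar>"] by auto
  qed
  then show "?f \<le> 1.3" "\<bar>w * ?f\<bar> \<le> 1" using abs_of_nonneg[OF 0] by (auto simp only: abs_mult[of w])
qed

lemma stein_bounds: "0 \<le> stein z w" "stein z w \<le> 2" "\<bar>w * stein z w\<bar> \<le> 1" "\<bar>stein' z w\<bar> \<le> 2"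
proof -
  have *: "0 \<le> stein z w \<and> stein z w \<le> 1.3 \<and> \<bar>w * stein z w\<bar> \<le> 1"
    using stein_half_bounds[of w z] stein_half_bounds[of "-w" "-z"] by (auto simp: stein_def Phi_minus)
  then show "0 \<le> stein z w" "stein z w \<le> 2" "\<bar>w * stein z w\<bar> \<le> 1" by auto
  then show "\<bar>stein' z w\<bar> \<le> 2" using Phi_pos[of z] Phi_less_1[of z] unfolding stein'_def by (auto simp: of_bool_def)
qed

text \<open>The derivative jumps at \<open>z\<close>, so the mean value theorem is applied on one
  side only; the two branches agree at \<open>z\<close>, which may therefore be an endpoint.\<close>

lemma stein_mvt:
  assumes "a < b" "b \<le> z \<or> z \<le> a"
  shows "\<exists>t. a < t \<and> t < b \<and> stein z b - stein z a = (b - a) * stein' z t"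
proof (cases "b \<le> z")
  case True
  have d: "((\<lambda>w. mills (- w) * (1 - Phi z)) has_real_derivative (w * mills (- w) + 1) * (1 - Phi z)) (at w)" for w
    by (auto intro!: derivative_eq_intros DERIV_chain'[OF _ mills_deriv, of "\<lambda>w. - w"] simp: algebra_simps)
  from MVT2[OF assms(1) d] obtain t where t: "a < t" "t < b" "mills (- b) * (1 - Phi z) - mills (- a) * (1 - Phi z) = (b - a) * ((t * mills (- t) + 1) * (1 - Phi z))"
    by blast
  then show ?thesis using True assms by (intro exI[of _ t]) (auto simp: stein_def stein'_def algebra_simps)
next
  case False
  then have a: "z \<le> a" using assms by auto
  have g: "stein z w = mills w * Phi z" if "z \<le> w" for w
  proof (cases "w = z")
    case True then show ?thesis by (simp add: stein_def mills_minus) (simp add: mills_def)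
  qed (use that in \<open>simp add: stein_def\<close>)
  have d: "((\<lambda>w. mills w * Phi z) has_real_derivative (w * mills w - 1) * Phi z) (at w)" for w
    by (auto intro!: derivative_eq_intros mills_deriv)
  from MVT2[OF assms(1) d] obtain t where t: "a < t" "t < b" "mills b * Phi z - mills a * Phi z = (b - a) * ((t * mills t - 1) * Phi z)"
    by blast
  have "stein' z t = (t * mills t - 1) * Phi z" using t a by (simp add: stein'_def stein_def algebra_simps)
  then show ?thesis using t a assms(1) by (intro exI[of _ t]) (auto simp: g)
qed

lemma stein_lipschitz: "\<bar>stein z a - stein z b\<bar> \<le> 2 * \<bar>a - b\<bar>"
proof -
  have 1: "\<bar>stein z b - stein z a\<bar> \<le> 2 * \<bar>b - a\<bar>" if ab: "a < b" "b \<le> z \<or> z \<le> a" for a b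
  proof -
    from stein_mvt[OF ab] obtain t where "stein z b - stein z a = (b - a) * stein' z t" by blast
    then show ?thesis using stein_bounds(4)[of z t] mult_left_mono[of "\<bar>stein' z t\<bar>" 2 "\<bar>b - a\<bar>"] by (simp add: abs_mult)
  qed
  have 2: "\<bar>stein z b - stein z a\<bar> \<le> 2 * \<bar>b - a\<bar>" if "a < b" for a b
  proof (cases "a < z \<and> z < b")
    case True
    then show ?thesis using 1[of a z] 1[of z b] by (simp add: abs_if split: if_splits)
  qed (use 1[of a b] that in force)
  show ?thesis using 2[of a b] 2[of b a] by (cases a b rule: linorder_cases) auto
qed

lemma continuous_on_stein: "continuous_on UNIV (stein z)"
proof -
  have "2-lipschitz_on UNIV (stein z)" using stein_lipschitz by (intro lipschitz_onI) (auto simp: dist_real_def)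
  then show ?thesis by (rule lipschitz_on_continuous_on)
qed

lemma stein_mult_diff: "\<bar>t * stein z t - w * stein z w\<bar> \<le> (2 * \<bar>w\<bar> + 2) * \<bar>t - w\<bar>"
proof -
  have "t * stein z t - w * stein z w = w * (stein z t - stein z w) + (t - w) * stein z t" by (simp add: algebra_simps)
  then have "\<bar>t * stein z t - w * stein z w\<bar> \<le> \<bar>w\<bar> * \<bar>stein z t - stein z w\<bar> + \<bar>t - w\<bar> * \<bar>stein z t\<bar>"
    by (metis abs_mult abs_triangle_ineq)
  also have "\<dots> \<le> \<bar>w\<bar> * (2 * \<bar>t - w\<bar>) + \<bar>t - w\<bar> * 2"
    using stein_bounds(1,2)[of z t] by (intro add_mono mult_left_mono stein_lipschitz) auto
  finally show ?thesis by (simp add: algebra_simps)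
qed

lemma stein'_diff: "\<bar>stein' z (w + u) - stein' z w\<bar> \<le> (2 * \<bar>w\<bar> + 2) * \<bar>u\<bar> + of_bool (\<bar>w - z\<bar> \<le> \<bar>u\<bar>)"
proof -
  have "\<bar>of_bool (w + u \<le> z) - of_bool (w \<le> z)\<bar> \<le> (of_bool (\<bar>w - z\<bar> \<le> \<bar>u\<bar>) :: real)" by (auto simp: abs_if)
  moreover have "\<bar>(w + u) * stein z (w + u) - w * stein z w\<bar> \<le> (2 * \<bar>w\<bar> + 2) * \<bar>u\<bar>" using stein_mult_diff[of "w + u" z w] by simp
  ultimately show ?thesis unfolding stein'_def by linarith
qed

text \<open>The second-order expansion fails only if the jump lies within |u| of w. There the
  Lipschitz bound is kept, and the indicator that records this case is paid for by the concentration
  inequality.\<close>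

lemma stein_taylor:
  "\<bar>stein z (w + u) - stein z w - u * stein' z w\<bar> \<le> (2 * \<bar>w\<bar> + 2) * u\<^sup>2 + 4 * \<bar>u\<bar> * of_bool (\<bar>w - z\<bar> \<le> \<bar>u\<bar>)"
proof (cases "\<bar>w - z\<bar> \<le> \<bar>u\<bar>")
  case True
  have "\<bar>stein z (w + u) - stein z w\<bar> \<le> 2 * \<bar>u\<bar>" using stein_lipschitz[of z "w + u" w] by simp
  moreover have "\<bar>u * stein' z w\<bar> \<le> \<bar>u\<bar> * 2" unfolding abs_mult by (intro mult_left_mono stein_bounds) auto
  ultimately have "\<bar>stein z (w + u) - stein z w - u * stein' z w\<bar> \<le> 4 * \<bar>u\<bar>" by linarith
  then show ?thesis using True by (simp add: add_increasing)
next
  case False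
  have ex: "\<exists>t. \<bar>t - w\<bar> \<le> \<bar>u\<bar> \<and> stein z (w + u) - stein z w = u * stein' z t"
  proof (cases u "0 :: real" rule: linorder_cases)
    case less
    have "w \<le> z \<or> z \<le> w + u" using False less by linarith
    with less stein_mvt[of "w + u" w z] obtain t where "w + u < t" "t < w" "stein z w - stein z (w + u) = - u * stein' z t" by auto
    then show ?thesis by (intro exI[of _ t]) auto
  next
    case greater
    have "w + u \<le> z \<or> z \<le> w" using False greater by linarith
    with greater stein_mvt[of w "w + u" z] obtain t where "w < t" "t < w + u" "stein z (w + u) - stein z w = u * stein' z t" by auto
    then show ?thesis by (intro exI[of _ t]) auto
  qed auto
  then obtain t where t: "\<bar>t - w\<bar> \<le> \<bar>u\<bar>" "stein z (w + u) - stein z w = u * stein' z t" by blast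
  have "stein' z t - stein' z w = t * stein z t - w * stein z w" using t(1) False unfolding stein'_def by (auto simp: abs_if split: if_splits)
  then have "\<bar>stein' z t - stein' z w\<bar> \<le> (2 * \<bar>w\<bar> + 2) * \<bar>t - w\<bar>" using stein_mult_diff by simp
  also have "\<dots> \<le> (2 * \<bar>w\<bar> + 2) * \<bar>u\<bar>" using t by (intro mult_left_mono) auto
  finally have "\<bar>u\<bar> * \<bar>stein' z t - stein' z w\<bar> \<le> \<bar>u\<bar> * ((2 * \<bar>w\<bar> + 2) * \<bar>u\<bar>)" by (intro mult_left_mono) auto
  also have "\<dots> = (2 * \<bar>w\<bar> + 2) * u\<^sup>2" by (subst power2_abs[symmetric]) (simp only: power2_eq_square mult_ac)
  finally show ?thesis using False by (simp add: t(2) right_diff_distrib[symmetric] abs_mult)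
qed

text \<open>Integrate (t - r)^2 * (t + r) \<ge> 0, respectively (t - r)^2 * (t + r / 2) \<ge> 0, at
  t = |\<xi>| with r the root mean square; this r makes the surplus terms cancel. The first claim
  lets first moments times the variance be absorbed by third moments in the normal
  approximation.\<close>

lemma (in prob_space) third_moment_ge:
  assumes xi: "bmeas M \<xi>"
  shows "(\<integral>z. (\<xi> z)\<^sup>2 \<partial>M) * (\<integral>z. \<bar>\<xi> z\<bar> \<partial>M) \<le> (\<integral>z. \<bar>\<xi> z\<bar>^3 \<partial>M)"
    and "(\<integral>z. (\<xi> z)\<^sup>2 \<partial>M) * sqrt (\<integral>z. (\<xi> z)\<^sup>2 \<partial>M) \<le> (\<integral>z. \<bar>\<xi> z\<bar>^3 \<partial>M)"
proof -
  define r where "r = sqrt (\<integral>z. (\<xi> z)\<^sup>2 \<partial>M)"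
  have r: "r\<^sup>2 = (\<integral>z. (\<xi> z)\<^sup>2 \<partial>M)" "r \<ge> 0" by (auto simp: r_def)
  have i: "integrable M (\<lambda>z. (\<xi> z)\<^sup>2)" "integrable M (\<lambda>z. \<bar>\<xi> z\<bar>)" "integrable M (\<lambda>z. \<bar>\<xi> z\<bar>^3)"
    by (intro bmeas_integrable bmeas_intros xi)+
  have "(\<integral>z. r\<^sup>2 * \<bar>\<xi> z\<bar> + r * (\<xi> z)\<^sup>2 - r ^ 3 \<partial>M) \<le> (\<integral>z. \<bar>\<xi> z\<bar>^3 \<partial>M)"
  proof (rule integral_mono)
    fix z
    have "0 \<le> (\<bar>\<xi> z\<bar> - r)\<^sup>2 * (\<bar>\<xi> z\<bar> + r)" using r by simp
    then show "r\<^sup>2 * \<bar>\<xi> z\<bar> + r * (\<xi> z)\<^sup>2 - r ^ 3 \<le> \<bar>\<xi> z\<bar>^3"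
      by (simp add: power2_eq_square power3_eq_cube algebra_simps flip: abs_mult)
  qed (use i in auto)
  then show "(\<integral>z. (\<xi> z)\<^sup>2 \<partial>M) * (\<integral>z. \<bar>\<xi> z\<bar> \<partial>M) \<le> (\<integral>z. \<bar>\<xi> z\<bar>^3 \<partial>M)"
    using i by (simp add: prob_space r(1)[symmetric]) (simp add: power2_eq_square power3_eq_cube)
  have "(\<integral>z. 3 / 2 * r * (\<xi> z)\<^sup>2 - r ^ 3 / 2 \<partial>M) \<le> (\<integral>z. \<bar>\<xi> z\<bar>^3 \<partial>M)"
  proof (rule integral_mono)
    fix z
    have "0 \<le> (\<bar>\<xi> z\<bar> - r)\<^sup>2 * (\<bar>\<xi> z\<bar> + r / 2)" using r by simp
    then show "3 / 2 * r * (\<xi> z)\<^sup>2 - r ^ 3 / 2 \<le> \<bar>\<xi> z\<bar>^3"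
      by (simp add: power2_eq_square power3_eq_cube algebra_simps flip: abs_mult)
  qed (use i in auto)
  then have "3 / 2 * r * r\<^sup>2 - r ^ 3 / 2 \<le> (\<integral>z. \<bar>\<xi> z\<bar>^3 \<partial>M)" using i by (simp add: prob_space r(1))
  then show "(\<integral>z. (\<xi> z)\<^sup>2 \<partial>M) * sqrt (\<integral>z. (\<xi> z)\<^sup>2 \<partial>M) \<le> (\<integral>z. \<bar>\<xi> z\<bar>^3 \<partial>M)"
    unfolding r_def[symmetric] r(1)[symmetric] using r(2) by (simp add: power2_eq_square power3_eq_cube mult_ac)
qed

text \<open>Stein's method, leaving out one summand at a time. The jump of the derivative is met
  only when the remaining sum falls into a window of half-width |\<xi>_i| around z, whose
  probability the concentration inequality bounds. 68 = 28 + 40 collects the pure third-moment terms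
  and the terms in \<open>\<Gamma>\<close> times the variance.\<close>

theorem (in prob_space) berry_esseen:
  assumes I: "finite I" and xi: "bmeas M \<xi>" and mean: "(\<integral>z. \<xi> z \<partial>M) = 0"
    and v: "card I * (\<integral>z. (\<xi> z)\<^sup>2 \<partial>M) = 1"
    and G: "card I * (\<integral>z. \<bar>\<xi> z\<bar> ^ 3 \<partial>M) \<le> \<Gamma>"
  shows "\<bar>measure (iid I) {p \<in> space (iid I). (\<Sum>i\<in>I. \<xi> (p i)) \<le> z} - Phi z\<bar> \<le> 68 * \<Gamma>"
proof (cases "card I \<ge> 2")
  \<comment> \<open>A single summand has variance 1, which forces \<Gamma> \<ge> 1, and the bound is
    trivial. With two or more, the sum of the others keeps at least half of the variance.\<close>
  case False
  interpret II: prob_space "iid I" by (rule prob_space_iid)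
  have "card I \<noteq> 0" using v by (metis mult_zero_left of_nat_0 zero_neq_one)
  then have 1: "card I = 1" using False by simp
  then have "1 \<le> \<Gamma>" using third_moment_ge(2)[OF xi] v G by simp
  moreover have "\<bar>measure (iid I) {p \<in> space (iid I). (\<Sum>i\<in>I. \<xi> (p i)) \<le> z} - Phi z\<bar> \<le> 1"
    using II.prob_le_1[of "{p \<in> space (iid I). (\<Sum>i\<in>I. \<xi> (p i)) \<le> z}"] Phi_pos[of z] Phi_less_1[of z]
      measure_nonneg[of "iid I" "{p \<in> space (iid I). (\<Sum>i\<in>I. \<xi> (p i)) \<le> z}"] by linarith
  ultimately show ?thesis by linarith
next
  case True
  interpret II: prob_space "iid I" by (rule prob_space_iid)
  define W where "W p = (\<Sum>i\<in>I. \<xi> (p i))" for p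
  define W' where "W' i p = (\<Sum>j\<in>I - {i}. \<xi> (p j))" for i p
  define V where "V = (\<integral>z. (\<xi> z)\<^sup>2 \<partial>M)"
  define t where "t = (\<integral>z. \<bar>\<xi> z\<bar> ^ 3 \<partial>M)"
  define e where "e = (\<integral>z. \<bar>\<xi> z\<bar> \<partial>M)"
  define B where "B i p \<longleftrightarrow> \<bar>W' i p - z\<bar> \<le> \<bar>\<xi> (p i)\<bar>" for i p
  let ?k = "real (card I)"
  have V0: "V \<ge> 0" "t \<ge> 0" "e \<ge> 0" by (auto simp: V_def t_def e_def)
  have kV: "?k * V = 1" using v by (simp add: V_def)
  then have Vpos: "V > 0" using V0 by (metis mult_zero_right order_le_less zero_neq_one)
  have tV: "V * e \<le> t" using third_moment_ge(1)[OF xi] by (simp add: V_def e_def t_def)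
  have "t > 0" using third_moment_ge(2)[OF xi] Vpos by (smt (verit) V_def t_def mult_pos_pos real_sqrt_gt_zero)
  then have G0: "\<Gamma> > 0" using G True by (smt (verit, best) mult_pos_pos of_nat_le_0_iff not_numeral_le_zero t_def)
  have W: "bmeas (iid I) W" unfolding W_def by (intro bmeas_intros bmeas_component xi)
  have W': "bmeas (iid I) (W' i)" for i unfolding W'_def by (intro bmeas_intros bmeas_component xi) auto
  have WW': "W p = W' i p + \<xi> (p i)" if "i \<in> I" for i p
    unfolding W_def W'_def using that I by (simp add: sum_diff1)
  have W'i: "W' i (p(i := y)) = W' i p" for i p y unfolding W'_def by (intro sum.cong) auto
  have xic: "i \<in> I \<Longrightarrow> bmeas (iid I) (\<lambda>p. \<xi> (p i))" for i by (intro bmeas_component xi)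
  have Bb: "bmeas (iid I) (\<lambda>p. of_bool (B i p))" if "i \<in> I" for i
    unfolding B_def by (intro bmeas_of_bool pred_bmeas bmeas_intros W' xic that)
  have bf: "bmeas N (\<lambda>p. stein z (w p))" if "bmeas N w" for N and w :: "(nat \<Rightarrow> 'a) \<Rightarrow> real"
    by (rule bmeas_compose[OF continuous_on_stein that])
  have bf': "bmeas N (\<lambda>p. stein' z (w p))" if "bmeas N w" for N and w :: "(nat \<Rightarrow> 'a) \<Rightarrow> real"
    unfolding stein'_def by (intro bmeas_intros bf that bmeas_of_bool pred_bmeas)
  note ei = II.bmeas_integrable
  have EW': "(\<integral>p. \<bar>W' i p\<bar> \<partial>iid I) \<le> 1" if i: "i \<in> I" for i
  proof -
    have "(\<integral>p. (W' i p)\<^sup>2 \<partial>iid I) = (\<integral>p. (\<Sum>j\<in>I - {i}. \<xi> (p j))\<^sup>2 \<partial>iid (I - {i}))"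
      using iid_split(1)[OF I i bmeas_power[OF W']] by (simp add: W'i prob_space) (simp add: W'_def)
    also have "\<dots> = card (I - {i}) * V" using iid_sum_second[of "I - {i}", OF _ xi mean] I by (simp add: V_def)
    also have "\<dots> \<le> ?k * V" using I V0 by (intro mult_right_mono) (auto intro: card_mono)
    finally have "sqrt (\<integral>p. (W' i p)\<^sup>2 \<partial>iid I) \<le> 1" using kV by simp
    with II.bmeas_abs_le_sqrt[OF W', of i] show ?thesis by (rule order_trans)
  qed
  \<comment> \<open>Given coordinate \<open>i\<close>, the window has the constant half-width |\<xi>
    y| and concerns the remaining sum only, so plain concentration applies.\<close>
  have EB: "(\<integral>p. u (p i) * of_bool (B i p) \<partial>iid I) \<le> (\<integral>y. u y * (4 * \<bar>\<xi> y\<bar> + 8 * \<Gamma>) \<partial>M)"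
    if i: "i \<in> I" and u: "bmeas M u" "\<And>y. u y \<ge> 0" for i u
  proof (rule integral_le_iid_split[OF I i])
    show "bmeas (iid I) (\<lambda>p. u (p i) * of_bool (B i p))" by (intro bmeas_intros bmeas_component u i Bb)
    show "bmeas M (\<lambda>y. u y * (4 * \<bar>\<xi> y\<bar> + 8 * \<Gamma>))" by (intro bmeas_intros u xi)
    fix y assume y: "y \<in> space M"
    interpret JJ: prob_space "iid (I - {i})" by (rule prob_space_iid)
    have w: "bmeas (iid (I - {i})) (\<lambda>p. \<Sum>j\<in>I - {i}. \<xi> (p j))" by (intro bmeas_intros bmeas_component xi)
    have "(\<integral>p. u ((p(i := y)) i) * of_bool (B i (p(i := y))) \<partial>iid (I - {i}))
       = u y * (\<integral>p. of_bool (\<bar>(\<Sum>j\<in>I - {i}. \<xi> (p j)) - z\<bar> \<le> \<bar>\<xi> y\<bar>) \<partial>iid (I - {i}))"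
      by (simp add: B_def W'i) (simp add: W'_def)
    also have "(\<integral>p. of_bool (\<bar>(\<Sum>j\<in>I - {i}. \<xi> (p j)) - z\<bar> \<le> \<bar>\<xi> y\<bar>) \<partial>iid (I - {i})) =
       measure (iid (I - {i})) {p \<in> space (iid (I - {i})). \<bar>(\<Sum>j\<in>I - {i}. \<xi> (p j)) - z\<bar> \<le> \<bar>\<xi> y\<bar>}"
      by (rule JJ.measure_eq_integral_of_bool[symmetric]) (intro pred_bmeas bmeas_intros w)
    also have "\<dots> \<le> 4 * \<bar>\<xi> y\<bar> + 8 * \<Gamma>"
    proof (rule concentration[OF _ xi mean])
      have c: "real (card (I - {i})) = ?k - 1" using I i True by (simp add: card_Diff_singleton of_nat_diff)
      show "card (I - {i}) * (\<integral>z. (\<xi> z)\<^sup>2 \<partial>M) \<le> 1" unfolding c V_def[symmetric] using kV V0 by (simp add: algebra_simps)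
      have "2 * V \<le> ?k * V" using True V0 by (intro mult_right_mono) auto
      then show "1 / 2 \<le> card (I - {i}) * (\<integral>z. (\<xi> z)\<^sup>2 \<partial>M)" unfolding c V_def[symmetric] using kV by (simp add: algebra_simps)
      show "card (I - {i}) * (\<integral>z. \<bar>\<xi> z\<bar> ^ 3 \<partial>M) \<le> \<Gamma>" unfolding c t_def[symmetric] left_diff_distrib using G[folded t_def] V0(2) by linarith
    qed (use I G0 in auto)
    finally show "(\<integral>p. u ((p(i := y)) i) * of_bool (B i (p(i := y))) \<partial>iid (I - {i})) \<le> u y * (4 * \<bar>\<xi> y\<bar> + 8 * \<Gamma>)"
      using u(2)[of y] by (simp add: mult_left_mono del: fun_upd_apply)
  qed
  \<comment> \<open>Expanding around \<open>W' i\<close>, which is independent of coordinate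
    \<open>i\<close>, produces V times the mean of \<open>stein'\<close> at \<open>W' i\<close>,
    with error 20 * t + 32 * \<Gamma> * V; exchanging \<open>W' i\<close> for W there adds 8 * t + 8
    * \<Gamma> * V.\<close>
  have main: "\<bar>(\<integral>p. \<xi> (p i) * stein z (W p) \<partial>iid I) - V * (\<integral>p. stein' z (W p) \<partial>iid I)\<bar> \<le> 28 * t + 40 * \<Gamma> * V" if i: "i \<in> I" for i
  proof -
    note b = bmeas_intros bf bf' W W' xic i Bb
    have im: "(\<integral>p. u (p i) * g (W' i p) \<partial>iid I) = (\<integral>y. u y \<partial>M) * (\<integral>p. g (W' i p) \<partial>iid I)"
      if "bmeas M u" "bmeas (iid I) (\<lambda>p. g (W' i p))" for u g
      by (rule iid_indep_mult[OF I i that]) (simp add: W'i)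
    have z0: "(\<integral>p. \<xi> (p i) * stein z (W' i p) \<partial>iid I) = 0" by (subst im) (auto intro!: xi b simp: mean)
    have z1: "(\<integral>p. (\<xi> (p i))\<^sup>2 * stein' z (W' i p) \<partial>iid I) = V * (\<integral>p. stein' z (W' i p) \<partial>iid I)"
      by (subst im[of "\<lambda>y. (\<xi> y)\<^sup>2"]) (auto intro!: xi b simp: V_def)
    have "\<bar>(\<integral>p. \<xi> (p i) * stein z (W p) \<partial>iid I) - V * (\<integral>p. stein' z (W' i p) \<partial>iid I)\<bar>
       = \<bar>\<integral>p. \<xi> (p i) * stein z (W p) - \<xi> (p i) * stein z (W' i p) - (\<xi> (p i))\<^sup>2 * stein' z (W' i p) \<partial>iid I\<bar>"
    proof -
      have i: "integrable (iid I) (\<lambda>p. \<xi> (p i) * stein z (W p))" "integrable (iid I) (\<lambda>p. \<xi> (p i) * stein z (W' i p))"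
        "integrable (iid I) (\<lambda>p. (\<xi> (p i))\<^sup>2 * stein' z (W' i p))" by (intro ei b)+
      show ?thesis using i z0 z1 by simp
    qed
    also have "\<dots> \<le> (\<integral>p. \<bar>\<xi> (p i) * stein z (W p) - \<xi> (p i) * stein z (W' i p) - (\<xi> (p i))\<^sup>2 * stein' z (W' i p)\<bar> \<partial>iid I)"
      by (rule integral_abs_bound)
    also have "\<dots> \<le> (\<integral>p. 2 * (\<bar>\<xi> (p i)\<bar>^3 * \<bar>W' i p\<bar>) + 2 * \<bar>\<xi> (p i)\<bar>^3 + 4 * ((\<xi> (p i))\<^sup>2 * of_bool (B i p)) \<partial>iid I)"
    proof (rule integral_mono)
      fix p
      define u w where "u = \<xi> (p i)" and "w = W' i p"
      have "\<bar>\<xi> (p i) * stein z (W p) - \<xi> (p i) * stein z (W' i p) - (\<xi> (p i))\<^sup>2 * stein' z (W' i p)\<bar>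
         = \<bar>u\<bar> * \<bar>stein z (w + u) - stein z w - u * stein' z w\<bar>"
        unfolding abs_mult[symmetric] WW'[OF i] u_def w_def by (simp add: power2_eq_square algebra_simps)
      also have "\<dots> \<le> \<bar>u\<bar> * ((2 * \<bar>w\<bar> + 2) * u\<^sup>2 + 4 * \<bar>u\<bar> * of_bool (\<bar>w - z\<bar> \<le> \<bar>u\<bar>))"
        by (intro mult_left_mono stein_taylor) auto
      also have "\<dots> = 2 * (\<bar>u\<bar>^3 * \<bar>w\<bar>) + 2 * \<bar>u\<bar>^3 + 4 * (u\<^sup>2 * of_bool (\<bar>w - z\<bar> \<le> \<bar>u\<bar>))"
        by (subst (1) power2_abs[symmetric], subst (2) power2_abs[symmetric]) (simp add: power2_eq_square power3_eq_cube algebra_simps)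
      finally show "\<bar>\<xi> (p i) * stein z (W p) - \<xi> (p i) * stein z (W' i p) - (\<xi> (p i))\<^sup>2 * stein' z (W' i p)\<bar>
        \<le> 2 * (\<bar>\<xi> (p i)\<bar>^3 * \<bar>W' i p\<bar>) + 2 * \<bar>\<xi> (p i)\<bar>^3 + 4 * ((\<xi> (p i))\<^sup>2 * of_bool (B i p))"
        unfolding B_def u_def w_def .
    qed (intro ei b)+
    also have "\<dots> = 2 * (\<integral>p. \<bar>\<xi> (p i)\<bar>^3 * \<bar>W' i p\<bar> \<partial>iid I) + 2 * (\<integral>p. \<bar>\<xi> (p i)\<bar>^3 \<partial>iid I) + 4 * (\<integral>p. (\<xi> (p i))\<^sup>2 * of_bool (B i p) \<partial>iid I)"
    proof -
      have "integrable (iid I) (\<lambda>p. \<bar>\<xi> (p i)\<bar>^3 * \<bar>W' i p\<bar>)" "integrable (iid I) (\<lambda>p. \<bar>\<xi> (p i)\<bar>^3)"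
        "integrable (iid I) (\<lambda>p. (\<xi> (p i))\<^sup>2 * of_bool (B i p))" by (intro ei b)+
      then show ?thesis by simp
    qed
    also have "\<dots> \<le> 2 * (t * 1) + 2 * t + 4 * (4 * t + 8 * \<Gamma> * V)"
    proof -
      have 1: "(\<integral>p. \<bar>\<xi> (p i)\<bar>^3 * \<bar>W' i p\<bar> \<partial>iid I) \<le> t * 1"
      proof -
        have "(\<integral>p. \<bar>\<xi> (p i)\<bar>^3 * \<bar>W' i p\<bar> \<partial>iid I) = t * (\<integral>p. \<bar>W' i p\<bar> \<partial>iid I)"
          by (subst im[of "\<lambda>y. \<bar>\<xi> y\<bar>^3"]) (auto intro!: xi b simp: t_def)
        also have "\<dots> \<le> t * 1" by (intro mult_left_mono EW' i V0)
        finally show ?thesis .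
      qed
      have 2: "(\<integral>p. \<bar>\<xi> (p i)\<bar>^3 \<partial>iid I) = t" unfolding t_def by (rule iid_component[OF I i]) (intro b xi)
      have "(\<integral>p. (\<xi> (p i))\<^sup>2 * of_bool (B i p) \<partial>iid I) \<le> (\<integral>y. (\<xi> y)\<^sup>2 * (4 * \<bar>\<xi> y\<bar> + 8 * \<Gamma>) \<partial>M)"
        by (rule EB[OF i]) (auto intro!: b xi)
      also have "\<dots> = (\<integral>y. 4 * \<bar>\<xi> y\<bar>^3 + 8 * \<Gamma> * (\<xi> y)\<^sup>2 \<partial>M)"
        by (intro Bochner_Integration.integral_cong refl, subst (1) power2_abs[symmetric]) (simp add: power2_eq_square power3_eq_cube algebra_simps)
      also have "\<dots> = 4 * t + 8 * \<Gamma> * V" unfolding t_def V_def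
        by (subst Bochner_Integration.integral_add) (auto intro!: bmeas_integrable bmeas_intros xi)
      finally show ?thesis using 1 2 by simp
    qed
    finally have A: "\<bar>(\<integral>p. \<xi> (p i) * stein z (W p) \<partial>iid I) - V * (\<integral>p. stein' z (W' i p) \<partial>iid I)\<bar> \<le> 20 * t + 32 * \<Gamma> * V" by simp
    have "\<bar>(\<integral>p. stein' z (W p) \<partial>iid I) - (\<integral>p. stein' z (W' i p) \<partial>iid I)\<bar> = \<bar>\<integral>p. stein' z (W p) - stein' z (W' i p) \<partial>iid I\<bar>"
      by (subst Bochner_Integration.integral_diff) (auto intro!: ei b)
    also have "\<dots> \<le> (\<integral>p. \<bar>stein' z (W p) - stein' z (W' i p)\<bar> \<partial>iid I)" by (rule integral_abs_bound)
    also have "\<dots> \<le> (\<integral>p. 2 * (\<bar>\<xi> (p i)\<bar> * \<bar>W' i p\<bar>) + 2 * \<bar>\<xi> (p i)\<bar> + 1 * of_bool (B i p) \<partial>iid I)"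
    proof (rule integral_mono)
      fix p show "\<bar>stein' z (W p) - stein' z (W' i p)\<bar> \<le> 2 * (\<bar>\<xi> (p i)\<bar> * \<bar>W' i p\<bar>) + 2 * \<bar>\<xi> (p i)\<bar> + 1 * of_bool (B i p)"
        unfolding WW'[OF i] B_def using stein'_diff[of z "W' i p" "\<xi> (p i)"] by (simp add: algebra_simps)
    qed (intro ei b)+
    also have "\<dots> = 2 * (\<integral>p. \<bar>\<xi> (p i)\<bar> * \<bar>W' i p\<bar> \<partial>iid I) + 2 * (\<integral>p. \<bar>\<xi> (p i)\<bar> \<partial>iid I) + (\<integral>p. 1 * of_bool (B i p) \<partial>iid I)"
    proof -
      have "integrable (iid I) (\<lambda>p. \<bar>\<xi> (p i)\<bar> * \<bar>W' i p\<bar>)" "integrable (iid I) (\<lambda>p. \<bar>\<xi> (p i)\<bar>)"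
        "integrable (iid I) (\<lambda>p. of_bool (B i p) :: real)" by (intro ei b)+
      then show ?thesis by simp
    qed
    also have "\<dots> \<le> 2 * (e * 1) + 2 * e + (4 * e + 8 * \<Gamma>)"
    proof -
      have 1: "(\<integral>p. \<bar>\<xi> (p i)\<bar> * \<bar>W' i p\<bar> \<partial>iid I) \<le> e * 1"
      proof -
        have "(\<integral>p. \<bar>\<xi> (p i)\<bar> * \<bar>W' i p\<bar> \<partial>iid I) = e * (\<integral>p. \<bar>W' i p\<bar> \<partial>iid I)"
          by (subst im[of "\<lambda>y. \<bar>\<xi> y\<bar>"]) (auto intro!: xi b simp: e_def)
        also have "\<dots> \<le> e * 1" by (intro mult_left_mono EW' i V0)
        finally show ?thesis .
      qed
      have 2: "(\<integral>p. \<bar>\<xi> (p i)\<bar> \<partial>iid I) = e" unfolding e_def by (rule iid_component[OF I i]) (intro b xi)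
      have "(\<integral>p. 1 * of_bool (B i p) \<partial>iid I) \<le> (\<integral>y. 1 * (4 * \<bar>\<xi> y\<bar> + 8 * \<Gamma>) \<partial>M)"
        by (rule EB[OF i]) (auto intro!: b xi)
      also have "\<dots> = 4 * e + 8 * \<Gamma>" unfolding e_def
        using bmeas_integrable[OF bmeas_abs[OF xi]] by (simp add: prob_space)
      finally show ?thesis using 1 2 by simp
    qed
    finally have "V * \<bar>(\<integral>p. stein' z (W p) \<partial>iid I) - (\<integral>p. stein' z (W' i p) \<partial>iid I)\<bar> \<le> V * (8 * e + 8 * \<Gamma>)"
      using V0 by (intro mult_left_mono) auto
    also have "\<dots> \<le> 8 * t + 8 * \<Gamma> * V" using tV by (simp add: algebra_simps)
    finally have "\<bar>V * (\<integral>p. stein' z (W p) \<partial>iid I) - V * (\<integral>p. stein' z (W' i p) \<partial>iid I)\<bar> \<le> 8 * t + 8 * \<Gamma> * V"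
      using V0 by (simp add: right_diff_distrib[symmetric] abs_mult)
    with A show ?thesis by linarith
  qed
  have "measure (iid I) {p \<in> space (iid I). W p \<le> z} = (\<integral>p. of_bool (W p \<le> z) \<partial>iid I)"
    by (rule II.measure_eq_integral_of_bool) (intro pred_bmeas bmeas_intros W)
  also have "\<dots> = (\<integral>p. (stein' z (W p) - W p * stein z (W p)) + Phi z \<partial>iid I)" by (simp add: stein'_def)
  also have "\<dots> = (\<integral>p. stein' z (W p) \<partial>iid I) - (\<integral>p. W p * stein z (W p) \<partial>iid I) + Phi z"
  proof -
    have "integrable (iid I) (\<lambda>p. stein' z (W p))" "integrable (iid I) (\<lambda>p. W p * stein z (W p))" by (intro ei bmeas_intros W bf bf')+
    then show ?thesis by (simp add: II.prob_space)
  qed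
  also have "(\<integral>p. W p * stein z (W p) \<partial>iid I) = (\<Sum>i\<in>I. \<integral>p. \<xi> (p i) * stein z (W p) \<partial>iid I)"
  proof -
    have "i \<in> I \<Longrightarrow> integrable (iid I) (\<lambda>p. \<xi> (p i) * stein z (W p))" for i by (intro ei bmeas_intros W bf xic)
    then show ?thesis by (subst Bochner_Integration.integral_sum[symmetric]) (auto simp: W_def sum_distrib_right)
  qed
  also have "(\<integral>p. stein' z (W p) \<partial>iid I) = (\<Sum>i\<in>I. V * (\<integral>p. stein' z (W p) \<partial>iid I))" using kV by simp
  finally have "\<bar>measure (iid I) {p \<in> space (iid I). W p \<le> z} - Phi z\<bar> = \<bar>\<Sum>i\<in>I. (\<integral>p. \<xi> (p i) * stein z (W p) \<partial>iid I) - V * (\<integral>p. stein' z (W p) \<partial>iid I)\<bar>"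
    by (simp add: sum_subtractf)
  also have "\<dots> \<le> (\<Sum>i\<in>I. 28 * t + 40 * \<Gamma> * V)" by (rule order_trans[OF sum_abs]) (intro sum_mono main)
  also have "\<dots> = 28 * (?k * t) + 40 * \<Gamma> * (?k * V)" by (simp add: algebra_simps)
  also have "\<dots> \<le> 28 * \<Gamma> + 40 * \<Gamma> * 1" using kV G by (intro add_mono mult_left_mono) (auto simp: t_def G0 less_imp_le)
  finally show ?thesis unfolding W_def by simp
qed

section \<open>Exponential tilting\<close>

definition tilt :: "'a measure \<Rightarrow> ('a \<Rightarrow> real) \<Rightarrow> 'a measure" where
  "tilt M \<psi> = density M (\<lambda>z. ennreal (exp (\<psi> z) / (\<integral>z. exp (\<psi> z) \<partial>M)))"

lemma space_tilt [simp]: "space (tilt M \<psi>) = space M" and sets_tilt [simp, measurable_cong]: "sets (tilt M \<psi>) = sets M"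
  by (auto simp: tilt_def)

lemma bmeas_cong_sets: "sets M = sets N \<Longrightarrow> bmeas M f \<longleftrightarrow> bmeas N f"
  unfolding bmeas_def using sets_eq_imp_space_eq[of M N] measurable_cong_sets[of M N borel borel] by auto

lemma bmeas_tilt [simp]: "bmeas (tilt M \<psi>) f \<longleftrightarrow> bmeas M f"
  by (rule bmeas_cong_sets) simp

lemma bmeas_PiM_tilt [simp]: "bmeas (Pi\<^sub>M I (\<lambda>_. tilt M \<psi>)) f \<longleftrightarrow> bmeas (Pi\<^sub>M I (\<lambda>_. M)) f"
  by (intro bmeas_cong_sets sets_PiM_cong) auto

lemma space_PiM_tilt [simp]: "space (Pi\<^sub>M I (\<lambda>_. tilt M \<psi>)) = space (Pi\<^sub>M I (\<lambda>_. M))"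
  by (simp add: space_PiM)

context prob_space
begin

lemma exp_integral_pos:
  assumes "bmeas M \<psi>" shows "0 < (\<integral>z. exp (\<psi> z) \<partial>M)"
proof -
  from assms obtain B where B: "\<forall>x\<in>space M. \<bar>\<psi> x\<bar> \<le> B" unfolding bmeas_def by auto
  have "exp (- B) = (\<integral>z. exp (- B) \<partial>M)" by (simp add: prob_space)
  also have "\<dots> \<le> (\<integral>z. exp (\<psi> z) \<partial>M)" using B
    by (intro integral_mono bmeas_integrable bmeas_intros assms) (auto simp: abs_le_iff minus_le_iff)
  finally show ?thesis using exp_gt_zero[of "-B"] by linarith
qed

lemma integral_tilt:
  assumes "bmeas M \<psi>" "bmeas M u"
  shows "(\<integral>z. u z \<partial>tilt M \<psi>) = (\<integral>z. u z * exp (\<psi> z) \<partial>M) / (\<integral>z. exp (\<psi> z) \<partial>M)"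
proof -
  note [measurable] = assms[THEN bmeas_measurable]
  have "(\<integral>z. u z \<partial>tilt M \<psi>) = (\<integral>z. (exp (\<psi> z) / (\<integral>z. exp (\<psi> z) \<partial>M)) *\<^sub>R u z \<partial>M)"
    unfolding tilt_def using exp_integral_pos[OF assms(1)] by (subst integral_density) auto
  then show ?thesis by (simp add: mult.commute)
qed

lemma prob_space_tilt: "bmeas M \<psi> \<Longrightarrow> prob_space (tilt M \<psi>)"
proof -
  assume b: "bmeas M \<psi>"
  note [measurable] = b[THEN bmeas_measurable]
  note pos = exp_integral_pos[OF b]
  have "emeasure (tilt M \<psi>) (space M) = (\<integral>\<^sup>+z. ennreal (exp (\<psi> z) / (\<integral>z. exp (\<psi> z) \<partial>M)) \<partial>M)"
    unfolding tilt_def by (subst emeasure_density) (auto intro!: nn_integral_cong)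
  also have "\<dots> = ennreal (\<integral>z. exp (\<psi> z) / (\<integral>z. exp (\<psi> z) \<partial>M) \<partial>M)"
    using pos by (intro nn_integral_eq_integral bmeas_integrable bmeas_intros b) auto
  also have "\<dots> = 1" using pos by simp
  finally show ?thesis by (intro prob_spaceI) simp
qed

text \<open>The density of the product factorises; comparing measures of rectangles is
  enough.\<close>

lemma PiM_tilt:
  assumes I: "finite I" and b: "bmeas M \<psi>"
  shows "Pi\<^sub>M I (\<lambda>_. tilt M \<psi>) = density (iid I) (\<lambda>p. \<Prod>i\<in>I. ennreal (exp (\<psi> (p i)) / (\<integral>z. exp (\<psi> z) \<partial>M)))"
    (is "_ = density _ ?f")
proof (rule sym)
  interpret T: prob_space "tilt M \<psi>" by (rule prob_space_tilt[OF b])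
  interpret TP: product_sigma_finite "\<lambda>_. tilt M \<psi>" by standard
  interpret PP: product_sigma_finite "\<lambda>_. M" by standard
  note [measurable] = b[THEN bmeas_measurable]
  show "density (iid I) ?f = Pi\<^sub>M I (\<lambda>_. tilt M \<psi>)"
  proof (rule TP.PiM_eqI[OF I])
    show "sets (density (iid I) ?f) = sets (Pi\<^sub>M I (\<lambda>_. tilt M \<psi>))" by (simp cong: sets_PiM_cong)
    fix A assume "\<And>i. i \<in> I \<Longrightarrow> A i \<in> sets (tilt M \<psi>)"
    then have A[measurable]: "\<And>i. i \<in> I \<Longrightarrow> A i \<in> sets M" by simp
    have P: "Pi\<^sub>E I A \<in> sets (iid I)" using A I by (intro sets_PiM_I_finite) auto
    have "emeasure (density (iid I) ?f) (Pi\<^sub>E I A) = (\<integral>\<^sup>+p. ?f p * indicator (Pi\<^sub>E I A) p \<partial>iid I)"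
      using P I by (intro emeasure_density) auto
    also have "\<dots> = (\<integral>\<^sup>+p. (\<Prod>i\<in>I. ennreal (exp (\<psi> (p i)) / (\<integral>z. exp (\<psi> z) \<partial>M)) * indicator (A i) (p i)) \<partial>iid I)"
    proof (rule nn_integral_cong)
      fix p assume "p \<in> space (iid I)"
      then have "indicator (Pi\<^sub>E I A) p = (\<Prod>i\<in>I. indicator (A i) (p i) :: ennreal)"
        using I by (auto simp: indicator_def space_PiM PiE_iff prod_zero_iff split: if_splits)
      then show "?f p * indicator (Pi\<^sub>E I A) p = (\<Prod>i\<in>I. ennreal (exp (\<psi> (p i)) / (\<integral>z. exp (\<psi> z) \<partial>M)) * indicator (A i) (p i))"
        by (simp add: prod.distrib)
    qed
    also have "\<dots> = (\<Prod>i\<in>I. \<integral>\<^sup>+z. ennreal (exp (\<psi> z) / (\<integral>z. exp (\<psi> z) \<partial>M)) * indicator (A i) z \<partial>M)"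
      using I A by (intro PP.product_nn_integral_prod) auto
    also have "\<dots> = (\<Prod>i\<in>I. emeasure (tilt M \<psi>) (A i))"
      unfolding tilt_def using A by (intro prod.cong refl) (subst emeasure_density, auto)
    finally show "emeasure (density (iid I) ?f) (Pi\<^sub>E I A) = (\<Prod>i\<in>I. emeasure (tilt M \<psi>) (A i))" .
  qed
qed

lemma iid_tilt:
  assumes I: "finite I" and b: "bmeas M \<psi>" and F: "bmeas (iid I) F"
  shows "(\<integral>p. F p * exp (\<Sum>i\<in>I. \<psi> (p i)) \<partial>iid I) = (\<integral>z. exp (\<psi> z) \<partial>M) ^ card I * (\<integral>p. F p \<partial>Pi\<^sub>M I (\<lambda>_. tilt M \<psi>))"
proof -
  define m where "m = (\<integral>z. exp (\<psi> z) \<partial>M)"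
  have m: "m > 0" unfolding m_def by (rule exp_integral_pos[OF b])
  note [measurable] = b[THEN bmeas_measurable] F[THEN bmeas_measurable]
  have pr: "(\<Prod>i\<in>I. ennreal (exp (\<psi> (p i)) / m)) = ennreal (exp (\<Sum>i\<in>I. \<psi> (p i)) / m ^ card I)" for p
    using m I by (simp add: prod_ennreal exp_sum prod_dividef)
  have "(\<integral>p. F p \<partial>Pi\<^sub>M I (\<lambda>_. tilt M \<psi>)) = (\<integral>p. F p \<partial>density (iid I) (\<lambda>p. ennreal (exp (\<Sum>i\<in>I. \<psi> (p i)) / m ^ card I)))"
    unfolding PiM_tilt[OF I b] m_def[symmetric] pr ..
  also have "\<dots> = (\<integral>p. (exp (\<Sum>i\<in>I. \<psi> (p i)) / m ^ card I) *\<^sub>R F p \<partial>iid I)"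
    using m by (intro integral_density) auto
  also have "\<dots> = (\<integral>p. F p * exp (\<Sum>i\<in>I. \<psi> (p i)) \<partial>iid I) / m ^ card I" by (simp add: mult.commute)
  finally show ?thesis using m by (simp add: m_def)
qed

end

section \<open>Exponentially weighted half-line expectations\<close>

lemma exponential_tail:
  assumes "0 < s" "0 \<le> u"
  shows "(\<integral>t. of_bool (u \<le> t) \<partial>density lborel (exponential_density s)) = exp (- s * u)"
proof -
  interpret X: prob_space "density lborel (exponential_density s)" by (rule prob_space_exponential_density[OF assms(1)])
  have D: "distributed (density lborel (exponential_density s)) lborel (\<lambda>x. x) (exponential_density s)"
    unfolding distributed_def by (auto intro!: measure_eqI simp: emeasure_distr)
  have "(\<integral>t. (of_bool (u \<le> t) :: real) \<partial>density lborel (exponential_density s)) = (\<integral>t. of_bool (u < t) \<partial>density lborel (exponential_density s))"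
  proof (rule integral_cong_AE)
    have "AE x in lborel. x \<noteq> u" by (rule AE_lborel_singleton)
    then have "AE x in density lborel (exponential_density s). x \<noteq> u" by (subst AE_density) auto
    then show "AE x in density lborel (exponential_density s). of_bool (u \<le> x) = (of_bool (u < x) :: real)" by eventually_elim auto
  qed (auto intro!: bmeas_measurable bmeas_of_bool)
  also have "\<dots> = measure (density lborel (exponential_density s)) {t \<in> space (density lborel (exponential_density s)). u < t}"
    by (rule X.measure_eq_integral_of_bool[symmetric]) auto
  also have "\<dots> = exp (- u * s)" by (rule X.exponential_distributedD_gt[OF D assms(2,1)])
  finally show ?thesis by (simp add: mult.commute)
qed

text \<open>Writing \<open>exp (- s * (W + r))\<close> as the tail of an exponential distribution turns the expectation into an
  average of window probabilities of \<open>W\<close>, which a Berry-Esseen bound controls.\<close>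

lemma (in prob_space) exp_window:
  assumes W[measurable]: "W \<in> borel_measurable M" and s: "0 < s"
  shows "(\<integral>p. of_bool (- r < W p) * exp (- s * (W p + r)) \<partial>M)
    = (\<integral>t. measure M {p\<in>space M. - r < W p \<and> W p \<le> t - r} \<partial>density lborel (exponential_density s))"
proof -
  let ?X = "density lborel (exponential_density s)"
  interpret X: prob_space ?X by (rule prob_space_exponential_density[OF s])
  interpret PR: pair_prob_space M ?X ..
  have m: "Measurable.pred (M \<Otimes>\<^sub>M ?X) (\<lambda>(p,t). - r < W p \<and> W p \<le> t - r)" by measurable
  have int: "integrable (M \<Otimes>\<^sub>M ?X) (\<lambda>(p,t). of_bool (- r < W p \<and> W p \<le> t - r) :: real)"
    using PR.bmeas_integrable[OF bmeas_of_bool[OF m]] by (simp add: case_prod_beta')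
  have "(\<integral>p. of_bool (- r < W p) * exp (- s * (W p + r)) \<partial>M) = (\<integral>p. (\<integral>t. of_bool (- r < W p \<and> W p \<le> t - r) \<partial>?X) \<partial>M)"
  proof (rule Bochner_Integration.integral_cong[OF refl])
    fix p
    show "of_bool (- r < W p) * exp (- s * (W p + r)) = (\<integral>t. of_bool (- r < W p \<and> W p \<le> t - r) \<partial>?X)"
    proof (cases "- r < W p")
      case True
      then have "(\<integral>t. (of_bool (- r < W p \<and> W p \<le> t - r) :: real) \<partial>?X) = (\<integral>t. of_bool (W p + r \<le> t) \<partial>?X)"
        by (simp add: le_diff_eq)
      then show ?thesis using True exponential_tail[OF s, of "W p + r"] by simp
    qed simp
  qed
  also have "\<dots> = (\<integral>t. (\<integral>p. of_bool (- r < W p \<and> W p \<le> t - r) \<partial>M) \<partial>?X)"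
    using PR.Fubini_integral[OF int] by simp
  also have "\<dots> = (\<integral>t. measure M {p\<in>space M. - r < W p \<and> W p \<le> t - r} \<partial>?X)"
    by (subst measure_eq_integral_of_bool) auto
  finally show ?thesis .
qed

text \<open>Completing the square converts the exponential weight into a shift of the normal law by
  \<open>s\<close>.\<close>

lemma normal_exp_window:
  assumes s: "0 < s"
  shows "(\<integral>t. of_bool (- r < t) * exp (- s * (t + r)) \<partial>density lborel gauss) = exp (- r\<^sup>2 / 2) * mills (s - r) / sqrt (2 * pi)"
proof -
  have g: "exp (- s * (t + r)) * gauss t = exp (s\<^sup>2 / 2 - s * r) * gauss (t + s)" for t
    unfolding std_normal_density_def by (simp add: exp_add[symmetric] power2_eq_square field_simps)
  have tail: "(\<integral>t. of_bool (u < t) \<partial>density lborel gauss) = 1 - Phi u" for u :: real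
  proof -
    have "(\<integral>t. of_bool (u < t) \<partial>density lborel gauss) = measure (density lborel gauss) {u<..}"
      using NORM.measure_eq_integral_of_bool[of "\<lambda>t. u < t"] by (simp add: greaterThan_def)
    also have "{u<..} = space (density lborel gauss) - {..u}" by auto
    also have "measure (density lborel gauss) \<dots> = 1 - Phi u" unfolding Phi_def by (rule NORM.prob_compl) auto
    finally show ?thesis .
  qed
  have "(\<integral>t. of_bool (- r < t) * exp (- s * (t + r)) \<partial>density lborel gauss) = (\<integral>t. gauss t *\<^sub>R (of_bool (- r < t) * exp (- s * (t + r))) \<partial>lborel)"
    by (rule integral_density) (auto intro!: borel_measurable_times bmeas_measurable[OF bmeas_of_bool])
  also have "\<dots> = (\<integral>t. exp (s\<^sup>2 / 2 - s * r) * (gauss (s + 1 * t) * of_bool (s - r < s + 1 * t)) \<partial>lborel)"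
    by (intro Bochner_Integration.integral_cong refl) (use g in \<open>simp add: algebra_simps\<close>)
  also have "\<dots> = exp (s\<^sup>2 / 2 - s * r) * (\<integral>t. gauss (s + 1 * t) * of_bool (s - r < s + 1 * t) \<partial>lborel)" by simp
  also have "(\<integral>t. gauss (s + 1 * t) * of_bool (s - r < s + 1 * t) \<partial>lborel) = (\<integral>t. gauss t * of_bool (s - r < t) \<partial>lborel)"
    by (subst (2) lborel_integral_real_affine[of 1 _ s]) auto
  also have "\<dots> = (\<integral>t. of_bool (s - r < t) \<partial>density lborel gauss)"
    by (subst integral_density) (auto intro!: bmeas_measurable[OF bmeas_of_bool])
  also have "\<dots> = mills (s - r) * gauss (s - r)" unfolding tail mills_def using gauss_pos[of "s - r"] by simp
  also have "exp (s\<^sup>2 / 2 - s * r) * (mills (s - r) * gauss (s - r)) = exp (- r\<^sup>2 / 2) * mills (s - r) / sqrt (2 * pi)"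
  proof -
    have "exp (s\<^sup>2 / 2 - s * r) * exp (- (s - r)\<^sup>2 / 2) = exp (- r\<^sup>2 / 2)"
      by (simp add: exp_add[symmetric] power2_eq_square field_simps)
    then show ?thesis unfolding std_normal_density_def by (simp add: mult.assoc mult.left_commute)
  qed
  finally show ?thesis .
qed

text \<open>Each window probability is off by at most 2 * \<epsilon>, and an average over a
  probability law preserves this bound uniformly in \<open>s\<close> and \<open>r\<close>.\<close>

lemma (in prob_space) exp_window_normal_approx:
  assumes W[measurable]: "W \<in> borel_measurable M" and s: "0 < s" and \<epsilon>: "\<And>z. \<bar>measure M {p\<in>space M. W p \<le> z} - Phi z\<bar> \<le> \<epsilon>"
  shows "\<bar>(\<integral>p. of_bool (- r < W p) * exp (- s * (W p + r)) \<partial>M) - exp (- r\<^sup>2 / 2) * mills (s - r) / sqrt (2 * pi)\<bar> \<le> 2 * \<epsilon>"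
proof -
  let ?X = "density lborel (exponential_density s)"
  interpret X: prob_space ?X by (rule prob_space_exponential_density[OF s])
  let ?f = "\<lambda>t. measure M {p\<in>space M. - r < W p \<and> W p \<le> t - r}"
  let ?g = "\<lambda>t. measure (density lborel gauss) {p\<in>space (density lborel gauss). - r < p \<and> p \<le> t - r}"
  have fe: "?f t = (if t \<le> 0 then 0 else measure M {p\<in>space M. W p \<le> t - r} - measure M {p\<in>space M. W p \<le> - r})" for t
  proof (cases "t \<le> 0")
    case False
    have "?f t = measure M ({p\<in>space M. W p \<le> t - r} - {p\<in>space M. W p \<le> - r})" by (intro arg_cong[where f="measure M"]) auto
    also have "\<dots> = measure M {p\<in>space M. W p \<le> t - r} - measure M {p\<in>space M. W p \<le> - r}"
      using False by (intro finite_measure_Diff) auto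
    finally show ?thesis using False by simp
  next
    case True
    then have "{p\<in>space M. - r < W p \<and> W p \<le> t - r} = {}" by auto
    then show ?thesis using True by (simp only: measure_empty if_True)
  qed
  have ge: "?g t = (if t \<le> 0 then 0 else Phi (t - r) - Phi (- r))" for t
  proof (cases "t \<le> 0")
    case False
    have "?g t = measure (density lborel gauss) ({..t - r} - {..- r})" by (intro arg_cong[where f="measure _"]) auto
    also have "\<dots> = Phi (t - r) - Phi (- r)" unfolding Phi_def
      using False by (intro NORM.finite_measure_Diff) auto
    finally show ?thesis using False by simp
  next
    case True
    then have "{p\<in>space (density lborel gauss). - r < p \<and> p \<le> t - r} = {}" by auto
    then show ?thesis using True by (simp only: measure_empty if_True)
  qed
  have "mono (\<lambda>z. measure M {p\<in>space M. W p \<le> z})" by (intro monoI finite_measure_mono) auto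
  then have [measurable]: "(\<lambda>z. measure M {p\<in>space M. W p \<le> z}) \<in> borel_measurable borel" by (rule borel_measurable_mono)
  have "mono Phi" by (intro monoI Phi_mono)
  then have [measurable]: "Phi \<in> borel_measurable borel" by (rule borel_measurable_mono)
  have e0: "\<epsilon> \<ge> 0" using \<epsilon>[of 0] by linarith
  have bf: "bmeas ?X ?f" by (rule bmeasI[where B=1], unfold fe, measurable) (unfold fe[symmetric], auto)
  have bg: "bmeas ?X ?g" by (rule bmeasI[where B=1], unfold ge, measurable) (unfold ge[symmetric], auto)
  have "\<bar>(\<integral>p. of_bool (- r < W p) * exp (- s * (W p + r)) \<partial>M) - exp (- r\<^sup>2 / 2) * mills (s - r) / sqrt (2 * pi)\<bar>
     = \<bar>(\<integral>t. ?f t \<partial>?X) - (\<integral>t. ?g t \<partial>?X)\<bar>"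
    unfolding exp_window[OF W s] normal_exp_window[OF s, symmetric]
    by (subst NORM.exp_window[OF _ s]) auto
  also have "\<dots> = \<bar>\<integral>t. ?f t - ?g t \<partial>?X\<bar>"
    using X.bmeas_integrable[OF bf] X.bmeas_integrable[OF bg] by simp
  also have "\<dots> \<le> (\<integral>t. \<bar>?f t - ?g t\<bar> \<partial>?X)" by (rule integral_abs_bound)
  also have "\<dots> \<le> (\<integral>t. 2 * \<epsilon> \<partial>?X)"
  proof (rule integral_mono)
    show "integrable ?X (\<lambda>t. \<bar>?f t - ?g t\<bar>)" by (intro X.bmeas_integrable bmeas_intros bf bg)
    fix t show "\<bar>?f t - ?g t\<bar> \<le> 2 * \<epsilon>" unfolding fe ge using \<epsilon>[of "t - r"] \<epsilon>[of "-r"] e0 by auto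
  qed auto
  also have "\<dots> = 2 * \<epsilon>" using X.prob_space by simp
  finally show ?thesis .
qed

section \<open>Taylor bounds\<close>

lemma exp_taylor_bound:
  fixes w :: real
  shows "\<bar>exp w - (\<Sum>m<k. w ^ m / fact m)\<bar> \<le> exp \<bar>w\<bar> * \<bar>w\<bar> ^ k / fact k"
proof -
  obtain t where t: "\<bar>t\<bar> \<le> \<bar>w\<bar>" "exp w = (\<Sum>m<k. w ^ m / fact m) + exp t / fact k * w ^ k"
    using Maclaurin_exp_le[of w k] by blast
  have "exp t \<le> exp \<bar>w\<bar>" using t by simp
  then have "exp t * \<bar>w\<bar> ^ k / fact k \<le> exp \<bar>w\<bar> * \<bar>w\<bar> ^ k / fact k"
    by (intro divide_right_mono mult_right_mono) auto
  then show ?thesis using t by (simp add: abs_mult power_abs)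
qed

lemma exp_le_numeral: "exp 1 \<le> (3::real)" "exp 2 \<le> (9::real)" "exp 3 \<le> (27::real)"
proof -
  show 1: "exp 1 \<le> (3::real)" using exp_le by simp
  have "exp 2 = exp (1::real) ^ 2" "exp 3 = exp (1::real) ^ 3" by (simp_all add: exp_of_nat_mult[symmetric])
  then show "exp 2 \<le> (9::real)" "exp 3 \<le> (27::real)" using power_mono[OF 1, of 2] power_mono[OF 1, of 3] by simp_all
qed

lemma abs_power_le: "\<bar>a\<bar> \<le> 1 \<Longrightarrow> k \<le> l \<Longrightarrow> \<bar>a\<bar> ^ l \<le> \<bar>a :: real\<bar> ^ k"
  by (intro power_decreasing) auto

lemma abs_power_ge: "1 \<le> \<bar>a\<bar> \<Longrightarrow> k \<le> l \<Longrightarrow> \<bar>a :: real\<bar> ^ k \<le> \<bar>a\<bar> ^ l"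
  by (intro power_increasing) auto

text \<open>The range 1/4 to 2 for \<open>\<theta>\<close> in this group covers the values 1/3, 1/2
  and 2 used for tilting. Since the weight is bounded, the expansions below hold for every real a:
  where |a| > 1, the power of |a| in the error term dominates all else.\<close>

lemma exp_quad_le:
  assumes "1/4 \<le> \<theta>" shows "exp (a - \<theta> * a\<^sup>2) \<le> (3::real)"
proof -
  have "a - \<theta> * a\<^sup>2 \<le> a - 1/4 * a\<^sup>2" using assms by (intro diff_left_mono mult_right_mono) auto
  also have "\<dots> \<le> 1" using zero_le_power2[of "a / 2 - 1"] by (simp add: power2_eq_square algebra_simps)
  finally show ?thesis using exp_le_numeral(1) by (smt (verit) exp_le_cancel_iff)
qed

lemma exp_quad_diff1:
  assumes "1/4 \<le> \<theta>" "\<theta> \<le> 2" shows "\<bar>exp (a - \<theta> * a\<^sup>2) - 1\<bar> \<le> 100 * \<bar>a::real\<bar>"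
proof (cases "\<bar>a\<bar> \<le> 1")
  case True
  define w where "w = a - \<theta> * a\<^sup>2"
  have "\<bar>\<theta> * a\<^sup>2\<bar> \<le> 2 * \<bar>a\<bar>" using assms abs_power_le[OF True, of 1 2] by (auto simp: abs_mult intro!: mult_mono)
  then have w: "\<bar>w\<bar> \<le> 3 * \<bar>a\<bar>" unfolding w_def by linarith
  have "\<bar>exp w - 1\<bar> \<le> exp \<bar>w\<bar> * \<bar>w\<bar>" using exp_taylor_bound[of w 1] by simp
  also have "\<dots> \<le> 27 * (3 * \<bar>a\<bar>)" using w True by (intro mult_mono order_trans[OF _ exp_le_numeral(3)]) auto
  finally show ?thesis unfolding w_def by simp
next
  case False
  have "\<bar>exp (a - \<theta> * a\<^sup>2) - 1\<bar> \<le> 3" using exp_quad_le[OF assms(1), of a] exp_gt_zero[of "a - \<theta> * a\<^sup>2"] by linarith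
  then show ?thesis using False by linarith
qed

lemma exp_quad_diff2:
  assumes "1/4 \<le> \<theta>" "\<theta> \<le> 2" shows "\<bar>exp (a - \<theta> * a\<^sup>2) - (1 + a + (1/2 - \<theta>) * a\<^sup>2)\<bar> \<le> 130 * \<bar>a::real\<bar> ^ 3"
proof (cases "\<bar>a\<bar> \<le> 1")
  case True
  define w where "w = a - \<theta> * a\<^sup>2"
  have "\<bar>\<theta> * a\<^sup>2\<bar> \<le> 2 * \<bar>a\<bar>" using assms abs_power_le[OF True, of 1 2] by (auto simp: abs_mult intro!: mult_mono)
  then have w: "\<bar>w\<bar> \<le> 3 * \<bar>a\<bar>" unfolding w_def by linarith
  have "\<bar>exp w - (1 + w + w\<^sup>2 / 2)\<bar> \<le> exp \<bar>w\<bar> * \<bar>w\<bar> ^ 3 / 6" using exp_taylor_bound[of w 3] by (simp add: numeral_3_eq_3 power2_eq_square)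
  also have "\<dots> \<le> 27 * (3 * \<bar>a\<bar>) ^ 3 / 6" using w True by (intro divide_right_mono mult_mono power_mono order_trans[OF _ exp_le_numeral(3)]) auto
  also have "\<dots> = 243/2 * \<bar>a\<bar> ^ 3" by (simp add: power_mult_distrib)
  also have "\<dots> \<le> 122 * \<bar>a\<bar> ^ 3" by (intro mult_right_mono) auto
  finally have 1: "\<bar>exp w - (1 + w + w\<^sup>2 / 2)\<bar> \<le> 122 * \<bar>a\<bar> ^ 3" .
  have "(1 + w + w\<^sup>2 / 2) - (1 + a + (1/2 - \<theta>) * a\<^sup>2) = - (\<theta> * a ^ 3) + \<theta>\<^sup>2 / 2 * a ^ 4"
    unfolding w_def by (simp add: field_simps power2_eq_square power3_eq_cube power4_eq_xxxx)
  moreover have "\<bar>\<theta> * a ^ 3\<bar> \<le> 2 * \<bar>a\<bar> ^ 3" using assms by (auto simp: abs_mult power_abs intro!: mult_mono)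
  moreover have "\<bar>\<theta>\<^sup>2 / 2 * a ^ 4\<bar> \<le> 2 * \<bar>a\<bar> ^ 3"
    using assms abs_power_le[OF True, of 3 4] power_mono[of \<theta> 2 2] by (auto simp: abs_mult power_abs intro!: mult_mono)
  ultimately show ?thesis using 1 zero_le_power[of "\<bar>a\<bar>" 3] unfolding w_def by linarith
next
  case False
  then have 1: "1 \<le> \<bar>a\<bar> ^ 3" "\<bar>a\<bar> \<le> \<bar>a\<bar> ^ 3" "\<bar>a\<bar>\<^sup>2 \<le> \<bar>a\<bar> ^ 3"
    using abs_power_ge[of a 0 3] abs_power_ge[of a 1 3] abs_power_ge[of a 2 3] by auto
  have "\<bar>exp (a - \<theta> * a\<^sup>2)\<bar> \<le> 3" using exp_quad_le[OF assms(1), of a] by simp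
  moreover have "\<bar>(1/2 - \<theta>) * a\<^sup>2\<bar> \<le> 2 * \<bar>a\<bar> ^ 3" unfolding abs_mult using assms 1 by (intro mult_mono) auto
  ultimately show ?thesis using 1 by linarith
qed

text \<open>The quadratic term of \<open>exp (wq a)\<close> vanishes, and the coefficient \<open>-1/3\<close> of its cubic term is the one in the
  skewness correction of the theorem.\<close>

definition wq :: "real \<Rightarrow> real" where "wq a = a - 1/2 * a\<^sup>2"

lemma wq_abs_le: "\<bar>a\<bar> \<le> 1 \<Longrightarrow> \<bar>wq a\<bar> \<le> 3/2 * \<bar>a\<bar>"
proof -
  assume "\<bar>a\<bar> \<le> 1"
  then have "a\<^sup>2 \<le> \<bar>a\<bar>" using abs_power_le[of a 1 2] by simp
  then show ?thesis unfolding wq_def using zero_le_power2[of a] by linarith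
qed

lemma exp_wq_le: "exp (wq a) \<le> 3"
  unfolding wq_def by (rule exp_quad_le) simp

lemma exp_wq_diff1: "\<bar>exp (wq a) - 1\<bar> \<le> 100 * \<bar>a\<bar>"
  unfolding wq_def by (rule exp_quad_diff1) auto

text \<open>For a negative exponent this is y^k * exp (- y) \<le> k!, a single term of the
  exponential series; a positive \<open>wq a\<close> is at most 1/2.\<close>

lemma wq_power_exp_le: "\<bar>wq a\<bar> ^ k * exp (wq a) \<le> 3 * fact k"
proof (cases "wq a \<ge> 0")
  case True
  have "wq a \<le> 1/2" using zero_le_power2[of "a - 1"] by (simp add: wq_def power2_diff)
  then have "\<bar>wq a\<bar> ^ k \<le> 1" using True by (intro power_le_one) auto
  then have "\<bar>wq a\<bar> ^ k * exp (wq a) \<le> fact k * 3" using exp_wq_le[of a] by (intro mult_mono) (auto intro: order_trans[OF _ fact_ge_1])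
  then show ?thesis by simp
next
  case False
  have "\<bar>wq a\<bar> ^ k / fact k \<le> exp \<bar>wq a\<bar>"
  proof -
    have "(\<lambda>m. \<bar>wq a\<bar> ^ m / fact m) sums exp \<bar>wq a\<bar>" using exp_converges[of "\<bar>wq a\<bar>"] by (simp add: divide_inverse mult.commute)
    from sums_unique[OF this] have "exp \<bar>wq a\<bar> = (\<Sum>m. \<bar>wq a\<bar> ^ m / fact m)" .
    moreover have "sum (\<lambda>m. \<bar>wq a\<bar> ^ m / fact m) {k} \<le> (\<Sum>m. \<bar>wq a\<bar> ^ m / fact m)"
      using \<open>_ sums _\<close> by (intro sum_le_suminf) (auto simp: sums_iff)
    ultimately show ?thesis by simp
  qed
  then have "\<bar>wq a\<bar> ^ k / fact k * exp (wq a) \<le> exp \<bar>wq a\<bar> * exp (wq a)" by (intro mult_right_mono) auto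
  also have "\<dots> = 1" using False by (simp add: exp_add[symmetric])
  finally show ?thesis by (simp add: field_simps) (smt (verit) fact_gt_zero)
qed

lemma exp_wq_diff3: "\<bar>exp (wq a) - (1 + a - a ^ 3 / 3)\<bar> \<le> 10 * a ^ 4"
proof (cases "\<bar>a\<bar> \<le> 1")
  case True
  define w where "w = wq a"
  have w: "\<bar>w\<bar> \<le> 3/2 * \<bar>a\<bar>" unfolding w_def by (rule wq_abs_le[OF True])
  have "\<bar>exp w - (1 + w + w\<^sup>2 / 2 + w ^ 3 / 6)\<bar> \<le> exp \<bar>w\<bar> * \<bar>w\<bar> ^ 4 / 24"
    using exp_taylor_bound[of w 4] by (simp add: eval_nat_numeral algebra_simps)
  also have "\<dots> \<le> 9 * (3/2 * \<bar>a\<bar>) ^ 4 / 24" using w True by (intro divide_right_mono mult_mono power_mono order_trans[OF _ exp_le_numeral(2)]) auto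
  also have "\<dots> = 243/128 * a ^ 4" by (simp add: power_mult_distrib power_divide)
  also have "\<dots> \<le> 2 * a ^ 4" by (intro mult_right_mono) auto
  finally have 1: "\<bar>exp w - (1 + w + w\<^sup>2 / 2 + w ^ 3 / 6)\<bar> \<le> 2 * a ^ 4" .
  have "(1 + w + w\<^sup>2 / 2 + w ^ 3 / 6) - (1 + a - a ^ 3 / 3) = - (a ^ 4 / 8) + a ^ 5 / 8 - a ^ 6 / 48"
    unfolding w_def wq_def by (simp add: field_simps eval_nat_numeral)
  moreover have "\<bar>a ^ 5\<bar> \<le> a ^ 4" "\<bar>a ^ 6\<bar> \<le> a ^ 4" "0 \<le> a ^ 4"
    using abs_power_le[OF True, of 4 5] abs_power_le[OF True, of 4 6] by (auto simp: power_abs)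
  ultimately show ?thesis using 1 unfolding w_def by linarith
next
  case False
  then have 1: "1 \<le> a ^ 4" "\<bar>a\<bar> \<le> a ^ 4" "\<bar>a\<bar> ^ 3 \<le> a ^ 4"
    using abs_power_ge[of a 0 4] abs_power_ge[of a 1 4] abs_power_ge[of a 3 4] by auto
  have "\<bar>exp (wq a)\<bar> \<le> 3" using exp_wq_le[of a] by simp
  moreover have "\<bar>a ^ 3 / 3\<bar> \<le> a ^ 4" using 1 by (simp add: power_abs)
  ultimately show ?thesis using 1 by linarith
qed

text \<open>With w = a - a^2 / 2, the expansion w + w^2 + O(w^3) becomes a + a^2 / 2 + O(a^3). The
  quadratic coefficient 1/2 is what puts the tilted mean at the threshold.\<close>

lemma wq_exp_diff: "\<bar>wq a * exp (wq a) - (a + a\<^sup>2 / 2)\<bar> \<le> 20 * \<bar>a\<bar> ^ 3"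
proof (cases "\<bar>a\<bar> \<le> 1")
  case True
  define w where "w = wq a"
  have w: "\<bar>w\<bar> \<le> 3/2 * \<bar>a\<bar>" unfolding w_def by (rule wq_abs_le[OF True])
  have "\<bar>exp w - (1 + w)\<bar> \<le> exp \<bar>w\<bar> * \<bar>w\<bar> ^ 2 / 2"
    using exp_taylor_bound[of w 2] by (simp add: eval_nat_numeral)
  then have "\<bar>w\<bar> * \<bar>exp w - (1 + w)\<bar> \<le> \<bar>w\<bar> * (exp \<bar>w\<bar> * \<bar>w\<bar> ^ 2 / 2)" by (intro mult_left_mono) auto
  also have "\<dots> = exp \<bar>w\<bar> * \<bar>w\<bar> ^ 3 / 2" by (simp add: eval_nat_numeral)
  also have "\<dots> \<le> 9 * (3/2 * \<bar>a\<bar>) ^ 3 / 2" using w True by (intro divide_right_mono mult_mono power_mono order_trans[OF _ exp_le_numeral(2)]) auto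
  also have "\<dots> = 243/16 * \<bar>a\<bar> ^ 3" by (simp add: power_mult_distrib power_divide)
  also have "\<dots> \<le> 16 * \<bar>a\<bar> ^ 3" by (intro mult_right_mono) auto
  finally have *: "\<bar>w\<bar> * \<bar>exp w - (1 + w)\<bar> \<le> 16 * \<bar>a\<bar> ^ 3" .
  have 1: "\<bar>w * exp w - (w + w\<^sup>2)\<bar> \<le> 16 * \<bar>a\<bar> ^ 3"
  proof -
    have "w * exp w - (w + w\<^sup>2) = w * (exp w - (1 + w))" by (simp add: algebra_simps power2_eq_square)
    then show ?thesis using * by (simp add: abs_mult)
  qed
  have "w + w\<^sup>2 - (a + a\<^sup>2 / 2) = - (a ^ 3) + a ^ 4 / 4"
    unfolding w_def wq_def by (simp add: field_simps eval_nat_numeral)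
  moreover have "\<bar>a ^ 3\<bar> = \<bar>a\<bar> ^ 3" "\<bar>a ^ 4\<bar> \<le> \<bar>a\<bar> ^ 3"
    using abs_power_le[OF True, of 3 4] by (auto simp: power_abs)
  ultimately show ?thesis using 1 unfolding w_def by linarith
next
  case False
  then have 1: "1 \<le> \<bar>a\<bar> ^ 3" "\<bar>a\<bar> \<le> \<bar>a\<bar> ^ 3" "\<bar>a\<bar>\<^sup>2 \<le> \<bar>a\<bar> ^ 3"
    using abs_power_ge[of a 0 3] abs_power_ge[of a 1 3] abs_power_ge[of a 2 3] by auto
  have "\<bar>wq a * exp (wq a)\<bar> \<le> 3" using wq_power_exp_le[of a 1] by (simp add: abs_mult)
  moreover have "\<bar>a\<^sup>2 / 2\<bar> \<le> \<bar>a\<bar> ^ 3" using 1 by simp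
  ultimately show ?thesis using 1 by linarith
qed

lemma wq2_exp_diff: "\<bar>(wq a)\<^sup>2 * exp (wq a) - a\<^sup>2\<bar> \<le> 230 * \<bar>a\<bar> ^ 3"
proof (cases "\<bar>a\<bar> \<le> 1")
  case True
  define w where "w = wq a"
  have w: "\<bar>w\<bar> \<le> 3/2 * \<bar>a\<bar>" unfolding w_def by (rule wq_abs_le[OF True])
  have "\<bar>w\<bar>\<^sup>2 * \<bar>exp w - 1\<bar> \<le> (3/2 * \<bar>a\<bar>)\<^sup>2 * (100 * \<bar>a\<bar>)"
    using w exp_wq_diff1[of a] unfolding w_def by (intro mult_mono power_mono) auto
  then have 1: "\<bar>w\<^sup>2 * exp w - w\<^sup>2\<bar> \<le> 225 * \<bar>a\<bar> ^ 3"
  proof -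
    have "w\<^sup>2 * exp w - w\<^sup>2 = w\<^sup>2 * (exp w - 1)" by (simp add: algebra_simps)
    then have "\<bar>w\<^sup>2 * exp w - w\<^sup>2\<bar> = \<bar>w\<bar>\<^sup>2 * \<bar>exp w - 1\<bar>" by (simp add: abs_mult)
    also note \<open>\<bar>w\<bar>\<^sup>2 * \<bar>exp w - 1\<bar> \<le> _\<close>
    also have "(3/2 * \<bar>a\<bar>)\<^sup>2 * (100 * \<bar>a\<bar>) = 225 * \<bar>a\<bar> ^ 3" unfolding power_mult_distrib by (simp add: power2_eq_square power3_eq_cube)
    finally show ?thesis .
  qed
  have "w\<^sup>2 - a\<^sup>2 = - (a ^ 3) + a ^ 4 / 4"
    unfolding w_def wq_def by (simp add: field_simps eval_nat_numeral)
  moreover have "\<bar>a ^ 3\<bar> = \<bar>a\<bar> ^ 3" "\<bar>a ^ 4\<bar> \<le> \<bar>a\<bar> ^ 3"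
    using abs_power_le[OF True, of 3 4] by (auto simp: power_abs)
  ultimately show ?thesis using 1 unfolding w_def by linarith
next
  case False
  then have 1: "1 \<le> \<bar>a\<bar> ^ 3" "\<bar>a\<bar>\<^sup>2 \<le> \<bar>a\<bar> ^ 3"
    using abs_power_ge[of a 0 3] abs_power_ge[of a 2 3] by auto
  have "\<bar>(wq a)\<^sup>2 * exp (wq a)\<bar> \<le> 6" using wq_power_exp_le[of a 2] by (simp add: abs_mult)
  moreover have "\<bar>a\<^sup>2\<bar> \<le> \<bar>a\<bar> ^ 3" using 1 by simp
  ultimately show ?thesis using 1 by linarith
qed

lemma wq3_exp_le: "\<bar>wq a\<bar> ^ 3 * exp (wq a) \<le> 18 * \<bar>a\<bar> ^ 3"
proof (cases "\<bar>a\<bar> \<le> 1")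
  case True
  have "\<bar>wq a\<bar> ^ 3 * exp (wq a) \<le> (3/2 * \<bar>a\<bar>) ^ 3 * 3"
    using wq_abs_le[OF True] exp_wq_le[of a] by (intro mult_mono power_mono) auto
  also have "\<dots> \<le> 18 * \<bar>a\<bar> ^ 3" using zero_le_power[of "\<bar>a\<bar>" 3] unfolding power_mult_distrib by (simp add: power_divide)
  finally show ?thesis .
next
  case False
  then show ?thesis using wq_power_exp_le[of a 3] abs_power_ge[of a 0 3] by (simp add: eval_nat_numeral)
qed

lemma wq1_exp_le: "\<bar>wq a\<bar> * exp (wq a) \<le> 5 * \<bar>a\<bar>"
proof (cases "\<bar>a\<bar> \<le> 1")
  case True
  have "\<bar>wq a\<bar> * exp (wq a) \<le> (3/2 * \<bar>a\<bar>) * 3"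
    using wq_abs_le[OF True] exp_wq_le[of a] by (intro mult_mono) auto
  then show ?thesis by simp
next
  case False
  then show ?thesis using wq_power_exp_le[of a 1] by simp
qed

text \<open>The Gaussian decay of the weight buys four further powers; this is how an eighth moment
  is obtained from a fourth.\<close>

lemma power4_exp_wq_le: "a ^ 4 * exp (wq a) \<le> 100"
proof -
  have "wq a \<le> 1 - a\<^sup>2 / 4" unfolding wq_def using zero_le_power2[of "a / 2 - 1"] by (simp add: power2_eq_square algebra_simps)
  then have "exp (wq a) \<le> exp 1 * exp (- (a\<^sup>2 / 4))" by (simp add: exp_add[symmetric])
  moreover have "(a\<^sup>2 / 4)\<^sup>2 / 2 \<le> exp (a\<^sup>2 / 4)" using exp_lower_Taylor_quadratic[of "a\<^sup>2 / 4"] zero_le_power2[of a] by linarith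
  then have "a ^ 4 \<le> 32 * exp (a\<^sup>2 / 4)" by (simp add: power2_eq_square power4_eq_xxxx)
  ultimately have "a ^ 4 * exp (wq a) \<le> (32 * exp (a\<^sup>2 / 4)) * (exp 1 * exp (- (a\<^sup>2 / 4)))" by (intro mult_mono) auto
  also have "\<dots> = 32 * exp 1" by (simp add: exp_minus)
  finally show ?thesis using exp_le_numeral(1) by simp
qed

section \<open>Moments under tilting\<close>

text \<open>The mean need not vanish, because trimming introduces a small bias.\<close>

locale unit_sample = prob_space M for M :: "'a measure" +
  fixes X :: "'a \<Rightarrow> real" and K :: real
  assumes X: "bmeas M X" and X2: "(\<integral>z. (X z)\<^sup>2 \<partial>M) = 1" and X4: "(\<integral>z. X z ^ 4 \<partial>M) \<le> K"
begin

abbreviation "mean \<equiv> \<integral>z. X z \<partial>M"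

lemmas bX = bmeas_intros X

lemma X_abs: "(\<integral>z. \<bar>X z\<bar> \<partial>M) \<le> 1"
  using bmeas_abs_le_sqrt[OF X] X2 by simp

lemma mean_abs: "\<bar>mean\<bar> \<le> 1"
  by (rule order_trans[OF integral_abs_bound X_abs])

lemma K_ge_1: "1 \<le> K"
proof -
  have "1 \<le> sqrt (\<integral>z. ((X z)\<^sup>2)\<^sup>2 \<partial>M)" using bmeas_abs_le_sqrt[of "\<lambda>z. (X z)\<^sup>2"] X2 by (simp add: bX)
  then have "1 \<le> (\<integral>z. X z ^ 4 \<partial>M)" by simp
  then show ?thesis using X4 by simp
qed

lemma X3: "(\<integral>z. \<bar>X z\<bar> ^ 3 \<partial>M) \<le> K"
proof -
  have "(\<integral>z. \<bar>X z\<bar> ^ 3 \<partial>M) \<le> (\<integral>z. (X z)\<^sup>2 / 2 + X z ^ 4 / 2 \<partial>M)"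
  proof (rule integral_mono)
    fix z
    have "0 \<le> (\<bar>X z\<bar> - (X z)\<^sup>2)\<^sup>2" by simp
    then show "\<bar>X z\<bar> ^ 3 \<le> (X z)\<^sup>2 / 2 + X z ^ 4 / 2"
      by (simp add: power2_diff power_mult_distrib eval_nat_numeral algebra_simps)
  qed (intro bmeas_integrable bX)+
  also have "\<dots> = 1 / 2 + (\<integral>z. X z ^ 4 \<partial>M) / 2"
    using X2 by (subst Bochner_Integration.integral_add) (auto intro!: bmeas_integrable bX)
  finally show ?thesis using X4 K_ge_1 by linarith
qed

lemma integral_diff_le:
  assumes f: "bmeas M f" and g: "bmeas M g" and k: "bmeas M k" and le: "\<And>z. \<bar>f z - g z\<bar> \<le> k z"
  shows "\<bar>(\<integral>z. f z \<partial>M) - (\<integral>z. g z \<partial>M)\<bar> \<le> (\<integral>z. k z \<partial>M)"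
proof -
  have "\<bar>(\<integral>z. f z \<partial>M) - (\<integral>z. g z \<partial>M)\<bar> = \<bar>\<integral>z. f z - g z \<partial>M\<bar>"
    using bmeas_integrable[OF f] bmeas_integrable[OF g] by simp
  also have "\<dots> \<le> (\<integral>z. \<bar>f z - g z\<bar> \<partial>M)" by (rule integral_abs_bound)
  also have "\<dots> \<le> (\<integral>z. k z \<partial>M)" by (intro integral_mono bmeas_integrable bmeas_intros f g k le)
  finally show ?thesis .
qed

text \<open>\<open>\<theta>\<close> stays free: 1/2 is the critical tilt, 2 favours a small
  self-normalizer, and 1/3 serves the shells on which the self-normalizer is large.\<close>

definition ex :: "real \<Rightarrow> real \<Rightarrow> 'a \<Rightarrow> real" where
  "ex \<theta> \<alpha> z = \<alpha> * X z - \<theta> * (\<alpha> * X z)\<^sup>2"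

definition mgf :: "real \<Rightarrow> real \<Rightarrow> real" where
  "mgf \<theta> \<alpha> = (\<integral>z. exp (ex \<theta> \<alpha> z) \<partial>M)"

lemma b_ex: "bmeas M (ex \<theta> \<alpha>)"
  unfolding ex_def[abs_def] by (intro bX)

lemmas bE = bX b_ex

lemma mgf_diff2:
  assumes "1/4 \<le> \<theta>" "\<theta> \<le> 2" "0 \<le> \<alpha>"
  shows "\<bar>mgf \<theta> \<alpha> - (1 + \<alpha> * mean + (1/2 - \<theta>) * \<alpha>\<^sup>2)\<bar> \<le> 130 * \<alpha> ^ 3 * K"
proof -
  have "(\<integral>z. 1 + \<alpha> * X z + (1/2 - \<theta>) * \<alpha>\<^sup>2 * (X z)\<^sup>2 \<partial>M) = 1 + \<alpha> * mean + (1/2 - \<theta>) * \<alpha>\<^sup>2"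
  proof -
    have "integrable M X" "integrable M (\<lambda>z. (X z)\<^sup>2)" by (intro bmeas_integrable bX)+
    then show ?thesis by (simp add: prob_space X2)
  qed
  moreover have "\<bar>mgf \<theta> \<alpha> - (\<integral>z. 1 + \<alpha> * X z + (1/2 - \<theta>) * \<alpha>\<^sup>2 * (X z)\<^sup>2 \<partial>M)\<bar> \<le> (\<integral>z. 130 * \<alpha> ^ 3 * \<bar>X z\<bar> ^ 3 \<partial>M)"
    unfolding mgf_def
  proof (rule integral_diff_le)
    fix z show "\<bar>exp (ex \<theta> \<alpha> z) - (1 + \<alpha> * X z + (1/2 - \<theta>) * \<alpha>\<^sup>2 * (X z)\<^sup>2)\<bar> \<le> 130 * \<alpha> ^ 3 * \<bar>X z\<bar> ^ 3"
      using exp_quad_diff2[OF assms(1,2), of "\<alpha> * X z"] assms(3) by (simp add: ex_def power_mult_distrib abs_mult)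
  qed (intro bE)+
  moreover have "(\<integral>z. 130 * \<alpha> ^ 3 * \<bar>X z\<bar> ^ 3 \<partial>M) \<le> 130 * \<alpha> ^ 3 * K"
    using X3 assms(3) by (simp add: mult_left_mono)
  ultimately show ?thesis by linarith
qed

lemma mgf_diff1:
  assumes "1/4 \<le> \<theta>" "\<theta> \<le> 2" "0 \<le> \<alpha>"
  shows "\<bar>mgf \<theta> \<alpha> - 1\<bar> \<le> 100 * \<alpha>"
proof -
  have "\<bar>mgf \<theta> \<alpha> - (\<integral>z. 1 \<partial>M)\<bar> \<le> (\<integral>z. 100 * \<alpha> * \<bar>X z\<bar> \<partial>M)"
    unfolding mgf_def
  proof (rule integral_diff_le)
    fix z show "\<bar>exp (ex \<theta> \<alpha> z) - 1\<bar> \<le> 100 * \<alpha> * \<bar>X z\<bar>"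
      using exp_quad_diff1[OF assms(1,2), of "\<alpha> * X z"] assms(3) by (simp add: ex_def abs_mult)
  qed (intro bE)+
  moreover have "(\<integral>z. 100 * \<alpha> * \<bar>X z\<bar> \<partial>M) \<le> 100 * \<alpha> * 1"
    using X_abs assms(3) by (simp add: mult_left_le)
  ultimately show ?thesis by (simp add: prob_space)
qed

lemma mgf_ge_half:
  assumes "1/4 \<le> \<theta>" "\<theta> \<le> 2" "0 \<le> \<alpha>" "\<alpha> \<le> 1/200"
  shows "1/2 \<le> mgf \<theta> \<alpha>" "mgf \<theta> \<alpha> \<le> 2"
  using mgf_diff1[OF assms(1-3)] assms(4) by linarith+

abbreviation "tlt \<theta> \<alpha> \<equiv> tilt M (ex \<theta> \<alpha>)"

lemma prob_space_tl: "prob_space (tlt \<theta> \<alpha>)"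
  by (rule prob_space_tilt[OF b_ex])

lemma measure_tlt [simp]: "measure (tlt \<theta> \<alpha>) (space M) = 1"
  using prob_space.prob_space[OF prob_space_tl] by simp

lemma integral_tl: "bmeas M u \<Longrightarrow> (\<integral>z. u z \<partial>tlt \<theta> \<alpha>) = (\<integral>z. u z * exp (ex \<theta> \<alpha> z) \<partial>M) / mgf \<theta> \<alpha>"
  unfolding mgf_def by (rule integral_tilt[OF b_ex])

lemma integral_tl_le:
  assumes "1/4 \<le> \<theta>" "\<theta> \<le> 2" "0 \<le> \<alpha>" "\<alpha> \<le> 1/200" "bmeas M u" "bmeas M k" and le: "\<And>z. u z * exp (ex \<theta> \<alpha> z) \<le> k z" and k: "(\<integral>z. k z \<partial>M) \<le> B" "0 \<le> B"
  shows "(\<integral>z. u z \<partial>tlt \<theta> \<alpha>) \<le> 2 * B"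
proof -
  note h = mgf_ge_half(1)[OF assms(1-4)]
  have "(\<integral>z. u z * exp (ex \<theta> \<alpha> z) \<partial>M) \<le> (\<integral>z. k z \<partial>M)"
    by (intro integral_mono bmeas_integrable bE assms)
  also have "\<dots> \<le> B" by (rule k)
  also have "\<dots> \<le> (2 * B) * mgf \<theta> \<alpha>" using mult_left_mono[OF h, of "2 * B"] k by simp
  finally show ?thesis unfolding integral_tl[OF assms(5)] using h by (simp add: divide_le_eq)
qed

lemma tl_X4:
  assumes "1/4 \<le> \<theta>" "\<theta> \<le> 2" "0 \<le> \<alpha>" "\<alpha> \<le> 1/200"
  shows "(\<integral>z. X z ^ 4 \<partial>tlt \<theta> \<alpha>) \<le> 6 * K"
proof -
  have "(\<integral>z. X z ^ 4 \<partial>tlt \<theta> \<alpha>) \<le> 2 * (3 * K)"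
  proof (rule integral_tl_le[OF assms])
    fix z show "X z ^ 4 * exp (ex \<theta> \<alpha> z) \<le> 3 * X z ^ 4"
      using mult_left_mono[OF exp_quad_le[OF assms(1), of "\<alpha> * X z"], of "X z ^ 4"] by (simp add: ex_def)
  qed (use X4 K_ge_1 in \<open>auto intro!: bX\<close>)
  then show ?thesis by simp
qed

text \<open>Numerator and normalising constant are both 1 + O(\<alpha> * K), so their difference is
  estimated before dividing; the division costs a factor 2 because the constant is at least
  1/2.\<close>

lemma tl_X2:
  assumes "1/4 \<le> \<theta>" "\<theta> \<le> 2" "0 \<le> \<alpha>" "\<alpha> \<le> 1/200"
  shows "\<bar>(\<integral>z. (X z)\<^sup>2 \<partial>tlt \<theta> \<alpha>) - 1\<bar> \<le> 400 * \<alpha> * K"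
proof -
  note h = mgf_ge_half(1)[OF assms]
  have "\<bar>(\<integral>z. (X z)\<^sup>2 * exp (ex \<theta> \<alpha> z) \<partial>M) - (\<integral>z. (X z)\<^sup>2 \<partial>M)\<bar> \<le> (\<integral>z. 100 * \<alpha> * \<bar>X z\<bar> ^ 3 \<partial>M)"
  proof (rule integral_diff_le)
    fix z
    have "(X z)\<^sup>2 * \<bar>exp (ex \<theta> \<alpha> z) - 1\<bar> \<le> (X z)\<^sup>2 * (100 * \<bar>\<alpha> * X z\<bar>)"
      unfolding ex_def by (intro mult_left_mono exp_quad_diff1 assms) auto
    then show "\<bar>(X z)\<^sup>2 * exp (ex \<theta> \<alpha> z) - (X z)\<^sup>2\<bar> \<le> 100 * \<alpha> * \<bar>X z\<bar> ^ 3"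
      using assms(3) abs_mult[of "(X z)\<^sup>2" "exp (ex \<theta> \<alpha> z) - 1"]
      by (simp add: right_diff_distrib abs_mult eval_nat_numeral mult_ac)
  qed (intro bE)+
  also have "\<dots> \<le> 100 * \<alpha> * K" using X3 assms(3) by (simp add: mult_left_mono)
  finally have "\<bar>(\<integral>z. (X z)\<^sup>2 * exp (ex \<theta> \<alpha> z) \<partial>M) - mgf \<theta> \<alpha>\<bar> \<le> 100 * \<alpha> * K + 100 * \<alpha>"
    using mgf_diff1[OF assms(1-3)] X2 by linarith
  also have "\<dots> \<le> 200 * \<alpha> * K" using K_ge_1 mult_left_mono[of 1 K "100 * \<alpha>"] assms(3) by (simp add: mult_ac)
  finally have *: "\<bar>(\<integral>z. (X z)\<^sup>2 * exp (ex \<theta> \<alpha> z) \<partial>M) - mgf \<theta> \<alpha>\<bar> \<le> 200 * \<alpha> * K" .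
  have "(\<integral>z. (X z)\<^sup>2 \<partial>tlt \<theta> \<alpha>) - 1 = ((\<integral>z. (X z)\<^sup>2 * exp (ex \<theta> \<alpha> z) \<partial>M) - mgf \<theta> \<alpha>) / mgf \<theta> \<alpha>"
    using h by (subst integral_tl) (auto intro!: bX simp: diff_divide_distrib)
  then have "\<bar>(\<integral>z. (X z)\<^sup>2 \<partial>tlt \<theta> \<alpha>) - 1\<bar> = \<bar>(\<integral>z. (X z)\<^sup>2 * exp (ex \<theta> \<alpha> z) \<partial>M) - mgf \<theta> \<alpha>\<bar> / mgf \<theta> \<alpha>"
    using h by (simp add: abs_divide)
  also have "\<dots> \<le> (200 * \<alpha> * K) / (1/2)" using * h assms(3) K_ge_1 by (intro frac_le) auto
  finally show ?thesis by simp
qed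

definition Sn :: "nat \<Rightarrow> (nat \<Rightarrow> 'a) \<Rightarrow> real" where "Sn n p = (\<Sum>i<n. X (p i))"
definition Vn :: "nat \<Rightarrow> (nat \<Rightarrow> 'a) \<Rightarrow> real" where "Vn n p = (\<Sum>i<n. (X (p i))\<^sup>2)"
definition yn :: "nat \<Rightarrow> (nat \<Rightarrow> 'a) \<Rightarrow> real" where "yn n p = Vn n p / n - 1"

abbreviation "Pn n \<equiv> iid {..<n}"
abbreviation "Tn \<theta> \<alpha> n \<equiv> Pi\<^sub>M {..<n} (\<lambda>_. tlt \<theta> \<alpha>)"

lemma measure_Tn [simp]: "measure (Tn \<theta> \<alpha> n) (space (Pn n)) = 1"
  using prob_space.prob_space[OF prob_space.prob_space_iid[OF prob_space_tl]] by simp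

lemma b_Sn: "bmeas (Pn n) (Sn n)" unfolding Sn_def[abs_def] by (intro bX bmeas_component) auto
lemma b_Vn: "bmeas (Pn n) (Vn n)" unfolding Vn_def[abs_def] by (rule bmeas_sum, rule bmeas_component, simp, intro bX)
lemma b_yn: "bmeas (Pn n) (yn n)" unfolding yn_def[abs_def] by (intro bX b_Vn)
lemmas bn = bmeas_intros b_Sn b_Vn b_yn

lemma Vn_nonneg: "0 \<le> Vn n p" unfolding Vn_def by (intro sum_nonneg) auto

lemma sum_ex: "(\<Sum>i<n. ex \<theta> \<alpha> (p i)) = \<alpha> * Sn n p - \<theta> * \<alpha>\<^sup>2 * Vn n p"
  unfolding ex_def Sn_def Vn_def by (simp add: sum_subtractf sum_distrib_left power_mult_distrib mult_ac)

lemma tilt_Pn: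
  "bmeas (Pn n) F \<Longrightarrow> (\<integral>p. F p * exp (\<alpha> * Sn n p - \<theta> * \<alpha>\<^sup>2 * Vn n p) \<partial>Pn n) = mgf \<theta> \<alpha> ^ n * (\<integral>p. F p \<partial>Tn \<theta> \<alpha> n)"
  using iid_tilt[OF _ b_ex, of "{..<n}" F \<theta> \<alpha>] by (simp add: sum_ex mgf_def)

text \<open>Variance plus squared bias: the tilt moves the mean of X^2 by at most 400 * \<alpha> *
  K, and 320000 = 2 * 400^2.\<close>

lemma yn_second_moment:
  assumes "1/4 \<le> \<theta>" "\<theta> \<le> 2" "0 \<le> \<alpha>" "\<alpha> \<le> 1/200" "n \<ge> 1"
  shows "(\<integral>p. (yn n p)\<^sup>2 \<partial>Tn \<theta> \<alpha> n) \<le> 12 * K / n + 320000 * \<alpha>\<^sup>2 * K\<^sup>2"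
proof -
  interpret T: prob_space "tlt \<theta> \<alpha>" by (rule prob_space_tl)
  interpret TT: prob_space "Tn \<theta> \<alpha> n" by (rule T.prob_space_iid)
  define v where "v = (\<integral>z. (X z)\<^sup>2 \<partial>tlt \<theta> \<alpha>)"
  define u where "u z = (X z)\<^sup>2 - v" for z
  have bu: "bmeas (tlt \<theta> \<alpha>) u" unfolding u_def[abs_def] by (simp add: bX)
  have bX2: "bmeas (tlt \<theta> \<alpha>) (\<lambda>z. (X z)\<^sup>2)" "bmeas (tlt \<theta> \<alpha>) (\<lambda>z. X z ^ 4)" by (simp_all add: bX)
  have mu: "(\<integral>z. u z \<partial>tlt \<theta> \<alpha>) = 0" unfolding u_def using T.bmeas_integrable[OF bX2(1)] by (simp add: v_def)
  have vu: "(\<integral>z. (u z)\<^sup>2 \<partial>tlt \<theta> \<alpha>) \<le> 6 * K"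
  proof -
    have "(\<integral>z. (u z)\<^sup>2 \<partial>tlt \<theta> \<alpha>) = (\<integral>z. X z ^ 4 - 2 * v * (X z)\<^sup>2 + v\<^sup>2 \<partial>tlt \<theta> \<alpha>)"
      by (intro Bochner_Integration.integral_cong refl) (simp add: u_def power2_diff)
    also have "\<dots> = (\<integral>z. X z ^ 4 \<partial>tlt \<theta> \<alpha>) - v\<^sup>2"
      using T.bmeas_integrable[OF bX2(1)] T.bmeas_integrable[OF bX2(2)] by (simp add: v_def[symmetric]) (simp add: power2_eq_square)
    also have "\<dots> \<le> (\<integral>z. X z ^ 4 \<partial>tlt \<theta> \<alpha>)" by simp
    finally show ?thesis using tl_X4[OF assms(1-4)] by simp
  qed
  have y: "yn n p = (\<Sum>i<n. u (p i)) / n + (v - 1)" for p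
    using assms(5) by (simp add: yn_def Vn_def u_def sum_subtractf diff_divide_distrib)
  have bs: "bmeas (Tn \<theta> \<alpha> n) (\<lambda>p. \<Sum>i<n. u (p i))" by (intro bmeas_sum T.bmeas_component[OF _ bu])
  have by': "bmeas (Tn \<theta> \<alpha> n) (yn n)" by (simp add: b_yn)
  have "(\<integral>p. (yn n p)\<^sup>2 \<partial>Tn \<theta> \<alpha> n) \<le> (\<integral>p. 2 / n\<^sup>2 * (\<Sum>i<n. u (p i))\<^sup>2 + 2 * (v - 1)\<^sup>2 \<partial>Tn \<theta> \<alpha> n)"
  proof (rule integral_mono)
    fix p
    have "(a + b)\<^sup>2 \<le> 2 * a\<^sup>2 + 2 * b\<^sup>2" for a b :: real using zero_le_power2[of "a - b"] by (simp add: power2_sum power2_diff)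
    from this[of "(\<Sum>i<n. u (p i)) / n" "v - 1"] show "(yn n p)\<^sup>2 \<le> 2 / n\<^sup>2 * (\<Sum>i<n. u (p i))\<^sup>2 + 2 * (v - 1)\<^sup>2"
      unfolding y by (simp add: power_divide)
  qed (intro TT.bmeas_integrable bmeas_intros by' bs)+
  also have "\<dots> = 2 / n\<^sup>2 * (\<integral>p. (\<Sum>i<n. u (p i))\<^sup>2 \<partial>Tn \<theta> \<alpha> n) + 2 * (v - 1)\<^sup>2"
    using TT.bmeas_integrable[OF bmeas_power[OF bs, of 2]] by simp
  also have "(\<integral>p. (\<Sum>i<n. u (p i))\<^sup>2 \<partial>Tn \<theta> \<alpha> n) = n * (\<integral>z. (u z)\<^sup>2 \<partial>tlt \<theta> \<alpha>)"
    using T.iid_sum_second[OF _ bu mu, of "{..<n}"] by simp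
  also have "2 / n\<^sup>2 * (n * (\<integral>z. (u z)\<^sup>2 \<partial>tlt \<theta> \<alpha>)) + 2 * (v - 1)\<^sup>2 \<le> 2 / n\<^sup>2 * (n * (6 * K)) + 2 * (400 * \<alpha> * K)\<^sup>2"
  proof -
    have "(v - 1)\<^sup>2 \<le> (400 * \<alpha> * K)\<^sup>2" using tl_X2[OF assms(1-4)] unfolding v_def by (subst abs_le_square_iff[symmetric]) auto
    then show ?thesis using vu by (intro add_mono mult_left_mono) auto
  qed
  also have "\<dots> = 12 * K / n + 320000 * \<alpha>\<^sup>2 * K\<^sup>2" using assms(5) by (simp add: power2_eq_square field_simps)
  finally show ?thesis .
qed

text \<open>Exponential Markov and Chebyshev in one step: the tilt supplies the exponential factor,
  and the second moment of \<open>yn\<close> under the tilted law supplies the factor 1 / n that the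
  exponential bound alone would not give.\<close>

lemma tilted_chebyshev:
  assumes "1/4 \<le> \<theta>" "\<theta> \<le> 2" "0 \<le> \<alpha>" "\<alpha> \<le> 1/200" "n \<ge> 1" "0 < \<delta>"
    and A: "Measurable.pred (Pn n) A" "\<And>p. A p \<Longrightarrow> \<delta> \<le> \<bar>yn n p\<bar>" "\<And>p. A p \<Longrightarrow> L \<le> \<alpha> * Sn n p - \<theta> * \<alpha>\<^sup>2 * Vn n p"
  shows "measure (Pn n) {p \<in> space (Pn n). A p}
    \<le> exp (- L + (1/2 - \<theta>) * n * \<alpha>\<^sup>2 + n * \<alpha> * mean + 130 * real n * \<alpha> ^ 3 * K) * (12 * K / n + 320000 * \<alpha>\<^sup>2 * K\<^sup>2) / \<delta>\<^sup>2"
proof -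
  interpret PP: prob_space "Pn n" by (rule prob_space_iid)
  let ?e = "\<lambda>p. exp (\<alpha> * Sn n p - \<theta> * \<alpha>\<^sup>2 * Vn n p)"
  have "measure (Pn n) {p \<in> space (Pn n). A p} = (\<integral>p. of_bool (A p) \<partial>Pn n)" by (rule PP.measure_eq_integral_of_bool[OF A(1)])
  also have "\<dots> \<le> (\<integral>p. exp (- L) / \<delta>\<^sup>2 * ((yn n p)\<^sup>2 * ?e p) \<partial>Pn n)"
  proof (rule integral_mono)
    fix p
    show "of_bool (A p) \<le> exp (- L) / \<delta>\<^sup>2 * ((yn n p)\<^sup>2 * ?e p)"
    proof (cases "A p")
      case True
      have "\<delta>\<^sup>2 \<le> (yn n p)\<^sup>2" using A(2)[OF True] assms(6) by (subst abs_le_square_iff[symmetric]) auto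
      then have "\<delta>\<^sup>2 * exp L \<le> (yn n p)\<^sup>2 * ?e p" using A(3)[OF True] by (intro mult_mono) auto
      then have "exp (- L) / \<delta>\<^sup>2 * (\<delta>\<^sup>2 * exp L) \<le> exp (- L) / \<delta>\<^sup>2 * ((yn n p)\<^sup>2 * ?e p)" by (intro mult_left_mono) auto
      then show ?thesis using True assms(6) by (simp add: exp_minus)
    qed simp
  qed (intro PP.bmeas_integrable bn bmeas_of_bool A)+
  also have "\<dots> = exp (- L) / \<delta>\<^sup>2 * (mgf \<theta> \<alpha> ^ n * (\<integral>p. (yn n p)\<^sup>2 \<partial>Tn \<theta> \<alpha> n))"
    by (subst tilt_Pn[symmetric]) (auto intro!: bn)
  also have "\<dots> \<le> exp (- L) / \<delta>\<^sup>2 * (exp (n * ((1/2 - \<theta>) * \<alpha>\<^sup>2 + \<alpha> * mean + 130 * \<alpha> ^ 3 * K)) * (12 * K / n + 320000 * \<alpha>\<^sup>2 * K\<^sup>2))"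
  proof (intro mult_left_mono mult_mono yn_second_moment assms)
    have "mgf \<theta> \<alpha> \<le> 1 + ((1/2 - \<theta>) * \<alpha>\<^sup>2 + \<alpha> * mean + 130 * \<alpha> ^ 3 * K)" using mgf_diff2[OF assms(1-3)] by linarith
    also have "\<dots> \<le> exp ((1/2 - \<theta>) * \<alpha>\<^sup>2 + \<alpha> * mean + 130 * \<alpha> ^ 3 * K)" by (rule exp_ge_add_one_self)
    finally have "mgf \<theta> \<alpha> ^ n \<le> exp ((1/2 - \<theta>) * \<alpha>\<^sup>2 + \<alpha> * mean + 130 * \<alpha> ^ 3 * K) ^ n"
      using mgf_ge_half(1)[OF assms(1-4)] by (intro power_mono) auto
    then show "mgf \<theta> \<alpha> ^ n \<le> exp (n * ((1/2 - \<theta>) * \<alpha>\<^sup>2 + \<alpha> * mean + 130 * \<alpha> ^ 3 * K))" by (simp add: exp_of_nat_mult)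
  qed auto
  also have "\<dots> = exp (- L + (1/2 - \<theta>) * n * \<alpha>\<^sup>2 + n * \<alpha> * mean + 130 * real n * \<alpha> ^ 3 * K) * (12 * K / n + 320000 * \<alpha>\<^sup>2 * K\<^sup>2) / \<delta>\<^sup>2"
    by (simp add: exp_add[symmetric] algebra_simps exp_diff exp_minus exp_add divide_simps)
  finally show ?thesis .
qed

end

section \<open>Atypical self-normalizers\<close>

lemma ex_power4_between:
  assumes "1 \<le> (r::real)" shows "\<exists>k. 4 ^ k \<le> r \<and> r < 4 ^ Suc k"
proof -
  obtain m where m: "r < 4 ^ m" using real_arch_pow[of 4 r] by auto
  define l where "l = (LEAST m. r < 4 ^ m)"
  have l: "r < 4 ^ l" unfolding l_def using m by (rule LeastI)
  then obtain k where k: "l = Suc k" using assms by (cases l) auto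
  have "\<not> r < 4 ^ k" using not_less_Least[of k "\<lambda>m. r < 4 ^ m"] k unfolding l_def by simp
  then show ?thesis using l k by (intro exI[of _ k]) auto
qed

lemma scale_eqs:
  fixes n :: nat and x h :: real
  assumes "n \<ge> 1" "h = x / sqrt n"
  shows "n * h\<^sup>2 = x\<^sup>2" "n * h = x * sqrt n" "x = h * sqrt n"
proof -
  show x: "x = h * sqrt n" using assms by simp
  show "n * h\<^sup>2 = x\<^sup>2" unfolding x by (simp add: power_mult_distrib)
  show "n * h = x * sqrt n" unfolding x by simp
qed

context unit_sample
begin

lemma yn_ge: "n \<ge> 1 \<Longrightarrow> -1 \<le> yn n p"
  using Vn_nonneg[of n p] by (simp add: yn_def)

lemma sqrt_Vn: "n \<ge> 1 \<Longrightarrow> sqrt (Vn n p) = sqrt n * sqrt (1 + yn n p)"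
  by (simp add: yn_def real_sqrt_mult[symmetric])

text \<open>A heavy penalty \<theta> = 2 on V favours small values of it. The normalising constant
  then contributes -3/2 * x^2, while the exponent falls on the event at most to -15/16 * x^2: with
  r^2 = 1 + y and r \<le> 1, r - 2 * r^2 \<ge> - r^2 \<ge> -15/16. The balance -9/16 lies strictly
  below -1/2.\<close>

lemma exceed_low:
  assumes n: "n \<ge> 1" and x: "0 < x" and h: "h = x / sqrt n" and hK: "130 * h * K \<le> 1/408" and m: "\<bar>x * sqrt n * mean\<bar> \<le> 1"
  shows "measure (Pn n) {p \<in> space (Pn n). x * sqrt (Vn n p) < Sn n p \<and> yn n p < -1/16}
    \<le> exp (1 - x\<^sup>2 / 2 - x\<^sup>2 / 136) * (12 * K / n + 320000 * h\<^sup>2 * K\<^sup>2) * 256"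
proof -
  have h0: "0 < h" using x n h by simp
  have nh: "n * h\<^sup>2 = x\<^sup>2" "n * h * mean = x * sqrt n * mean" using scale_eqs[OF n h] by auto
  have "h \<le> h * K" using K_ge_1 h0 mult_left_mono[of 1 K h] by simp
  then have h2: "h \<le> 1/200" using hK by simp
  have "measure (Pn n) {p \<in> space (Pn n). x * sqrt (Vn n p) < Sn n p \<and> yn n p < -1/16}
    \<le> exp (- (- (15/16 * x\<^sup>2)) + (1/2 - 2) * n * h\<^sup>2 + n * h * mean + 130 * real n * h ^ 3 * K) * (12 * K / n + 320000 * h\<^sup>2 * K\<^sup>2) / (1/16)\<^sup>2"
  proof (rule tilted_chebyshev)
    show "Measurable.pred (Pn n) (\<lambda>p. x * sqrt (Vn n p) < Sn n p \<and> yn n p < -1/16)" by (intro pred_bmeas bn)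
    fix p assume p: "x * sqrt (Vn n p) < Sn n p \<and> yn n p < -1/16"
    define r where "r = sqrt (1 + yn n p)"
    have r: "0 \<le> r" "r\<^sup>2 = 1 + yn n p" "r\<^sup>2 \<le> 15/16" using p yn_ge[OF n, of p] by (auto simp: r_def)
    have "r \<le> 1" using r(3) by (intro power2_le_imp_le[of r 1]) auto
    have "h * Sn n p \<ge> h * (x * sqrt (Vn n p))" using p h0 by (intro mult_left_mono) auto
    also have "h * (x * sqrt (Vn n p)) = x\<^sup>2 * r" using n by (simp add: sqrt_Vn[OF n] h r_def power2_eq_square)
    finally have a: "x\<^sup>2 * r \<le> h * Sn n p" .
    have b: "2 * h\<^sup>2 * Vn n p = 2 * x\<^sup>2 * r\<^sup>2" using n nh(1) by (simp add: r(2) yn_def field_simps)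
    have "r\<^sup>2 \<le> r" using mult_left_mono[OF \<open>r \<le> 1\<close> r(1)] unfolding power2_eq_square by simp
    then have "x\<^sup>2 * r\<^sup>2 \<le> x\<^sup>2 * r" by (rule mult_left_mono) simp
    moreover have "x\<^sup>2 * r\<^sup>2 \<le> x\<^sup>2 * (15/16)" using r(3) by (rule mult_left_mono) simp
    ultimately show "- (15/16 * x\<^sup>2) \<le> h * Sn n p - 2 * h\<^sup>2 * Vn n p" unfolding b using a by linarith
    show "1/16 \<le> \<bar>yn n p\<bar>" using p by simp
  qed (use n h0 h2 in auto)
  also have "\<dots> \<le> exp (1 - x\<^sup>2 / 2 - x\<^sup>2 / 136) * (12 * K / n + 320000 * h\<^sup>2 * K\<^sup>2) / (1/16)\<^sup>2"
  proof (intro divide_right_mono mult_right_mono)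
    have "130 * real n * h ^ 3 * K = (n * h\<^sup>2) * (130 * h * K)" by (simp add: power2_eq_square power3_eq_cube)
    also have "\<dots> \<le> x\<^sup>2 * (1/408)" unfolding nh by (intro mult_left_mono hK) auto
    finally have "130 * real n * h ^ 3 * K \<le> x\<^sup>2 * (1/408)" .
    moreover have "(1/2 - 2) * n * h\<^sup>2 = -3/2 * x\<^sup>2" using nh by simp
    ultimately have "- (- (15/16 * x\<^sup>2)) + (1/2 - 2) * n * h\<^sup>2 + n * h * mean + 130 * real n * h ^ 3 * K \<le> 1 - x\<^sup>2 / 2 - x\<^sup>2 / 136"
      using m nh(2) zero_le_power2[of x] by linarith
    then show "exp (- (- (15/16 * x\<^sup>2)) + (1/2 - 2) * n * h\<^sup>2 + n * h * mean + 130 * real n * h ^ 3 * K) \<le> exp (1 - x\<^sup>2 / 2 - x\<^sup>2 / 136)"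
      by simp
    show "0 \<le> 12 * K / n + 320000 * h\<^sup>2 * K\<^sup>2" using K_ge_1 by simp
  qed auto
  finally show ?thesis by (simp add: power2_eq_square)
qed

text \<open>With \<open>v = sqrt (1 + y) / u\<close>, the inequality \<open>(v - 1) * (2 - v) \<ge> 0\<close> bounds the exponent
  \<open>\<alpha> * S - \<alpha>\<^sup>2 * V / 3\<close> from below by \<open>2 * x\<^sup>2 / 3\<close> on the whole shell \<open>1 \<le> v \<le> 2\<close>; this is the reason for the
  coefficient \<open>1/3\<close> and for the ratio 4 between consecutive shells.\<close>

lemma exceed_dyadic:
  assumes n: "n \<ge> 1" and x: "0 < x" and h: "h = x / sqrt n" and hK: "130 * h * K \<le> 1/408" and m: "\<bar>x * sqrt n * mean\<bar> \<le> 1"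
  shows "measure (Pn n) {p \<in> space (Pn n). x * sqrt (Vn n p) < Sn n p \<and> 17/16 * 4 ^ k \<le> 1 + yn n p \<and> 1 + yn n p < 17/16 * 4 ^ Suc k}
    \<le> exp (1 - x\<^sup>2 / 2 - x\<^sup>2 / 136) * (12 * K / n + 320000 * h\<^sup>2 * K\<^sup>2) * 256 * (1/16) ^ k"
proof -
  have h0: "0 < h" using x n h by simp
  have nh: "n * h\<^sup>2 = x\<^sup>2" "n * h * mean = x * sqrt n * mean" using scale_eqs[OF n h] by auto
  have "h \<le> h * K" using K_ge_1 h0 mult_left_mono[of 1 K h] by simp
  then have h2: "h \<le> 1/200" using hK by simp
  \<comment> \<open>Inner radius of the shell for sqrt V, in units of sqrt n. Tilting by h / u
    instead of h adapts the tilt to this radius.\<close>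
  define u where "u = sqrt (17/16 * 4 ^ k)"
  have u2: "u\<^sup>2 = 17/16 * 4 ^ k" by (simp add: u_def)
  have k1: "1 \<le> (4::real) ^ k" by simp
  have "1 \<le> u\<^sup>2" unfolding u2 using k1 by linarith
  then have u1: "1 \<le> u" unfolding u_def by (simp add: real_sqrt_ge_1_iff)
  define \<alpha> where "\<alpha> = h / u"
  have "h / u \<le> h / 1" using h0 u1 by (intro divide_left_mono) auto
  then have al: "0 \<le> \<alpha>" "\<alpha> \<le> h" using h0 u1 unfolding \<alpha>_def by auto
  have "measure (Pn n) {p \<in> space (Pn n). x * sqrt (Vn n p) < Sn n p \<and> 17/16 * 4 ^ k \<le> 1 + yn n p \<and> 1 + yn n p < 17/16 * 4 ^ Suc k}
    \<le> exp (- (2/3 * x\<^sup>2) + (1/2 - 1/3) * n * \<alpha>\<^sup>2 + n * \<alpha> * mean + 130 * real n * \<alpha> ^ 3 * K) * (12 * K / n + 320000 * \<alpha>\<^sup>2 * K\<^sup>2) / (4 ^ k / 16)\<^sup>2"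
  proof (rule tilted_chebyshev)
    show "Measurable.pred (Pn n) (\<lambda>p. x * sqrt (Vn n p) < Sn n p \<and> 17/16 * 4 ^ k \<le> 1 + yn n p \<and> 1 + yn n p < 17/16 * 4 ^ Suc k)" by (intro pred_bmeas bn)
    fix p assume p: "x * sqrt (Vn n p) < Sn n p \<and> 17/16 * 4 ^ k \<le> 1 + yn n p \<and> 1 + yn n p < 17/16 * 4 ^ Suc k"
    define r where "r = sqrt (1 + yn n p) / u"
    have ru: "(r * u)\<^sup>2 = 1 + yn n p" "0 \<le> r" using u1 yn_ge[OF n, of p] by (auto simp: r_def)
    have sq: "u\<^sup>2 \<le> (r * u)\<^sup>2" "(r * u)\<^sup>2 \<le> (2 * u)\<^sup>2" using p unfolding ru(1) by (auto simp: power_mult_distrib u2)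
    have "u \<le> r * u" by (rule power2_le_imp_le[OF sq(1)]) (use u1 ru(2) in auto)
    moreover have "r * u \<le> 2 * u" by (rule power2_le_imp_le[OF sq(2)]) (use u1 in auto)
    ultimately have r: "1 \<le> r" "r \<le> 2" using u1 by auto
    have "\<alpha> * Sn n p \<ge> \<alpha> * (x * sqrt (Vn n p))" using p al by (intro mult_left_mono) auto
    also have "\<alpha> * (x * sqrt (Vn n p)) = x\<^sup>2 * r" using n u1 by (simp add: sqrt_Vn[OF n] h \<alpha>_def r_def power2_eq_square)
    finally have a: "x\<^sup>2 * r \<le> \<alpha> * Sn n p" .
    have b: "1/3 * \<alpha>\<^sup>2 * Vn n p = x\<^sup>2 * (r\<^sup>2 / 3)"
    proof -
      have "\<alpha>\<^sup>2 * Vn n p = (n * h\<^sup>2) * ((1 + yn n p) / u\<^sup>2)" using n unfolding \<alpha>_def yn_def by (simp add: power_divide)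
      also have "(1 + yn n p) / u\<^sup>2 = r\<^sup>2" using u1 unfolding ru(1)[symmetric] by (simp add: power_mult_distrib)
      finally show ?thesis using nh by simp
    qed
    have "0 \<le> (r - 1) * (2 - r)" using r by simp
    then have "2/3 \<le> r - r\<^sup>2 / 3" by (simp add: power2_eq_square algebra_simps)
    then have "x\<^sup>2 * (2/3) \<le> x\<^sup>2 * (r - r\<^sup>2 / 3)" by (intro mult_left_mono) auto
    then show "2/3 * x\<^sup>2 \<le> \<alpha> * Sn n p - 1/3 * \<alpha>\<^sup>2 * Vn n p" unfolding b using a by (simp add: right_diff_distrib)
    \<comment> \<open>17/16 * 4^k - 1 \<ge> 4^k / 16 because 4^k \<ge> 1. The square of this
      deviation is what makes the bounds summable over the shells.\<close>
    have "4 ^ k / 16 \<le> yn n p" using p k1 by linarith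
    then show "4 ^ k / 16 \<le> \<bar>yn n p\<bar>" by linarith
  qed (use n h0 h2 al in auto)
  also have "\<dots> \<le> exp (1 - x\<^sup>2 / 2 - x\<^sup>2 / 136) * (12 * K / n + 320000 * h\<^sup>2 * K\<^sup>2) / (4 ^ k / 16)\<^sup>2"
  proof (intro divide_right_mono mult_mono)
    \<comment> \<open>The gap 1/16 in the threshold enters here: it gives (1/2 - 1/3) * 16/17 = 8/51
      instead of 1/6, and 2/3 - 1/6 alone would just equal 1/2.\<close>
    have a2: "\<alpha>\<^sup>2 \<le> h\<^sup>2 * (16/17)"
    proof -
      have "17/16 \<le> u\<^sup>2" unfolding u2 using k1 by linarith
      then have "h\<^sup>2 / u\<^sup>2 \<le> h\<^sup>2 / (17/16)" by (intro divide_left_mono) auto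
      then show ?thesis unfolding \<alpha>_def by (simp add: power_divide)
    qed
    have "n * \<alpha>\<^sup>2 \<le> n * (h\<^sup>2 * (16/17))" by (intro mult_left_mono a2) auto
    then have 1: "(1/2 - 1/3) * n * \<alpha>\<^sup>2 \<le> 8/51 * x\<^sup>2" using nh(1) by simp
    have "\<alpha>\<^sup>2 * \<alpha> \<le> h\<^sup>2 * h" using al by (intro mult_mono power_mono) auto
    then have "130 * real n * \<alpha> ^ 3 * K \<le> 130 * real n * h ^ 3 * K" using K_ge_1 by (intro mult_right_mono mult_left_mono) (auto simp: power2_eq_square power3_eq_cube)
    also have "130 * real n * h ^ 3 * K = (n * h\<^sup>2) * (130 * h * K)" by (simp add: power2_eq_square power3_eq_cube)
    also have "\<dots> \<le> x\<^sup>2 * (1/408)" unfolding nh by (intro mult_left_mono hK) auto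
    finally have 2: "130 * real n * \<alpha> ^ 3 * K \<le> x\<^sup>2 * (1/408)" .
    have "n * \<alpha> * mean = (x * sqrt n * mean) / u" using nh(2) by (simp add: \<alpha>_def)
    also have "\<dots> \<le> 1" using m u1 by (simp add: divide_le_eq abs_le_iff)
    finally have 3: "n * \<alpha> * mean \<le> 1" .
    \<comment> \<open>-2/3 + 8/51 + 1/408 = -1/2 - 1/136 exactly: the first two terms leave 1/102
      beyond 1/2, of which the cubic error may consume a quarter.\<close>
    show "exp (- (2/3 * x\<^sup>2) + (1/2 - 1/3) * n * \<alpha>\<^sup>2 + n * \<alpha> * mean + 130 * real n * \<alpha> ^ 3 * K) \<le> exp (1 - x\<^sup>2 / 2 - x\<^sup>2 / 136)"
      unfolding exp_le_cancel_iff using 1 2 3 by linarith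
    show "12 * K / n + 320000 * \<alpha>\<^sup>2 * K\<^sup>2 \<le> 12 * K / n + 320000 * h\<^sup>2 * K\<^sup>2" using al by (auto intro!: mult_right_mono power_mono)
    show "0 \<le> 12 * K / n + 320000 * \<alpha>\<^sup>2 * K\<^sup>2" using K_ge_1 by simp
  qed auto
  also have "\<dots> = exp (1 - x\<^sup>2 / 2 - x\<^sup>2 / 136) * (12 * K / n + 320000 * h\<^sup>2 * K\<^sup>2) * 256 * (1/16) ^ k"
  proof -
    have e: "((4::real) ^ k / 16)\<^sup>2 = 16 ^ k / 256" by (simp add: power_divide power_mult_distrib[symmetric] power2_eq_square)
    show ?thesis unfolding e by (simp add: power_one_over)
  qed
  finally show ?thesis .
qed

text \<open>Half of the excess rate 1/136 pays for the factor x^2, through x^2 \<le> 272 * exp (x^2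
  / 272). The other half is kept for the comparison with the main term, whose skewness factor may be
  small.\<close>

lemma exceed_outer:
  assumes n: "n \<ge> 1" and x: "0 < x" and h: "h = x / sqrt n" and hK: "130 * h * K \<le> 1/408" and m: "\<bar>x * sqrt n * mean\<bar> \<le> 1"
  shows "measure (Pn n) {p \<in> space (Pn n). x * sqrt (Vn n p) < Sn n p \<and> 1/16 < \<bar>yn n p\<bar>}
    \<le> 3 * 10 ^ 11 * K\<^sup>2 / n * exp (- x\<^sup>2 / 2 - x\<^sup>2 / 272)"
proof -
  interpret PP: prob_space "Pn n" by (rule prob_space_iid)
  let ?A = "{p \<in> space (Pn n). x * sqrt (Vn n p) < Sn n p \<and> yn n p < -1/16}"
  let ?B = "\<lambda>k. {p \<in> space (Pn n). x * sqrt (Vn n p) < Sn n p \<and> 17/16 * 4 ^ k \<le> 1 + yn n p \<and> 1 + yn n p < 17/16 * 4 ^ Suc k}"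
  define c where "c = exp (1 - x\<^sup>2 / 2 - x\<^sup>2 / 136) * (12 * K / n + 320000 * h\<^sup>2 * K\<^sup>2) * 256"
  have c0: "0 \<le> c" unfolding c_def using K_ge_1 by simp
  have pA: "Measurable.pred (Pn n) (\<lambda>p. x * sqrt (Vn n p) < Sn n p \<and> yn n p < -1/16)" by (intro pred_bmeas bn)
  have pB: "Measurable.pred (Pn n) (\<lambda>p. x * sqrt (Vn n p) < Sn n p \<and> 17/16 * 4 ^ k \<le> 1 + yn n p \<and> 1 + yn n p < 17/16 * 4 ^ Suc k)" for k
    by (intro pred_bmeas bn)
  have mA: "?A \<in> sets (Pn n)" using pA by simp
  have mB: "?B k \<in> sets (Pn n)" for k using pB[of k] by simp
  have B: "measure (Pn n) (?B k) \<le> c * (1/16) ^ k" for k using exceed_dyadic[OF assms] unfolding c_def .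
  have sm: "summable (\<lambda>k. c * (1/16::real) ^ k)" by (intro summable_mult summable_geometric) auto
  have smB: "summable (\<lambda>k. measure (Pn n) (?B k))"
    by (rule summable_comparison_test[OF _ sm]) (use B in \<open>auto intro!: exI[of _ 0]\<close>)
  have "{p \<in> space (Pn n). x * sqrt (Vn n p) < Sn n p \<and> 1/16 < \<bar>yn n p\<bar>} \<subseteq> ?A \<union> (\<Union>k. ?B k)"
  proof
    fix p assume p: "p \<in> {p \<in> space (Pn n). x * sqrt (Vn n p) < Sn n p \<and> 1/16 < \<bar>yn n p\<bar>}"
    show "p \<in> ?A \<union> (\<Union>k. ?B k)"
    proof (cases "yn n p < 0")
      case False
      then have "1 \<le> (1 + yn n p) / (17/16)" using p by simp
      from ex_power4_between[OF this] obtain k where "4 ^ k \<le> (1 + yn n p) / (17/16)" "(1 + yn n p) / (17/16) < 4 ^ Suc k" by blast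
      then have "17/16 * 4 ^ k \<le> 1 + yn n p" "1 + yn n p < 17/16 * 4 ^ Suc k" by (simp_all add: field_simps)
      then show ?thesis using p by blast
    qed (use p in auto)
  qed
  then have "measure (Pn n) {p \<in> space (Pn n). x * sqrt (Vn n p) < Sn n p \<and> 1/16 < \<bar>yn n p\<bar>} \<le> measure (Pn n) (?A \<union> (\<Union>k. ?B k))"
    using mA mB by (intro PP.finite_measure_mono) auto
  also have "\<dots> \<le> measure (Pn n) ?A + measure (Pn n) (\<Union>k. ?B k)"
    using mA mB by (intro measure_Un_le) auto
  also have "measure (Pn n) (\<Union>k. ?B k) \<le> (\<Sum>k. measure (Pn n) (?B k))"
    using mB by (intro PP.finite_measure_subadditive_countably smB) auto
  also have "\<dots> \<le> (\<Sum>k. c * (1/16) ^ k)" by (intro suminf_le B smB sm)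
  also have "\<dots> = c * (16/15)" using suminf_geometric[of "1/16::real"] by (subst suminf_mult) (auto intro: summable_geometric)
  also have "measure (Pn n) ?A \<le> c" using exceed_low[OF assms] unfolding c_def .
  finally have "measure (Pn n) {p \<in> space (Pn n). x * sqrt (Vn n p) < Sn n p \<and> 1/16 < \<bar>yn n p\<bar>} \<le> 3 * c" using c0 by simp
  also have "3 * c \<le> 3 * 10 ^ 11 * K\<^sup>2 / n * exp (- x\<^sup>2 / 2 - x\<^sup>2 / 272)"
  proof -
    define e where "e = exp (x\<^sup>2 / 272)"
    have e: "1 \<le> e" "x\<^sup>2 \<le> 272 * e" unfolding e_def using exp_ge_add_one_self[of "x\<^sup>2 / 272"] zero_le_power2[of x] by (auto simp del: exp_ge_add_one_self zero_le_power2)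
    have "12 * K / n + 320000 * h\<^sup>2 * K\<^sup>2 \<le> (12 + 320000 * x\<^sup>2) * (K\<^sup>2 / n)"
    proof -
      have "K \<le> K\<^sup>2" using K_ge_1 mult_left_mono[of 1 K K] by (simp add: power2_eq_square)
      then have "12 * K / n \<le> 12 * K\<^sup>2 / n" by (intro divide_right_mono) auto
      moreover have "h\<^sup>2 = x\<^sup>2 / n" using h by (simp add: power_divide)
      ultimately show ?thesis by (simp add: algebra_simps)
    qed
    also have "\<dots> \<le> (10 ^ 8 * e) * (K\<^sup>2 / n)" using e by (intro mult_right_mono) auto
    finally have 1: "12 * K / n + 320000 * h\<^sup>2 * K\<^sup>2 \<le> 10 ^ 8 * e * (K\<^sup>2 / n)" .
    have 2: "exp (1 - x\<^sup>2 / 2 - x\<^sup>2 / 136) * e \<le> 3 * exp (- x\<^sup>2 / 2 - x\<^sup>2 / 272)"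
    proof -
      have "exp (1 - x\<^sup>2 / 2 - x\<^sup>2 / 136) * e = exp 1 * exp (- x\<^sup>2 / 2 - x\<^sup>2 / 272)"
        unfolding e_def exp_add[symmetric] by simp
      then show ?thesis using exp_le_numeral(1) by simp
    qed
    have "c \<le> exp (1 - x\<^sup>2 / 2 - x\<^sup>2 / 136) * (10 ^ 8 * e * (K\<^sup>2 / n)) * 256"
      unfolding c_def by (intro mult_right_mono mult_left_mono 1) auto
    also have "\<dots> = (exp (1 - x\<^sup>2 / 2 - x\<^sup>2 / 136) * e) * (256 * 10 ^ 8 * K\<^sup>2 / n)" by simp
    also have "\<dots> \<le> (3 * exp (- x\<^sup>2 / 2 - x\<^sup>2 / 272)) * (256 * 10 ^ 8 * K\<^sup>2 / n)" by (intro mult_right_mono 2) auto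
    also have "\<dots> = (768 * 10 ^ 8) * (K\<^sup>2 / n * exp (- x\<^sup>2 / 2 - x\<^sup>2 / 272))" by simp
    also have "\<dots> \<le> 10 ^ 11 * (K\<^sup>2 / n * exp (- x\<^sup>2 / 2 - x\<^sup>2 / 272))" by (intro mult_right_mono) auto
    finally show ?thesis by simp
  qed
  finally show ?thesis .
qed

end

section \<open>Moments under the critical tilt\<close>

text \<open>\<open>hK\<close> and \<open>xhK\<close> keep x small against sqrt n and n^(1/4). The
  bias conditions reflect that \<tau>^3 is large against sqrt n and that x is at most a multiple of
  \<tau>^3 / sqrt n. The numerical values are chosen with ample room for the constants of the
  estimates that follow.\<close>

locale tilted_sample = unit_sample M X K for M :: "'a measure" and X K +
  fixes n :: nat and x h :: real
  assumes n: "n \<ge> 1" and x: "0 < x" and h: "h = x / sqrt n" and hK: "h * K \<le> 1 / 100000" and xhK: "x * h * K \<le> 1 / 100000"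
    and bias: "sqrt n * \<bar>mean\<bar> \<le> 1 / 100" and xbias: "x * sqrt n * \<bar>mean\<bar> \<le> 1"
begin

lemmas scale = scale_eqs[OF n h]

lemma h_pos: "0 < h" using n x h by simp

lemma h_le: "h \<le> h * K" "h \<le> 1 / 100000"
proof -
  show "h \<le> h * K" using mult_left_mono[OF K_ge_1, of h] h_pos by simp
  then show "h \<le> 1 / 100000" using hK by linarith
qed

lemma h_le': "h \<le> 1 / 200" using h_le(2) by simp

lemma mean_le: "\<bar>mean\<bar> \<le> 1 / 100" "\<bar>mean\<bar> \<le> sqrt n * \<bar>mean\<bar>"
proof -
  show "\<bar>mean\<bar> \<le> sqrt n * \<bar>mean\<bar>" using n mult_right_mono[of 1 "sqrt n" "\<bar>mean\<bar>"] by simp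
  then show "\<bar>mean\<bar> \<le> 1 / 100" using bias by simp
qed

lemma x_le: "x \<le> sqrt n"
  using scale(3) h_le(2) mult_right_mono[of h 1 "sqrt n"] by simp

lemma pow_h: "h ^ 3 * K \<le> h\<^sup>2 / 100000" "h ^ 4 * K \<le> h ^ 3" "h\<^sup>2 \<le> h" "h ^ 3 \<le> h\<^sup>2"
proof -
  show "h ^ 3 * K \<le> h\<^sup>2 / 100000" using mult_left_mono[OF hK, of "h\<^sup>2"] by (simp add: power2_eq_square power3_eq_cube mult_ac)
  show "h ^ 4 * K \<le> h ^ 3" using mult_left_mono[OF hK, of "h ^ 3"] h_pos zero_le_power[of h 3]
    by (simp add: power3_eq_cube power4_eq_xxxx mult_ac)
  show "h\<^sup>2 \<le> h" "h ^ 3 \<le> h\<^sup>2" using h_pos h_le(2) power_decreasing[of 1 2 h] power_decreasing[of 2 3 h] by auto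
qed

definition w :: "'a \<Rightarrow> real" where "w z = wq (h * X z)"
abbreviation "m \<equiv> mgf (1/2) h"
abbreviation "T \<equiv> tlt (1/2) h"
abbreviation "TN \<equiv> Tn (1/2) h n"

lemma w_ex: "w = ex (1/2) h" by (auto simp: w_def wq_def ex_def fun_eq_iff)

sublocale T: prob_space T by (rule prob_space_tl)
sublocale TN: prob_space TN by (rule T.prob_space_iid)

lemma bw: "bmeas M w" unfolding w_ex by (rule b_ex)
lemmas bT = bX bw

lemma m_bounds: "1/2 \<le> m" "m \<le> 2" "\<bar>m - 1\<bar> \<le> h * \<bar>mean\<bar> + 130 * h ^ 3 * K" "\<bar>1 / m - 1\<bar> \<le> 2 * h * \<bar>mean\<bar> + 260 * h ^ 3 * K"
proof -
  show 1: "1/2 \<le> m" "m \<le> 2" using mgf_ge_half[of "1/2" h] h_pos h_le' by auto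
  have "\<bar>h * mean\<bar> = h * \<bar>mean\<bar>" using h_pos by (simp add: abs_mult)
  then show 2: "\<bar>m - 1\<bar> \<le> h * \<bar>mean\<bar> + 130 * h ^ 3 * K" using mgf_diff2[of "1/2" h] h_pos by simp
  have "1 / m - 1 = (1 - m) / m" using 1 by (simp add: diff_divide_distrib)
  then have "\<bar>1 / m - 1\<bar> = \<bar>m - 1\<bar> / m" using 1 by (simp add: abs_divide abs_minus_commute)
  also have "\<dots> \<le> \<bar>m - 1\<bar> / (1/2)" using 1 by (intro divide_left_mono) auto
  finally show "\<bar>1 / m - 1\<bar> \<le> 2 * h * \<bar>mean\<bar> + 260 * h ^ 3 * K" using 2 by simp
qed

lemma m_expansion: "\<bar>m - (1 + h * mean - h ^ 3 * (\<integral>z. X z ^ 3 \<partial>M) / 3)\<bar> \<le> 10 * h ^ 4 * K"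
proof -
  have "\<bar>m - (\<integral>z. 1 + h * X z - h ^ 3 / 3 * X z ^ 3 \<partial>M)\<bar> \<le> (\<integral>z. 10 * h ^ 4 * X z ^ 4 \<partial>M)"
    unfolding mgf_def
  proof (rule integral_diff_le)
    fix z show "\<bar>exp (ex (1/2) h z) - (1 + h * X z - h ^ 3 / 3 * X z ^ 3)\<bar> \<le> 10 * h ^ 4 * X z ^ 4"
      using exp_wq_diff3[of "h * X z"] by (simp add: w_ex[symmetric] w_def power_mult_distrib)
  qed (intro bE)+
  moreover have "(\<integral>z. 1 + h * X z - h ^ 3 / 3 * X z ^ 3 \<partial>M) = 1 + h * mean - h ^ 3 * (\<integral>z. X z ^ 3 \<partial>M) / 3"
    using bmeas_integrable[OF X] bmeas_integrable[OF bmeas_power[OF X, of 3]] by (simp add: prob_space)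
  moreover have "(\<integral>z. 10 * h ^ 4 * X z ^ 4 \<partial>M) \<le> 10 * h ^ 4 * K" using X4 by (simp add: mult_left_mono)
  ultimately show ?thesis by linarith
qed

lemma ET: "bmeas M u \<Longrightarrow> (\<integral>z. u z \<partial>T) = (\<integral>z. u z * exp (w z) \<partial>M) / m"
  using integral_tl[of u "1/2" h] by (simp add: w_ex)

lemma ET_le:
  assumes "bmeas M u" "bmeas M k" "\<And>z. u z * exp (w z) \<le> k z" "(\<integral>z. k z \<partial>M) \<le> B" "0 \<le> B"
  shows "(\<integral>z. u z \<partial>T) \<le> 2 * B"
  by (rule integral_tl_le[of "1/2" h]) (use assms h_pos h_le' in \<open>auto simp: w_ex\<close>)

definition \<mu> where "\<mu> = (\<integral>z. w z \<partial>T)"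
definition \<nu> where "\<nu> = (\<integral>z. (w z - \<mu>)\<^sup>2 \<partial>T)"
definition s where "s = sqrt (n * \<nu>)"
text \<open>By how many tilted standard deviations the mean of the linear statistic exceeds the
  threshold x^2 / 2. Its smallness is what makes the tilt critical.\<close>

definition \<rho> where "\<rho> = (n * \<mu> - x\<^sup>2 / 2) / s"
definition \<xi> where "\<xi> z = (w z - \<mu>) / s"
definition W where "W p = (\<Sum>i<n. \<xi> (p i))"
definition v where "v = (\<integral>z. (X z)\<^sup>2 \<partial>T)"
definition u where "u z = (X z)\<^sup>2 - v"
definition y' where "y' p = (\<Sum>i<n. u (p i)) / n"

text \<open>As E X^2 = 1, the expansion of w * exp w has mean h * mean + h^2 / 2; n copies of h^2 /
  2 make up x^2 / 2, the threshold.\<close>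

lemma \<mu>_approx: "\<bar>\<mu> - (h * mean + h\<^sup>2 / 2)\<bar> \<le> 43 * h ^ 3 * K + 4 * h\<^sup>2 * \<bar>mean\<bar>"
proof -
  define q where "q = h * mean + h\<^sup>2 / 2"
  have i: "(\<integral>z. h * X z + h\<^sup>2 / 2 * (X z)\<^sup>2 \<partial>M) = q"
    using bmeas_integrable[OF X] bmeas_integrable[OF bmeas_power[OF X, of 2]] X2 by (simp add: q_def)
  have "\<bar>(\<integral>z. w z * exp (w z) \<partial>M) - (\<integral>z. h * X z + h\<^sup>2 / 2 * (X z)\<^sup>2 \<partial>M)\<bar> \<le> (\<integral>z. 20 * h ^ 3 * \<bar>X z\<bar> ^ 3 \<partial>M)"
  proof (rule integral_diff_le)
    fix z show "\<bar>w z * exp (w z) - (h * X z + h\<^sup>2 / 2 * (X z)\<^sup>2)\<bar> \<le> 20 * h ^ 3 * \<bar>X z\<bar> ^ 3"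
      using wq_exp_diff[of "h * X z"] h_pos by (simp add: w_def power_mult_distrib abs_mult)
  qed (intro bT)+
  also have "\<dots> \<le> 20 * h ^ 3 * K" using X3 h_pos by (simp add: mult_left_mono)
  finally have 1: "\<bar>(\<integral>z. w z * exp (w z) \<partial>M) - q\<bar> \<le> 20 * h ^ 3 * K" unfolding i .
  have "\<mu> - q = ((\<integral>z. w z * exp (w z) \<partial>M) - q) / m + q * (1 / m - 1)"
    unfolding \<mu>_def ET[OF bw] using m_bounds(1) by (simp add: field_simps)
  then have "\<bar>\<mu> - q\<bar> \<le> \<bar>((\<integral>z. w z * exp (w z) \<partial>M) - q) / m\<bar> + \<bar>q * (1 / m - 1)\<bar>" by linarith
  also have "\<bar>((\<integral>z. w z * exp (w z) \<partial>M) - q) / m\<bar> \<le> (20 * h ^ 3 * K) / (1/2)"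
    unfolding abs_divide using 1 m_bounds(1) h_pos K_ge_1 by (intro frac_le) auto
  also have "\<bar>q * (1 / m - 1)\<bar> \<le> (h * \<bar>mean\<bar> + h\<^sup>2) * (2 * h * \<bar>mean\<bar> + 260 * h ^ 3 * K)"
    unfolding abs_mult
  proof (intro mult_mono m_bounds)
    have "\<bar>h * mean\<bar> = h * \<bar>mean\<bar>" using h_pos by (simp add: abs_mult)
    then show "\<bar>q\<bar> \<le> h * \<bar>mean\<bar> + h\<^sup>2" unfolding q_def using zero_le_power2[of h] by linarith
  qed (use h_pos in auto)
  also have "\<dots> = 2 * h\<^sup>2 * (\<bar>mean\<bar> * \<bar>mean\<bar>) + 2 * h ^ 3 * \<bar>mean\<bar> + 260 * h * (h ^ 3 * K) * (\<bar>mean\<bar> + h)"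
    by (simp add: power2_eq_square power3_eq_cube algebra_simps)
  also have "\<dots> \<le> 2 * h\<^sup>2 * (\<bar>mean\<bar> * 1) + 2 * h\<^sup>2 * \<bar>mean\<bar> + 260 * (1/100000) * (h ^ 3 * K) * (1 + 1)"
    using h_pos h_le mean_abs pow_h K_ge_1 by (intro add_mono mult_mono mult_left_mono mult_right_mono) auto
  also have "\<dots> \<le> 4 * h\<^sup>2 * \<bar>mean\<bar> + 3 * h ^ 3 * K" using h_pos K_ge_1 by simp
  finally show ?thesis unfolding q_def by (simp add: mult_ac)
qed

lemma \<mu>_le: "\<bar>\<mu>\<bar> \<le> h * \<bar>mean\<bar> + 2 * h\<^sup>2" "\<bar>\<mu>\<bar> \<le> h"
proof -
  have "\<bar>h * mean\<bar> = h * \<bar>mean\<bar>" using h_pos by (simp add: abs_mult)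
  moreover have "4 * h\<^sup>2 * \<bar>mean\<bar> \<le> 4 * h\<^sup>2 * (1 / 100)" by (intro mult_left_mono mean_le) auto
  moreover have "43 * h ^ 3 * K \<le> h\<^sup>2" using pow_h(1) zero_le_power2[of h] by linarith
  ultimately show 1: "\<bar>\<mu>\<bar> \<le> h * \<bar>mean\<bar> + 2 * h\<^sup>2" using \<mu>_approx zero_le_power2[of h] by linarith
  have "h * \<bar>mean\<bar> \<le> h * (1 / 100)" using h_pos by (intro mult_left_mono mean_le) auto
  moreover have "h * h \<le> h * (1 / 100000)" using h_pos by (intro mult_left_mono h_le) auto
  ultimately show "\<bar>\<mu>\<bar> \<le> h" using 1 h_pos unfolding power2_eq_square by linarith
qed

lemma \<nu>_approx: "\<bar>\<nu> - h\<^sup>2\<bar> \<le> h\<^sup>2 * (480 * h * K + 3 * \<bar>mean\<bar>)"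
proof -
  have "\<bar>(\<integral>z. (w z)\<^sup>2 * exp (w z) \<partial>M) - (\<integral>z. h\<^sup>2 * (X z)\<^sup>2 \<partial>M)\<bar> \<le> (\<integral>z. 230 * h ^ 3 * \<bar>X z\<bar> ^ 3 \<partial>M)"
  proof (rule integral_diff_le)
    fix z show "\<bar>(w z)\<^sup>2 * exp (w z) - h\<^sup>2 * (X z)\<^sup>2\<bar> \<le> 230 * h ^ 3 * \<bar>X z\<bar> ^ 3"
      using wq2_exp_diff[of "h * X z"] h_pos by (simp add: w_def power_mult_distrib abs_mult)
  qed (intro bT)+
  also have "\<dots> \<le> 230 * h ^ 3 * K" using X3 h_pos by (simp add: mult_left_mono)
  finally have 1: "\<bar>(\<integral>z. (w z)\<^sup>2 * exp (w z) \<partial>M) - h\<^sup>2\<bar> \<le> 230 * h ^ 3 * K" using X2 by simp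
  have "(\<integral>z. (w z)\<^sup>2 \<partial>T) - h\<^sup>2 = ((\<integral>z. (w z)\<^sup>2 * exp (w z) \<partial>M) - h\<^sup>2) / m + h\<^sup>2 * (1 / m - 1)"
    using m_bounds(1) by (subst ET) (auto intro!: bT simp: field_simps)
  then have "\<bar>(\<integral>z. (w z)\<^sup>2 \<partial>T) - h\<^sup>2\<bar> \<le> \<bar>((\<integral>z. (w z)\<^sup>2 * exp (w z) \<partial>M) - h\<^sup>2) / m\<bar> + \<bar>h\<^sup>2 * (1 / m - 1)\<bar>" by linarith
  also have "\<bar>((\<integral>z. (w z)\<^sup>2 * exp (w z) \<partial>M) - h\<^sup>2) / m\<bar> \<le> (230 * h ^ 3 * K) / (1/2)"
    unfolding abs_divide using 1 m_bounds(1) h_pos K_ge_1 by (intro frac_le) auto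
  also have "\<bar>h\<^sup>2 * (1 / m - 1)\<bar> \<le> h\<^sup>2 * (2 * h * 1 + 260 * (h\<^sup>2 / 100000))"
  proof -
    have "h * \<bar>mean\<bar> \<le> h * 1" using mean_abs h_pos by (intro mult_left_mono) auto
    then have "\<bar>1 / m - 1\<bar> \<le> 2 * h * 1 + 260 * (h\<^sup>2 / 100000)" using m_bounds(4) pow_h(1) by simp
    then show ?thesis unfolding abs_mult by (simp add: mult_left_mono)
  qed
  also have "\<dots> \<le> h\<^sup>2 * (3 * h)"
  proof (rule mult_left_mono)
    show "2 * h * 1 + 260 * (h\<^sup>2 / 100000) \<le> 3 * h" using pow_h(3) h_pos by linarith
  qed simp
  also have "\<dots> \<le> 3 * h ^ 3 * K" using mult_left_mono[OF K_ge_1, of "3 * h ^ 3"] h_pos by (simp add: power2_eq_square power3_eq_cube)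
  finally have 2: "\<bar>(\<integral>z. (w z)\<^sup>2 \<partial>T) - h\<^sup>2\<bar> \<le> 463 * h ^ 3 * K" by (simp add: mult_ac)
  have bw': "bmeas T w" "bmeas T (\<lambda>z. (w z)\<^sup>2)" by (simp_all add: bT)
  have 3: "\<nu> = (\<integral>z. (w z)\<^sup>2 \<partial>T) - \<mu>\<^sup>2"
    unfolding \<nu>_def power2_diff using T.bmeas_integrable[OF bw'(1)] T.bmeas_integrable[OF bw'(2)]
    by (simp add: \<mu>_def[symmetric]) (simp add: power2_eq_square)
  have "\<mu>\<^sup>2 \<le> (h * \<bar>mean\<bar> + 2 * h\<^sup>2)\<^sup>2" using \<mu>_le(1) h_pos by (subst abs_le_square_iff[symmetric]) auto
  also have "\<dots> = h\<^sup>2 * (\<bar>mean\<bar> * \<bar>mean\<bar> + 4 * h * \<bar>mean\<bar> + 4 * h\<^sup>2)" by (simp add: power2_eq_square algebra_simps)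
  also have "\<dots> \<le> h\<^sup>2 * (\<bar>mean\<bar> * 1 + 4 * h * 1 + 4 * h)"
    using mean_abs pow_h h_pos by (intro mult_left_mono add_mono) auto
  also have "\<dots> \<le> h\<^sup>2 * (\<bar>mean\<bar> + 8 * (h * K))" using h_le by (intro mult_left_mono) auto
  finally have "\<bar>\<nu> - h\<^sup>2\<bar> \<le> 463 * h ^ 3 * K + h\<^sup>2 * (\<bar>mean\<bar> + 8 * (h * K))" using 2 3 zero_le_power2[of \<mu>] by linarith
  also have "\<dots> = h\<^sup>2 * (471 * h * K + \<bar>mean\<bar>)" by (simp add: power2_eq_square power3_eq_cube algebra_simps)
  also have "\<dots> \<le> h\<^sup>2 * (480 * h * K + 3 * \<bar>mean\<bar>)" using h_pos K_ge_1 by (intro mult_left_mono add_mono mult_right_mono) auto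
  finally show ?thesis .
qed

lemma s_facts: "x / 2 \<le> s" "0 < s" "\<bar>s - x\<bar> \<le> x * (480 * h * K + 3 * \<bar>mean\<bar>)" "s\<^sup>2 = n * \<nu>"
proof -
  define e where "e = 480 * h * K + 3 * \<bar>mean\<bar>"
  have e: "0 \<le> e" "e \<le> 1/4" unfolding e_def using hK mean_le(1) h_pos K_ge_1 by auto
  have nu: "\<bar>\<nu> - h\<^sup>2\<bar> \<le> h\<^sup>2 * e" using \<nu>_approx unfolding e_def .
  have "h\<^sup>2 * e \<le> h\<^sup>2 * (1/4)" using e by (intro mult_left_mono) auto
  then have nu0: "h\<^sup>2 * (3/4) \<le> \<nu>" using nu by simp
  have nupos: "0 \<le> \<nu>" using nu0 zero_le_power2[of h] by linarith
  show s2: "s\<^sup>2 = n * \<nu>" unfolding s_def using nupos by simp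
  have "n * \<bar>\<nu> - h\<^sup>2\<bar> \<le> n * (h\<^sup>2 * e)" using nu by (intro mult_left_mono) auto
  then have d: "\<bar>s\<^sup>2 - x\<^sup>2\<bar> \<le> x\<^sup>2 * e" unfolding s2 using scale(1) by (simp add: abs_mult right_diff_distrib[symmetric] flip: scale(1))
  have "x\<^sup>2 * e \<le> x\<^sup>2 * (1/4)" using e by (intro mult_left_mono) auto
  then have "(x / 2)\<^sup>2 \<le> s\<^sup>2" using d zero_le_power2[of x] by (simp add: power_divide)
  moreover have s0: "0 \<le> s" unfolding s_def using nupos by simp
  ultimately show h2: "x / 2 \<le> s" by (rule power2_le_imp_le)
  then show sp: "0 < s" using x by simp
  have "\<bar>s - x\<bar> * x \<le> \<bar>s - x\<bar> * (s + x)" using s0 by (intro mult_left_mono) auto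
  also have "\<dots> = \<bar>s\<^sup>2 - x\<^sup>2\<bar>"
  proof -
    have "s\<^sup>2 - x\<^sup>2 = (s - x) * (s + x)" by (simp add: power2_eq_square algebra_simps)
    then show ?thesis using sp x by (simp add: abs_mult)
  qed
  also have "\<dots> \<le> x * e * x" using d by (simp add: power2_eq_square mult_ac)
  finally show "\<bar>s - x\<bar> \<le> x * (480 * h * K + 3 * \<bar>mean\<bar>)" unfolding e_def using x by (simp add: mult.commute)
qed

text \<open>The numerator carries a factor x, which cancels against s \<ge> x / 2; hence the bound
  does not deteriorate as x tends to 0.\<close>

lemma \<rho>_le: "\<bar>\<rho>\<bar> \<le> 86 * (x * h * K) + 10 * (sqrt n * \<bar>mean\<bar>)"
proof -
  have "n * \<mu> - x\<^sup>2 / 2 = n * (\<mu> - (h * mean + h\<^sup>2 / 2)) + (n * h) * mean"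
    using scale(1) by (simp add: algebra_simps)
  then have "\<bar>n * \<mu> - x\<^sup>2 / 2\<bar> \<le> \<bar>n * (\<mu> - (h * mean + h\<^sup>2 / 2))\<bar> + \<bar>(n * h) * mean\<bar>" by linarith
  also have "\<bar>(n * h) * mean\<bar> = x * sqrt n * \<bar>mean\<bar>" unfolding scale(2) using x by (simp add: abs_mult)
  also have "\<bar>n * (\<mu> - (h * mean + h\<^sup>2 / 2))\<bar> \<le> n * (43 * h ^ 3 * K + 4 * h\<^sup>2 * \<bar>mean\<bar>)"
    unfolding abs_mult using \<mu>_approx by (simp add: mult_left_mono)
  also have "n * (43 * h ^ 3 * K + 4 * h\<^sup>2 * \<bar>mean\<bar>) = (n * h\<^sup>2) * (43 * h * K + 4 * \<bar>mean\<bar>)"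
    by (simp add: power2_eq_square power3_eq_cube algebra_simps)
  also have "\<dots> = x * (43 * (x * h * K) + 4 * (x * \<bar>mean\<bar>))" unfolding scale(1) by (simp add: power2_eq_square algebra_simps)
  also have "\<dots> \<le> x * (43 * (x * h * K) + 4 * (sqrt n * \<bar>mean\<bar>))" using x x_le by (intro mult_left_mono add_mono order_refl mult_right_mono) auto
  finally have "\<bar>n * \<mu> - x\<^sup>2 / 2\<bar> \<le> x * (43 * (x * h * K) + 5 * (sqrt n * \<bar>mean\<bar>))" by (simp add: algebra_simps)
  then have "\<bar>\<rho>\<bar> \<le> (x * (43 * (x * h * K) + 5 * (sqrt n * \<bar>mean\<bar>))) / (x / 2)"
    unfolding \<rho>_def abs_divide using s_facts x h_pos K_ge_1 by (intro frac_le) auto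
  then show ?thesis using x by simp
qed

lemma ET_abs_w: "(\<integral>z. \<bar>w z\<bar> \<partial>T) \<le> 10 * h"
proof -
  have "(\<integral>z. \<bar>w z\<bar> \<partial>T) \<le> 2 * (5 * h * 1)"
  proof (rule ET_le)
    fix z show "\<bar>w z\<bar> * exp (w z) \<le> 5 * h * \<bar>X z\<bar>" using wq1_exp_le[of "h * X z"] h_pos by (simp add: w_def abs_mult)
    show "(\<integral>z. 5 * h * \<bar>X z\<bar> \<partial>M) \<le> 5 * h * 1" using mult_left_mono[OF X_abs, of "5 * h"] h_pos by simp
  qed (use h_pos in \<open>auto intro!: bT\<close>)
  then show ?thesis by simp
qed

lemma ET_w3: "(\<integral>z. \<bar>w z - \<mu>\<bar> ^ 3 \<partial>T) \<le> 150 * h ^ 3 * K"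
proof -
  have "(\<integral>z. \<bar>w z\<bar> ^ 3 \<partial>T) \<le> 2 * (18 * h ^ 3 * K)"
  proof (rule ET_le)
    fix z show "\<bar>w z\<bar> ^ 3 * exp (w z) \<le> 18 * h ^ 3 * \<bar>X z\<bar> ^ 3" using wq3_exp_le[of "h * X z"] h_pos by (simp add: w_def abs_mult power_mult_distrib)
    show "(\<integral>z. 18 * h ^ 3 * \<bar>X z\<bar> ^ 3 \<partial>M) \<le> 18 * h ^ 3 * K" using mult_left_mono[OF X3, of "18 * h ^ 3"] h_pos by simp
  qed (use h_pos K_ge_1 in \<open>auto intro!: bT\<close>)
  moreover have "(\<integral>z. \<bar>w z - \<mu>\<bar> ^ 3 \<partial>T) \<le> (\<integral>z. 4 * \<bar>w z\<bar> ^ 3 + 4 * h ^ 3 \<partial>T)"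
  proof (rule integral_mono)
    fix z
    have c: "(a + b) ^ 3 \<le> 4 * a ^ 3 + 4 * b ^ 3" if "0 \<le> a" "0 \<le> b" for a b :: real
    proof -
      have "0 \<le> 3 * (a + b) * (a - b)\<^sup>2" using that by simp
      then show ?thesis by (simp add: power2_eq_square power3_eq_cube algebra_simps)
    qed
    have "\<bar>w z - \<mu>\<bar> \<le> \<bar>w z\<bar> + h" using \<mu>_le(2) by linarith
    then have "\<bar>w z - \<mu>\<bar> ^ 3 \<le> (\<bar>w z\<bar> + h) ^ 3" by (intro power_mono) auto
    also have "\<dots> \<le> 4 * \<bar>w z\<bar> ^ 3 + 4 * h ^ 3" using h_pos by (intro c) auto
    finally show "\<bar>w z - \<mu>\<bar> ^ 3 \<le> 4 * \<bar>w z\<bar> ^ 3 + 4 * h ^ 3" .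
  qed (intro T.bmeas_integrable, simp add: bT)+
  moreover have "(\<integral>z. 4 * \<bar>w z\<bar> ^ 3 + 4 * h ^ 3 \<partial>T) = 4 * (\<integral>z. \<bar>w z\<bar> ^ 3 \<partial>T) + 4 * h ^ 3"
  proof -
    have "integrable T (\<lambda>z. \<bar>w z\<bar> ^ 3)" by (intro T.bmeas_integrable) (simp add: bT)
    then show ?thesis by simp
  qed
  moreover have "h ^ 3 \<le> h ^ 3 * K" using mult_left_mono[OF K_ge_1, of "h ^ 3"] h_pos by simp
  moreover have "0 \<le> h ^ 3 * K" using h_pos K_ge_1 by simp
  ultimately show ?thesis by linarith
qed

lemma b_T: "bmeas T X" "bmeas T w" by (simp_all add: bT)

lemma b_xi: "bmeas T \<xi>" unfolding \<xi>_def[abs_def] by (simp add: bT)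
lemma b_u: "bmeas T u" unfolding u_def[abs_def] by (simp add: bT)

lemma xi_mean: "(\<integral>z. \<xi> z \<partial>T) = 0"
proof -
  have "integrable T w" by (intro T.bmeas_integrable) (simp add: bT)
  then show ?thesis unfolding \<xi>_def by (simp add: \<mu>_def)
qed

lemma xi_var: "n * (\<integral>z. (\<xi> z)\<^sup>2 \<partial>T) = 1"
proof -
  have "(\<integral>z. (\<xi> z)\<^sup>2 \<partial>T) = \<nu> / s\<^sup>2" by (simp add: \<xi>_def power_divide \<nu>_def)
  then have "n * (\<integral>z. (\<xi> z)\<^sup>2 \<partial>T) = s\<^sup>2 / s\<^sup>2" using s_facts(4) by simp
  then show ?thesis using s_facts(2) by simp
qed

text \<open>h^3 cancels against s^3 \<ge> (x / 2)^3 because h / x = 1 / sqrt n, so the Lyapunov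
  ratio is O(K / sqrt n) uniformly in x.\<close>

lemma xi_third: "n * (\<integral>z. \<bar>\<xi> z\<bar> ^ 3 \<partial>T) \<le> 1200 * K / sqrt n"
proof -
  have "(\<integral>z. \<bar>\<xi> z\<bar> ^ 3 \<partial>T) = (\<integral>z. \<bar>w z - \<mu>\<bar> ^ 3 \<partial>T) / s ^ 3"
    using s_facts(2) by (simp add: \<xi>_def power_divide abs_divide)
  also have "\<dots> \<le> (150 * h ^ 3 * K) / (x / 2) ^ 3"
    using s_facts(1) x h_pos K_ge_1 ET_w3 by (intro frac_le power_mono) auto
  also have "\<dots> = 1200 * K * (h / x) ^ 3" by (simp add: power_divide)
  finally have "n * (\<integral>z. \<bar>\<xi> z\<bar> ^ 3 \<partial>T) \<le> n * (1200 * K * (h / x) ^ 3)" by (intro mult_left_mono) auto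
  also have "h / x = 1 / sqrt n" using h x by simp
  also have "n * (1200 * K * (1 / sqrt n) ^ 3) = 1200 * K / sqrt n" using n by (simp add: power_divide power3_eq_cube field_simps)
  finally show ?thesis .
qed

section \<open>Fluctuation of the self-normalizer under the critical tilt\<close>

lemma v_approx: "\<bar>v - 1\<bar> \<le> 400 * h * K" "\<bar>v\<bar> \<le> 2"
proof -
  show "\<bar>v - 1\<bar> \<le> 400 * h * K" unfolding v_def using tl_X2[of "1/2" h] h_pos h_le' by simp
  then show "\<bar>v\<bar> \<le> 2" using hK by simp
qed

lemma u_mean: "(\<integral>z. u z \<partial>T) = 0"
proof -
  have "integrable T (\<lambda>z. (X z)\<^sup>2)" by (intro T.bmeas_integrable) (simp add: bT)
  then show ?thesis unfolding u_def by (simp add: v_def)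
qed

lemma u2_le: "(u z)\<^sup>2 \<le> 2 * X z ^ 4 + 8"
proof -
  have "(u z)\<^sup>2 \<le> 2 * ((X z)\<^sup>2)\<^sup>2 + 2 * v\<^sup>2" unfolding u_def using zero_le_power2[of "(X z)\<^sup>2 + v"]
    by (simp add: power2_sum power2_diff)
  moreover have "v\<^sup>2 \<le> 2\<^sup>2" using v_approx(2) by (subst abs_le_square_iff[symmetric]) auto
  ultimately show ?thesis by simp
qed

lemma ET_X4: "(\<integral>z. X z ^ 4 \<partial>T) \<le> 6 * K" using tl_X4[of "1/2" h] h_pos h_le' by simp

lemma u_second: "(\<integral>z. (u z)\<^sup>2 \<partial>T) \<le> 6 * K"
proof -
  have "integrable T (\<lambda>z. (X z)\<^sup>2)" "integrable T (\<lambda>z. X z ^ 4)" by (intro T.bmeas_integrable; simp add: bT)+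
  then have "(\<integral>z. (u z)\<^sup>2 \<partial>T) = (\<integral>z. X z ^ 4 \<partial>T) - v\<^sup>2"
    unfolding u_def power2_diff by (simp add: v_def[symmetric]) (simp add: power2_eq_square)
  then show ?thesis using ET_X4 zero_le_power2[of v] by linarith
qed

text \<open>Through the decay of the weight, the eighth moment of X costs a factor h^-4, which is
  bad for small x. In the fourth moment of \<open>y'\<close> it is compensated exactly by a factor
  x^4, since n * h^2 = x^2.\<close>

lemma u_fourth: "(\<integral>z. u z ^ 4 \<partial>T) \<le> 1800 * K / h ^ 4"
proof -
  have 1: "(\<integral>z. X z ^ 8 \<partial>T) \<le> 2 * (100 / h ^ 4 * K)"
  proof (rule ET_le)
    fix z
    have "(h * X z) ^ 4 * exp (w z) * X z ^ 4 \<le> 100 * X z ^ 4" using power4_exp_wq_le[of "h * X z"] unfolding w_def by (intro mult_right_mono) auto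
    then have "X z ^ 8 * exp (w z) * h ^ 4 \<le> 100 * X z ^ 4" by (simp add: power_mult_distrib power_add[symmetric] mult_ac)
    then show "X z ^ 8 * exp (w z) \<le> 100 / h ^ 4 * X z ^ 4" using h_pos by (simp add: field_simps)
    show "(\<integral>z. 100 / h ^ 4 * X z ^ 4 \<partial>M) \<le> 100 / h ^ 4 * K" using mult_left_mono[OF X4, of "100 / h ^ 4"] by simp
  qed (use K_ge_1 in \<open>auto intro!: bT\<close>)
  have "(\<integral>z. u z ^ 4 \<partial>T) \<le> (\<integral>z. 8 * X z ^ 8 + 128 \<partial>T)"
  proof (rule integral_mono)
    fix z
    have "(u z ^ 2)\<^sup>2 \<le> (2 * X z ^ 4 + 8)\<^sup>2" using u2_le[of z] by (intro power_mono) auto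
    also have "\<dots> \<le> 8 * X z ^ 8 + 128" using zero_le_power2[of "2 * X z ^ 4 - 8"] by (simp add: power2_sum power2_diff power_mult_distrib)
    finally show "u z ^ 4 \<le> 8 * X z ^ 8 + 128" by simp
  qed (intro T.bmeas_integrable bmeas_intros b_u b_T)+
  moreover have "(\<integral>z. 8 * X z ^ 8 + 128 \<partial>T) = 8 * (\<integral>z. X z ^ 8 \<partial>T) + 128"
  proof -
    have "integrable T (\<lambda>z. X z ^ 8)" by (intro T.bmeas_integrable) (simp add: bT)
    then show ?thesis by simp
  qed
  moreover have "1 \<le> K / h ^ 4"
  proof -
    have "h ^ 4 \<le> 1" using h_pos h_le(2) by (intro power_le_one) auto
    then show ?thesis using K_ge_1 h_pos by (simp add: le_divide_eq)
  qed
  moreover have "2 * (100 / h ^ 4 * K) = 200 * (K / h ^ 4)" "1800 * K / h ^ 4 = 1800 * (K / h ^ 4)" by simp_all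
  ultimately show ?thesis using 1 by linarith
qed

lemma b_y': "bmeas TN y'" unfolding y'_def[abs_def] by (intro bmeas_divide bmeas_sum T.bmeas_component[OF _ b_u])
lemma b_W: "bmeas TN W" unfolding W_def[abs_def] by (intro bmeas_sum T.bmeas_component[OF _ b_xi])

lemma y'_second: "(\<integral>p. (y' p)\<^sup>2 \<partial>TN) \<le> 6 * K / n"
proof -
  have "(\<integral>p. (y' p)\<^sup>2 \<partial>TN) = (\<integral>p. (\<Sum>i<n. u (p i))\<^sup>2 \<partial>TN) / n\<^sup>2" by (simp add: y'_def power_divide)
  also have "\<dots> = n * (\<integral>z. (u z)\<^sup>2 \<partial>T) / n\<^sup>2" using T.iid_sum_second[OF _ b_u u_mean, of "{..<n}"] by simp
  also have "\<dots> \<le> n * (6 * K) / n\<^sup>2" by (intro divide_right_mono mult_left_mono u_second) auto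
  finally show ?thesis using n by (simp add: power2_eq_square)
qed

lemma xh_small: "x ^ 4 / n = (x * h)\<^sup>2" "K * x ^ 4 / n \<le> 1 / 100"
proof -
  show e: "x ^ 4 / n = (x * h)\<^sup>2" using n unfolding h by (simp add: power_divide power_mult_distrib power4_eq_xxxx power2_eq_square)
  have "x * h * 1 \<le> x * h * K" using x h_pos K_ge_1 by (intro mult_left_mono) auto
  then have "x * h \<le> 1" using xhK by linarith
  then have "(x * h) * (x * h * K) \<le> 1 * (1 / 100000)" using xhK x h_pos K_ge_1 by (intro mult_mono) auto
  moreover have "K * x ^ 4 / n = (x * h) * (x * h * K)" using e by (simp add: power2_eq_square mult_ac flip: times_divide_eq_right)
  ultimately show "K * x ^ 4 / n \<le> 1 / 100" by linarith
qed

lemma y'_fourth: "x ^ 4 * (\<integral>p. y' p ^ 4 \<partial>TN) \<le> 1908 * K\<^sup>2 / n"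
proof -
  have "(\<integral>p. y' p ^ 4 \<partial>TN) = (\<integral>p. (\<Sum>i<n. u (p i)) ^ 4 \<partial>TN) / real n ^ 4" by (simp add: y'_def power_divide)
  also have "\<dots> \<le> (n * (\<integral>z. u z ^ 4 \<partial>T) + 3 * (real n * (\<integral>z. (u z)\<^sup>2 \<partial>T))\<^sup>2) / real n ^ 4"
    using T.iid_sum_fourth[OF _ b_u u_mean, of "{..<n}"] by (intro divide_right_mono) auto
  also have "\<dots> \<le> (n * (1800 * K / h ^ 4) + 3 * (real n * (6 * K))\<^sup>2) / real n ^ 4"
    by (intro divide_right_mono add_mono mult_left_mono power_mono u_fourth u_second) auto
  finally have "x ^ 4 * (\<integral>p. y' p ^ 4 \<partial>TN) \<le> x ^ 4 * ((n * (1800 * K / h ^ 4) + 3 * (real n * (6 * K))\<^sup>2) / real n ^ 4)"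
    by (intro mult_left_mono) auto
  also have "\<dots> = 1800 * K / n * (x ^ 4 / (real n ^ 2 * h ^ 4)) + 108 * K\<^sup>2 / n * (x ^ 4 / n)"
  proof -
    define N where "N = real n"
    have "N \<noteq> 0" using n by (simp add: N_def)
    then have "x ^ 4 * (N * (1800 * K / h ^ 4) / N ^ 4) = 1800 * K / N * (x ^ 4 / (N\<^sup>2 * h ^ 4))"
      "x ^ 4 * (3 * (N * (6 * K))\<^sup>2 / N ^ 4) = 108 * K\<^sup>2 / N * (x ^ 4 / N)"
      by (simp_all add: power4_eq_xxxx[of N] power2_eq_square mult_ac)
    then show ?thesis unfolding N_def[symmetric] add_divide_distrib distrib_left by simp
  qed
  also have "real n ^ 2 * h ^ 4 = (n * h\<^sup>2)\<^sup>2" by (simp add: power_mult_distrib)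
  also have "x ^ 4 / (n * h\<^sup>2)\<^sup>2 = 1" unfolding scale(1) using x by simp
  also have "108 * K\<^sup>2 / n * (x ^ 4 / n) \<le> 108 * K\<^sup>2 / n * 1"
  proof (intro mult_left_mono)
    have "1 * (x ^ 4 / n) \<le> K * (x ^ 4 / n)" using K_ge_1 by (intro mult_right_mono) auto
    moreover have "K * (x ^ 4 / n) \<le> 1 / 100" using xh_small(2) by simp
    ultimately show "x ^ 4 / n \<le> 1" by linarith
  qed auto
  also have "1800 * K / n * 1 + 108 * K\<^sup>2 / n * 1 \<le> 1908 * K\<^sup>2 / n"
  proof -
    have "K \<le> K\<^sup>2" using K_ge_1 mult_left_mono[of 1 K K] by (simp add: power2_eq_square)
    then have "1800 * K / n \<le> 1800 * K\<^sup>2 / n" by (intro divide_right_mono) auto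
    moreover have "1908 * K\<^sup>2 / n = 1800 * K\<^sup>2 / n + 108 * K\<^sup>2 / n" by (simp add: add_divide_distrib[symmetric])
    ultimately show ?thesis by linarith
  qed
  finally show ?thesis by simp
qed

text \<open>The exponent h^2 * X^2 / 4 uses half of the h^2 * X^2 / 2 subtracted by the tilt, so the
  weight stays bounded. Centring makes each factor at most 1 + 9 * h^4 * K, and n * h^4 * K = K *
  x^4 / n is small because x is of order at most n^(1/4).\<close>

lemma y'_exp:
  assumes c: "c = 1 \<or> c = (-1::real)"
  shows "(\<integral>p. exp (c * x\<^sup>2 * y' p / 4) \<partial>TN) \<le> 3"
proof -
  define t where "t z = c * h\<^sup>2 / 4 * u z" for z
  have bt: "bmeas T t" unfolding t_def by (intro bmeas_intros b_u)
  have btM: "bmeas M t" using bt by simp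
  have t0: "(\<integral>z. t z \<partial>T) = 0" by (simp add: t_def u_mean)
  have "(\<integral>z. exp (t z) \<partial>T) \<le> (\<integral>z. 1 + t z + exp \<bar>t z\<bar> * (t z)\<^sup>2 / 2 \<partial>T)"
  proof (rule integral_mono)
    fix z show "exp (t z) \<le> 1 + t z + exp \<bar>t z\<bar> * (t z)\<^sup>2 / 2"
      using exp_taylor_bound[of "t z" 2] by (simp add: eval_nat_numeral)
  qed (intro T.bmeas_integrable bmeas_intros bt)+
  also have "\<dots> = 1 + (\<integral>z. exp \<bar>t z\<bar> * (t z)\<^sup>2 \<partial>T) / 2"
  proof -
    have "integrable T t" "integrable T (\<lambda>z. exp \<bar>t z\<bar> * (t z)\<^sup>2)" by (intro T.bmeas_integrable bmeas_intros bt)+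
    then show ?thesis using t0 by simp
  qed
  also have "(\<integral>z. exp \<bar>t z\<bar> * (t z)\<^sup>2 \<partial>T) \<le> 2 * (9 * h ^ 4 * K)"
  proof (rule ET_le)
    fix z
    have ct: "\<bar>t z\<bar> = h\<^sup>2 / 4 * \<bar>u z\<bar>" using c by (auto simp: t_def abs_mult)
    have "\<bar>u z\<bar> \<le> (X z)\<^sup>2 + 2" unfolding u_def using v_approx(2) zero_le_power2[of "X z"] by linarith
    then have "\<bar>t z\<bar> \<le> h\<^sup>2 / 4 * ((X z)\<^sup>2 + 2)" unfolding ct by (intro mult_left_mono) auto
    also have "\<dots> \<le> (h * X z)\<^sup>2 / 4 + 1" using pow_h(3) h_le(2) by (simp add: power_mult_distrib algebra_simps)
    finally have "\<bar>t z\<bar> + w z \<le> 1 + (h * X z - 1/4 * (h * X z)\<^sup>2)" by (simp add: w_def wq_def)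
    then have "exp \<bar>t z\<bar> * exp (w z) \<le> exp 1 * exp (h * X z - 1/4 * (h * X z)\<^sup>2)" by (simp add: exp_add[symmetric])
    also have "\<dots> \<le> 3 * 3" by (intro mult_mono exp_le_numeral exp_quad_le) auto
    finally have a: "exp \<bar>t z\<bar> * exp (w z) \<le> 9" by simp
    have "(t z)\<^sup>2 = h ^ 4 / 16 * (u z)\<^sup>2" using c by (auto simp: t_def power_mult_distrib power_divide)
    also have "\<dots> \<le> h ^ 4 / 16 * (2 * X z ^ 4 + 8)" by (intro mult_left_mono u2_le) auto
    finally have "(exp \<bar>t z\<bar> * exp (w z)) * (t z)\<^sup>2 \<le> 9 * (h ^ 4 / 16 * (2 * X z ^ 4 + 8))" using a by (intro mult_mono) auto
    then show "exp \<bar>t z\<bar> * (t z)\<^sup>2 * exp (w z) \<le> 9 / 16 * h ^ 4 * (2 * X z ^ 4 + 8)" by (simp add: mult_ac)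
  next
    have "(\<integral>z. 9 / 16 * h ^ 4 * (2 * X z ^ 4 + 8) \<partial>M) = 9 / 16 * h ^ 4 * (2 * (\<integral>z. X z ^ 4 \<partial>M) + 8)"
    proof -
      have "integrable M (\<lambda>z. X z ^ 4)" by (intro bmeas_integrable bX)
      then show ?thesis by (simp add: prob_space)
    qed
    also have "\<dots> \<le> 9 / 16 * h ^ 4 * (16 * K)" using X4 K_ge_1 by (intro mult_left_mono) auto
    finally show "(\<integral>z. 9 / 16 * h ^ 4 * (2 * X z ^ 4 + 8) \<partial>M) \<le> 9 * h ^ 4 * K" by simp
  qed (use K_ge_1 in \<open>auto intro!: bmeas_intros btM X\<close>)
  finally have "(\<integral>z. exp (t z) \<partial>T) \<le> 1 + 9 * h ^ 4 * K" by linarith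
  also have "\<dots> \<le> exp (9 * h ^ 4 * K)" by (rule exp_ge_add_one_self)
  finally have "(\<integral>z. exp (t z) \<partial>T) ^ n \<le> exp (9 * h ^ 4 * K) ^ n" by (intro power_mono) auto
  also have "\<dots> = exp (9 * (K * x ^ 4 / n))"
  proof -
    have "n * h ^ 4 = (n * h\<^sup>2)\<^sup>2 / n" using n by (simp add: power2_eq_square power4_eq_xxxx)
    then have "n * h ^ 4 = x ^ 4 / n" unfolding scale(1) by simp
    moreover have "n * (9 * h ^ 4 * K) = 9 * (K * (n * h ^ 4))" by simp
    ultimately have "n * (9 * h ^ 4 * K) = 9 * (K * x ^ 4 / n)" by simp
    then show ?thesis by (simp add: exp_of_nat_mult[symmetric])
  qed
  also have "\<dots> \<le> exp 1" using xh_small(2) by simp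
  also have "\<dots> \<le> 3" by (rule exp_le_numeral)
  finally have "(\<integral>z. exp (t z) \<partial>T) ^ n \<le> 3" .
  moreover have "c * x\<^sup>2 * y' p / 4 = (\<Sum>i<n. t (p i))" for p
    unfolding t_def y'_def scale(1)[symmetric] sum_distrib_left[symmetric] using n by simp
  ultimately show ?thesis using T.iid_integral_exp_sum[OF _ bt, of "{..<n}"] by simp
qed

lemma ET_w_u: "(\<integral>z. \<bar>w z - \<mu>\<bar> * \<bar>u z\<bar> \<partial>T) \<le> 50 * h * K" "(\<integral>z. \<bar>w z - \<mu>\<bar> * (u z)\<^sup>2 \<partial>T) \<le> 20 * K"
proof -
  have iu: "(\<integral>z. \<bar>u z\<bar> \<partial>T) \<le> 6 * K"
  proof -
    have "(\<integral>z. \<bar>u z\<bar> \<partial>T) \<le> sqrt (6 * K)" by (rule order_trans[OF T.bmeas_abs_le_sqrt[OF b_u]]) (use u_second in simp)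
    also have "\<dots> \<le> 6 * K" using K_ge_1 mult_left_mono[of 1 "6 * K" "6 * K"] by (intro real_le_lsqrt) (auto simp: power2_eq_square)
    finally show ?thesis .
  qed
  have bt: "bmeas T w" by (simp add: bT)
  have "(\<integral>z. \<bar>w z\<bar> * \<bar>u z\<bar> \<partial>T) \<le> 2 * (15 * h * K)"
  proof (rule ET_le)
    fix z
    have "\<bar>u z\<bar> \<le> (X z)\<^sup>2 + 2" unfolding u_def using v_approx(2) zero_le_power2[of "X z"] by linarith
    then have "(\<bar>w z\<bar> * exp (w z)) * \<bar>u z\<bar> \<le> (5 * \<bar>h * X z\<bar>) * ((X z)\<^sup>2 + 2)" unfolding w_def by (intro mult_mono wq1_exp_le) auto
    then show "\<bar>w z\<bar> * \<bar>u z\<bar> * exp (w z) \<le> 5 * h * (\<bar>X z\<bar> ^ 3 + 2 * \<bar>X z\<bar>)" using h_pos by (simp add: abs_mult eval_nat_numeral algebra_simps)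
  next
    have "(\<integral>z. 5 * h * (\<bar>X z\<bar> ^ 3 + 2 * \<bar>X z\<bar>) \<partial>M) = 5 * h * ((\<integral>z. \<bar>X z\<bar> ^ 3 \<partial>M) + 2 * (\<integral>z. \<bar>X z\<bar> \<partial>M))"
    proof -
      have "integrable M (\<lambda>z. \<bar>X z\<bar> ^ 3)" "integrable M (\<lambda>z. \<bar>X z\<bar>)" by (intro bmeas_integrable bX)+
      then show ?thesis by simp
    qed
    also have "\<dots> \<le> 5 * h * (3 * K)" using X3 X_abs K_ge_1 h_pos by (intro mult_left_mono) auto
    finally show "(\<integral>z. 5 * h * (\<bar>X z\<bar> ^ 3 + 2 * \<bar>X z\<bar>) \<partial>M) \<le> 15 * h * K" by simp
  qed (use K_ge_1 h_pos b_u in \<open>auto intro!: bT\<close>)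
  moreover have "(\<integral>z. \<bar>w z - \<mu>\<bar> * \<bar>u z\<bar> \<partial>T) \<le> (\<integral>z. \<bar>w z\<bar> * \<bar>u z\<bar> + h * \<bar>u z\<bar> \<partial>T)"
  proof (rule integral_mono)
    fix z have "\<bar>w z - \<mu>\<bar> * \<bar>u z\<bar> \<le> (\<bar>w z\<bar> + h) * \<bar>u z\<bar>" using \<mu>_le(2) by (intro mult_right_mono) auto
    then show "\<bar>w z - \<mu>\<bar> * \<bar>u z\<bar> \<le> \<bar>w z\<bar> * \<bar>u z\<bar> + h * \<bar>u z\<bar>" by (simp add: algebra_simps)
  qed (intro T.bmeas_integrable bmeas_intros b_u bt)+
  moreover have "(\<integral>z. \<bar>w z\<bar> * \<bar>u z\<bar> + h * \<bar>u z\<bar> \<partial>T) = (\<integral>z. \<bar>w z\<bar> * \<bar>u z\<bar> \<partial>T) + h * (\<integral>z. \<bar>u z\<bar> \<partial>T)"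
  proof -
    have "integrable T (\<lambda>z. \<bar>w z\<bar> * \<bar>u z\<bar>)" "integrable T (\<lambda>z. \<bar>u z\<bar>)" by (intro T.bmeas_integrable bmeas_intros b_u bt)+
    then show ?thesis by simp
  qed
  moreover have "h * (\<integral>z. \<bar>u z\<bar> \<partial>T) \<le> h * (6 * K)" using iu h_pos by (intro mult_left_mono) auto
  moreover have "0 \<le> h * K" using h_pos K_ge_1 by simp
  ultimately show "(\<integral>z. \<bar>w z - \<mu>\<bar> * \<bar>u z\<bar> \<partial>T) \<le> 50 * h * K" by linarith
  have "(\<integral>z. \<bar>w z\<bar> * (u z)\<^sup>2 \<partial>T) \<le> (\<integral>z. 2 * (\<bar>w z\<bar> * X z ^ 4) + 8 * \<bar>w z\<bar> \<partial>T)"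
  proof (rule integral_mono)
    fix z show "\<bar>w z\<bar> * (u z)\<^sup>2 \<le> 2 * (\<bar>w z\<bar> * X z ^ 4) + 8 * \<bar>w z\<bar>"
      using mult_left_mono[OF u2_le[of z], of "\<bar>w z\<bar>"] by (simp add: algebra_simps)
  qed (intro T.bmeas_integrable bmeas_intros b_u b_T)+
  also have "\<dots> = 2 * (\<integral>z. \<bar>w z\<bar> * X z ^ 4 \<partial>T) + 8 * (\<integral>z. \<bar>w z\<bar> \<partial>T)"
  proof -
    have "integrable T (\<lambda>z. \<bar>w z\<bar> * X z ^ 4)" "integrable T (\<lambda>z. \<bar>w z\<bar>)" by (intro T.bmeas_integrable; simp add: bT)+
    then show ?thesis by simp
  qed
  also have "(\<integral>z. \<bar>w z\<bar> * X z ^ 4 \<partial>T) \<le> 2 * (3 * K)"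
  proof (rule ET_le)
    fix z
    have "(\<bar>w z\<bar> ^ 1 * exp (w z)) * X z ^ 4 \<le> (3 * fact 1) * X z ^ 4" unfolding w_def by (intro mult_right_mono wq_power_exp_le) auto
    then show "\<bar>w z\<bar> * X z ^ 4 * exp (w z) \<le> 3 * X z ^ 4" by (simp add: mult_ac)
    show "(\<integral>z. 3 * X z ^ 4 \<partial>M) \<le> 3 * K" using X4 by simp
  qed (use K_ge_1 in \<open>auto intro!: bT\<close>)
  finally have a: "(\<integral>z. \<bar>w z\<bar> * (u z)\<^sup>2 \<partial>T) \<le> 12 * K + 1" using ET_abs_w h_le(2) by simp
  have "(\<integral>z. \<bar>w z - \<mu>\<bar> * (u z)\<^sup>2 \<partial>T) \<le> (\<integral>z. \<bar>w z\<bar> * (u z)\<^sup>2 + h * (u z)\<^sup>2 \<partial>T)"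
  proof (rule integral_mono)
    fix z have "\<bar>w z - \<mu>\<bar> * (u z)\<^sup>2 \<le> (\<bar>w z\<bar> + h) * (u z)\<^sup>2" using \<mu>_le(2) by (intro mult_right_mono) auto
    then show "\<bar>w z - \<mu>\<bar> * (u z)\<^sup>2 \<le> \<bar>w z\<bar> * (u z)\<^sup>2 + h * (u z)\<^sup>2" by (simp add: algebra_simps)
  qed (intro T.bmeas_integrable bmeas_intros b_u bt)+
  also have "\<dots> = (\<integral>z. \<bar>w z\<bar> * (u z)\<^sup>2 \<partial>T) + h * (\<integral>z. (u z)\<^sup>2 \<partial>T)"
  proof -
    have "integrable T (\<lambda>z. \<bar>w z\<bar> * (u z)\<^sup>2)" "integrable T (\<lambda>z. (u z)\<^sup>2)" by (intro T.bmeas_integrable bmeas_intros b_u bt)+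
    then show ?thesis by simp
  qed
  also have "\<dots> \<le> (12 * K + 1) + 1 * (6 * K)" using h_pos h_le(2) by (intro add_mono a mult_mono u_second) auto
  finally show "(\<integral>z. \<bar>w z - \<mu>\<bar> * (u z)\<^sup>2 \<partial>T) \<le> 20 * K" using K_ge_1 by simp
qed

end

section \<open>The linearised event\<close>

text \<open>The linear branch matters only for \<open>x < 1\<close>, where no fourth moment of the fluctuation of \<open>V\<close> is available
  uniformly in \<open>x\<close>.\<close>

definition qmin :: "real \<Rightarrow> real" where "qmin y = min (y\<^sup>2) \<bar>y\<bar>"

lemma qmin_nonneg: "0 \<le> qmin y" by (simp add: qmin_def)

lemma qmin_diff: "\<bar>qmin a - qmin b\<bar> \<le> \<bar>a - b\<bar> * (\<bar>a\<bar> + \<bar>b\<bar>)"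
proof -
  have *: "\<bar>qmin a - qmin b\<bar> \<le> \<bar>a - b\<bar> * (\<bar>a\<bar> + \<bar>b\<bar>)" if le: "\<bar>b\<bar> \<le> \<bar>a\<bar>" for a b
  proof -
    have sq: "\<bar>a\<bar>\<^sup>2 - \<bar>b\<bar>\<^sup>2 = (\<bar>a\<bar> - \<bar>b\<bar>) * (\<bar>a\<bar> + \<bar>b\<bar>)" by (simp add: power2_eq_square algebra_simps)
    have "(\<bar>a\<bar> - \<bar>b\<bar>) * (\<bar>a\<bar> + \<bar>b\<bar>) \<le> \<bar>a - b\<bar> * (\<bar>a\<bar> + \<bar>b\<bar>)" by (intro mult_right_mono) auto
    moreover have "\<bar>qmin a - qmin b\<bar> \<le> \<bar>a\<bar>\<^sup>2 - \<bar>b\<bar>\<^sup>2"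
    proof (cases "\<bar>b\<bar> \<le> 1")
      case True
      then have b: "qmin b = \<bar>b\<bar>\<^sup>2" using abs_power_le[of b 1 2] by (simp add: qmin_def)
      have "\<bar>b\<bar>\<^sup>2 \<le> \<bar>a\<bar>\<^sup>2" using le by (intro power_mono) auto
      moreover have "\<bar>b\<bar>\<^sup>2 \<le> \<bar>a\<bar>" using abs_power_le[OF True, of 1 2] le by simp
      ultimately show ?thesis unfolding b by (auto simp: qmin_def)
    next
      case False
      then have "qmin b = \<bar>b\<bar>" "qmin a = \<bar>a\<bar>" using abs_power_ge[of b 1 2] abs_power_ge[of a 1 2] le by (simp_all add: qmin_def)
      moreover have "(\<bar>a\<bar> - \<bar>b\<bar>) * 1 \<le> (\<bar>a\<bar> - \<bar>b\<bar>) * (\<bar>a\<bar> + \<bar>b\<bar>)" using False le by (intro mult_left_mono) auto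
      ultimately show ?thesis unfolding sq using le by simp
    qed
    ultimately show ?thesis unfolding sq by linarith
  qed
  show ?thesis
  proof (cases "\<bar>b\<bar> \<le> \<bar>a\<bar>")
    case False then show ?thesis using *[of a b] by (simp add: abs_minus_commute add.commute)
  qed (rule *)
qed

lemma qmin_add: assumes "\<bar>a\<bar> \<le> 1" shows "qmin (a + b) \<le> 2 * a\<^sup>2 + 2 * qmin b"
proof (cases "\<bar>b\<bar> \<le> 1")
  case True
  have "qmin (a + b) \<le> (a + b)\<^sup>2" by (simp add: qmin_def)
  also have "\<dots> \<le> 2 * a\<^sup>2 + 2 * b\<^sup>2" using zero_le_power2[of "a - b"] by (simp add: power2_sum power2_diff)
  finally show ?thesis using abs_power_le[OF True, of 1 2] by (simp add: qmin_def)
next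
  case False
  then have "qmin b = \<bar>b\<bar>" using abs_power_ge[of b 1 2] by (simp add: qmin_def)
  moreover have "qmin (a + b) \<le> \<bar>a + b\<bar>" by (simp add: qmin_def)
  ultimately show ?thesis using False assms zero_le_power2[of a] by linarith
qed

text \<open>sqrt (1 + y) - 1 = y / (sqrt (1 + y) + 1), and the denominator is at least 1 and at
  least |sqrt (1 + y) - 1|.\<close>

lemma sqrt_diff_qmin: assumes "-1 \<le> y" shows "(sqrt (1 + y) - 1)\<^sup>2 \<le> qmin y"
proof -
  define r where "r = sqrt (1 + y)"
  have r: "0 \<le> r" "y = (r - 1) * (r + 1)" using assms by (auto simp: r_def algebra_simps)
  have "\<bar>r - 1\<bar> * 1 \<le> \<bar>r - 1\<bar> * (r + 1)" "\<bar>r - 1\<bar> * \<bar>r - 1\<bar> \<le> \<bar>r - 1\<bar> * (r + 1)" using r by (intro mult_left_mono; auto)+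
  moreover have y: "\<bar>y\<bar> = \<bar>r - 1\<bar> * (r + 1)" using r by (simp add: abs_mult)
  ultimately have 1: "\<bar>r - 1\<bar> \<le> \<bar>y\<bar>" "(r - 1)\<^sup>2 \<le> \<bar>y\<bar>" by (simp_all add: power2_eq_square)
  have "(r - 1)\<^sup>2 \<le> y\<^sup>2" using 1(1) by (subst abs_le_square_iff[symmetric])
  then show ?thesis using 1 unfolding r_def[symmetric] qmin_def by simp
qed

context tilted_sample
begin

text \<open>A bound for the linearisation remainder in units of \<open>s\<close>, split into the
  deterministic drift v - 1 and the centred fluctuation \<open>y'\<close>. Only the latter changes
  when a coordinate is left out.\<close>

definition \<Delta> where "\<Delta> p = (x\<^sup>2 * (v - 1)\<^sup>2 + x\<^sup>2 * qmin (y' p)) / s"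

lemma b_q: "bmeas TN (\<lambda>p. qmin (y' p))"
  unfolding qmin_def by (intro bmeas_intros b_y')

lemma b_\<Delta>: "bmeas TN \<Delta>"
  unfolding \<Delta>_def by (intro bmeas_intros b_q)

lemma x_over_s: "x / s \<le> 2"
  using s_facts(1,2) by (simp add: divide_le_eq)

lemma \<Delta>_second: "sqrt (\<integral>p. (\<Delta> p)\<^sup>2 \<partial>TN) \<le> 640000 * K\<^sup>2 * x ^ 3 / n + 176 * K / sqrt n"
proof -
  define A where "A = 320000 * K\<^sup>2 * x ^ 3 / n"
  have A0: "0 \<le> A" unfolding A_def using x by simp
  have D1: "x\<^sup>2 * (v - 1)\<^sup>2 / s \<le> A"
  proof -
    have "(v - 1)\<^sup>2 \<le> (400 * h * K)\<^sup>2" using v_approx(1) by (subst abs_le_square_iff[symmetric]) auto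
    then have "x * (x / s) * (v - 1)\<^sup>2 \<le> x * 2 * (400 * h * K)\<^sup>2" using x x_over_s s_facts(2) by (intro mult_mono mult_left_mono) auto
    also have "\<dots> = 320000 * K\<^sup>2 * (x * h\<^sup>2)" by (simp add: power2_eq_square)
    also have "x * h\<^sup>2 = x ^ 3 / n" unfolding h by (simp add: power_divide power2_eq_square power3_eq_cube)
    finally show ?thesis unfolding A_def by (simp add: power2_eq_square mult_ac)
  qed
  \<comment> \<open>For x \<le> 1 the variance of \<open>y'\<close> suffices; for x > 1 the factor
    x^2 is enlarged to x^4 to meet the fourth-moment bound.\<close>
  have B: "x\<^sup>2 * (\<integral>p. (qmin (y' p))\<^sup>2 \<partial>TN) \<le> 1908 * K\<^sup>2 / n"
  proof (cases "x \<le> 1")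
    case True
    have "(\<integral>p. (qmin (y' p))\<^sup>2 \<partial>TN) \<le> (\<integral>p. (y' p)\<^sup>2 \<partial>TN)"
    proof (rule integral_mono)
      fix p have "qmin (y' p) \<le> \<bar>y' p\<bar>" by (simp add: qmin_def)
      from power_mono[OF this qmin_nonneg, of 2] show "(qmin (y' p))\<^sup>2 \<le> (y' p)\<^sup>2" by simp
    qed (intro TN.bmeas_integrable bmeas_intros b_q b_y')+
    also have "\<dots> \<le> 6 * K / n" by (rule y'_second)
    finally have "x\<^sup>2 * (\<integral>p. (qmin (y' p))\<^sup>2 \<partial>TN) \<le> 1 * (6 * K / n)" using True x by (intro mult_mono power_le_one) auto
    also have "\<dots> \<le> 1908 * K\<^sup>2 / n" using K_ge_1 mult_left_mono[of 1 K K] by (simp add: power2_eq_square divide_right_mono)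
    finally show ?thesis .
  next
    case False
    have "(\<integral>p. (qmin (y' p))\<^sup>2 \<partial>TN) \<le> (\<integral>p. y' p ^ 4 \<partial>TN)"
    proof (rule integral_mono)
      fix p have "qmin (y' p) \<le> (y' p)\<^sup>2" by (simp add: qmin_def)
      from power_mono[OF this qmin_nonneg, of 2] show "(qmin (y' p))\<^sup>2 \<le> y' p ^ 4" by simp
    qed (intro TN.bmeas_integrable bmeas_intros b_q b_y')+
    then have "x\<^sup>2 * (\<integral>p. (qmin (y' p))\<^sup>2 \<partial>TN) \<le> x ^ 4 * (\<integral>p. y' p ^ 4 \<partial>TN)" using False by (intro mult_mono power_increasing) auto
    then show ?thesis using y'_fourth by simp
  qed
  have "(\<integral>p. (\<Delta> p)\<^sup>2 \<partial>TN) \<le> (\<integral>p. 2 * A\<^sup>2 + 8 * x\<^sup>2 * (qmin (y' p))\<^sup>2 \<partial>TN)"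
  proof (rule integral_mono)
    fix p
    have "x\<^sup>2 * qmin (y' p) / s = (x / s) * (x * qmin (y' p))" by (simp add: power2_eq_square)
    also have "\<dots> \<le> 2 * (x * qmin (y' p))" using x x_over_s qmin_nonneg by (intro mult_right_mono) auto
    finally have "\<Delta> p \<le> A + 2 * (x * qmin (y' p))" using D1 unfolding \<Delta>_def add_divide_distrib by linarith
    moreover have "0 \<le> \<Delta> p" unfolding \<Delta>_def using s_facts(2) qmin_nonneg by simp
    ultimately have "(\<Delta> p)\<^sup>2 \<le> (A + 2 * (x * qmin (y' p)))\<^sup>2" by (intro power_mono) auto
    also have "\<dots> \<le> 2 * A\<^sup>2 + 2 * (2 * (x * qmin (y' p)))\<^sup>2" using zero_le_power2[of "A - 2 * (x * qmin (y' p))"] by (simp add: power2_sum power2_diff)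
    finally show "(\<Delta> p)\<^sup>2 \<le> 2 * A\<^sup>2 + 8 * x\<^sup>2 * (qmin (y' p))\<^sup>2" by (simp add: power_mult_distrib)
  qed (intro TN.bmeas_integrable bmeas_intros b_q b_\<Delta>)+
  also have "\<dots> = 2 * A\<^sup>2 + 8 * (x\<^sup>2 * (\<integral>p. (qmin (y' p))\<^sup>2 \<partial>TN))"
  proof -
    have "integrable TN (\<lambda>p. (qmin (y' p))\<^sup>2)" by (intro TN.bmeas_integrable bmeas_intros b_q)
    then show ?thesis by simp
  qed
  also have "\<dots> \<le> (2 * A + 176 * K / sqrt n)\<^sup>2"
  proof -
    have "(176 * K / sqrt n)\<^sup>2 = 30976 * K\<^sup>2 / n" by (simp add: power_divide power_mult_distrib)
    moreover have "8 * (1908 * K\<^sup>2 / n) \<le> 30976 * K\<^sup>2 / n" using K_ge_1 by (simp add: divide_right_mono)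
    moreover have "(2 * A)\<^sup>2 + (176 * K / sqrt n)\<^sup>2 \<le> (2 * A + 176 * K / sqrt n)\<^sup>2" using A0 K_ge_1 by (subst power2_sum) simp
    moreover have "(2 * A)\<^sup>2 = 4 * A\<^sup>2" by (simp add: power_mult_distrib)
    ultimately show ?thesis using B zero_le_power2[of A] by linarith
  qed
  finally have "sqrt (\<integral>p. (\<Delta> p)\<^sup>2 \<partial>TN) \<le> 2 * A + 176 * K / sqrt n" using A0 K_ge_1 by (intro real_le_lsqrt) auto
  then show ?thesis unfolding A_def by simp
qed

section \<open>Leaving one coordinate out of the window width\<close>

definition y2 where "y2 i p = (\<Sum>j\<in>{..<n} - {i}. u (p j)) / n"
definition \<Delta>2 where "\<Delta>2 i p = (x\<^sup>2 * (v - 1)\<^sup>2 + x\<^sup>2 * qmin (y2 i p)) / s"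

lemma b_y2: "bmeas TN (y2 i)" unfolding y2_def[abs_def] by (intro bmeas_divide bmeas_sum T.bmeas_component[OF _ b_u]) auto
lemma b_\<Delta>2: "bmeas TN (\<Delta>2 i)"
  unfolding \<Delta>2_def[abs_def] qmin_def by (intro bmeas_intros b_y2)

lemma y2_upd: "y2 i (p(i := z)) = y2 i p" unfolding y2_def by (intro arg_cong2[where f="(/)"] sum.cong) auto

lemma y2_abs: assumes i: "i < n" shows "(\<integral>p. \<bar>y2 i p\<bar> \<partial>TN) \<le> 3 * K / sqrt n"
proof -
  have "(\<integral>p. (y2 i p)\<^sup>2 \<partial>TN) = (\<integral>p. (y2 i p)\<^sup>2 \<partial>Pi\<^sub>M ({..<n} - {i}) (\<lambda>_. T))"
    using T.iid_split(1)[of "{..<n}" i, OF _ _ bmeas_power[OF b_y2]] i by (simp add: y2_upd)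
  also have "\<dots> = (card ({..<n} - {i}) * (\<integral>z. (u z)\<^sup>2 \<partial>T)) / n\<^sup>2"
    using T.iid_sum_second[OF _ b_u u_mean, of "{..<n} - {i}"] by (simp add: y2_def power_divide)
  also have "\<dots> \<le> (n * (6 * K)) / n\<^sup>2"
  proof (intro divide_right_mono mult_mono u_second)
    show "real (card ({..<n} - {i})) \<le> real n" using card_mono[of "{..<n}" "{..<n} - {i}"] by simp
  qed auto
  also have "\<dots> = 6 * K / n" using n by (simp add: power2_eq_square)
  also have "\<dots> \<le> (3 * K / sqrt n)\<^sup>2"
    using K_ge_1 mult_left_mono[of 1 K K] by (simp add: power_divide power_mult_distrib power2_eq_square divide_right_mono)
  finally have "sqrt (\<integral>p. (y2 i p)\<^sup>2 \<partial>TN) \<le> 3 * K / sqrt n" using K_ge_1 by (intro real_le_lsqrt) auto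
  then show ?thesis by (rule order_trans[OF TN.bmeas_abs_le_sqrt[OF b_y2]])
qed

text \<open>Order n^(-3/2) per coordinate, so that the n terms of the concentration bound add up to
  K / sqrt n. The powers of x disappear in (x / s)^2 \<le> 4, and the cross term factorises because
  \<open>y2 i\<close> is independent of coordinate i.\<close>

lemma \<Delta>_leave_one_out:
  assumes i: "i < n" shows "(\<integral>p. \<bar>\<xi> (p i)\<bar> * \<bar>\<Delta> p - \<Delta>2 i p\<bar> \<partial>TN) \<le> 81 * K / (sqrt n * n)"
proof -
  let ?a = "\<lambda>z. \<bar>w z - \<mu>\<bar> * \<bar>u z\<bar>" and ?b = "\<lambda>z. \<bar>w z - \<mu>\<bar> * (u z)\<^sup>2"
  have ba: "bmeas T ?a" "bmeas T ?b" by (intro bmeas_intros b_u b_T)+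
  have ii: "i \<in> {..<n}" using i by simp
  have bi: "bmeas TN (\<lambda>p. ?a (p i))" "bmeas TN (\<lambda>p. ?b (p i))" by (intro T.bmeas_component[OF ii] ba)+
  have bxi: "bmeas TN (\<lambda>p. \<xi> (p i))" by (intro T.bmeas_component[OF ii] b_xi)
  have "(\<integral>p. \<bar>\<xi> (p i)\<bar> * \<bar>\<Delta> p - \<Delta>2 i p\<bar> \<partial>TN) \<le> (\<integral>p. 8 / n * (?a (p i) * \<bar>y2 i p\<bar>) + 4 / n\<^sup>2 * ?b (p i) \<partial>TN)"
  proof (rule integral_mono)
    fix p
    define \<eta> where "\<eta> = u (p i) / n"
    have y: "y' p - y2 i p = \<eta>" unfolding y'_def y2_def \<eta>_def using i by (simp add: sum_diff1 diff_divide_distrib)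
    have "\<bar>\<Delta> p - \<Delta>2 i p\<bar> = x\<^sup>2 / s * \<bar>qmin (y' p) - qmin (y2 i p)\<bar>"
    proof -
      have "\<Delta> p - \<Delta>2 i p = x\<^sup>2 / s * (qmin (y' p) - qmin (y2 i p))" unfolding \<Delta>_def \<Delta>2_def by (simp add: diff_divide_distrib add_divide_distrib right_diff_distrib)
      then show ?thesis using s_facts(2) by (simp add: abs_mult)
    qed
    also have "\<dots> \<le> x\<^sup>2 / s * (\<bar>\<eta>\<bar> * (2 * \<bar>y2 i p\<bar> + \<bar>\<eta>\<bar>))"
    proof (intro mult_left_mono)
      have "\<bar>y' p\<bar> + \<bar>y2 i p\<bar> \<le> 2 * \<bar>y2 i p\<bar> + \<bar>\<eta>\<bar>" using y by linarith
      then have "\<bar>\<eta>\<bar> * (\<bar>y' p\<bar> + \<bar>y2 i p\<bar>) \<le> \<bar>\<eta>\<bar> * (2 * \<bar>y2 i p\<bar> + \<bar>\<eta>\<bar>)" by (intro mult_left_mono) auto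
      then show "\<bar>qmin (y' p) - qmin (y2 i p)\<bar> \<le> \<bar>\<eta>\<bar> * (2 * \<bar>y2 i p\<bar> + \<bar>\<eta>\<bar>)"
        using qmin_diff[of "y' p" "y2 i p"] unfolding y by linarith
    qed (use s_facts(2) in auto)
    finally have "\<bar>\<xi> (p i)\<bar> * \<bar>\<Delta> p - \<Delta>2 i p\<bar> \<le> \<bar>\<xi> (p i)\<bar> * (x\<^sup>2 / s * (\<bar>\<eta>\<bar> * (2 * \<bar>y2 i p\<bar> + \<bar>\<eta>\<bar>)))" by (intro mult_left_mono) auto
    also have "\<dots> = (x / s)\<^sup>2 * (\<bar>w (p i) - \<mu>\<bar> * (\<bar>\<eta>\<bar> * (2 * \<bar>y2 i p\<bar> + \<bar>\<eta>\<bar>)))"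
      unfolding \<xi>_def using s_facts(2) by (simp add: abs_divide power2_eq_square)
    also have "\<dots> \<le> 2\<^sup>2 * (\<bar>w (p i) - \<mu>\<bar> * (\<bar>\<eta>\<bar> * (2 * \<bar>y2 i p\<bar> + \<bar>\<eta>\<bar>)))"
      using x_over_s x s_facts(2) by (intro mult_right_mono power_mono) auto
    also have "\<dots> = 8 / n * (?a (p i) * \<bar>y2 i p\<bar>) + 4 / n\<^sup>2 * ?b (p i)"
    proof -
      have e: "\<bar>\<eta>\<bar> = \<bar>u (p i)\<bar> / n" unfolding \<eta>_def by simp
      have "(u (p i))\<^sup>2 = \<bar>u (p i)\<bar> * \<bar>u (p i)\<bar>" by (simp add: power2_eq_square)
      then show ?thesis unfolding e by (simp add: power2_eq_square distrib_left mult_ac)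
    qed
    finally show "\<bar>\<xi> (p i)\<bar> * \<bar>\<Delta> p - \<Delta>2 i p\<bar> \<le> 8 / n * (?a (p i) * \<bar>y2 i p\<bar>) + 4 / n\<^sup>2 * ?b (p i)" .
  qed (intro TN.bmeas_integrable bmeas_add bmeas_mult[of _ _ "\<lambda>p. \<bar>y2 i p\<bar>"] bmeas_mult[OF bmeas_const] bmeas_mult[OF bmeas_abs[OF bxi]] bmeas_abs bmeas_diff b_\<Delta> b_\<Delta>2 b_y2 bi)+
  also have "\<dots> = 8 / n * (\<integral>p. ?a (p i) * \<bar>y2 i p\<bar> \<partial>TN) + 4 / n\<^sup>2 * (\<integral>p. ?b (p i) \<partial>TN)"
  proof -
    have "integrable TN (\<lambda>p. ?a (p i) * \<bar>y2 i p\<bar>)" "integrable TN (\<lambda>p. ?b (p i))"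
      by (intro TN.bmeas_integrable bmeas_mult[of _ _ "\<lambda>p. \<bar>y2 i p\<bar>"] bmeas_abs b_y2 bi)+
    then show ?thesis by simp
  qed
  also have "(\<integral>p. ?a (p i) * \<bar>y2 i p\<bar> \<partial>TN) = (\<integral>z. ?a z \<partial>T) * (\<integral>p. \<bar>y2 i p\<bar> \<partial>TN)"
    by (rule T.iid_indep_mult[OF _ ii ba(1)]) (auto intro!: bmeas_abs b_y2 simp: y2_upd simp del: bmeas_PiM_tilt)
  also have "(\<integral>p. ?b (p i) \<partial>TN) = (\<integral>z. ?b z \<partial>T)" by (rule T.iid_component[OF _ ii ba(2)]) simp
  also have "8 / n * ((\<integral>z. ?a z \<partial>T) * (\<integral>p. \<bar>y2 i p\<bar> \<partial>TN)) + 4 / n\<^sup>2 * (\<integral>z. ?b z \<partial>T)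
     \<le> 8 / n * ((50 * h * K) * (3 * K / sqrt n)) + 4 / n\<^sup>2 * (20 * K)"
    using h_pos K_ge_1 by (intro add_mono mult_left_mono mult_mono ET_w_u y2_abs i) auto
  also have "\<dots> = (1200 * (h * K) + 80 / sqrt n) * (K / (sqrt n * n))"
  proof -
    have "4 / n\<^sup>2 * (20 * K) = 80 / sqrt n * (K / (sqrt n * n))" by (simp add: power2_eq_square mult.assoc[symmetric])
    moreover have "8 / n * ((50 * h * K) * (3 * K / sqrt n)) = 1200 * (h * K) * (K / (sqrt n * n))" by (simp add: mult_ac)
    ultimately show ?thesis by (simp only: distrib_right)
  qed
  also have "\<dots> \<le> 81 * (K / (sqrt n * n))"
  proof (intro mult_right_mono)
    have "80 / sqrt n \<le> 80" using n by (simp add: divide_le_eq)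
    then show "1200 * (h * K) + 80 / sqrt n \<le> 81" using hK by linarith
  qed (use K_ge_1 in auto)
  finally show ?thesis by simp
qed

text \<open>An outcome on the wrong side of the linear threshold - \<rho> can be carried into the
  exceedance event by the remainder only from within this window.\<close>

lemma window_prob:
  "measure TN {p \<in> space TN. - \<rho> - \<Delta> p \<le> W p \<and> W p \<le> - \<rho>} \<le> 1300000 * K\<^sup>2 * x ^ 3 / n + 10500 * K / sqrt n"
proof -
  have G: "card {..<n} * (\<integral>z. \<bar>\<xi> z\<bar> ^ 3 \<partial>T) \<le> 1200 * K / sqrt n" using xi_third by simp
  have 1: "measure TN {p \<in> space TN. - \<rho> - \<Delta> p \<le> W p \<and> W p \<le> - \<rho>}
     \<le> 2 * sqrt (\<integral>p. (\<Delta> p)\<^sup>2 \<partial>TN) + 8 * (1200 * K / sqrt n) + 6 * (\<Sum>i<n. \<integral>p. \<bar>\<xi> (p i)\<bar> * \<bar>\<Delta> p - \<Delta>2 i p\<bar> \<partial>TN)"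
    unfolding W_def
  proof (rule T.randomized_concentration[OF _ b_xi xi_mean _ _ G])
    show "0 < 1200 * K / sqrt n" using K_ge_1 n by simp
    show "0 \<le> \<Delta> p" for p unfolding \<Delta>_def using s_facts(2) qmin_nonneg by simp
    show "0 \<le> \<Delta>2 i p" for i p unfolding \<Delta>2_def using s_facts(2) qmin_nonneg by simp
    show "\<Delta>2 i (p(i := z)) = \<Delta>2 i p" for i p z unfolding \<Delta>2_def by (simp add: y2_upd)
  qed (use xi_var b_\<Delta> b_\<Delta>2 in auto)
  have "(\<Sum>i<n. \<integral>p. \<bar>\<xi> (p i)\<bar> * \<bar>\<Delta> p - \<Delta>2 i p\<bar> \<partial>TN) \<le> (\<Sum>i<n. 81 * K / (sqrt n * n))"
    by (intro sum_mono \<Delta>_leave_one_out) auto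
  also have "\<dots> = 81 * K / sqrt n" using n by simp
  finally have "(\<Sum>i<n. \<integral>p. \<bar>\<xi> (p i)\<bar> * \<bar>\<Delta> p - \<Delta>2 i p\<bar> \<partial>TN) \<le> 81 * K / sqrt n" .
  then have "measure TN {p \<in> space TN. - \<rho> - \<Delta> p \<le> W p \<and> W p \<le> - \<rho>} \<le>
    2 * (640000 * K\<^sup>2 * x ^ 3 / n + 176 * K / sqrt n) + 8 * (1200 * K / sqrt n) + 6 * (81 * K / sqrt n)" by (intro order_trans[OF 1] add_mono mult_left_mono \<Delta>_second order_refl) auto
  also have "\<dots> = 1280000 * (K\<^sup>2 * x ^ 3 / n) + 10438 * (K / sqrt n)" by simp
  also have "\<dots> \<le> 1300000 * (K\<^sup>2 * x ^ 3 / n) + 10500 * (K / sqrt n)" using x K_ge_1 by (intro add_mono mult_right_mono) auto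
  finally show ?thesis by simp
qed

lemma normal_part:
  "\<bar>(\<integral>p. of_bool (- \<rho> < W p) * exp (- s * (W p + \<rho>)) \<partial>TN) - exp (- \<rho>\<^sup>2 / 2) * mills (s - \<rho>) / sqrt (2 * pi)\<bar> \<le> 163200 * K / sqrt n"
proof -
  have "\<bar>(\<integral>p. of_bool (- \<rho> < W p) * exp (- s * (W p + \<rho>)) \<partial>TN) - exp (- \<rho>\<^sup>2 / 2) * mills (s - \<rho>) / sqrt (2 * pi)\<bar> \<le> 2 * (68 * (1200 * K / sqrt n))"
  proof (rule TN.exp_window_normal_approx[OF bmeas_measurable[OF b_W] s_facts(2)])
    fix z
    show "\<bar>measure TN {p \<in> space TN. W p \<le> z} - Phi z\<bar> \<le> 68 * (1200 * K / sqrt n)"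
      unfolding W_def by (rule T.berry_esseen[OF _ b_xi xi_mean]) (use xi_var xi_third in auto)
  qed
  then show ?thesis by simp
qed

text \<open>As \<open>h * sqrt V\<close> is close to \<open>x\<close>, linearising the square root rewrites \<open>x * sqrt V < S\<close> as \<open>0 < T' + R\<close> with an
  additive \<open>T'\<close> and a quadratic remainder \<open>R\<close>.\<close>

definition T' where "T' p = h * Sn n p - 1/2 * h\<^sup>2 * Vn n p - x\<^sup>2 / 2"

lemma T'_W: "T' p = s * (W p + \<rho>)"
proof -
  have "s * W p = (\<Sum>i<n. w (p i)) - n * \<mu>"
    unfolding W_def \<xi>_def using s_facts(2) by (simp add: sum_divide_distrib[symmetric] sum_subtractf)
  moreover have "s * \<rho> = n * \<mu> - x\<^sup>2 / 2" unfolding \<rho>_def using s_facts(2) by simp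
  moreover have "(\<Sum>i<n. w (p i)) = h * Sn n p - 1/2 * h\<^sup>2 * Vn n p" unfolding w_ex sum_ex ..
  ultimately show ?thesis unfolding T'_def by (simp add: distrib_left)
qed

lemma b_T': "bmeas (Pn n) T'" unfolding T'_def by (intro bn)

text \<open>The prefactor carries the skewness correction and the Gaussian exponent; what remains is
  an expectation under the tilted law, for which absolute errors are good enough.\<close>

lemma tilt_event:
  assumes "Measurable.pred (Pn n) A"
  shows "measure (Pn n) {p \<in> space (Pn n). A p} = m ^ n * exp (- x\<^sup>2 / 2) * (\<integral>p. of_bool (A p) * exp (- T' p) \<partial>TN)"
proof -
  interpret PP: prob_space "Pn n" by (rule prob_space_iid)
  have "measure (Pn n) {p \<in> space (Pn n). A p} = (\<integral>p. of_bool (A p) \<partial>Pn n)" by (rule PP.measure_eq_integral_of_bool[OF assms])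
  also have "\<dots> = (\<integral>p. exp (- x\<^sup>2 / 2) * (of_bool (A p) * exp (- T' p)) * exp (h * Sn n p - 1/2 * h\<^sup>2 * Vn n p) \<partial>Pn n)"
    by (intro Bochner_Integration.integral_cong refl) (simp add: T'_def exp_add[symmetric] exp_diff exp_minus field_simps)
  also have "\<dots> = m ^ n * (\<integral>p. exp (- x\<^sup>2 / 2) * (of_bool (A p) * exp (- T' p)) \<partial>TN)"
    by (rule tilt_Pn) (intro bmeas_intros bmeas_of_bool assms b_T')
  finally show ?thesis by simp
qed

definition R where "R p = (h * sqrt (Vn n p) - x)\<^sup>2 / 2"

text \<open>Nothing is approximated: the square in \<open>R\<close> completes \<open>T'\<close> to
  T' + R = h * (S - x * sqrt V).\<close>

lemma exceed_iff: "x * sqrt (Vn n p) < Sn n p \<longleftrightarrow> 0 < T' p + R p"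
proof -
  have "T' p + R p = h * (Sn n p - x * sqrt (Vn n p))"
    unfolding T'_def R_def power2_diff using Vn_nonneg[of n p] by (simp add: power_mult_distrib field_simps power2_eq_square)
  then show ?thesis using h_pos by (simp add: zero_less_mult_iff)
qed

lemma y_split: "yn n p = (v - 1) + y' p"
  using n by (simp add: yn_def Vn_def y'_def u_def sum_subtractf diff_divide_distrib)

lemma R_le: "R p \<le> x\<^sup>2 * (v - 1)\<^sup>2 + x\<^sup>2 * qmin (y' p)"
proof -
  have "h * sqrt (Vn n p) = x * sqrt (1 + yn n p)" unfolding sqrt_Vn[OF n] using n by (simp add: h)
  then have "R p = x\<^sup>2 / 2 * (sqrt (1 + yn n p) - 1)\<^sup>2" unfolding R_def by (simp add: power_mult_distrib[symmetric] algebra_simps)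
  also have "\<dots> \<le> x\<^sup>2 / 2 * qmin (yn n p)" by (intro mult_left_mono sqrt_diff_qmin yn_ge[OF n]) auto
  also have "\<dots> \<le> x\<^sup>2 / 2 * (2 * (v - 1)\<^sup>2 + 2 * qmin (y' p))"
    unfolding y_split by (intro mult_left_mono qmin_add order_trans[OF v_approx(1)]) (use hK in auto)
  finally show ?thesis by (simp add: algebra_simps)
qed

text \<open>On the event - T' < R controls the weight. If R \<le> 1, the weight is at most 3 and W
  lies in the window. If R > 1, then x^2 * y'^2 \<ge> 15/16, so this small quantity may be inserted
  as a factor at bounded cost, and the weight remains as an exponential of |y'|.\<close>

lemma mid_pointwise:
  assumes E: "x * sqrt (Vn n p) < Sn n p" "T' p \<le> 0" "\<bar>yn n p\<bar> \<le> 1/16"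
  shows "exp (- T' p) \<le> 3 * of_bool (- \<rho> - \<Delta> p \<le> W p \<and> W p \<le> - \<rho>) + 4 * ((x\<^sup>2 * (y' p)\<^sup>2) * exp (x\<^sup>2 * \<bar>y' p\<bar> / 8))"
proof -
  have TR: "- T' p < R p" using E(1) unfolding exceed_iff by simp
  show ?thesis
  proof (cases "R p \<le> 1")
    case True
    have "exp (- T' p) \<le> exp 1" using TR True by simp
    then have e: "exp (- T' p) \<le> 3" using exp_le_numeral(1) by linarith
    moreover have "W p \<le> - \<rho>" using E(2) s_facts(2) unfolding T'_W by (simp add: mult_le_0_iff)
    moreover have "- \<rho> - \<Delta> p \<le> W p"
    proof -
      have "- (s * (W p + \<rho>)) \<le> s * \<Delta> p" using TR R_le[of p] s_facts(2) unfolding T'_W \<Delta>_def by simp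
      then have "s * (- (W p + \<rho>)) \<le> s * \<Delta> p" by (simp only: mult_minus_right)
      then have "- (W p + \<rho>) \<le> \<Delta> p" using s_facts(2) by (rule mult_left_le_imp_le)
      then show ?thesis by simp
    qed
    moreover have "0 \<le> 4 * ((x\<^sup>2 * (y' p)\<^sup>2) * exp (x\<^sup>2 * \<bar>y' p\<bar> / 8))" by simp
    ultimately show ?thesis by (simp add: add_increasing2)
  next
    case False
    \<comment> \<open>Together with |y| \<le> 1/16 this gives |y'| \<le> 1/8, which linearises x^2 *
      y'^2 to x^2 * |y'| / 8, an exponent whose moments are under control.\<close>
    have D: "\<bar>v - 1\<bar> \<le> 1/16" using v_approx(1) hK by linarith
    then have y: "\<bar>y' p\<bar> \<le> 1/8" using E(3) unfolding y_split by linarith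
    have q: "qmin (y' p) \<le> (y' p)\<^sup>2" by (simp add: qmin_def)
    have "x * \<bar>v - 1\<bar> \<le> x * (400 * h * K)" using x by (intro mult_left_mono v_approx) auto
    then have "x * \<bar>v - 1\<bar> \<le> 1/4" using xhK by (simp add: mult_ac)
    then have "(x * \<bar>v - 1\<bar>)\<^sup>2 \<le> (1/4)\<^sup>2" using x by (intro power_mono) auto
    then have D2: "x\<^sup>2 * (v - 1)\<^sup>2 \<le> 1/16" by (simp add: power_mult_distrib power_divide)
    have xq: "x\<^sup>2 * qmin (y' p) \<le> x\<^sup>2 * (y' p)\<^sup>2" by (intro mult_left_mono q) auto
    have "(y' p)\<^sup>2 \<le> \<bar>y' p\<bar> * (1/8)" using mult_left_mono[OF y, of "\<bar>y' p\<bar>"] by (simp add: power2_eq_square)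
    then have y8: "x\<^sup>2 * (y' p)\<^sup>2 \<le> x\<^sup>2 * (\<bar>y' p\<bar> * (1/8))" by (intro mult_left_mono) auto
    have "R p \<le> 1/16 + x\<^sup>2 * (y' p)\<^sup>2" using R_le[of p] D2 xq by linarith
    then have a: "15/16 \<le> x\<^sup>2 * (y' p)\<^sup>2" "- T' p \<le> 1 + x\<^sup>2 * \<bar>y' p\<bar> / 8" using False TR y8 by auto
    have "exp (- T' p) \<le> exp 1 * exp (x\<^sup>2 * \<bar>y' p\<bar> / 8)" unfolding exp_add[symmetric] using a by simp
    also have "\<dots> \<le> 3 * exp (x\<^sup>2 * \<bar>y' p\<bar> / 8)" by (intro mult_right_mono exp_le_numeral) auto
    also have "\<dots> \<le> (4 * (x\<^sup>2 * (y' p)\<^sup>2)) * exp (x\<^sup>2 * \<bar>y' p\<bar> / 8)" using a by (intro mult_right_mono) auto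
    finally show ?thesis by (simp add: mult_ac add_increasing)
  qed
qed

lemma mid_prob:
  "measure (Pn n) {p \<in> space (Pn n). x * sqrt (Vn n p) < Sn n p \<and> T' p \<le> 0 \<and> \<bar>yn n p\<bar> \<le> 1/16}
    \<le> m ^ n * exp (- x\<^sup>2 / 2) * (3900000 * K\<^sup>2 * x ^ 3 / n + 32000 * K / sqrt n)"
proof -
  define A where "A p \<longleftrightarrow> x * sqrt (Vn n p) < Sn n p \<and> T' p \<le> 0 \<and> \<bar>yn n p\<bar> \<le> 1/16" for p
  define B where "B p \<longleftrightarrow> - \<rho> - \<Delta> p \<le> W p \<and> W p \<le> - \<rho>" for p
  let ?f = "\<lambda>p. x\<^sup>2 * (y' p)\<^sup>2" and ?g = "\<lambda>p. exp (x\<^sup>2 * \<bar>y' p\<bar> / 8)"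
  have pA: "Measurable.pred (Pn n) A" unfolding A_def by (intro pred_bmeas bn b_T')
  have pw: "Measurable.pred TN B" unfolding B_def by (intro pred_bmeas bmeas_intros b_\<Delta> b_W)
  have bA: "bmeas TN (\<lambda>p. of_bool (A p) * exp (- T' p))" unfolding bmeas_PiM_tilt by (intro bmeas_intros bmeas_of_bool pA b_T')
  have bf: "bmeas TN ?f" and bg: "bmeas TN ?g" by (intro bmeas_intros b_y')+
  have "(\<integral>p. of_bool (A p) * exp (- T' p) \<partial>TN) \<le> (\<integral>p. 3 * of_bool (B p) + 4 * (?f p * ?g p) \<partial>TN)"
  proof (rule integral_mono)
    fix p show "of_bool (A p) * exp (- T' p) \<le> 3 * of_bool (B p) + 4 * (?f p * ?g p)"
    proof (cases "A p")
      case True then show ?thesis using mid_pointwise[of p] unfolding B_def A_def by simp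
    qed simp
  qed (intro TN.bmeas_integrable bA bmeas_add bmeas_mult[OF bmeas_const] bmeas_mult[OF bf bg] bmeas_of_bool pw)+
  also have "\<dots> = 3 * measure TN {p \<in> space TN. B p} + 4 * (\<integral>p. ?f p * ?g p \<partial>TN)"
  proof -
    have "integrable TN (\<lambda>p. of_bool (B p) :: real)" "integrable TN (\<lambda>p. ?f p * ?g p)"
      by (intro TN.bmeas_integrable bmeas_mult[OF bf bg] bmeas_of_bool pw)+
    then show ?thesis by (simp only: TN.measure_eq_integral_of_bool[OF pw] Bochner_Integration.integral_add integral_mult_right_zero integrable_mult_right)
  qed
  also have "(\<integral>p. ?f p * ?g p \<partial>TN) \<le> 125 * K / sqrt n"
  proof -
    have "(\<integral>p. ?f p * ?g p \<partial>TN) = (\<integral>p. \<bar>?f p * ?g p\<bar> \<partial>TN)" by simp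
    also have "\<dots> \<le> sqrt (\<integral>p. (?f p)\<^sup>2 \<partial>TN) * sqrt (\<integral>p. (?g p)\<^sup>2 \<partial>TN)" by (rule TN.bmeas_cauchy_schwarz[OF bf bg])
    also have "\<dots> \<le> (50 * K / sqrt n) * (5 / 2)"
    proof (intro mult_mono)
      have "(\<integral>p. (?f p)\<^sup>2 \<partial>TN) = x ^ 4 * (\<integral>p. y' p ^ 4 \<partial>TN)" by (simp add: power_mult_distrib)
      also have "\<dots> \<le> 1908 * K\<^sup>2 / n" by (rule y'_fourth)
      also have "\<dots> \<le> (50 * K / sqrt n)\<^sup>2" by (simp add: power_divide power_mult_distrib divide_right_mono)
      finally show "sqrt (\<integral>p. (?f p)\<^sup>2 \<partial>TN) \<le> 50 * K / sqrt n" using K_ge_1 by (intro real_le_lsqrt) auto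
      \<comment> \<open>The square of \<open>?g\<close> has exponent x^2 * |y'| / 4, the one treated
        in \<open>y'_exp\<close>; the two signs of \<open>y'\<close> give the sum 6, and sqrt 6
        \<le> 5/2.\<close>
      have "(\<integral>p. (?g p)\<^sup>2 \<partial>TN) \<le> (\<integral>p. exp (1 * x\<^sup>2 * y' p / 4) + exp (-1 * x\<^sup>2 * y' p / 4) \<partial>TN)"
      proof (rule integral_mono)
        fix p
        have "(?g p)\<^sup>2 = exp (x\<^sup>2 * \<bar>y' p\<bar> / 4)" by (simp add: exp_double[symmetric] power2_eq_square exp_add[symmetric])
        also have "\<dots> \<le> exp (1 * x\<^sup>2 * y' p / 4) + exp (-1 * x\<^sup>2 * y' p / 4)" by (cases "y' p \<ge> 0") auto
        finally show "(?g p)\<^sup>2 \<le> exp (1 * x\<^sup>2 * y' p / 4) + exp (-1 * x\<^sup>2 * y' p / 4)" .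
      qed (intro TN.bmeas_integrable bmeas_intros b_y')+
      also have "\<dots> = (\<integral>p. exp (1 * x\<^sup>2 * y' p / 4) \<partial>TN) + (\<integral>p. exp (-1 * x\<^sup>2 * y' p / 4) \<partial>TN)"
        by (rule Bochner_Integration.integral_add) (intro TN.bmeas_integrable bmeas_intros b_y')+
      also have "\<dots> \<le> 3 + 3" by (intro add_mono y'_exp) auto
      finally show "sqrt (\<integral>p. (?g p)\<^sup>2 \<partial>TN) \<le> 5 / 2" by (intro real_le_lsqrt) (auto simp: power_divide)
    qed (use K_ge_1 in auto)
    finally show ?thesis by simp
  qed
  also note window_prob[folded B_def]
  finally have "(\<integral>p. of_bool (A p) * exp (- T' p) \<partial>TN) \<le> 3 * (1300000 * K\<^sup>2 * x ^ 3 / n + 10500 * K / sqrt n) + 4 * (125 * K / sqrt n)" by simp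
  also have "\<dots> = 3900000 * K\<^sup>2 * x ^ 3 / n + 32000 * K / sqrt n" by simp
  finally show ?thesis unfolding A_def[symmetric] tilt_event[OF pA] using m_bounds(1) by (intro mult_left_mono) auto
qed

end

section \<open>Self-normalized tail probabilities\<close>

context tilted_sample
begin

abbreviation "\<gamma> \<equiv> \<integral>z. X z ^ 3 \<partial>M"
definition b where "b = sqrt n * \<bar>mean\<bar>"
definition err where "err = (1 + x ^ 4) / n + (1 + x) * b + (1 + x) / sqrt n"

lemma b_nonneg: "0 \<le> b" by (simp add: b_def)

lemma err_parts: "x ^ 4 / n \<le> err" "b \<le> err" "x * b \<le> err" "x / sqrt n \<le> err" "1 / sqrt n \<le> err" "0 \<le> err"
   "(1 + x) * (x ^ 3 / n + 1 / sqrt n) \<le> 2 * err"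
proof -
  have p: "0 \<le> x ^ 4 / n" "0 \<le> 1 / n" "0 \<le> x * b" "0 \<le> b" "0 \<le> x / sqrt n" "0 \<le> 1 / sqrt n" using x b_nonneg by auto
  have e: "err = (1 / n + x ^ 4 / n) + (b + x * b) + (1 / sqrt n + x / sqrt n)"
    unfolding err_def by (simp add: add_divide_distrib distrib_right)
  show "x ^ 4 / n \<le> err" "b \<le> err" "x * b \<le> err" "x / sqrt n \<le> err" "1 / sqrt n \<le> err" "0 \<le> err" unfolding e using p by linarith+
  have "x ^ 3 \<le> 1 + x ^ 4"
  proof (cases "x \<le> 1")
    case True then show ?thesis using x power_le_one[of x 3] by (simp add: add_increasing2)
  next
    case False then show ?thesis using power_increasing[of 3 4 x] by linarith
  qed
  then have "(x ^ 3 + x ^ 4) / n \<le> 2 * ((1 + x ^ 4) / n)" by (simp add: divide_right_mono)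
  moreover have "(1 + x) * (x ^ 3 / n + 1 / sqrt n) = (x ^ 3 + x ^ 4) / n + (1 + x) / sqrt n"
    by (simp add: algebra_simps add_divide_distrib eval_nat_numeral)
  moreover have "0 \<le> (1 + x) / sqrt n" "0 \<le> (1 + x) * b" using x b_nonneg by auto
  moreover have "B \<le> 2 * (A + D + C)" if "U \<le> 2 * A" "B = U + C" "0 \<le> C" "0 \<le> D" for A B C D U :: real using that by (simp add: distrib_left)
  ultimately show "(1 + x) * (x ^ 3 / n + 1 / sqrt n) \<le> 2 * err" unfolding err_def by blast
qed

lemma K_le_K2: "K \<le> K\<^sup>2" "1 \<le> K\<^sup>2"
proof -
  show "K \<le> K\<^sup>2" using K_ge_1 mult_left_mono[of 1 K K] by (simp add: power2_eq_square)
  then show "1 \<le> K\<^sup>2" using K_ge_1 by linarith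
qed

text \<open>The argument s - \<rho> differs from x by O(x * h * K + b), and x * h * K = K * x^2 /
  sqrt n would be too large as an error; division by 1 + x in the relative Lipschitz bound reduces
  it to K * x / sqrt n. In the factor with \<rho>^2 it enters squared, as K^2 * x^4 / n.\<close>

lemma mills_ratio:
  "\<bar>exp (- \<rho>\<^sup>2 / 2) * mills (s - \<rho>) - mills x\<bar> \<le> 150000 * K\<^sup>2 * err * mills x"
proof -
  define a where "a = x * h * K"
  have a: "0 \<le> a" "a \<le> 1 / 100000" unfolding a_def using x h_pos K_ge_1 xhK by auto
  have b1: "b \<le> 1 / 100" using bias by (simp add: b_def)
  have xm: "x * \<bar>mean\<bar> \<le> b" unfolding b_def using x_le by (intro mult_right_mono) auto
  have r: "\<bar>\<rho>\<bar> \<le> 86 * a + 10 * b" using \<rho>_le unfolding a_def b_def .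
  have "\<bar>s - x\<bar> \<le> 480 * a + 3 * (x * \<bar>mean\<bar>)" using s_facts(3) unfolding a_def by (simp add: algebra_simps)
  then have d: "\<bar>(s - \<rho>) - x\<bar> \<le> 566 * a + 13 * b" using xm r by linarith
  note d
  also have "566 * a + 13 * b \<le> 1 / 2" using a b1 by linarith
  also have "1 / 2 \<le> (1 + x) / 2" using x by simp
  finally have d2: "\<bar>(s - \<rho>) - x\<bar> \<le> (1 + x) / 2" .
  have x0: "0 \<le> x" using x by simp
  have mx: "0 < mills x" by (rule mills_pos)
  have ax: "a / (1 + x) \<le> K * (x / sqrt n)"
  proof -
    have "a = (K * (x / sqrt n)) * x" unfolding a_def h by simp
    also have "\<dots> \<le> (K * (x / sqrt n)) * (1 + x)" using x K_ge_1 by (intro mult_left_mono) auto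
    finally show ?thesis using x by (simp add: divide_le_eq)
  qed
  have "32 * \<bar>(s - \<rho>) - x\<bar> / (1 + x) \<le> 32 * (566 * a + 13 * b) / (1 + x)" using d x by (intro divide_right_mono mult_left_mono) auto
  also have "\<dots> = 18112 * (a / (1 + x)) + 416 * (b / (1 + x))" by (simp add: add_divide_distrib distrib_left)
  also have "\<dots> \<le> 18112 * (K * (x / sqrt n)) + 416 * b"
  proof -
    have "b / (1 + x) \<le> b / 1" using x b_nonneg by (intro divide_left_mono) auto
    then show ?thesis using ax by simp
  qed
  finally have c1: "32 * \<bar>(s - \<rho>) - x\<bar> / (1 + x) \<le> 18112 * (K * (x / sqrt n)) + 416 * b" .
  have L: "\<bar>mills (s - \<rho>) - mills x\<bar> \<le> 32 * \<bar>(s - \<rho>) - x\<bar> / (1 + x) * mills x" by (rule mills_lipschitz[OF x0 d2])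
  have L1: "\<bar>mills (s - \<rho>) - mills x\<bar> \<le> (18112 * (K * (x / sqrt n)) + 416 * b) * mills x"
    using L mult_right_mono[OF c1, of "mills x"] mx by linarith
  have "32 * \<bar>(s - \<rho>) - x\<bar> / (1 + x) \<le> 16" using d2 x by (simp add: divide_le_eq)
  then have "32 * \<bar>(s - \<rho>) - x\<bar> / (1 + x) * mills x \<le> 16 * mills x" using mx by (intro mult_right_mono) auto
  then have L2: "mills (s - \<rho>) \<le> 17 * mills x" using L by linarith
  have r2: "\<rho>\<^sup>2 \<le> 14792 * a\<^sup>2 + 2 * b"
  proof -
    have "\<rho>\<^sup>2 \<le> (86 * a + 10 * b)\<^sup>2" using r a b_nonneg by (subst abs_le_square_iff[symmetric]) auto
    also have "\<dots> \<le> 2 * (86 * a)\<^sup>2 + 2 * (10 * b)\<^sup>2" using zero_le_power2[of "86 * a - 10 * b"] by (simp add: power2_sum power2_diff)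
    also have "\<dots> = 14792 * a\<^sup>2 + 200 * (b * b)" by (simp add: power2_eq_square)
    also have "b * b \<le> b * (1 / 100)" using b1 b_nonneg by (intro mult_left_mono) auto
    finally show ?thesis by simp
  qed
  have "1 - \<rho>\<^sup>2 / 2 \<le> exp (- \<rho>\<^sup>2 / 2)" using exp_ge_add_one_self[of "- \<rho>\<^sup>2 / 2"] by simp
  moreover have "exp (- \<rho>\<^sup>2 / 2) \<le> 1" by simp
  ultimately have "\<bar>exp (- \<rho>\<^sup>2 / 2) - 1\<bar> \<le> 7396 * a\<^sup>2 + b" using r2 by linarith
  then have "\<bar>(exp (- \<rho>\<^sup>2 / 2) - 1) * mills (s - \<rho>)\<bar> \<le> (7396 * a\<^sup>2 + b) * (17 * mills x)"
    unfolding abs_mult using L2 mills_pos[of "s - \<rho>"] b_nonneg by (intro mult_mono) auto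
  moreover have "exp (- \<rho>\<^sup>2 / 2) * mills (s - \<rho>) - mills x = (exp (- \<rho>\<^sup>2 / 2) - 1) * mills (s - \<rho>) + (mills (s - \<rho>) - mills x)"
    by (simp add: algebra_simps)
  ultimately have "\<bar>exp (- \<rho>\<^sup>2 / 2) * mills (s - \<rho>) - mills x\<bar> \<le> (7396 * a\<^sup>2 + b) * (17 * mills x) + (18112 * (K * (x / sqrt n)) + 416 * b) * mills x"
    using L1 by linarith
  also have "\<dots> = (125732 * a\<^sup>2 + 433 * b + 18112 * (K * (x / sqrt n))) * mills x" by (simp add: algebra_simps)
  also have "\<dots> \<le> (125732 * (K\<^sup>2 * err) + 433 * (K\<^sup>2 * err) + 18112 * (K\<^sup>2 * err)) * mills x"
  proof (intro mult_right_mono add_mono mult_left_mono)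
    have "a\<^sup>2 = K\<^sup>2 * (x ^ 4 / n)" unfolding xh_small(1) a_def by (simp add: power_mult_distrib)
    also have "\<dots> \<le> K\<^sup>2 * err" by (intro mult_left_mono err_parts) auto
    finally show "a\<^sup>2 \<le> K\<^sup>2 * err" .
    have "1 * b \<le> K\<^sup>2 * err" using K_le_K2 err_parts b_nonneg by (intro mult_mono) auto
    then show "b \<le> K\<^sup>2 * err" by simp
    show "K * (x / sqrt n) \<le> K\<^sup>2 * err" using K_le_K2 err_parts x K_ge_1 by (intro mult_mono) auto
  qed (use mx in auto)
  also have "\<dots> = 144277 * (K\<^sup>2 * err * mills x)" by simp
  also have "\<dots> \<le> 150000 * (K\<^sup>2 * err * mills x)" using mx err_parts(6) by (intro mult_right_mono) auto
  finally show ?thesis by simp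
qed

text \<open>n * ln m is n * (m - 1) up to O(n * (m - 1)^2). Since n * h^3 = x^3 / sqrt n, the cubic
  term of m gives the skewness exponent; the bias term n * h * mean has size x * b, and the rest is
  O(K * x^4 / n + x * b). The last bound holds because h * K \<le> 1 / 100000 keeps the skewness
  exponent below x^2 / 272.\<close>

lemma m_power:
  obtains r where "m ^ n = exp (- (x ^ 3 * \<gamma>) / (3 * sqrt n)) * exp r" "\<bar>r\<bar> \<le> 14 * K * err" "\<bar>r\<bar> \<le> 3"
    "exp (- x\<^sup>2 / 272) * exp r \<le> m ^ n"
proof -
  define t where "t = m - 1"
  have tb: "\<bar>t\<bar> \<le> h * \<bar>mean\<bar> + 130 * h ^ 3 * K" using m_bounds(3) by (simp add: t_def)
  have h2: "h * \<bar>mean\<bar> \<le> 1 * (1 / 100)" using h_pos h_le(2) mean_le(1) by (intro mult_mono) auto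
  have h3: "h\<^sup>2 \<le> 1" using h_pos h_le(2) by (intro power_le_one) auto
  have t1: "\<bar>t\<bar> \<le> 1/2" using tb h2 h3 pow_h(1) by linarith
  define r where "r = n * ln m + x ^ 3 * \<gamma> / (3 * sqrt n)"
  have mpos: "0 < m" using m_bounds(1) by linarith
  have "\<bar>ln (1 + t) - t\<bar> \<le> 2 * t\<^sup>2" using t1 by (rule abs_ln_one_plus_x_minus_x_bound)
  then have l: "\<bar>ln m - t\<bar> \<le> 2 * t\<^sup>2" by (simp add: t_def)
  have "t\<^sup>2 \<le> (h * \<bar>mean\<bar> + 130 * h ^ 3 * K)\<^sup>2" using tb h_pos K_ge_1 by (subst abs_le_square_iff[symmetric]) auto
  also have "\<dots> \<le> 2 * (h * \<bar>mean\<bar>)\<^sup>2 + 2 * (130 * h ^ 3 * K)\<^sup>2" using zero_le_power2[of "h * \<bar>mean\<bar> - 130 * h ^ 3 * K"] by (simp add: power2_sum power2_diff)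
  also have "\<dots> = 2 * (h\<^sup>2 * \<bar>mean\<bar>\<^sup>2) + 33800 * (h ^ 4 * (h * K)\<^sup>2)" by (simp add: power_mult_distrib power2_eq_square eval_nat_numeral)
  finally have "n * t\<^sup>2 \<le> n * (2 * (h\<^sup>2 * \<bar>mean\<bar>\<^sup>2) + 33800 * (h ^ 4 * (h * K)\<^sup>2))" by (intro mult_left_mono) auto
  also have "\<dots> = 2 * (n * h\<^sup>2 * \<bar>mean\<bar>\<^sup>2) + 33800 * (n * h ^ 4 * (h * K)\<^sup>2)" by (simp add: algebra_simps)
  finally have n0: "n * t\<^sup>2 \<le> 2 * (n * h\<^sup>2 * \<bar>mean\<bar>\<^sup>2) + 33800 * (n * h ^ 4 * (h * K)\<^sup>2)" .
  have nh4: "n * h ^ 4 = x ^ 4 / n"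
  proof -
    have "n * h ^ 4 = (n * h\<^sup>2)\<^sup>2 / n" using n by (simp add: power2_eq_square power4_eq_xxxx)
    then show ?thesis unfolding scale(1) by simp
  qed
  have n1: "n * h\<^sup>2 * \<bar>mean\<bar>\<^sup>2 \<le> x * b * (1 / 100)"
  proof -
    have "n * h\<^sup>2 * \<bar>mean\<bar>\<^sup>2 = (x * \<bar>mean\<bar>) * (x * \<bar>mean\<bar>)" unfolding scale(1) by (simp add: power2_eq_square)
    also have "\<dots> \<le> (x * b) * (1 / 100)"
    proof (rule mult_mono)
      show "x * \<bar>mean\<bar> \<le> 1 / 100" using mult_right_mono[OF x_le, of "\<bar>mean\<bar>"] bias by simp
      show "x * \<bar>mean\<bar> \<le> x * b" unfolding b_def using mean_le(2) x by (intro mult_left_mono) auto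
    qed (use x b_nonneg in auto)
    finally show ?thesis .
  qed
  have n2: "x ^ 4 / n * (h * K)\<^sup>2 \<le> x ^ 4 / n * (1 / 100000)"
  proof (intro mult_left_mono)
    have "h * K * (h * K) \<le> 1 * (1 / 100000)" using hK h_pos K_ge_1 by (intro mult_mono) auto
    then show "(h * K)\<^sup>2 \<le> 1 / 100000" by (simp add: power2_eq_square)
  qed auto
  have "n * t\<^sup>2 \<le> 2 * (x * b * (1 / 100)) + 33800 * (x ^ 4 / n * (1 / 100000))"
    by (rule order_trans[OF n0[unfolded nh4]]) (intro add_mono mult_left_mono n1 n2; simp)
  also have "\<dots> \<le> x * b / 50 + x ^ 4 / n"
  proof -
    have *: "2 * (y * (1 / 100)) + 33800 * (z * (1 / 100000)) \<le> y / 50 + z" if "0 \<le> z" for y z :: real using that by linarith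
    show ?thesis by (rule *) simp
  qed
  finally have nt: "n * t\<^sup>2 \<le> x * b / 50 + x ^ 4 / n" .
  have r: "\<bar>r\<bar> \<le> 12 * (K * (x ^ 4 / n)) + 2 * (x * b)"
  proof -
    define q where "q = m - (1 + h * mean - h ^ 3 * \<gamma> / 3)"
    have q: "\<bar>q\<bar> \<le> 10 * h ^ 4 * K" unfolding q_def by (rule m_expansion)
    have nq: "n * \<bar>q\<bar> \<le> 10 * (K * (x ^ 4 / n))"
    proof -
      have "n * \<bar>q\<bar> \<le> n * (10 * h ^ 4 * K)" using q by (intro mult_left_mono) auto
      also have "\<dots> = 10 * (K * (n * h ^ 4))" by simp
      finally show ?thesis unfolding nh4 .
    qed
    have nh3: "n * h ^ 3 = x ^ 3 / sqrt n"
    proof -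
      have "n * h ^ 3 = (n * h\<^sup>2) * h" by (simp add: power2_eq_square power3_eq_cube)
      then show ?thesis unfolding scale(1) by (simp add: h power2_eq_square power3_eq_cube)
    qed
    have "n * t = (n * h) * mean - (n * h ^ 3) * \<gamma> / 3 + n * q" unfolding t_def q_def by (simp add: algebra_simps)
    then have "r = n * (ln m - t) + (n * h) * mean + n * q" unfolding r_def nh3 by (simp add: algebra_simps)
    moreover have "\<bar>(n * h) * mean\<bar> = x * b" unfolding scale(2) b_def using x by (simp add: abs_mult)
    moreover have "\<bar>n * (ln m - t)\<bar> \<le> 2 * (n * t\<^sup>2)" unfolding abs_mult using mult_left_mono[OF l, of "real n"] by (simp add: mult_ac)
    moreover have "\<bar>n * q\<bar> = n * \<bar>q\<bar>" by (simp add: abs_mult)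
    moreover have "1 * (x ^ 4 / n) \<le> K * (x ^ 4 / n)" using K_ge_1 by (intro mult_right_mono) auto
    moreover have "0 \<le> x * b" using x b_nonneg by simp
    ultimately show ?thesis using nt nq by linarith
  qed
  show thesis
  proof (rule that[of r])
    have "m ^ n = exp (n * ln m)" using mpos by (simp add: exp_of_nat_mult)
    then show e: "m ^ n = exp (- (x ^ 3 * \<gamma>) / (3 * sqrt n)) * exp r" unfolding exp_add[symmetric] r_def by simp
    have "1 * (x * b) \<le> K * err" using K_ge_1 err_parts x b_nonneg by (intro mult_mono) auto
    moreover have "K * (x ^ 4 / n) \<le> K * err" using K_ge_1 by (intro mult_left_mono err_parts) auto
    ultimately show "\<bar>r\<bar> \<le> 14 * K * err" using r by linarith
    have "K * (x ^ 4 / n) \<le> 1 / 100" using xh_small(2) by simp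
    moreover have "x * b \<le> 1" using xbias by (simp add: b_def mult_ac)
    ultimately show "\<bar>r\<bar> \<le> 3" using r by linarith
    have "x ^ 3 * \<gamma> / (3 * sqrt n) \<le> x\<^sup>2 / 272"
    proof -
      have g: "\<bar>\<gamma>\<bar> \<le> K"
        by (rule order_trans[OF integral_abs_bound]) (use X3 in \<open>simp add: power_abs\<close>)
      have "x ^ 3 * \<gamma> / (3 * sqrt n) = x\<^sup>2 * (h * \<gamma>) / 3" by (simp add: h power2_eq_square power3_eq_cube)
      also have "h * \<gamma> \<le> h * K" using g h_pos by (intro mult_left_mono) auto
      also have "\<dots> \<le> 1 / 100000" by (rule hK)
      finally have "x ^ 3 * \<gamma> / (3 * sqrt n) \<le> x\<^sup>2 * (1 / 100000) / 3" by (simp add: mult_left_mono divide_right_mono)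
      also have "\<dots> \<le> x\<^sup>2 / 272" by simp
      finally show ?thesis .
    qed
    then show "exp (- x\<^sup>2 / 272) * exp r \<le> m ^ n" unfolding e by simp
  qed
qed

text \<open>As R \<ge> 0, the linear event is contained in the exceedance event, so P lies between
  P0 and P0 + P1 + P2. P0 is an exponentially weighted half-line expectation of a nearly normal sum,
  P1 the loss by linearisation, P2 the atypical self-normalizers.\<close>

theorem self_normalized_tail:
  defines "main \<equiv> (1 - Phi x) * exp (- (x ^ 3 * \<gamma>) / (3 * sqrt n))"
  shows "\<bar>measure (Pn n) {p \<in> space (Pn n). x * sqrt (Vn n p) < Sn n p} - main\<bar> \<le> main * (2 * 10 ^ 16 * K\<^sup>2 * err)"
proof -
  interpret PP: prob_space "Pn n" by (rule prob_space_iid)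
  obtain r where r: "m ^ n = exp (- (x ^ 3 * \<gamma>) / (3 * sqrt n)) * exp r" "\<bar>r\<bar> \<le> 14 * K * err" "\<bar>r\<bar> \<le> 3"
    "exp (- x\<^sup>2 / 272) * exp r \<le> m ^ n" by (rule m_power)
  define P where "P = measure (Pn n) {p \<in> space (Pn n). x * sqrt (Vn n p) < Sn n p}"
  define P0 where "P0 = measure (Pn n) {p \<in> space (Pn n). 0 < T' p}"
  define P1 where "P1 = measure (Pn n) {p \<in> space (Pn n). x * sqrt (Vn n p) < Sn n p \<and> T' p \<le> 0 \<and> \<bar>yn n p\<bar> \<le> 1/16}"
  define P2 where "P2 = measure (Pn n) {p \<in> space (Pn n). x * sqrt (Vn n p) < Sn n p \<and> 1/16 < \<bar>yn n p\<bar>}"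
  define mm where "mm = m ^ n * exp (- x\<^sup>2 / 2)"
  define N where "N = (\<integral>p. of_bool (- \<rho> < W p) * exp (- s * (W p + \<rho>)) \<partial>TN)"
  define c where "c = sqrt (2 * pi)"
  have c: "0 < c" "c \<le> 3" unfolding c_def using sqrt_2pi_le by auto
  have mm: "0 < mm" unfolding mm_def using m_bounds(1) by simp
  have preds: "Measurable.pred (Pn n) (\<lambda>p. 0 < T' p)"
     "Measurable.pred (Pn n) (\<lambda>p. x * sqrt (Vn n p) < Sn n p)"
     "Measurable.pred (Pn n) (\<lambda>p. x * sqrt (Vn n p) < Sn n p \<and> T' p \<le> 0 \<and> \<bar>yn n p\<bar> \<le> 1/16)"
     "Measurable.pred (Pn n) (\<lambda>p. x * sqrt (Vn n p) < Sn n p \<and> 1/16 < \<bar>yn n p\<bar>)"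
    by (intro pred_bmeas bn b_T')+
  note ms = preds[unfolded pred_def]
  have R0: "0 \<le> R p" for p by (simp add: R_def)
  have P0P: "P0 \<le> P" unfolding P0_def P_def using ms R0
    by (intro PP.finite_measure_mono) (auto simp: exceed_iff add_pos_nonneg)
  have "P \<le> P0 + (P1 + P2)"
  proof -
    have "P \<le> measure (Pn n) ({p \<in> space (Pn n). 0 < T' p} \<union> ({p \<in> space (Pn n). x * sqrt (Vn n p) < Sn n p \<and> T' p \<le> 0 \<and> \<bar>yn n p\<bar> \<le> 1/16}
       \<union> {p \<in> space (Pn n). x * sqrt (Vn n p) < Sn n p \<and> 1/16 < \<bar>yn n p\<bar>}))"
      unfolding P_def using ms by (intro PP.finite_measure_mono) auto
    also have "\<dots> \<le> P0 + (P1 + P2)" unfolding P0_def P1_def P2_def using ms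
      by (intro order_trans[OF measure_Un_le] add_left_mono) auto
    finally show ?thesis .
  qed
  moreover have P1: "P1 \<le> mm * (3900000 * K\<^sup>2 * x ^ 3 / n + 32000 * K / sqrt n)" unfolding P1_def mm_def by (rule mid_prob)
  moreover have P2: "P2 \<le> mm * (27 * (3 * 10 ^ 11 * K\<^sup>2 / n))"
  proof -
    have "130 * h * K \<le> 1 / 408" using hK by linarith
    moreover have "\<bar>x * sqrt n * mean\<bar> \<le> 1" using xbias x by (simp add: abs_mult)
    ultimately have "P2 \<le> 3 * 10 ^ 11 * K\<^sup>2 / n * exp (- x\<^sup>2 / 2 - x\<^sup>2 / 272)" unfolding P2_def using exceed_outer[OF n x h] by simp
    moreover have "exp (- x\<^sup>2 / 2 - x\<^sup>2 / 272) \<le> 27 * mm"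
    proof -
      have "1 \<le> 27 * exp r"
      proof -
        have "exp (- r) \<le> exp 3" using r(3) by simp
        also note exp_le_numeral(3)
        finally have "exp (- r) * exp r \<le> 27 * exp r" by (intro mult_right_mono) auto
        then show ?thesis by (simp add: exp_add[symmetric])
      qed
      then have "exp (- x\<^sup>2 / 272) * 1 \<le> exp (- x\<^sup>2 / 272) * (27 * exp r)" by (intro mult_left_mono) auto
      also have "\<dots> \<le> 27 * m ^ n" using r(4) by simp
      finally have "exp (- x\<^sup>2 / 2) * exp (- x\<^sup>2 / 272) \<le> exp (- x\<^sup>2 / 2) * (27 * m ^ n)" by (intro mult_left_mono) auto
      then show ?thesis unfolding mm_def exp_add[symmetric] by (simp add: mult_ac)
    qed
    then have "3 * 10 ^ 11 * K\<^sup>2 / n * exp (- x\<^sup>2 / 2 - x\<^sup>2 / 272) \<le> 3 * 10 ^ 11 * K\<^sup>2 / n * (27 * mm)" by (intro mult_left_mono) auto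
    ultimately show ?thesis by (simp add: mult_ac)
  qed
  moreover have P0: "P0 = mm * N"
  proof -
    have "of_bool (0 < T' p) * exp (- T' p) = of_bool (- \<rho> < W p) * exp (- s * (W p + \<rho>))" for p
      unfolding T'_W using s_facts(2) by (simp add: zero_less_mult_iff)
    then show ?thesis unfolding P0_def tilt_event[OF preds(1)] mm_def N_def by simp
  qed
  ultimately have PN: "\<bar>P - mm * N\<bar> \<le> mm * (3900000 * K\<^sup>2 * x ^ 3 / n + 32000 * K / sqrt n) + mm * (27 * (3 * 10 ^ 11 * K\<^sup>2 / n))"
    using P0P by linarith
  have "\<bar>mm * N - mm * (mills x / c)\<bar> \<le> mm * (163200 * K / sqrt n + 150000 * K\<^sup>2 * err * mills x / c)"
  proof -
    have "\<bar>exp (- \<rho>\<^sup>2 / 2) * mills (s - \<rho>) / c - mills x / c\<bar> \<le> 150000 * K\<^sup>2 * err * mills x / c"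
      using mills_ratio c by (simp add: diff_divide_distrib[symmetric] abs_divide divide_right_mono)
    moreover have "\<bar>N - exp (- \<rho>\<^sup>2 / 2) * mills (s - \<rho>) / c\<bar> \<le> 163200 * K / sqrt n" unfolding N_def c_def by (rule normal_part)
    ultimately have "\<bar>N - mills x / c\<bar> \<le> 163200 * K / sqrt n + 150000 * K\<^sup>2 * err * mills x / c" by linarith
    then have "mm * \<bar>N - mills x / c\<bar> \<le> mm * (163200 * K / sqrt n + 150000 * K\<^sup>2 * err * mills x / c)" using mm by (intro mult_left_mono) auto
    then show ?thesis unfolding right_diff_distrib[symmetric] abs_mult abs_of_pos[OF mm] .
  qed
  then have "\<bar>P - mm * (mills x / c)\<bar> \<le> mm * ((163200 * K / sqrt n + 150000 * K\<^sup>2 * err * mills x / c) + (3900000 * K\<^sup>2 * x ^ 3 / n + 32000 * K / sqrt n) + 27 * (3 * 10 ^ 11 * K\<^sup>2 / n))"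
    using PN unfolding distrib_left by linarith
  also have "\<dots> \<le> mm * (150000 * K\<^sup>2 * err * mills x / c + 10 ^ 13 * (K\<^sup>2 * (x ^ 3 / n + 1 / sqrt n)))"
  proof (intro mult_left_mono)
    have 1: "K / sqrt n \<le> K\<^sup>2 / sqrt n" by (intro divide_right_mono K_le_K2) auto
    have "sqrt n \<le> n" using n mult_left_mono[of 1 "sqrt n" "sqrt n"] by simp
    then have 2: "K\<^sup>2 / n \<le> K\<^sup>2 / sqrt n" using n by (intro divide_left_mono) auto
    have 3: "0 \<le> K\<^sup>2 * x ^ 3 / n" "0 \<le> K\<^sup>2 / sqrt n" using x by auto
    have "10 ^ 13 * (K\<^sup>2 * (x ^ 3 / n + 1 / sqrt n)) = 10000000000000 * (K\<^sup>2 * x ^ 3 / n) + 10000000000000 * (K\<^sup>2 / sqrt n)" by (simp add: distrib_left)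
    moreover have "163200 * K / sqrt n = 163200 * (K / sqrt n)" "32000 * K / sqrt n = 32000 * (K / sqrt n)" "3900000 * K\<^sup>2 * x ^ 3 / n = 3900000 * (K\<^sup>2 * x ^ 3 / n)"
      "27 * (3 * 10 ^ 11 * K\<^sup>2 / n) = 8100000000000 * (K\<^sup>2 / n)" by simp_all
    ultimately show "(163200 * K / sqrt n + 150000 * K\<^sup>2 * err * mills x / c) + (3900000 * K\<^sup>2 * x ^ 3 / n + 32000 * K / sqrt n) + 27 * (3 * 10 ^ 11 * K\<^sup>2 / n)
       \<le> 150000 * K\<^sup>2 * err * mills x / c + 10 ^ 13 * (K\<^sup>2 * (x ^ 3 / n + 1 / sqrt n))"
      using 1 2 3 by linarith
  qed (use mm in auto)
  also have "\<dots> \<le> mm * (mills x / c) * (2 * 10 ^ 14 * K\<^sup>2 * err)"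
  proof -
    \<comment> \<open>The Mills ratio is at least 1 / (2 * (1 + x)), so an absolute error becomes
      relative at the price 1 + x. This produces the term (1 + x) / sqrt n, and from x^3 / n the
      term (1 + x^4) / n.\<close>
    have "1 \<le> (6 * (1 + x)) * (mills x / c)"
    proof -
      have "1 \<le> 2 * (1 + x) * mills x" using mills_ge[of x] x by (simp add: divide_le_eq mult_ac)
      then have "c \<le> 3 * (2 * (1 + x) * mills x)" using c by linarith
      then show ?thesis using c by (simp add: le_divide_eq mult_ac)
    qed
    then have "10 ^ 13 * (K\<^sup>2 * (x ^ 3 / n + 1 / sqrt n)) * 1 \<le> 10 ^ 13 * (K\<^sup>2 * (x ^ 3 / n + 1 / sqrt n)) * ((6 * (1 + x)) * (mills x / c))"
      using x by (intro mult_left_mono) auto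
    also have "\<dots> = 6 * 10 ^ 13 * K\<^sup>2 * (mills x / c) * ((1 + x) * (x ^ 3 / n + 1 / sqrt n))" by simp
    also have "\<dots> \<le> 6 * 10 ^ 13 * K\<^sup>2 * (mills x / c) * (2 * err)" using mills_pos[of x] c by (intro mult_left_mono err_parts) auto
    also have "\<dots> = 120000000000000 * (K\<^sup>2 * err * (mills x / c))" by (simp add: mult_ac)
    finally have "10 ^ 13 * (K\<^sup>2 * (x ^ 3 / n + 1 / sqrt n)) \<le> 120000000000000 * (K\<^sup>2 * err * (mills x / c))" by simp
    moreover have "150000 * K\<^sup>2 * err * mills x / c = 150000 * (K\<^sup>2 * err * (mills x / c))" by simp
    ultimately have "150000 * K\<^sup>2 * err * mills x / c + 10 ^ 13 * (K\<^sup>2 * (x ^ 3 / n + 1 / sqrt n)) \<le> (120000000150000) * (K\<^sup>2 * err * (mills x / c))" by linarith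
    also have "\<dots> \<le> (2 * 10 ^ 14) * (K\<^sup>2 * err * (mills x / c))" using mills_pos[of x] c err_parts(6) by (intro mult_right_mono) auto
    finally have "mm * (150000 * K\<^sup>2 * err * mills x / c + 10 ^ 13 * (K\<^sup>2 * (x ^ 3 / n + 1 / sqrt n))) \<le> mm * ((2 * 10 ^ 14) * (K\<^sup>2 * err * (mills x / c)))"
      using mm by (intro mult_left_mono) auto
    also have "\<dots> = mm * (mills x / c) * (2 * 10 ^ 14 * K\<^sup>2 * err)" by simp
    finally show ?thesis .
  qed
  finally have F: "\<bar>P - mm * (mills x / c)\<bar> \<le> mm * (mills x / c) * (2 * 10 ^ 14 * K\<^sup>2 * err)" .
  have "1 - Phi x = mills x * gauss x" unfolding mills_def using gauss_pos[of x] by simp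
  also have "\<dots> = mills x / c * exp (- x\<^sup>2 / 2)" unfolding c_def std_normal_density_def by simp
  finally have mains: "mm * (mills x / c) = main * exp r" unfolding main_def mm_def r(1) by simp
  have main0: "0 \<le> main" unfolding main_def using Phi_less_1[of x] by simp
  have er: "exp r \<le> 27"
  proof -
    have "exp r \<le> exp 3" using r(3) by simp
    then show ?thesis using exp_le_numeral(3) by linarith
  qed
  have er1: "\<bar>exp r - 1\<bar> \<le> 378 * K\<^sup>2 * err"
  proof -
    have "\<bar>exp r - 1\<bar> \<le> exp \<bar>r\<bar> * \<bar>r\<bar>" using exp_taylor_bound[of r 1] by simp
    also have "\<dots> \<le> 27 * (14 * K * err)"
    proof (intro mult_mono r(2))
      have "exp \<bar>r\<bar> \<le> exp 3" using r(3) by simp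
      then show "exp \<bar>r\<bar> \<le> 27" using exp_le_numeral(3) by linarith
    qed auto
    also have "\<dots> \<le> 27 * (14 * K\<^sup>2 * err)" using K_le_K2 err_parts(6) by (intro mult_left_mono mult_right_mono) auto
    finally show ?thesis by simp
  qed
  have "\<bar>P - main\<bar> \<le> \<bar>P - main * exp r\<bar> + \<bar>main * (exp r - 1)\<bar>" by (simp add: right_diff_distrib)
  also have "\<dots> \<le> main * 27 * (2 * 10 ^ 14 * K\<^sup>2 * err) + main * (378 * K\<^sup>2 * err)"
  proof (intro add_mono)
    have "main * exp r * (2 * 10 ^ 14 * K\<^sup>2 * err) \<le> main * 27 * (2 * 10 ^ 14 * K\<^sup>2 * err)" using er main0 err_parts(6) by (intro mult_left_mono mult_right_mono) auto
    then show "\<bar>P - main * exp r\<bar> \<le> main * 27 * (2 * 10 ^ 14 * K\<^sup>2 * err)" using F unfolding mains by linarith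
    show "\<bar>main * (exp r - 1)\<bar> \<le> main * (378 * K\<^sup>2 * err)" unfolding abs_mult using er1 main0 by (simp add: mult_left_mono)
  qed
  also have "\<dots> = 5400000000000378 * (main * (K\<^sup>2 * err))" by simp
  also have "\<dots> \<le> 2 * 10 ^ 16 * (main * (K\<^sup>2 * err))" using main0 err_parts(6) by (intro mult_right_mono) auto
  finally show ?thesis unfolding P_def by (simp add: mult_ac)
qed

end

section \<open>Trimming\<close>

text \<open>The lower bounds on \<open>\<tau>\<close> ensure that trimming removes at most half of the variance.\<close>

locale trimmed = prob_space D for D :: "real measure" +
  fixes \<mu> \<sigma> m \<tau> :: real
  assumes D_borel: "sets D = sets borel" and int4: "integrable D (\<lambda>y. y ^ 4)"
    and mu: "\<mu> = (\<integral>y. y \<partial>D)" and var: "(\<integral>y. (y - \<mu>)\<^sup>2 \<partial>D) = \<sigma>\<^sup>2" and m4: "(\<integral>y. y ^ 4 \<partial>D) \<le> m" and m1: "1 \<le> m"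
    and \<sigma>: "0 < \<sigma>" and \<tau>1: "1 \<le> \<tau>" and \<tau>2: "34 * m / \<sigma>\<^sup>2 \<le> \<tau>"
begin

lemma meas: "f \<in> borel_measurable borel \<Longrightarrow> f \<in> borel_measurable D"
  using D_borel measurable_cong_sets by blast

lemma dominated:
  assumes "f \<in> borel_measurable borel" "\<And>y. \<bar>f y\<bar> \<le> C * (1 + y ^ 4)"
  shows "integrable D f"
proof (rule Bochner_Integration.integrable_bound)
  show "integrable D (\<lambda>y. C * (1 + y ^ 4))" using int4 by simp
  show "AE y in D. norm (f y) \<le> norm (C * (1 + y ^ 4))"
  proof (rule AE_I2)
    fix y show "norm (f y) \<le> norm (C * (1 + y ^ 4))" using assms(2)[of y] abs_ge_self[of "C * (1 + y ^ 4)"] by simp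
  qed
qed (rule meas[OF assms(1)])

lemma power_le_1_power4: "k \<le> 4 \<Longrightarrow> \<bar>y\<bar> ^ k \<le> 1 + (y::real) ^ 4"
proof (cases "\<bar>y\<bar> \<le> 1")
  case True then show ?thesis using power_le_one[of "\<bar>y\<bar>" k] zero_le_even_power[of 4 y] by (simp add: add_increasing2)
next
  case False
  assume "k \<le> 4" then show ?thesis using power_increasing[of k 4 "\<bar>y\<bar>"] False by simp
qed

lemma power4_diff: "(y - c) ^ 4 \<le> 8 * y ^ 4 + 8 * (c::real) ^ 4"
proof -
  have "(y - c)\<^sup>2 \<le> 2 * y\<^sup>2 + 2 * c\<^sup>2" using zero_le_power2[of "y + c"] by (simp add: power2_sum power2_diff)
  then have "((y - c)\<^sup>2)\<^sup>2 \<le> (2 * y\<^sup>2 + 2 * c\<^sup>2)\<^sup>2" by (intro power_mono) auto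
  also have "\<dots> \<le> 8 * (y\<^sup>2)\<^sup>2 + 8 * (c\<^sup>2)\<^sup>2" using zero_le_power2[of "2 * y\<^sup>2 - 2 * c\<^sup>2"] by (simp add: power2_sum power2_diff power_mult_distrib)
  finally show ?thesis by simp
qed

lemma int_power: "k \<le> 4 \<Longrightarrow> integrable D (\<lambda>y. y ^ k)"
  by (rule dominated[where C=1]) (auto simp: power_abs power_le_1_power4)

lemma int_centered: assumes "k \<le> 4" shows "integrable D (\<lambda>y. (y - \<mu>) ^ k)"
proof (rule dominated[where C="8 + 8 * \<mu> ^ 4"])
  fix y
  have "\<bar>y - \<mu>\<bar> ^ k \<le> 1 + (y - \<mu>) ^ 4" by (rule power_le_1_power4[OF assms])
  also have "\<dots> \<le> 1 + (8 * y ^ 4 + 8 * \<mu> ^ 4)" using power4_diff by simp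
  also have "\<dots> \<le> (8 + 8 * \<mu> ^ 4) * (1 + y ^ 4)" by (simp add: distrib_left distrib_right)
  finally show "\<bar>(y - \<mu>) ^ k\<bar> \<le> (8 + 8 * \<mu> ^ 4) * (1 + y ^ 4)" by (simp add: power_abs)
qed measurable

lemma \<mu>4: "\<mu> ^ 4 \<le> m" and fourth_moment_ge: "\<sigma> ^ 4 \<le> (\<integral>y. y ^ 4 \<partial>D)"
proof -
  define e where "e = (\<integral>y. y\<^sup>2 \<partial>D)"
  have "(\<integral>y. (y - \<mu>)\<^sup>2 \<partial>D) = e - \<mu>\<^sup>2"
    using int_power[of 1] int_power[of 2] unfolding power2_diff by (simp add: e_def mu[symmetric] prob_space) (simp add: power2_eq_square)
  then have "\<mu>\<^sup>2 \<le> e" "\<sigma>\<^sup>2 \<le> e" using var zero_le_power2[of \<sigma>] zero_le_power2[of \<mu>] by linarith+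
  then have *: "(\<mu>\<^sup>2)\<^sup>2 \<le> e\<^sup>2" "(\<sigma>\<^sup>2)\<^sup>2 \<le> e\<^sup>2" by (intro power_mono; auto)+
  have "e\<^sup>2 \<le> (\<integral>y. y ^ 4 \<partial>D)"
  proof -
    have "0 \<le> (\<integral>y. (y\<^sup>2 - e)\<^sup>2 \<partial>D)" by simp
    also have "\<dots> = (\<integral>y. y ^ 4 \<partial>D) - e\<^sup>2"
      using int_power[of 4] int_power[of 2] unfolding power2_diff by (simp add: prob_space e_def[symmetric]) (simp add: power2_eq_square)
    finally show ?thesis by simp
  qed
  then show "\<mu> ^ 4 \<le> m" "\<sigma> ^ 4 \<le> (\<integral>y. y ^ 4 \<partial>D)" using * m4 by simp_all
qed

lemma centered4: "(\<integral>y. (y - \<mu>) ^ 4 \<partial>D) \<le> 16 * m"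
proof -
  have "(\<integral>y. (y - \<mu>) ^ 4 \<partial>D) \<le> (\<integral>y. 8 * y ^ 4 + 8 * \<mu> ^ 4 \<partial>D)"
    using int4 by (intro integral_mono int_centered power4_diff) auto
  also have "\<dots> = 8 * (\<integral>y. y ^ 4 \<partial>D) + 8 * \<mu> ^ 4" using int4 by (simp add: prob_space)
  finally show ?thesis using m4 \<mu>4 by simp
qed

text \<open>A trimmed observation becomes 0 and not - \<mu>, so it contributes to neither sum,
  exactly as if its index were left out.\<close>

definition Z where "Z y = (if \<bar>y\<bar> \<le> \<tau> then y - \<mu> else 0)"

lemma Z_meas [measurable]: "Z \<in> borel_measurable borel" unfolding Z_def[abs_def] by measurable

lemma b_Z: "bmeas D Z"
proof (rule bmeasI[where B="\<tau> + \<bar>\<mu>\<bar>"])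
  show "Z \<in> borel_measurable D" by (rule meas) measurable
  fix y show "\<bar>Z y\<bar> \<le> \<tau> + \<bar>\<mu>\<bar>" using \<tau>1 by (auto simp: Z_def)
qed

lemma int_Z: "integrable D (\<lambda>y. Z y ^ k)" by (intro bmeas_integrable bmeas_power b_Z)

lemma tail_bound:
  assumes "\<tau> < \<bar>y\<bar>" shows "1 \<le> \<bar>y\<bar> ^ k / \<tau> ^ k"
  using assms \<tau>1 power_mono[of \<tau> "\<bar>y\<bar>" k] by simp

lemma mixed_power_le: "\<bar>a\<bar> ^ j * \<bar>b\<bar> ^ k \<le> a ^ 4 + (b::real) ^ 4" if "j + k = 4"
proof -
  have "\<bar>a\<bar> ^ j * \<bar>b\<bar> ^ k \<le> max \<bar>a\<bar> \<bar>b\<bar> ^ j * max \<bar>a\<bar> \<bar>b\<bar> ^ k" by (intro mult_mono power_mono) auto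
  also have "\<dots> = max \<bar>a\<bar> \<bar>b\<bar> ^ 4" using that by (simp add: power_add[symmetric])
  also have "\<dots> \<le> a ^ 4 + b ^ 4" by (auto simp: max_def)
  finally show ?thesis .
qed

text \<open>Outside the trimming range 1 \<le> |y|^k / \<tau>^k, so the lost part of the j-th moment
  is a mixed fourth moment over \<tau>^k. It is used for the bias (j = 1), the variance (j = 2) and
  the skewness (j = 3); 17 = 16 + 1 for the centred and the raw fourth moment.\<close>

lemma trim_error:
  assumes jk: "j + k = 4" "1 \<le> j"
  shows "\<bar>(\<integral>y. (y - \<mu>) ^ j \<partial>D) - (\<integral>y. Z y ^ j \<partial>D)\<bar> \<le> 17 * m / \<tau> ^ k"
proof -
  have j: "j \<le> 4" using jk by simp
  have "\<bar>(\<integral>y. (y - \<mu>) ^ j \<partial>D) - (\<integral>y. Z y ^ j \<partial>D)\<bar> = \<bar>\<integral>y. (y - \<mu>) ^ j - Z y ^ j \<partial>D\<bar>"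
    using int_centered[OF j] int_Z by simp
  also have "\<dots> \<le> (\<integral>y. \<bar>(y - \<mu>) ^ j - Z y ^ j\<bar> \<partial>D)" by (rule integral_abs_bound)
  also have "\<dots> \<le> (\<integral>y. ((y - \<mu>) ^ 4 + y ^ 4) / \<tau> ^ k \<partial>D)"
  proof (rule integral_mono)
    show "integrable D (\<lambda>y. \<bar>(y - \<mu>) ^ j - Z y ^ j\<bar>)" using int_centered[OF j] int_Z by simp
    show "integrable D (\<lambda>y. ((y - \<mu>) ^ 4 + y ^ 4) / \<tau> ^ k)" using int_centered[of 4] int4 by simp
    fix y
    show "\<bar>(y - \<mu>) ^ j - Z y ^ j\<bar> \<le> ((y - \<mu>) ^ 4 + y ^ 4) / \<tau> ^ k"
    proof (cases "\<bar>y\<bar> \<le> \<tau>")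
      case True then show ?thesis using \<tau>1 by (simp add: Z_def)
    next
      case False
      then have "\<bar>(y - \<mu>) ^ j - Z y ^ j\<bar> = \<bar>y - \<mu>\<bar> ^ j * 1" using jk by (simp add: Z_def power_abs zero_power)
      also have "\<dots> \<le> \<bar>y - \<mu>\<bar> ^ j * (\<bar>y\<bar> ^ k / \<tau> ^ k)" using False by (intro mult_left_mono tail_bound) auto
      also have "\<dots> = (\<bar>y - \<mu>\<bar> ^ j * \<bar>y\<bar> ^ k) / \<tau> ^ k" by simp
      also have "\<dots> \<le> ((y - \<mu>) ^ 4 + y ^ 4) / \<tau> ^ k" using \<tau>1 by (intro divide_right_mono mixed_power_le jk) auto
      finally show ?thesis .
    qed
  qed
  also have "\<dots> = ((\<integral>y. (y - \<mu>) ^ 4 \<partial>D) + (\<integral>y. y ^ 4 \<partial>D)) / \<tau> ^ k" using int_centered[of 4] int4 by simp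
  also have "\<dots> \<le> (17 * m) / \<tau> ^ k" using centered4 m4 \<tau>1 by (intro divide_right_mono) auto
  finally show ?thesis .
qed

lemma Z_mean: "\<bar>\<integral>y. Z y \<partial>D\<bar> \<le> 17 * m / \<tau> ^ 3"
proof -
  have "(\<integral>y. y - \<mu> \<partial>D) = 0" using int_power[of 1] by (simp add: prob_space mu)
  then show ?thesis using trim_error[of 1 3] by simp
qed

definition s where "s = sqrt (\<integral>y. (Z y)\<^sup>2 \<partial>D)"

lemma s_bounds: "\<sigma>\<^sup>2 - s\<^sup>2 \<le> 17 * m / \<tau>\<^sup>2" "\<sigma>\<^sup>2 / 2 \<le> s\<^sup>2" "s \<le> \<sigma>" "\<sigma> / 2 \<le> s" "0 < s" "s\<^sup>2 = (\<integral>y. (Z y)\<^sup>2 \<partial>D)"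
proof -
  show s2: "s\<^sup>2 = (\<integral>y. (Z y)\<^sup>2 \<partial>D)" unfolding s_def by simp
  have "\<bar>\<sigma>\<^sup>2 - s\<^sup>2\<bar> \<le> 17 * m / \<tau>\<^sup>2" using trim_error[of 2 2] var s2 by simp
  then show 1: "\<sigma>\<^sup>2 - s\<^sup>2 \<le> 17 * m / \<tau>\<^sup>2" by linarith
  have "34 * m / \<sigma>\<^sup>2 \<le> \<tau>\<^sup>2" using \<tau>2 \<tau>1 power_increasing[of 1 2 \<tau>] by simp
  then have "17 * m / \<tau>\<^sup>2 \<le> \<sigma>\<^sup>2 / 2" using \<sigma> \<tau>1 by (simp add: field_simps)
  then show 2: "\<sigma>\<^sup>2 / 2 \<le> s\<^sup>2" using 1 by linarith
  have s0: "0 \<le> s" unfolding s_def by simp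
  have "(\<sigma> / 2)\<^sup>2 \<le> s\<^sup>2" using 2 by (simp add: power_divide) (smt (verit) zero_le_power2)
  then show 3: "\<sigma> / 2 \<le> s" using s0 by (rule power2_le_imp_le)
  then show "0 < s" using \<sigma> by simp
  have "s\<^sup>2 \<le> \<sigma>\<^sup>2" unfolding s2 var[symmetric]
    using int_Z int_centered[of 2] by (intro integral_mono) (auto simp: Z_def)
  then show "s \<le> \<sigma>" using \<sigma> by (intro power2_le_imp_le[of s \<sigma>]) auto
qed

lemma Z4: "(\<integral>y. Z y ^ 4 \<partial>D) \<le> 16 * m"
proof -
  have "(\<integral>y. Z y ^ 4 \<partial>D) \<le> (\<integral>y. (y - \<mu>) ^ 4 \<partial>D)"
    using int_Z int_centered[of 4] by (intro integral_mono) (auto simp: Z_def)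
  then show ?thesis using centered4 by simp
qed

lemma third_le: "\<bar>\<integral>y. (y - \<mu>) ^ 3 \<partial>D\<bar> \<le> 17 * m" "\<bar>\<integral>y. Z y ^ 3 \<partial>D\<bar> \<le> 17 * m"
proof -
  have "\<bar>\<integral>y. (y - \<mu>) ^ 3 \<partial>D\<bar> \<le> (\<integral>y. 1 + (y - \<mu>) ^ 4 \<partial>D)"
  proof (rule order_trans[OF integral_abs_bound integral_mono])
    fix y show "\<bar>(y - \<mu>) ^ 3\<bar> \<le> 1 + (y - \<mu>) ^ 4" unfolding power_abs by (rule power_le_1_power4) simp
  qed (use int_centered[of 3] int_centered[of 4] in simp_all)
  also have "\<dots> = 1 + (\<integral>y. (y - \<mu>) ^ 4 \<partial>D)" using int_centered[of 4] by (simp add: prob_space)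
  finally show "\<bar>\<integral>y. (y - \<mu>) ^ 3 \<partial>D\<bar> \<le> 17 * m" using centered4 m1 by linarith
  have "\<bar>\<integral>y. Z y ^ 3 \<partial>D\<bar> \<le> (\<integral>y. 1 + Z y ^ 4 \<partial>D)"
  proof (rule order_trans[OF integral_abs_bound integral_mono])
    fix y show "\<bar>Z y ^ 3\<bar> \<le> 1 + Z y ^ 4" unfolding power_abs by (rule power_le_1_power4) simp
  qed (use int_Z[of 3] int_Z[of 4] in simp_all)
  also have "\<dots> = 1 + (\<integral>y. Z y ^ 4 \<partial>D)" using int_Z by (simp add: prob_space)
  finally show "\<bar>\<integral>y. Z y ^ 3 \<partial>D\<bar> \<le> 17 * m" using Z4 m1 by linarith
qed

text \<open>Numerator and denominator are exchanged one after the other. The variance defect 17 * m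
  / \<tau>^2 is weakened to 17 * m / \<tau>, the rate of the third moment. The constants are 51 = 3
  * 17 from \<sigma>^3 - s^3, 408 = 51 * 2^3 from s \<ge> \<sigma> / 2, and 6936 = 17 * 408.\<close>

lemma skewness_diff:
  "\<bar>(\<integral>y. (y - \<mu>) ^ 3 \<partial>D) / \<sigma> ^ 3 - (\<integral>y. Z y ^ 3 \<partial>D) / s ^ 3\<bar> \<le> (17 * m / \<sigma> ^ 3 + 6936 * m\<^sup>2 / \<sigma> ^ 5) / \<tau>"
proof -
  define a b where "a = (\<integral>y. (y - \<mu>) ^ 3 \<partial>D)" and "b = (\<integral>y. Z y ^ 3 \<partial>D)"
  note sb = s_bounds
  have "a / \<sigma> ^ 3 - b / s ^ 3 = (a - b) / \<sigma> ^ 3 - b * (1 / s ^ 3 - 1 / \<sigma> ^ 3)" by (simp add: diff_divide_distrib right_diff_distrib)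
  then have "\<bar>a / \<sigma> ^ 3 - b / s ^ 3\<bar> \<le> \<bar>(a - b) / \<sigma> ^ 3\<bar> + \<bar>b * (1 / s ^ 3 - 1 / \<sigma> ^ 3)\<bar>" by linarith
  also have "\<bar>(a - b) / \<sigma> ^ 3\<bar> \<le> (17 * m / \<tau>) / \<sigma> ^ 3"
  proof -
    have "\<bar>a - b\<bar> \<le> 17 * m / \<tau>" using trim_error[of 3 1] by (simp add: a_def b_def)
    then have "\<bar>a - b\<bar> / \<sigma> ^ 3 \<le> (17 * m / \<tau>) / \<sigma> ^ 3" using \<sigma> by (intro divide_right_mono) auto
    moreover have "\<bar>(a - b) / \<sigma> ^ 3\<bar> = \<bar>a - b\<bar> / \<sigma> ^ 3" using \<sigma> by (simp add: abs_divide)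
    ultimately show ?thesis by (simp only:)
  qed
  also have "\<bar>b * (1 / s ^ 3 - 1 / \<sigma> ^ 3)\<bar> \<le> 17 * m * (408 * m / (\<sigma> ^ 5 * \<tau>))" unfolding abs_mult
  proof (rule mult_mono)
    show "\<bar>b\<bar> \<le> 17 * m" unfolding b_def by (rule third_le)
    have "s ^ 3 \<le> \<sigma> ^ 3" using sb by (intro power_mono) auto
    then have "\<bar>1 / s ^ 3 - 1 / \<sigma> ^ 3\<bar> = 1 / s ^ 3 - 1 / \<sigma> ^ 3" using sb \<sigma> by (simp add: frac_le)
    also have "\<dots> = (\<sigma> ^ 3 - s ^ 3) / (s ^ 3 * \<sigma> ^ 3)" using sb \<sigma> by (simp add: diff_divide_distrib)
    also have "\<dots> \<le> (51 * m * \<sigma> / \<tau>) / ((\<sigma> / 2) ^ 3 * \<sigma> ^ 3)"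
    proof (rule frac_le)
      have "(\<sigma> - s) * \<sigma> \<le> (\<sigma> - s) * (\<sigma> + s)" using sb by (intro mult_left_mono) auto
      also have "\<dots> = \<sigma>\<^sup>2 - s\<^sup>2" by (simp add: power2_eq_square algebra_simps)
      also have "\<dots> \<le> 17 * m / \<tau>\<^sup>2" by (rule sb)
      also have "\<dots> \<le> 17 * m / \<tau>" using \<tau>1 m1 power_increasing[of 1 2 \<tau>] by (intro divide_left_mono) auto
      finally have 1: "(\<sigma> - s) * \<sigma> \<le> 17 * m / \<tau>" .
      have "s * \<sigma> \<le> \<sigma> * \<sigma>" "s * s \<le> \<sigma> * \<sigma>" using sb \<sigma> by (auto intro: mult_mono)
      then have "\<sigma> * \<sigma> + s * \<sigma> + s * s \<le> 3 * (\<sigma> * \<sigma>)" by linarith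
      then have "(\<sigma> - s) * (\<sigma> * \<sigma> + s * \<sigma> + s * s) \<le> (\<sigma> - s) * (3 * (\<sigma> * \<sigma>))" using sb by (intro mult_left_mono) auto
      also have "\<dots> = ((\<sigma> - s) * \<sigma>) * (3 * \<sigma>)" by simp
      also have "\<dots> \<le> (17 * m / \<tau>) * (3 * \<sigma>)" using \<sigma> by (intro mult_right_mono 1) auto
      finally show "\<sigma> ^ 3 - s ^ 3 \<le> 51 * m * \<sigma> / \<tau>" by (simp add: power3_eq_cube algebra_simps)
      show "(\<sigma> / 2) ^ 3 * \<sigma> ^ 3 \<le> s ^ 3 * \<sigma> ^ 3" using sb \<sigma> by (intro mult_right_mono power_mono) auto
    qed (use \<sigma> m1 \<tau>1 in auto)
    also have "\<dots> = 408 * m / (\<sigma> ^ 5 * \<tau>)" using \<sigma> by (simp add: power_divide eval_nat_numeral)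
    finally show "\<bar>1 / s ^ 3 - 1 / \<sigma> ^ 3\<bar> \<le> 408 * m / (\<sigma> ^ 5 * \<tau>)" .
  qed (use m1 in auto)
  finally have "\<bar>a / \<sigma> ^ 3 - b / s ^ 3\<bar> \<le> (17 * m / \<tau>) / \<sigma> ^ 3 + 17 * m * (408 * m / (\<sigma> ^ 5 * \<tau>))" by simp
  also have "\<dots> = (17 * m / \<sigma> ^ 3 + 6936 * m\<^sup>2 / \<sigma> ^ 5) / \<tau>" by (simp add: add_divide_distrib power2_eq_square mult_ac)
  finally show ?thesis unfolding a_def b_def .
qed

section \<open>Reduction to unit second moment\<close>

definition X where "X y = Z y / s"

lemma unit_sample_X: "unit_sample D X (64 * m / \<sigma> ^ 4)"
proof
  show "bmeas D X" unfolding X_def[abs_def] by (intro bmeas_intros b_Z)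
  show "(\<integral>z. (X z)\<^sup>2 \<partial>D) = 1" unfolding X_def power_divide using s_bounds(5) by (simp add: s_bounds(6)[symmetric])
  have "(\<integral>z. X z ^ 4 \<partial>D) = (\<integral>z. Z z ^ 4 \<partial>D) / s ^ 4" by (simp add: X_def power_divide)
  also have "\<dots> \<le> (16 * m) / (\<sigma> ^ 4 / 4)"
  proof (rule frac_le)
    have "(\<sigma>\<^sup>2 / 2)\<^sup>2 \<le> (s\<^sup>2)\<^sup>2" using s_bounds(2) by (intro power_mono) auto
    then show "\<sigma> ^ 4 / 4 \<le> s ^ 4" by (simp add: power_divide)
  qed (use Z4 m1 \<sigma> in auto)
  finally show "(\<integral>z. X z ^ 4 \<partial>D) \<le> 64 * m / \<sigma> ^ 4" by simp
qed

sublocale U: unit_sample D X "64 * m / \<sigma> ^ 4" by (rule unit_sample_X)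

lemma X_mean: "\<bar>U.mean\<bar> \<le> 34 * m / (\<sigma> * \<tau> ^ 3)"
proof -
  have "\<bar>U.mean\<bar> = \<bar>\<integral>y. Z y \<partial>D\<bar> / s" using s_bounds(5) by (simp add: X_def abs_divide)
  also have "\<dots> \<le> (17 * m / \<tau> ^ 3) / (\<sigma> / 2)" using s_bounds \<sigma> Z_mean m1 \<tau>1 by (intro frac_le) auto
  finally show ?thesis by (simp add: mult_ac)
qed

text \<open>The scale \<open>s\<close> cancels in the quotient, and indices outside the trimming set
  contribute zeros, so the statistic is S / sqrt V over all n indices.\<close>

lemma U_star_iff:
  assumes "0 < x"
  shows "x < U_star \<mu> \<tau> n p \<longleftrightarrow> x * sqrt (U.Vn n p) < U.Sn n p"
proof -
  have t: "(\<Sum>i\<in>trim_set \<tau> n p. f (p i * indicator {t. \<bar>t\<bar> \<le> \<tau>} (p i) - \<mu>)) = (\<Sum>i<n. f (Z (p i)))"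
    if "f 0 = 0" for f :: "real \<Rightarrow> real"
  proof -
    have "(\<Sum>i<n. f (Z (p i))) = (\<Sum>i\<in>trim_set \<tau> n p. f (Z (p i)))"
      by (rule sum.mono_neutral_right) (auto simp: trim_set_def Z_def that)
    also have "\<dots> = (\<Sum>i\<in>trim_set \<tau> n p. f (p i * indicator {t. \<bar>t\<bar> \<le> \<tau>} (p i) - \<mu>))"
      by (intro sum.cong) (auto simp: trim_set_def Z_def)
    finally show ?thesis ..
  qed
  define S V where "S = (\<Sum>i<n. Z (p i))" and "V = (\<Sum>i<n. (Z (p i))\<^sup>2)"
  have U: "U_star \<mu> \<tau> n p = S / sqrt V" unfolding U_star_def S_def V_def using t[of "\<lambda>z. z"] t[of "\<lambda>z. z\<^sup>2"] by simp
  have V0: "0 \<le> V" unfolding V_def by (intro sum_nonneg) auto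
  have 1: "U.Sn n p = S / s" "sqrt (U.Vn n p) = sqrt V / s" unfolding U.Sn_def U.Vn_def S_def V_def X_def
    using s_bounds(5) by (simp_all add: sum_divide_distrib[symmetric] power_divide real_sqrt_divide)
  have "x < S / sqrt V \<longleftrightarrow> x * sqrt V < S"
  proof (cases "V = 0")
    \<comment> \<open>If V = 0 then every summand is 0; the quotient is 0 by convention, and for x >
      0 both inequalities are false.\<close>
    case True
    then have "S = 0" unfolding S_def V_def by (subst (asm) sum_nonneg_eq_0_iff) auto
    then show ?thesis using True assms by simp
  next
    case False
    then show ?thesis using V0 by (simp add: less_divide_eq)
  qed
  then show ?thesis unfolding U 1 using s_bounds(5) by (simp add: field_simps)
qed

lemma trimmed_tail:
  fixes n :: nat and x :: real
  defines "K \<equiv> 64 * m / \<sigma> ^ 4" and "Cd \<equiv> 17 * m / \<sigma> ^ 3 + 6936 * m\<^sup>2 / \<sigma> ^ 5"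
    and "main \<equiv> (1 - Phi x) * exp (- (x ^ 3 * (\<integral>y. (y - \<mu>) ^ 3 \<partial>D)) / (3 * sqrt n * \<sigma> ^ 3))"
    and "e \<equiv> (1 + x ^ 4) / n + (1 + x) * sqrt n / \<tau> ^ 3 + (1 + x) / sqrt n"
  assumes n: "n \<ge> 1" and x: "0 < x" and hK: "x / sqrt n * K \<le> 1 / 100000" and xhK: "x * (x / sqrt n) * K \<le> 1 / 100000"
    and bias: "34 * m / \<sigma> * (sqrt n / \<tau> ^ 3) \<le> 1 / 100" and xbias: "x * (34 * m / \<sigma> * (sqrt n / \<tau> ^ 3)) \<le> 1"
    and xtau: "x * (sqrt n / \<tau> ^ 3) \<le> 1"
  shows "\<bar>measure (U.Pn n) {p \<in> space (U.Pn n). x < U_star \<mu> \<tau> n p} - main\<bar>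
    \<le> main * ((exp Cd * (2 * 10 ^ 16 * K\<^sup>2 * (1 + 34 * m / \<sigma>)) + Cd * exp Cd) * e)"
proof -
  define B where "B = sqrt n / \<tau> ^ 3"
  define A where "A = x ^ 3 / n"
  have B0: "0 \<le> B" unfolding B_def using \<tau>1 by simp
  have A0: "0 \<le> A" unfolding A_def using x by simp
  have n0: "0 < real n" "1 \<le> sqrt n" using n by auto
  have mean_B: "sqrt n * \<bar>U.mean\<bar> \<le> 34 * m / \<sigma> * B"
  proof -
    have "sqrt n * \<bar>U.mean\<bar> \<le> sqrt n * (34 * m / (\<sigma> * \<tau> ^ 3))" by (intro mult_left_mono X_mean) auto
    then show ?thesis unfolding B_def by (simp add: mult_ac)
  qed
  interpret TS: tilted_sample D X "64 * m / \<sigma> ^ 4" n x "x / sqrt n"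
  proof
    show "sqrt n * \<bar>U.mean\<bar> \<le> 1 / 100" using mean_B bias unfolding B_def by linarith
    have "x * (sqrt n * \<bar>U.mean\<bar>) \<le> x * (34 * m / \<sigma> * B)" using x by (intro mult_left_mono mean_B) auto
    also have "\<dots> \<le> 1" using xbias unfolding B_def .
    finally show "x * sqrt n * \<bar>U.mean\<bar> \<le> 1" by (simp add: mult_ac)
  qed (use n x hK xhK in \<open>auto simp: K_def\<close>)
  have e_eq: "e = (1 + x ^ 4) / n + (1 + x) * B + (1 + x) / sqrt n" unfolding e_def B_def by simp
  have e0: "0 \<le> (1 + x ^ 4) / n" "0 \<le> (1 + x) * B" "0 \<le> (1 + x) / sqrt n" using x B0 by auto
  have K0: "0 \<le> K" unfolding K_def using m1 \<sigma> by simp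
  define mX where "mX = (1 - Phi x) * exp (- (x ^ 3 * TS.\<gamma>) / (3 * sqrt n))"
  define P where "P = measure (U.Pn n) {p \<in> space (U.Pn n). x < U_star \<mu> \<tau> n p}"
  define d where "d = x ^ 3 / (3 * sqrt n) * ((\<integral>y. (y - \<mu>) ^ 3 \<partial>D) / \<sigma> ^ 3 - (\<integral>y. Z y ^ 3 \<partial>D) / s ^ 3)"
  have core: "\<bar>P - mX\<bar> \<le> mX * (2 * 10 ^ 16 * K\<^sup>2 * TS.err)"
    using TS.self_normalized_tail unfolding P_def mX_def U_star_iff[OF x] K_def .
  \<comment> \<open>Only the bias term of \<open>TS.err\<close> needs translating: sqrt n * |mean|
    is at most 34 * m / \<sigma> times sqrt n / \<tau>^3.\<close>
  have err_e: "TS.err \<le> (1 + 34 * m / \<sigma>) * e"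
  proof -
    have c: "0 \<le> 34 * m / \<sigma>" using m1 \<sigma> by simp
    have "(1 + x) * TS.b \<le> (1 + x) * (34 * m / \<sigma> * B)" unfolding TS.b_def using x by (intro mult_left_mono mean_B) auto
    moreover have "(1 + x) * (34 * m / \<sigma> * B) = 34 * m / \<sigma> * ((1 + x) * B)" by simp
    moreover have "p + q + r \<le> (1 + c) * (p + t + r)" if "q \<le> c * t" "0 \<le> c" "0 \<le> p" "0 \<le> r" "0 \<le> t" for p q r t c :: real
    proof -
      have "(1 + c) * (p + t + r) = p + t + r + (c * p + c * t + c * r)" by (simp add: algebra_simps)
      moreover have "0 \<le> c * p" "0 \<le> c * r" using that by auto
      ultimately show ?thesis using that by linarith
    qed
    ultimately show ?thesis unfolding TS.err_def e_eq using e0 c by metis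
  qed
  have g: "TS.\<gamma> = (\<integral>y. Z y ^ 3 \<partial>D) / s ^ 3" by (simp add: X_def power_divide)
  have mXd: "mX = main * exp d"
  proof -
    have "- (x ^ 3 * TS.\<gamma>) / (3 * sqrt n) = - (x ^ 3 * (\<integral>y. (y - \<mu>) ^ 3 \<partial>D)) / (3 * sqrt n * \<sigma> ^ 3) + d"
      unfolding d_def g by (simp add: right_diff_distrib)
    then show ?thesis unfolding mX_def main_def by (simp add: exp_add[symmetric])
  qed
  have Cd0: "0 \<le> Cd" unfolding Cd_def using m1 \<sigma> by simp
  have young: "x\<^sup>2 / (sqrt n * \<tau>) \<le> A + B"
  proof (rule power_le_imp_le_base[of _ 2])
    have r3: "sqrt n ^ 3 = n * sqrt n" using n0 by (simp add: power3_eq_cube)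
    have "(x\<^sup>2 / (sqrt n * \<tau>)) ^ Suc 2 = x ^ 6 / (n * sqrt n * \<tau> ^ 3)"
      unfolding power_divide power_mult_distrib using r3 by (simp flip: power_mult add: eval_nat_numeral mult_ac)
    also have "\<dots> = A * A * B"
    proof -
      have "n * sqrt n * (sqrt n) = n * n" using n0 by simp
      then have "1 / (n * sqrt n) = sqrt n / (n * n)" using n0 by (simp add: field_simps)
      then have "x ^ 6 / \<tau> ^ 3 * (1 / (n * sqrt n)) = x ^ 6 / \<tau> ^ 3 * (sqrt n / (n * n))" by simp
      then show ?thesis unfolding A_def B_def by (simp add: eval_nat_numeral mult_ac)
    qed
    also have "\<dots> \<le> (A + B) * (A + B) * (A + B)" using A0 B0 by (intro mult_mono) auto
    finally show "(x\<^sup>2 / (sqrt n * \<tau>)) ^ Suc 2 \<le> (A + B) ^ Suc 2" by (simp add: eval_nat_numeral)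
  qed (use A0 B0 in auto)
  have dd: "\<bar>d\<bar> \<le> Cd * (x * (A + B)) / 3"
  proof -
    have "\<bar>d\<bar> \<le> x ^ 3 / (3 * sqrt n) * (Cd / \<tau>)" unfolding d_def abs_mult Cd_def using x by (intro mult_mono skewness_diff) auto
    also have "\<dots> = Cd * (x * (x\<^sup>2 / (sqrt n * \<tau>))) / 3" by (simp add: power2_eq_square power3_eq_cube mult_ac)
    also have "\<dots> \<le> Cd * (x * (A + B)) / 3" using x Cd0 by (intro divide_right_mono mult_left_mono young) auto
    finally show ?thesis .
  qed
  have xA: "x * A = x ^ 4 / n" unfolding A_def by (simp add: eval_nat_numeral)
  have xA1: "x * A \<le> 1"
  proof -
    have "1 * (x ^ 4 / n) \<le> 64 * m / \<sigma> ^ 4 * (x ^ 4 / n)" using U.K_ge_1 by (intro mult_right_mono) auto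
    then show ?thesis using TS.xh_small(2) unfolding xA by simp
  qed
  have d1: "\<bar>d\<bar> \<le> Cd"
  proof -
    have "x * (A + B) \<le> 3" using xA1 xtau unfolding B_def by (simp add: distrib_left)
    then have "Cd * (x * (A + B)) \<le> Cd * 3" using Cd0 by (intro mult_left_mono) auto
    then show ?thesis using dd by simp
  qed
  have d2: "\<bar>d\<bar> \<le> Cd * e"
  proof -
    have "x * (A + B) \<le> e"
    proof -
      have "x * A \<le> (1 + x ^ 4) / n" unfolding xA by (simp add: divide_right_mono)
      moreover have "x * B \<le> (1 + x) * B" using B0 by (intro mult_right_mono) auto
      ultimately show ?thesis unfolding e_eq using e0 by (simp only: distrib_left)
    qed
    then have "Cd * (x * (A + B)) \<le> Cd * e" using Cd0 by (intro mult_left_mono) auto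
    moreover have "0 \<le> Cd * e" using Cd0 e0 unfolding e_eq by simp
    ultimately show ?thesis using dd by simp
  qed
  have main0: "0 \<le> main" unfolding main_def using Phi_less_1[of x] by simp
  have ed: "exp d \<le> exp Cd" using d1 by simp
  have "\<bar>exp d - 1\<bar> \<le> exp \<bar>d\<bar> * \<bar>d\<bar>" using exp_taylor_bound[of d 1] by simp
  also have "\<dots> \<le> exp Cd * (Cd * e)" using d1 d2 by (intro mult_mono) auto
  finally have ed1: "\<bar>exp d - 1\<bar> \<le> exp Cd * (Cd * e)" .
  have e00: "0 \<le> e" unfolding e_eq using e0 by simp
  have "\<bar>P - main\<bar> \<le> \<bar>P - mX\<bar> + \<bar>main * (exp d - 1)\<bar>" unfolding mXd by (simp add: right_diff_distrib)
  also have "\<dots> \<le> main * exp Cd * (2 * 10 ^ 16 * K\<^sup>2 * ((1 + 34 * m / \<sigma>) * e)) + main * (exp Cd * (Cd * e))"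
  proof (rule add_mono)
    have "mX * (2 * 10 ^ 16 * K\<^sup>2 * TS.err) \<le> main * exp Cd * (2 * 10 ^ 16 * K\<^sup>2 * ((1 + 34 * m / \<sigma>) * e))"
      unfolding mXd using main0 ed err_e TS.err_parts(6) by (intro mult_mono mult_left_mono) auto
    with core show "\<bar>P - mX\<bar> \<le> main * exp Cd * (2 * 10 ^ 16 * K\<^sup>2 * ((1 + 34 * m / \<sigma>) * e))" by (rule order_trans)
    show "\<bar>main * (exp d - 1)\<bar> \<le> main * (exp Cd * (Cd * e))" unfolding abs_mult using main0 ed1 by (simp add: mult_left_mono)
  qed
  also have "\<dots> = main * ((exp Cd * (2 * 10 ^ 16 * K\<^sup>2 * (1 + 34 * m / \<sigma>)) + Cd * exp Cd) * e)" by (simp add: distrib_left distrib_right mult_ac)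
  finally show ?thesis unfolding P_def .
qed

end

section \<open>Choice of the constants and the final estimate\<close>

lemma relative_error_form:
  assumes "0 < main" "0 < e" "\<bar>P - main\<bar> \<le> main * (A * e)"
  shows "\<exists>O1::real. \<bar>O1\<bar> \<le> A \<and> P = main * (1 + O1 * e)"
proof (intro exI[of _ "(P - main) / (main * e)"] conjI)
  have "\<bar>(P - main) / (main * e)\<bar> = \<bar>P - main\<bar> / (main * e)" using assms by (simp add: abs_divide)
  also have "\<dots> \<le> A" using assms by (simp add: divide_le_eq mult_ac)
  finally show "\<bar>(P - main) / (main * e)\<bar> \<le> A" .
  show "P = main * (1 + (P - main) / (main * e) * e)" using assms by (simp add: field_simps)
qed

theorem theorem4p2:
  "\<exists>c1>0. \<forall>(\<sigma>::real) (m3::real) (m4::real). \<sigma> > 0 \<longrightarrow>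
     (\<exists>c2>0. \<exists>A>0. \<forall>D::real measure.
        (prob_space D \<and> sets D = sets borel \<and> integrable D (\<lambda>y. y ^ 4)
         \<and> (let \<mu> = (\<integral>y. y \<partial>D) in
             (\<integral>y. (y - \<mu>)\<^sup>2 \<partial>D) = \<sigma>\<^sup>2
             \<and> (\<integral>y. \<bar>y\<bar> ^ 3 \<partial>D) = m3
             \<and> (\<integral>y. y ^ 4 \<partial>D) = m4)) \<longrightarrow>
        (let \<mu> = (\<integral>y. y \<partial>D); \<kappa>3 = (\<integral>y. (y - \<mu>) ^ 3 \<partial>D) in
         \<forall>(n::nat) (\<tau>::real) (x::real).
           n \<ge> 1 \<longrightarrow>
           \<tau> \<ge> c1 * real n powr (1/6) * max (sqrt m4 / \<sigma>) ((m4 / \<sigma>) powr (1/3)) \<longrightarrow>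
           0 < x \<longrightarrow> x < c2 * min (real n powr (1/4)) (\<tau> ^ 3 * real n powr (-1/2)) \<longrightarrow>
           (\<exists>O1. \<bar>O1\<bar> \<le> A \<and>
              measure (PiM {..<n} (\<lambda>_. D)) {\<omega> \<in> space (PiM {..<n} (\<lambda>_. D)). U_star \<mu> \<tau> n \<omega> > x}
              = (1 - Phi x) * exp (- (x ^ 3 * \<kappa>3) / (3 * sqrt (real n) * \<sigma> ^ 3))
                * (1 + O1 * ((1 + x ^ 4) / real n + (1 + x) * sqrt (real n) / \<tau> ^ 3
                             + (1 + x) / sqrt (real n))))))"
proof (rule exI[of _ 1], rule conjI, simp, intro allI impI)
  fix \<sigma> m3 m4 :: real assume \<sigma>: "0 < \<sigma>"
  \<comment> \<open>Replacing the fourth moment by an upper bound that is at least 1 lets additive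
    constants be absorbed into multiples of m.\<close>
  define m where "m = max m4 1"
  define K where "K = 64 * m / \<sigma> ^ 4"
  define t0 where "t0 = max 1 (34 * m / \<sigma>\<^sup>2)"
  \<comment> \<open>Threshold for \<tau>^3 / sqrt n: 3400 * m / \<sigma> brings the scaled bias 34 *
    m / \<sigma> * sqrt n / \<tau>^3 down to 1/100, and t0^3 forces \<tau> \<ge> t0.\<close>
  define q0 where "q0 = max (max (3400 * m / \<sigma>) (t0 ^ 3)) 1"
  \<comment> \<open>1 / (100000 * K) serves both smallness conditions on x, \<sigma> / (34 * m)
    keeps x times the scaled bias at most 1, and the bound 1 keeps x * sqrt n / \<tau>^3 at most
    1.\<close>
  define c2 where "c2 = min 1 (min (1 / (100000 * K)) (\<sigma> / (34 * m)))"
  define Cd where "Cd = 17 * m / \<sigma> ^ 3 + 6936 * m\<^sup>2 / \<sigma> ^ 5"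
  \<comment> \<open>A lower bound for the main term over all x \<le> c2 * q0, uniform in n and in
    the law, because the third central moment is at most 17 * m.\<close>
  define L where "L = (1 - Phi (c2 * q0)) * exp (- ((c2 * q0) ^ 3 * (17 * m) / (3 * \<sigma> ^ 3)))"
  define A1 where "A1 = exp Cd * (2 * 10 ^ 16 * K\<^sup>2 * (1 + 34 * m / \<sigma>)) + Cd * exp Cd"
  \<comment> \<open>For \<tau>^3 / sqrt n < q0 the trivial error 1 + main is at most main * (1 / L +
    1), and the middle term of e gives 1 \<le> q0 * e.\<close>
  define A2 where "A2 = q0 * (1 / L + 1)"
  define A where "A = A1 + A2"
  have m1: "1 \<le> m" by (simp add: m_def)
  have K0: "0 < K" using m1 \<sigma> by (simp add: K_def)
  have c2: "0 < c2" "c2 \<le> 1" "c2 * K \<le> 1 / 100000" "c2 * (34 * m / \<sigma>) \<le> 1"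
  proof -
    show "0 < c2" "c2 \<le> 1" using K0 m1 \<sigma> by (auto simp: c2_def)
    have "c2 * K \<le> 1 / (100000 * K) * K" using K0 by (intro mult_right_mono) (auto simp: c2_def)
    then show "c2 * K \<le> 1 / 100000" using K0 by simp
    have "c2 * (34 * m / \<sigma>) \<le> \<sigma> / (34 * m) * (34 * m / \<sigma>)" using m1 \<sigma> by (intro mult_right_mono) (auto simp: c2_def)
    then show "c2 * (34 * m / \<sigma>) \<le> 1" using m1 \<sigma> by simp
  qed
  have t0: "1 \<le> t0" "34 * m / \<sigma>\<^sup>2 \<le> t0" by (auto simp: t0_def)
  have q0: "1 \<le> q0" "3400 * m / \<sigma> \<le> q0" "t0 ^ 3 \<le> q0" by (auto simp: q0_def)
  have L0: "0 < L" unfolding L_def using Phi_less_1[of "c2 * q0"] by simp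
  have A1: "0 \<le> A1" unfolding A1_def Cd_def using m1 \<sigma> by (intro add_nonneg_nonneg mult_nonneg_nonneg) auto
  have A2: "0 < A2" unfolding A2_def using q0 L0 by (intro mult_pos_pos add_pos_pos) auto
  have "\<forall>D::real measure.
        (prob_space D \<and> sets D = sets borel \<and> integrable D (\<lambda>y. y ^ 4)
         \<and> (let \<mu> = (\<integral>y. y \<partial>D) in
             (\<integral>y. (y - \<mu>)\<^sup>2 \<partial>D) = \<sigma>\<^sup>2
             \<and> (\<integral>y. \<bar>y\<bar> ^ 3 \<partial>D) = m3
             \<and> (\<integral>y. y ^ 4 \<partial>D) = m4)) \<longrightarrow>
        (let \<mu> = (\<integral>y. y \<partial>D); \<kappa>3 = (\<integral>y. (y - \<mu>) ^ 3 \<partial>D) in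
         \<forall>(n::nat) (\<tau>::real) (x::real).
           n \<ge> 1 \<longrightarrow>
           \<tau> \<ge> 1 * real n powr (1/6) * max (sqrt m4 / \<sigma>) ((m4 / \<sigma>) powr (1/3)) \<longrightarrow>
           0 < x \<longrightarrow> x < c2 * min (real n powr (1/4)) (\<tau> ^ 3 * real n powr (-1/2)) \<longrightarrow>
           (\<exists>O1. \<bar>O1\<bar> \<le> A \<and>
              measure (PiM {..<n} (\<lambda>_. D)) {\<omega> \<in> space (PiM {..<n} (\<lambda>_. D)). U_star \<mu> \<tau> n \<omega> > x}
              = (1 - Phi x) * exp (- (x ^ 3 * \<kappa>3) / (3 * sqrt (real n) * \<sigma> ^ 3))
                * (1 + O1 * ((1 + x ^ 4) / real n + (1 + x) * sqrt (real n) / \<tau> ^ 3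
                             + (1 + x) / sqrt (real n)))))"
    unfolding Let_def
  proof (intro allI impI)
    fix D :: "real measure" and n :: nat and \<tau> x :: real
    define \<mu> where "\<mu> = (\<integral>y. y \<partial>D)"
    assume "prob_space D \<and> sets D = sets borel \<and> integrable D (\<lambda>y. y ^ 4)
         \<and> (\<integral>y. (y - (\<integral>y. y \<partial>D))\<^sup>2 \<partial>D) = \<sigma>\<^sup>2 \<and> (\<integral>y. \<bar>y\<bar> ^ 3 \<partial>D) = m3 \<and> (\<integral>y. y ^ 4 \<partial>D) = m4"
    then have D: "prob_space D" "sets D = sets borel" "integrable D (\<lambda>y. y ^ 4)" "(\<integral>y. (y - \<mu>)\<^sup>2 \<partial>D) = \<sigma>\<^sup>2" "(\<integral>y. y ^ 4 \<partial>D) = m4"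
      by (auto simp: \<mu>_def)
    assume n: "1 \<le> n" and \<tau>: "1 * real n powr (1/6) * max (sqrt m4 / \<sigma>) ((m4 / \<sigma>) powr (1/3)) \<le> \<tau>"
      and x: "0 < x" and xc: "x < c2 * min (real n powr (1/4)) (\<tau> ^ 3 * real n powr (-1/2))"
    have trim: "trimmed D \<mu> \<sigma> m t" if "1 \<le> t" "34 * m / \<sigma>\<^sup>2 \<le> t" for t
      by (intro trimmed.intro trimmed_axioms.intro D) (use that D m1 \<sigma> in \<open>auto simp: \<mu>_def m_def\<close>)
    \<comment> \<open>Taken at the level t0, so that the facts about the untrimmed law are at hand
      in both cases below; the given \<tau> may be smaller than t0.\<close>
    interpret T0: trimmed D \<mu> \<sigma> m t0 by (rule trim) (rule t0)+
    define \<kappa> where "\<kappa> = (\<integral>y. (y - \<mu>) ^ 3 \<partial>D)"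
    define P where "P = measure (PiM {..<n} (\<lambda>_. D)) {\<omega> \<in> space (PiM {..<n} (\<lambda>_. D)). U_star \<mu> \<tau> n \<omega> > x}"
    define main where "main = (1 - Phi x) * exp (- (x ^ 3 * \<kappa>) / (3 * sqrt n * \<sigma> ^ 3))"
    define e where "e = (1 + x ^ 4) / n + (1 + x) * sqrt n / \<tau> ^ 3 + (1 + x) / sqrt n"
    define q where "q = \<tau> ^ 3 / sqrt n"
    define r where "r = real n powr (1/4)"
    have n0: "1 \<le> real n" "1 \<le> sqrt n" using n by auto
    \<comment> \<open>\<sigma> > 0 forces a positive fourth moment, and the assumed lower bound on
      \<tau> then makes \<tau> positive.\<close>
    have m4: "0 < m4" using T0.fourth_moment_ge D(5) \<sigma> zero_less_power[of \<sigma> 4] by linarith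
    have "0 < real n powr (1/6) * (sqrt m4 / \<sigma>)" using n0 m4 \<sigma> by simp
    also have "\<dots> \<le> 1 * real n powr (1/6) * max (sqrt m4 / \<sigma>) ((m4 / \<sigma>) powr (1/3))" unfolding mult_1_left by (intro mult_left_mono) auto
    finally have \<tau>0: "0 < \<tau>" using \<tau> by linarith
    have q: "0 < q" "sqrt n / \<tau> ^ 3 = 1 / q" unfolding q_def using \<tau>0 n0 by auto
    have pq: "\<tau> ^ 3 * real n powr (-1/2) = q"
    proof -
      have "real n powr (-1/2) = 1 / sqrt n" using n0 powr_minus_divide[of "real n" "1/2"] by (simp add: powr_half_sqrt)
      then show ?thesis by (simp add: q_def)
    qed
    have r2: "r * r = sqrt n" unfolding r_def powr_add[symmetric] using n0 by (simp add: powr_half_sqrt)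
    have r1: "1 \<le> r" unfolding r_def using n0 by (simp add: ge_one_powr_ge_zero)
    have xr: "x \<le> c2 * r" and xq: "x \<le> c2 * q"
    proof -
      have "c2 * min r q \<le> c2 * r" "c2 * min r q \<le> c2 * q" using c2 by (auto intro: mult_left_mono)
      then show "x \<le> c2 * r" "x \<le> c2 * q" using xc unfolding pq r_def[symmetric] by auto
    qed
    have main0: "0 < main" unfolding main_def using Phi_less_1[of x] by simp
    have e_pos: "0 \<le> (1 + x ^ 4) / n" "0 < (1 + x) * sqrt n / \<tau> ^ 3" "0 < (1 + x) / sqrt n" using x n0 \<tau>0 by auto
    then have e0: "0 < e" unfolding e_def by linarith
    have "\<bar>P - main\<bar> \<le> main * (A * e)"
    proof (cases "q0 \<le> q")
      case True
      have \<tau>t: "t0 \<le> \<tau>"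
      proof -
        have "q * 1 \<le> q * sqrt n" using q n0 by (intro mult_left_mono) auto
        then have "t0 ^ 3 \<le> \<tau> ^ 3" using q0(3) True n0 by (simp add: q_def)
        then show ?thesis using \<tau>0 by (simp add: power_mono_iff[of t0 \<tau> 3] order_trans[OF zero_le_one t0(1)])
      qed
      interpret T1: trimmed D \<mu> \<sigma> m \<tau> by (rule trim) (use \<tau>t t0 in auto)
      have xn: "x / sqrt n \<le> c2"
      proof -
        have "x \<le> c2 * r * 1" using xr by simp
        also have "\<dots> \<le> c2 * r * r" using c2 r1 by (intro mult_left_mono) auto
        finally have "x \<le> c2 * sqrt n" using r2 by (simp add: mult.assoc)
        then show ?thesis using n0 by (simp add: divide_le_eq)
      qed
      have xxn: "x * (x / sqrt n) \<le> c2"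
      proof -
        have "x * x \<le> (c2 * r) * (c2 * r)" using x xr by (intro mult_mono) auto
        also have "\<dots> = (c2 * c2) * sqrt n" using r2 by (simp add: mult_ac)
        also have "\<dots> \<le> c2 * sqrt n" using c2 by (intro mult_right_mono mult_left_le) auto
        finally show ?thesis using n0 by (simp add: divide_le_eq)
      qed
      have "\<bar>P - main\<bar> \<le> main * (A1 * e)" unfolding P_def main_def \<kappa>_def e_def A1_def Cd_def K_def
      proof (rule T1.trimmed_tail[OF n x])
        show "x / sqrt n * (64 * m / \<sigma> ^ 4) \<le> 1 / 100000" using mult_right_mono[OF xn, of K] K0 c2(3) unfolding K_def by linarith
        show "x * (x / sqrt n) * (64 * m / \<sigma> ^ 4) \<le> 1 / 100000" using mult_right_mono[OF xxn, of K] K0 c2(3) unfolding K_def by linarith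
        have "34 * m / \<sigma> / q \<le> 34 * m / \<sigma> / (3400 * m / \<sigma>)" using True q0(2) m1 \<sigma> q by (intro divide_left_mono) auto
        then show "34 * m / \<sigma> * (sqrt n / \<tau> ^ 3) \<le> 1 / 100" unfolding q(2) using m1 \<sigma> by simp
        have xq1: "x / q \<le> c2" using xq q by (simp add: divide_le_eq)
        have "(x / q) * (34 * m / \<sigma>) \<le> c2 * (34 * m / \<sigma>)" using m1 \<sigma> by (intro mult_right_mono xq1) auto
        then show "x * (34 * m / \<sigma> * (sqrt n / \<tau> ^ 3)) \<le> 1" unfolding q(2) using c2(4) by (simp add: mult_ac)
        show "x * (sqrt n / \<tau> ^ 3) \<le> 1" unfolding q(2) using xq1 c2(2) by simp
      qed
      also have "\<dots> \<le> main * (A * e)" using main0 e0 A2 by (intro mult_left_mono mult_right_mono) (auto simp: A_def)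
      finally show ?thesis .
    next
      case False
      \<comment> \<open>Here \<open>x\<close> is bounded and \<open>e\<close> is bounded away from 0, so a large constant suffices.\<close>
      have xb: "x \<le> c2 * q0" using xq False c2 mult_left_mono[of q q0 c2] by linarith
      have "L \<le> main" unfolding L_def main_def
      proof (rule mult_mono)
        show "1 - Phi (c2 * q0) \<le> 1 - Phi x" using Phi_mono[OF xb] by simp
        have "x ^ 3 * \<kappa> / (3 * sqrt n * \<sigma> ^ 3) \<le> (c2 * q0) ^ 3 * (17 * m) / (3 * \<sigma> ^ 3)"
        proof -
          have "x ^ 3 * \<kappa> \<le> (c2 * q0) ^ 3 * (17 * m)"
          proof -
            have "x ^ 3 * \<kappa> \<le> x ^ 3 * (17 * m)" using T0.third_le(1) x unfolding \<kappa>_def by (intro mult_left_mono) auto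
            also have "\<dots> \<le> (c2 * q0) ^ 3 * (17 * m)" using xb x m1 by (intro mult_right_mono power_mono) auto
            finally show ?thesis .
          qed
          moreover have "3 * \<sigma> ^ 3 * 1 \<le> 3 * \<sigma> ^ 3 * sqrt n" using n0 \<sigma> by (intro mult_left_mono) auto
          moreover have "0 \<le> (c2 * q0) ^ 3 * (17 * m)" using c2 q0 m1 by simp
          ultimately have "x ^ 3 * \<kappa> / (3 * \<sigma> ^ 3 * sqrt n) \<le> (c2 * q0) ^ 3 * (17 * m) / (3 * \<sigma> ^ 3)"
            using \<sigma> by (intro frac_le) auto
          then show ?thesis by (simp add: mult_ac)
        qed
        then show "exp (- ((c2 * q0) ^ 3 * (17 * m) / (3 * \<sigma> ^ 3))) \<le> exp (- (x ^ 3 * \<kappa>) / (3 * sqrt n * \<sigma> ^ 3))" by simp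
      qed (use Phi_less_1[of x] in auto)
      have qe: "1 \<le> q0 * e"
      proof -
        have "1 \<le> (1 + x) * (q0 / q)" using False q x mult_mono[of 1 "1 + x" 1 "q0 / q"] by (simp add: le_divide_eq)
        also have "\<dots> = q0 * ((1 + x) * (sqrt n / \<tau> ^ 3))" unfolding q(2) by simp
        also have "\<dots> \<le> q0 * e" using q0 e_pos unfolding e_def by (intro mult_left_mono) auto
        finally show ?thesis .
      qed
      have "P \<le> 1" unfolding P_def by (rule prob_space.prob_le_1[OF T0.prob_space_iid])
      then have "\<bar>P - main\<bar> \<le> 1 + main" using main0 measure_nonneg[of "PiM {..<n} (\<lambda>_. D)"] unfolding P_def by (simp add: abs_le_iff add_increasing)
      also have "\<dots> \<le> main * (1 / L) + main * 1" using \<open>L \<le> main\<close> L0 by (simp add: le_divide_eq)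
      also have "\<dots> = main * (1 / L + 1) * 1" by (simp add: distrib_left)
      also have "\<dots> \<le> main * (1 / L + 1) * (q0 * e)" using main0 L0 by (intro mult_left_mono qe) auto
      also have "\<dots> = main * (A2 * e)" by (simp add: A2_def)
      also have "\<dots> \<le> main * (A * e)" using main0 e0 A1 by (intro mult_left_mono mult_right_mono) (auto simp: A_def)
      finally show ?thesis .
    qed
    from relative_error_form[OF main0 e0 this]
    show "\<exists>O1. \<bar>O1\<bar> \<le> A \<and>
              measure (PiM {..<n} (\<lambda>_. D)) {\<omega> \<in> space (PiM {..<n} (\<lambda>_. D)). U_star (\<integral>y. y \<partial>D) \<tau> n \<omega> > x}
              = (1 - Phi x) * exp (- (x ^ 3 * (\<integral>y. (y - (\<integral>y. y \<partial>D)) ^ 3 \<partial>D)) / (3 * sqrt (real n) * \<sigma> ^ 3))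
                * (1 + O1 * ((1 + x ^ 4) / real n + (1 + x) * sqrt (real n) / \<tau> ^ 3
                             + (1 + x) / sqrt (real n)))"
      unfolding P_def main_def e_def \<kappa>_def \<mu>_def .
  qed
  moreover have "0 < A" using A1 A2 by (simp add: A_def)
  ultimately show "\<exists>c2>0. \<exists>A>0. \<forall>D::real measure.
        (prob_space D \<and> sets D = sets borel \<and> integrable D (\<lambda>y. y ^ 4)
         \<and> (let \<mu> = (\<integral>y. y \<partial>D) in
             (\<integral>y. (y - \<mu>)\<^sup>2 \<partial>D) = \<sigma>\<^sup>2
             \<and> (\<integral>y. \<bar>y\<bar> ^ 3 \<partial>D) = m3
             \<and> (\<integral>y. y ^ 4 \<partial>D) = m4)) \<longrightarrow>
        (let \<mu> = (\<integral>y. y \<partial>D); \<kappa>3 = (\<integral>y. (y - \<mu>) ^ 3 \<partial>D) in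
         \<forall>(n::nat) (\<tau>::real) (x::real).
           n \<ge> 1 \<longrightarrow>
           \<tau> \<ge> 1 * real n powr (1/6) * max (sqrt m4 / \<sigma>) ((m4 / \<sigma>) powr (1/3)) \<longrightarrow>
           0 < x \<longrightarrow> x < c2 * min (real n powr (1/4)) (\<tau> ^ 3 * real n powr (-1/2)) \<longrightarrow>
           (\<exists>O1. \<bar>O1\<bar> \<le> A \<and>
              measure (PiM {..<n} (\<lambda>_. D)) {\<omega> \<in> space (PiM {..<n} (\<lambda>_. D)). U_star \<mu> \<tau> n \<omega> > x}
              = (1 - Phi x) * exp (- (x ^ 3 * \<kappa>3) / (3 * sqrt (real n) * \<sigma> ^ 3))
                * (1 + O1 * ((1 + x ^ 4) / real n + (1 + x) * sqrt (real n) / \<tau> ^ 3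
                             + (1 + x) / sqrt (real n)))))"
    using c2(1) by blast
qed

end
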